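(* For $i\in\{0,1\}$ there exists $\overline{f_i}\in C^\infty(\overline\Omega)$, vanishing identically in neighborhoods of $(x_i,0)$ and of $\{z=\pm1\}$, such that $\bar u^i_{\mathrm{sing}}$ is the unique solution in $Z^0(\Omega)$ to $z\partial_xu-\partial_{zz}u=\overline{f_i}$ in $\Omega$, $u_{|\Sigma_0\cup\Sigma_1}=0$, $u_{|z=\pm1}=0$. Moreover $\bar u^i_{\mathrm{sing}}\in C^\infty(\overline\Omega\setminus\{(x_i,0)\})$ but $\bar u^i_{\mathrm{sing}}\notin H^1((x_0,x_1);H^1(-1,1))$.
   Context: Fix $x_0<x_1$, $\Omega=(x_0,x_1)\times(-1,1)$, coordinates $(x,z)$, $\Sigma_0=\{x_0\}\times(0,1)$, $\Sigma_1=\{x_1\}\times(-1,0)$. $Z^0(\Omega)$: functions with $\phi,\partial_z\phi,\partial_{zz}\phi,z\partial_x\phi\in L^2(\Omega)$. Let $M(a,b,\zeta)=\sum_{n\ge0}\frac{(a)_n}{(b)_n}\frac{\zeta^n}{n!}$ be Kummer's function and $\Lambda_0(t)=9^{1/6}(1+t^2)^{-1/4}\big[\frac{\Gamma(1/3)}{\Gamma(1/6)}M(-\frac16,\frac23,-\frac{t^3}9)-\frac{t}{9^{1/3}}\frac{\Gamma(-1/3)}{\Gamma(-1/6)}M(\frac16,\frac43,-\frac{t^3}9)\big]$ (a smooth bounded function with $\Lambda_0(-\infty)=1$, $\Lambda_0(+\infty)=0$). For $i=0,1$ let $\chi_i\in C^\infty(\overline\Omega)$ with $\chi_i\equiv1$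 near $(x_i,0)$ and $\operatorname{supp}\chi_i\subset B((x_i,0),\bar R)$, $\bar R<\min(1,x_1-x_0)/2$; $r_i=(z^2+|x-x_i|^{2/3})^{1/2}$, $t_i=(-1)^iz|x-x_i|^{-1/3}$, and $\bar u^i_{\mathrm{sing}}:=r_i^{1/2}\Lambda_0(t_i)\chi_i$. *)

theory Defs
  imports "HOL-Analysis.Analysis"
begin

definition kummerM :: "real \<Rightarrow> real \<Rightarrow> real \<Rightarrow> real" where
  "kummerM a b \<zeta> = (\<Sum>n. pochhammer a n / pochhammer b n * \<zeta> ^ n / fact n)"

definition Lambda0 :: "real \<Rightarrow> real" where
  "Lambda0 t = 9 powr (1/6) * (1 + t\<^sup>2) powr (-1/4) *
     (Gamma (1/3) / Gamma (1/6) * kummerM (-1/6) (2/3) (- (t ^ 3) / 9)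
      - t / 9 powr (1/3) * (Gamma (-1/3) / Gamma (-1/6)) * kummerM (1/6) (4/3) (- (t ^ 3) / 9))"

definition Omega :: "real \<Rightarrow> real \<Rightarrow> (real \<times> real) set" where
  "Omega x0 x1 = {x0<..<x1} \<times> {-1<..<1}"

definition dx :: "(real \<times> real \<Rightarrow> real) \<Rightarrow> real \<times> real \<Rightarrow> real" where
  "dx f p = deriv (\<lambda>s. f (s, snd p)) (fst p)"

definition dz :: "(real \<times> real \<Rightarrow> real) \<Rightarrow> real \<times> real \<Rightarrow> real" where
  "dz f p = deriv (\<lambda>s. f (fst p, s)) (snd p)"

fun Ck_on :: "nat \<Rightarrow> (real \<times> real) set \<Rightarrow> (real \<times> real \<Rightarrow> real) \<Rightarrow> bool" where
  "Ck_on 0 U f = continuous_on U f"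
| "Ck_on (Suc k) U f =
     ((\<forall>p\<in>U. f differentiable (at p)) \<and> Ck_on k U (dx f) \<and> Ck_on k U (dz f))"

definition smooth_on :: "(real \<times> real) set \<Rightarrow> (real \<times> real \<Rightarrow> real) \<Rightarrow> bool" where
  "smooth_on U f \<longleftrightarrow> open U \<and> (\<forall>k. Ck_on k U f)"

text \<open>A function (only its values on the open set Om matter) belongs to C^\<infinity>(S),
  S a subset of the closure of Om, if near each point of S it coincides on Om with
  a smooth function defined on an open neighbourhood.\<close>
definition smooth_upto :: "(real \<times> real) set \<Rightarrow> (real \<times> real) set \<Rightarrow> (real \<times> real \<Rightarrow> real) \<Rightarrow> bool" where
  "smooth_upto Om S f \<longleftrightarrow>
     (\<forall>p\<in>S. \<exists>U g. open U \<and> p \<in> U \<and> smooth_on U g \<and> (\<forall>q\<in>U \<inter> Om. g q = f q))"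

definition test_fn :: "(real \<times> real) set \<Rightarrow> (real \<times> real \<Rightarrow> real) \<Rightarrow> bool" where
  "test_fn Om \<phi> \<longleftrightarrow> smooth_on UNIV \<phi> \<and> (\<exists>K. compact K \<and> K \<subseteq> Om \<and> (\<forall>p. p \<notin> K \<longrightarrow> \<phi> p = 0))"

definition L2_on :: "(real \<times> real) set \<Rightarrow> (real \<times> real \<Rightarrow> real) \<Rightarrow> bool" where
  "L2_on Om f \<longleftrightarrow> (\<lambda>p. indicator Om p * f p) \<in> borel_measurable lebesgue
     \<and> integrable lebesgue (\<lambda>p. indicator Om p * (f p)\<^sup>2)"

definition weak_eq :: "(real \<times> real) set \<Rightarrow> (real \<times> real \<Rightarrow> real)
    \<Rightarrow> ((real \<times> real \<Rightarrow> real) \<Rightarrow> real \<times> real \<Rightarrow> real) \<Rightarrow> (real \<times> real \<Rightarrow> real) \<Rightarrow> bool" where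
  "weak_eq Om u A g \<longleftrightarrow> (\<forall>\<phi>. test_fn Om \<phi> \<longrightarrow>
      set_integrable lebesgue Om (\<lambda>p. u p * A \<phi> p) \<and> set_integrable lebesgue Om (\<lambda>p. g p * \<phi> p) \<and>
      (LINT p:Om|lebesgue. u p * A \<phi> p) = (LINT p:Om|lebesgue. g p * \<phi> p))"

definition weak_dz :: "(real \<times> real) set \<Rightarrow> (real \<times> real \<Rightarrow> real) \<Rightarrow> (real \<times> real \<Rightarrow> real) \<Rightarrow> bool" where
  "weak_dz Om u g \<longleftrightarrow> weak_eq Om u (\<lambda>\<phi> p. - dz \<phi> p) g"

definition weak_dx :: "(real \<times> real) set \<Rightarrow> (real \<times> real \<Rightarrow> real) \<Rightarrow> (real \<times> real \<Rightarrow> real) \<Rightarrow> bool" where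
  "weak_dx Om u g \<longleftrightarrow> weak_eq Om u (\<lambda>\<phi> p. - dx \<phi> p) g"

definition weak_dzz :: "(real \<times> real) set \<Rightarrow> (real \<times> real \<Rightarrow> real) \<Rightarrow> (real \<times> real \<Rightarrow> real) \<Rightarrow> bool" where
  "weak_dzz Om u g \<longleftrightarrow> weak_eq Om u (\<lambda>\<phi> p. dz (dz \<phi>) p) g"

definition weak_dxz :: "(real \<times> real) set \<Rightarrow> (real \<times> real \<Rightarrow> real) \<Rightarrow> (real \<times> real \<Rightarrow> real) \<Rightarrow> bool" where
  "weak_dxz Om u g \<longleftrightarrow> weak_eq Om u (\<lambda>\<phi> p. dx (dz \<phi>) p) g"

definition weak_zdx :: "(real \<times> real) set \<Rightarrow> (real \<times> real \<Rightarrow> real) \<Rightarrow> (real \<times> real \<Rightarrow> real) \<Rightarrow> bool" where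
  "weak_zdx Om u h \<longleftrightarrow> weak_eq Om u (\<lambda>\<phi> p. - (snd p * dx \<phi> p)) h"

definition Z0 :: "real \<Rightarrow> real \<Rightarrow> (real \<times> real \<Rightarrow> real) \<Rightarrow> bool" where
  "Z0 x0 x1 u \<longleftrightarrow> L2_on (Omega x0 x1) u
     \<and> (\<exists>g. L2_on (Omega x0 x1) g \<and> weak_dz (Omega x0 x1) u g)
     \<and> (\<exists>g. L2_on (Omega x0 x1) g \<and> weak_dzz (Omega x0 x1) u g)
     \<and> (\<exists>h. L2_on (Omega x0 x1) h \<and> weak_zdx (Omega x0 x1) u h)"

definition H1H1 :: "real \<Rightarrow> real \<Rightarrow> (real \<times> real \<Rightarrow> real) \<Rightarrow> bool" where
  "H1H1 x0 x1 u \<longleftrightarrow> L2_on (Omega x0 x1) u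
     \<and> (\<exists>g. L2_on (Omega x0 x1) g \<and> weak_dz (Omega x0 x1) u g)
     \<and> (\<exists>g. L2_on (Omega x0 x1) g \<and> weak_dx (Omega x0 x1) u g)
     \<and> (\<exists>g. L2_on (Omega x0 x1) g \<and> weak_dxz (Omega x0 x1) u g)"

definition trace_zero_top_bottom :: "real \<Rightarrow> real \<Rightarrow> (real \<times> real \<Rightarrow> real) \<Rightarrow> bool" where
  "trace_zero_top_bottom x0 x1 u \<longleftrightarrow>
     (AE x in lborel. x \<in> {x0<..<x1} \<longrightarrow>
        (\<exists>g. continuous_on {-1..1} g \<and> g (-1) = 0 \<and> g 1 = 0 \<and>
             (AE z in lborel. z \<in> {-1<..<1} \<longrightarrow> u (x, z) = g z)))"

text \<open>Vanishing trace on Sigma_0 = {x0} x (0,1) and on Sigma_1 = {x1} x (-1,0),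
  in the (weighted, |z| dz) L^2 sense, expressed through averaged limits.\<close>
definition trace_zero_Sigma0 :: "real \<Rightarrow> (real \<times> real \<Rightarrow> real) \<Rightarrow> bool" where
  "trace_zero_Sigma0 x0 u \<longleftrightarrow>
     ((\<lambda>h. (1 / h) * (LINT p:({x0<..<x0+h} \<times> {0<..<1})|lebesgue. \<bar>snd p\<bar> * (u p)\<^sup>2))
        \<longlongrightarrow> 0) (at_right 0)"

definition trace_zero_Sigma1 :: "real \<Rightarrow> (real \<times> real \<Rightarrow> real) \<Rightarrow> bool" where
  "trace_zero_Sigma1 x1 u \<longleftrightarrow>
     ((\<lambda>h. (1 / h) * (LINT p:({x1-h<..<x1} \<times> {-1<..<0})|lebesgue. \<bar>snd p\<bar> * (u p)\<^sup>2))
        \<longlongrightarrow> 0) (at_right 0)"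

definition solves_bvp :: "real \<Rightarrow> real \<Rightarrow> (real \<times> real \<Rightarrow> real) \<Rightarrow> (real \<times> real \<Rightarrow> real) \<Rightarrow> bool" where
  "solves_bvp x0 x1 f u \<longleftrightarrow>
     weak_eq (Omega x0 x1) u (\<lambda>\<phi> p. - (snd p * dx \<phi> p) - dz (dz \<phi>) p) f
     \<and> trace_zero_Sigma0 x0 u \<and> trace_zero_Sigma1 x1 u
     \<and> trace_zero_top_bottom x0 x1 u"

definition u_sing :: "real \<Rightarrow> (real \<times> real \<Rightarrow> real) \<Rightarrow> nat \<Rightarrow> real \<times> real \<Rightarrow> real" where
  "u_sing xi chi i p =
     sqrt (sqrt ((snd p)\<^sup>2 + \<bar>fst p - xi\<bar> powr (2/3)))
     * Lambda0 ((-1) ^ i * snd p * \<bar>fst p - xi\<bar> powr (-1/3)) * chi p"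

end

theory Submission imports Defs begin

text \<open>Near the corner the function is the self-similar solution \<open>s\<^sup>1\<^sup>/\<^sup>6 G (z s\<^sup>-\<^sup>1\<^sup>/\<^sup>3)\<close> of
  \<open>z \<partial>\<^sub>x u = \<partial>\<^sub>z\<^sub>z u\<close>, where \<open>s\<close> is the distance to the lateral side and \<open>G\<close> solves \<open>G'' + (t\<^sup>2/3) G' - (t/6) G = 0\<close>;
  the commutator with the cutoff gives the source term. Smoothness up to the lateral side away from the corner
  needs the behaviour of \<open>G\<close> at infinity: comparing values and derivatives at \<open>0\<close> identifies \<open>G\<close> with a
  Laplace-type integral that is smooth in \<open>1/t\<^sup>3\<close>, times \<open>\<bar>t\<bar>\<^sup>1\<^sup>/\<^sup>2\<close> for \<open>t < 0\<close> and times \<open>t\<^sup>-\<^sup>5\<^sup>/\<^sup>2 exp (- t\<^sup>3/9)\<close>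
  for \<open>t > 0\<close>. Uniqueness is the energy identity, obtained on almost every horizontal and vertical slice, where
  elements of \<open>Z0\<close> are indefinite integrals of their weak derivatives; the inflow traces make the boundary terms
  of \<open>z \<partial>\<^sub>x u u\<close> nonnegative. Finally \<open>\<partial>\<^sub>x u\<close> scales like \<open>s\<^sup>-\<^sup>5\<^sup>/\<^sup>6\<close> on boxes of size \<open>s\<close> by \<open>s\<^sup>1\<^sup>/\<^sup>3\<close>, so it is not
  square integrable.\<close>

subsection \<open>Differentiability classes in one and two variables\<close>

text \<open>At each end the ODE has two behaviours: t^(1/2) or t^(-5/2) exp(-t^3/9) at +infinity,
  |t|^(1/2) or exponential growth at -infinity. The exponent 1/6 is one for which a single solution
  avoids both t^(1/2) at +infinity and growth at -infinity; the Gamma quotients in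
  \<open>Lambda0\<close> select it. Asymptotics of Kummer's series are bypassed: with w = 9/|t|^3
  the point t = 0 is w -> infinity, where the integrals tend to Gamma or Beta values that match
  \<open>G0\<close> and \<open>G1\<close>, and the lateral side is w = 0. The integrals make sense
  for w >= 0, but smoothness up to the boundary needs a function smooth around w = 0; so the power
  in the integrand is extended positively past its singularity. Uniqueness uses neither density of
  smooth functions in \<open>Z0\<close> nor a trace theorem. For the difference W of two solutions
  let B be its second weak z-derivative; by the equation B is also the weak x-derivative of z W.
  Integrating W B along vertical slices first gives minus the squared norm of the z-derivative,
  along horizontal slices first a nonnegative number. So the z-derivative is 0, and W with
  it.\<close>

fun Cn_on :: "nat \<Rightarrow> real set \<Rightarrow> (real \<Rightarrow> real) \<Rightarrow> bool" where
  "Cn_on 0 V f = continuous_on V f"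
| "Cn_on (Suc n) V f = (\<exists>f'. (\<forall>x\<in>V. (f has_real_derivative f' x) (at x)) \<and> Cn_on n V f')"

lemma Cn_on_derivI:
  "(\<And>x. x \<in> V \<Longrightarrow> (f has_real_derivative f' x) (at x)) \<Longrightarrow> Cn_on n V f' \<Longrightarrow> Cn_on (Suc n) V f"
  by auto

lemma Cn_on_SucD: "Cn_on (Suc n) V f \<Longrightarrow> Cn_on n V f"
proof (induction n arbitrary: f)
  case 0
  then obtain f' where "\<And>x. x \<in> V \<Longrightarrow> (f has_real_derivative f' x) (at x)" by auto
  then have "continuous_on V f"
    by (meson DERIV_continuous continuous_at_imp_continuous_on)
  then show ?case by simp
next
  case (Suc n)
  then obtain f' where "\<And>x. x \<in> V \<Longrightarrow> (f has_real_derivative f' x) (at x)" "Cn_on (Suc n) V f'" by auto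
  with Suc.IH show ?case by auto
qed

lemma Cn_on_const [simp]: "Cn_on n V (\<lambda>x. c)"
proof (induction n arbitrary: c)
  case (Suc n)
  have "\<forall>x\<in>V. ((\<lambda>x. c) has_real_derivative (\<lambda>_. 0) x) (at x)" by auto
  with Suc[of 0] show ?case by (intro Cn_on_derivI[of _ _ "\<lambda>_. 0"]) auto
qed auto

lemma Cn_on_id: "Cn_on n V (\<lambda>x. x)"
proof (cases n)
  case (Suc m)
  have "\<forall>x\<in>V. ((\<lambda>x. x) has_real_derivative (\<lambda>_. 1) x) (at x)" by auto
  with Suc show ?thesis by (auto intro!: exI[of _ "\<lambda>_. 1"])
qed auto

lemma Cn_on_add: "Cn_on n V f \<Longrightarrow> Cn_on n V g \<Longrightarrow> Cn_on n V (\<lambda>x. f x + g x)"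
proof (induction n arbitrary: f g)
  case 0
  then show ?case by (auto intro: continuous_on_add)
next
  case (Suc n)
  obtain f' where "\<And>x. x \<in> V \<Longrightarrow> (f has_real_derivative f' x) (at x)" "Cn_on n V f'"
    using Suc.prems(1) by auto
  moreover obtain g' where "\<And>x. x \<in> V \<Longrightarrow> (g has_real_derivative g' x) (at x)" "Cn_on n V g'"
    using Suc.prems(2) by auto
  ultimately have *: "\<And>x. x \<in> V \<Longrightarrow> (f has_real_derivative f' x) (at x)" "Cn_on n V f'"
    "\<And>x. x \<in> V \<Longrightarrow> (g has_real_derivative g' x) (at x)" "Cn_on n V g'" by auto
  show ?case
    by (rule Cn_on_derivI[of V _ "\<lambda>x. f' x + g' x"]) (use * Suc.IH in \<open>auto intro!: derivative_intros\<close>)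
qed

lemma Cn_on_mult: "Cn_on n V f \<Longrightarrow> Cn_on n V g \<Longrightarrow> Cn_on n V (\<lambda>x. f x * g x)"
proof (induction n arbitrary: f g)
  case 0
  then show ?case by (auto intro: continuous_on_mult)
next
  case (Suc n)
  obtain f' where 1: "\<And>x. x \<in> V \<Longrightarrow> (f has_real_derivative f' x) (at x)" "Cn_on n V f'"
    using Suc.prems(1) by auto
  obtain g' where 2: "\<And>x. x \<in> V \<Longrightarrow> (g has_real_derivative g' x) (at x)" "Cn_on n V g'"
    using Suc.prems(2) by auto
  note * = 1 2
  have "Cn_on n V (\<lambda>x. f' x * g x + g' x * f x)"
    using Suc.IH * Cn_on_SucD[OF Suc.prems(1)] Cn_on_SucD[OF Suc.prems(2)] by (intro Cn_on_add) auto
  then show ?case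
    by (rule Cn_on_derivI[rotated]) (use * in \<open>auto intro!: derivative_eq_intros\<close>)
qed

lemma Cn_on_uminus: "Cn_on n V f \<Longrightarrow> Cn_on n V (\<lambda>x. - f x)"
  using Cn_on_mult[of n V "\<lambda>_. -1" f] by simp

lemma Cn_on_diff: "Cn_on n V f \<Longrightarrow> Cn_on n V g \<Longrightarrow> Cn_on n V (\<lambda>x. f x - g x)"
  using Cn_on_add[of n V f "\<lambda>x. - g x"] Cn_on_uminus by simp

lemma Cn_on_power: "Cn_on n V f \<Longrightarrow> Cn_on n V (\<lambda>x. f x ^ k)"
  by (induction k) (auto intro: Cn_on_mult)

lemma Cn_on_compose:
  "Cn_on n V f \<Longrightarrow> Cn_on n W g \<Longrightarrow> f ` V \<subseteq> W \<Longrightarrow> Cn_on n V (\<lambda>x. g (f x))"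
proof (induction n arbitrary: f g)
  case 0
  then show ?case by (auto intro: continuous_on_compose2)
next
  case (Suc n)
  obtain f' where 1: "\<And>x. x \<in> V \<Longrightarrow> (f has_real_derivative f' x) (at x)" "Cn_on n V f'"
    using Suc.prems(1) by auto
  obtain g' where 2: "\<And>x. x \<in> W \<Longrightarrow> (g has_real_derivative g' x) (at x)" "Cn_on n W g'"
    using Suc.prems(2) by auto
  note * = 1 2
  have c: "Cn_on n V (\<lambda>x. g' (f x) * f' x)"
    using Suc.IH[of f g'] * Cn_on_SucD[OF Suc.prems(1)] Suc.prems by (intro Cn_on_mult) auto
  have "((\<lambda>x. g (f x)) has_real_derivative g' (f x) * f' x) (at x)" if "x \<in> V" for x
    using DERIV_chain2[OF *(3) *(1)] that Suc.prems(3) by auto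
  with c show ?case by (intro Cn_on_derivI) auto
qed

lemma Cn_on_powr: "Cn_on n {0<..} (\<lambda>x. x powr a)"
proof (induction n arbitrary: a)
  case 0
  then show ?case by (auto intro!: continuous_intros)
next
  case (Suc n)
  have "\<forall>x\<in>{0<..}. ((\<lambda>x::real. x powr a) has_real_derivative a * x powr (a - 1)) (at x)"
    by (auto intro!: has_real_derivative_powr)
  moreover have "Cn_on n {0<..} (\<lambda>x. a * x powr (a - 1))"
    by (intro Cn_on_mult Suc.IH) auto
  ultimately show ?case by (auto intro!: exI[of _ "\<lambda>x. a * x powr (a - 1)"])
qed

section \<open>Calculus of the two-variable classes \<open>Ck_on\<close> and
  \<open>smooth_on\<close>\<close>

lemma partials_cong:
  assumes "open U" "p \<in> U" "\<And>q. q \<in> U \<Longrightarrow> f q = g q"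
  shows "dx f p = dx g p" "dz f p = dz g p"
proof -
  have ev: "\<forall>\<^sub>F q in nhds p. f q = g q"
    using assms by (auto simp: eventually_nhds)
  have "((\<lambda>s. (s, snd p)) \<longlongrightarrow> (fst p, snd p)) (nhds (fst p))"
    by (intro tendsto_Pair filterlim_ident tendsto_const)
  then have "filterlim (\<lambda>s. (s, snd p)) (nhds p) (nhds (fst p))" by simp
  then have "\<forall>\<^sub>F s in nhds (fst p). f (s, snd p) = g (s, snd p)"
    using ev by (rule eventually_compose_filterlim[rotated])
  then show "dx f p = dx g p" unfolding dx_def by (intro deriv_cong_ev) auto
  have "((\<lambda>s. (fst p, s)) \<longlongrightarrow> (fst p, snd p)) (nhds (snd p))"
    by (intro tendsto_Pair filterlim_ident tendsto_const)
  then have "filterlim (\<lambda>s. (fst p, s)) (nhds p) (nhds (snd p))" by simp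
  then have "\<forall>\<^sub>F s in nhds (snd p). f (fst p, s) = g (fst p, s)"
    using ev by (rule eventually_compose_filterlim[rotated])
  then show "dz f p = dz g p" unfolding dz_def by (intro deriv_cong_ev) auto
qed

lemma Ck_on_cong:
  assumes "open U" "\<And>p. p \<in> U \<Longrightarrow> f p = g p"
  shows "Ck_on k U f \<longleftrightarrow> Ck_on k U g"
  using assms(2)
proof (induction k arbitrary: f g)
  case 0
  then show ?case using continuous_on_cong[of U U f g] by simp
next
  case (Suc k)
  have d: "f differentiable (at p) \<longleftrightarrow> g differentiable (at p)" if "p \<in> U" for p
  proof -
    have "(f has_derivative D) (at p) \<longleftrightarrow> (g has_derivative D) (at p)" for D
      using has_derivative_transform_within_open[of f D p UNIV U g]
        has_derivative_transform_within_open[of g D p UNIV U f] that assms(1) Suc.prems by auto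
    then show ?thesis by (simp add: differentiable_def)
  qed
  have "dx f p = dx g p" "dz f p = dz g p" if "p \<in> U" for p
    using partials_cong[of U p f g] that assms(1) Suc.prems by auto
  then show ?case using d Suc.IH[of "dx f" "dx g"] Suc.IH[of "dz f" "dz g"] by auto
qed

lemma Ck_on_subset: "Ck_on k U f \<Longrightarrow> V \<subseteq> U \<Longrightarrow> Ck_on k V f"
proof (induction k arbitrary: f)
  case 0
  then show ?case using continuous_on_subset by auto
next
  case (Suc k)
  show ?case using Suc.prems Suc.IH[of "dx f"] Suc.IH[of "dz f"]
    unfolding Ck_on.simps by blast
qed

lemma Ck_on_SucD: "Ck_on (Suc k) U f \<Longrightarrow> Ck_on k U f"
proof (induction k arbitrary: f)
  case 0
  then show ?case
    by (auto intro!: continuous_at_imp_continuous_on dest!: differentiable_imp_continuous_within)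
next
  case (Suc k)
  show ?case using Suc.prems Suc.IH[of "dx f"] Suc.IH[of "dz f"]
    unfolding Ck_on.simps by blast
qed

lemma partials_of_has_derivative:
  assumes "(f has_derivative (\<lambda>h. a * fst h + b * snd h)) (at p)"
  shows "((\<lambda>s. f (s, snd p)) has_real_derivative a) (at (fst p))"
    "((\<lambda>s. f (fst p, s)) has_real_derivative b) (at (snd p))"
    "dx f p = a" "dz f p = b"
proof -
  have "((\<lambda>s. f (s, snd p)) has_derivative (\<lambda>h. a * fst (h, 0::real) + b * snd (h, 0::real))) (at (fst p))"
    by (rule has_derivative_compose[of "\<lambda>s. (s, snd p)" "\<lambda>h. (h, 0)" "fst p" UNIV f])
      (use assms in \<open>auto intro!: derivative_eq_intros\<close>)
  then show *: "((\<lambda>s. f (s, snd p)) has_real_derivative a) (at (fst p))"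
    by (simp add: has_field_derivative_def)
  have "((\<lambda>s. f (fst p, s)) has_derivative (\<lambda>h. a * fst (0::real, h) + b * snd (0::real, h))) (at (snd p))"
    by (rule has_derivative_compose[of "\<lambda>s. (fst p, s)" "\<lambda>h. (0, h)" "snd p" UNIV f])
      (use assms in \<open>auto intro!: derivative_eq_intros\<close>)
  then show **: "((\<lambda>s. f (fst p, s)) has_real_derivative b) (at (snd p))"
    by (simp add: has_field_derivative_def)
  show "dx f p = a" "dz f p = b"
    using DERIV_imp_deriv[OF *] DERIV_imp_deriv[OF **] by (auto simp: dx_def dz_def)
qed

lemma has_derivative_partials:
  assumes "f differentiable (at p)"
  shows "(f has_derivative (\<lambda>h. dx f p * fst h + dz f p * snd h)) (at p)"
proof -
  obtain D where D: "(f has_derivative D) (at p)" using assms by (auto simp: differentiable_def)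
  interpret D: linear D using D has_derivative_linear by blast
  have "D h = D (1, 0) * fst h + D (0, 1) * snd h" for h
  proof -
    have "D h = D (fst h *\<^sub>R (1, 0) + snd h *\<^sub>R (0, 1))" by simp
    also have "\<dots> = fst h * D (1, 0) + snd h * D (0, 1)" unfolding D.add D.scaleR by simp
    finally show ?thesis by (simp add: mult.commute)
  qed
  then have eq: "D = (\<lambda>h. D (1, 0) * fst h + D (0, 1) * snd h)" by blast
  have "(f has_derivative (\<lambda>h. D (1, 0) * fst h + D (0, 1) * snd h)) (at p)" using D eq by simp
  from partials_of_has_derivative(3,4)[OF this] this show ?thesis by simp
qed

text \<open>The recursion is driven by a differential given in closed form: it determines
  \<open>dx f\<close> and \<open>dz f\<close> on the open set U, where congruence then replaces them
  by a and b.\<close>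

lemma Ck_on_SucI:
  assumes "open U" "\<And>p. p \<in> U \<Longrightarrow> (f has_derivative (\<lambda>h. a p * fst h + b p * snd h)) (at p)"
    "Ck_on k U a" "Ck_on k U b"
  shows "Ck_on (Suc k) U f"
proof -
  have "dx f p = a p" "dz f p = b p" if "p \<in> U" for p
    using partials_of_has_derivative[OF assms(2)[OF that]] by auto
  then have "Ck_on k U (dx f)" "Ck_on k U (dz f)"
    using assms(1,3,4) Ck_on_cong[of U "dx f" a k] Ck_on_cong[of U "dz f" b k] by auto
  then show ?thesis using assms(2) by (auto simp: differentiable_def)
qed

lemma Ck_on_const [simp]: "open U \<Longrightarrow> Ck_on k U (\<lambda>p. c)"
proof (induction k arbitrary: c)
  case (Suc k)
  then show ?case by (intro Ck_on_SucI[of _ _ "\<lambda>_. 0" "\<lambda>_. 0"]) auto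
qed auto

lemma Ck_on_fst: "open U \<Longrightarrow> Ck_on k U fst"
proof (cases k)
  case (Suc n)
  assume "open U"
  then show ?thesis unfolding Suc by (intro Ck_on_SucI[of _ _ "\<lambda>_. 1" "\<lambda>_. 0"]) (auto intro!: derivative_eq_intros)
qed (auto intro!: continuous_intros)

lemma Ck_on_snd: "open U \<Longrightarrow> Ck_on k U snd"
proof (cases k)
  case (Suc n)
  assume "open U"
  then show ?thesis unfolding Suc by (intro Ck_on_SucI[of _ _ "\<lambda>_. 0" "\<lambda>_. 1"]) (auto intro!: derivative_eq_intros)
qed (auto intro!: continuous_intros)

lemma Ck_on_add: "open U \<Longrightarrow> Ck_on k U f \<Longrightarrow> Ck_on k U g \<Longrightarrow> Ck_on k U (\<lambda>p. f p + g p)"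
proof (induction k arbitrary: f g)
  case (Suc k)
  show ?case
  proof (rule Ck_on_SucI[OF \<open>open U\<close>])
    fix p assume "p \<in> U"
    then have "(f has_derivative (\<lambda>h. dx f p * fst h + dz f p * snd h)) (at p)"
      "(g has_derivative (\<lambda>h. dx g p * fst h + dz g p * snd h)) (at p)"
      using Suc.prems has_derivative_partials by auto
    from has_derivative_add[OF this]
    show "((\<lambda>p. f p + g p) has_derivative (\<lambda>h. (dx f p + dx g p) * fst h + (dz f p + dz g p) * snd h)) (at p)"
      by (simp add: algebra_simps)
  next
    show "Ck_on k U (\<lambda>p. dx f p + dx g p)" "Ck_on k U (\<lambda>p. dz f p + dz g p)" using Suc by auto
  qed
qed (auto intro: continuous_on_add)

lemma Ck_on_mult: "open U \<Longrightarrow> Ck_on k U f \<Longrightarrow> Ck_on k U g \<Longrightarrow> Ck_on k U (\<lambda>p. f p * g p)"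
proof (induction k arbitrary: f g)
  case (Suc k)
  show ?case
  proof (rule Ck_on_SucI[OF \<open>open U\<close>])
    fix p assume "p \<in> U"
    then have "(f has_derivative (\<lambda>h. dx f p * fst h + dz f p * snd h)) (at p)"
      "(g has_derivative (\<lambda>h. dx g p * fst h + dz g p * snd h)) (at p)"
      using Suc.prems has_derivative_partials by auto
    from has_derivative_mult[OF this]
    show "((\<lambda>p. f p * g p) has_derivative (\<lambda>h. (f p * dx g p + dx f p * g p) * fst h + (f p * dz g p + dz f p * g p) * snd h)) (at p)"
      by (simp add: algebra_simps)
  next
    show "Ck_on k U (\<lambda>p. f p * dx g p + dx f p * g p)" "Ck_on k U (\<lambda>p. f p * dz g p + dz f p * g p)"
      using Suc Ck_on_SucD[OF Suc.prems(2)] Ck_on_SucD[OF Suc.prems(3)] by (auto intro!: Ck_on_add)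
  qed
qed (auto intro: continuous_on_mult)

lemma Ck_on_uminus: "open U \<Longrightarrow> Ck_on k U f \<Longrightarrow> Ck_on k U (\<lambda>p. - f p)"
  using Ck_on_mult[of U k "\<lambda>_. -1" f] by simp

lemma Ck_on_diff: "open U \<Longrightarrow> Ck_on k U f \<Longrightarrow> Ck_on k U g \<Longrightarrow> Ck_on k U (\<lambda>p. f p - g p)"
  using Ck_on_add[of U k f "\<lambda>p. - g p"] Ck_on_uminus by simp

lemma Ck_on_compose1:
  assumes "open U"
  shows "Ck_on k U f \<Longrightarrow> Cn_on k V F \<Longrightarrow> f ` U \<subseteq> V \<Longrightarrow> Ck_on k U (\<lambda>p. F (f p))"
proof (induction k arbitrary: f F)
  case 0
  then show ?case by (auto intro: continuous_on_compose2)
next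
  case (Suc k)
  obtain F' where F': "\<And>x. x \<in> V \<Longrightarrow> (F has_real_derivative F' x) (at x)" "Cn_on k V F'"
    using Suc.prems(2) by auto
  have c: "Ck_on k U (\<lambda>p. F' (f p))"
    using Suc F'(2) Ck_on_SucD[OF Suc.prems(1)] by auto
  show ?case
  proof (rule Ck_on_SucI[OF \<open>open U\<close>])
    fix p assume p: "p \<in> U"
    then have "(f has_derivative (\<lambda>h. dx f p * fst h + dz f p * snd h)) (at p)"
      using Suc.prems has_derivative_partials by auto
    moreover have "(F has_derivative (\<lambda>h. F' (f p) * h)) (at (f p))"
      using F'(1)[of "f p"] p Suc.prems(3) by (auto simp: has_field_derivative_def)
    ultimately have "((\<lambda>p. F (f p)) has_derivative (\<lambda>h. F' (f p) * (dx f p * fst h + dz f p * snd h))) (at p)"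
      by (rule has_derivative_compose)
    then show "((\<lambda>p. F (f p)) has_derivative (\<lambda>h. (F' (f p) * dx f p) * fst h + (F' (f p) * dz f p) * snd h)) (at p)"
      by (simp add: algebra_simps)
  next
    show "Ck_on k U (\<lambda>p. F' (f p) * dx f p)" "Ck_on k U (\<lambda>p. F' (f p) * dz f p)"
      using Suc.prems c \<open>open U\<close> by (auto intro!: Ck_on_mult)
  qed
qed

text \<open>Affine maps that keep the coordinates apart are enough: they do not mix the two partial
  derivatives, and the reflections and translations taking either corner to the origin are of this
  kind.\<close>

lemma Ck_on_affine:
  assumes "open U" "open V" "\<And>p. p \<in> V \<Longrightarrow> (c * fst p + d, c' * snd p + d') \<in> U"
  shows "Ck_on k U f \<Longrightarrow> Ck_on k V (\<lambda>p. f (c * fst p + d, c' * snd p + d'))"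
proof (induction k arbitrary: f)
  case 0
  then show ?case using assms(3) by (auto intro!: continuous_intros continuous_on_compose2[of U f])
next
  case (Suc k)
  show ?case
  proof (rule Ck_on_SucI[OF \<open>open V\<close>])
    fix p assume p: "p \<in> V"
    let ?q = "(c * fst p + d, c' * snd p + d')"
    have "(f has_derivative (\<lambda>h. dx f ?q * fst h + dz f ?q * snd h)) (at ?q)"
      using Suc.prems assms(3)[OF p] has_derivative_partials by auto
    moreover have "((\<lambda>p. (c * fst p + d, c' * snd p + d')) has_derivative (\<lambda>h. (c * fst h, c' * snd h))) (at p)"
      by (auto intro!: derivative_eq_intros)
    ultimately have "((\<lambda>p. f (c * fst p + d, c' * snd p + d')) has_derivative
      (\<lambda>h. dx f ?q * fst (c * fst h, c' * snd h) + dz f ?q * snd (c * fst h, c' * snd h))) (at p)"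
      by (rule has_derivative_compose[rotated])
    then show "((\<lambda>p. f (c * fst p + d, c' * snd p + d')) has_derivative
      (\<lambda>h. (dx f ?q * c) * fst h + (dz f ?q * c') * snd h)) (at p)"
      by (simp add: algebra_simps)
  next
    show "Ck_on k V (\<lambda>p. dx f (c * fst p + d, c' * snd p + d') * c)"
      "Ck_on k V (\<lambda>p. dz f (c * fst p + d, c' * snd p + d') * c')"
      using Suc \<open>open V\<close> by (auto intro!: Ck_on_mult)
  qed
qed

lemma smooth_on_Suc:
  "smooth_on U f \<Longrightarrow> (\<forall>p\<in>U. f differentiable (at p)) \<and> Ck_on k U (dx f) \<and> Ck_on k U (dz f)"
  using Ck_on.simps(2)[of k U f] unfolding smooth_on_def by blast

lemma smooth_on_dx: "smooth_on U f \<Longrightarrow> smooth_on U (dx f)"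
  and smooth_on_dz: "smooth_on U f \<Longrightarrow> smooth_on U (dz f)"
  using smooth_on_Suc[of U f] by (simp_all add: smooth_on_def)

lemma smooth_on_continuous: "smooth_on U f \<Longrightarrow> continuous_on U f"
  using Ck_on.simps(1)[of U f] unfolding smooth_on_def by blast

lemma smooth_on_differentiable: "smooth_on U f \<Longrightarrow> p \<in> U \<Longrightarrow> f differentiable (at p)"
  using smooth_on_Suc[of U f] by simp

lemma smooth_on_has_partials:
  assumes "smooth_on U f" "p \<in> U"
  shows "((\<lambda>s. f (s, snd p)) has_real_derivative dx f p) (at (fst p))"
    "((\<lambda>s. f (fst p, s)) has_real_derivative dz f p) (at (snd p))"
  by (rule partials_of_has_derivative[OF has_derivative_partials[OF smooth_on_differentiable[OF assms]]])+

lemma smooth_on_subset: "smooth_on U f \<Longrightarrow> open V \<Longrightarrow> V \<subseteq> U \<Longrightarrow> smooth_on V f"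
  unfolding smooth_on_def by (auto intro: Ck_on_subset)

lemma smooth_on_cong: "smooth_on U f \<Longrightarrow> (\<And>p. p \<in> U \<Longrightarrow> f p = g p) \<Longrightarrow> smooth_on U g"
  unfolding smooth_on_def using Ck_on_cong[of U f g] by simp

lemma smooth_on_mult: "smooth_on U f \<Longrightarrow> smooth_on U g \<Longrightarrow> smooth_on U (\<lambda>p. f p * g p)"
  unfolding smooth_on_def by (auto intro: Ck_on_mult)

lemma smooth_on_diff: "smooth_on U f \<Longrightarrow> smooth_on U g \<Longrightarrow> smooth_on U (\<lambda>p. f p - g p)"
  unfolding smooth_on_def by (auto intro: Ck_on_diff)

text \<open>Differentiability and both partials at a point depend on a neighbourhood only, so the
  induction passes through them. It serves to glue local pieces, for instance a product extended by
  zero.\<close>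

lemma Ck_on_local:
  assumes "\<And>p. p \<in> U \<Longrightarrow> \<exists>V. open V \<and> p \<in> V \<and> Ck_on k V f"
  shows "Ck_on k U f"
  using assms
proof (induction k arbitrary: f)
  case 0
  have "isCont f p" if p: "p \<in> U" for p
  proof -
    obtain V where "open V" "p \<in> V" "continuous_on V f" using 0[OF p] unfolding Ck_on.simps by blast
    then show ?thesis by (simp add: continuous_on_eq_continuous_at)
  qed
  then show ?case by (simp add: continuous_at_imp_continuous_on)
next
  case (Suc k)
  have "f differentiable (at p)" if p: "p \<in> U" for p
    using Suc.prems[OF p] unfolding Ck_on.simps by blast
  moreover have "Ck_on k U (dx f)"
    by (rule Suc.IH) (use Suc.prems in \<open>unfold Ck_on.simps, blast\<close>)
  moreover have "Ck_on k U (dz f)"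
    by (rule Suc.IH) (use Suc.prems in \<open>unfold Ck_on.simps, blast\<close>)
  ultimately show ?case by simp
qed

lemma smooth_on_local:
  assumes "open U" "\<And>p. p \<in> U \<Longrightarrow> \<exists>V. p \<in> V \<and> smooth_on V f"
  shows "smooth_on U f"
  unfolding smooth_on_def
proof (intro conjI allI Ck_on_local)
  fix k p assume "p \<in> U"
  from assms(2)[OF this] show "\<exists>V. open V \<and> p \<in> V \<and> Ck_on k V f"
    unfolding smooth_on_def by blast
qed fact

subsection \<open>Smooth integral transforms\<close>

text \<open>The classical flat function exp(-1/x), zero for x <= 0; the negative powers of x are
  carried along because differentiation produces them.\<close>

definition flat :: "nat \<Rightarrow> real \<Rightarrow> real" where
  "flat k x = (if x > 0 then exp (- 1 / x) / x ^ k else 0)"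

lemma power_le_fact_exp:
  fixes y :: real assumes "y \<ge> 0"
  shows "y ^ n \<le> fact n * exp y"
proof -
  have "(\<lambda>n. inverse (fact n) * y ^ n) sums exp y"
    using exp_converges[of y] by (simp add: scaleR_conv_of_real field_simps)
  then have "inverse (fact n) * y ^ n \<le> exp y"
    by (rule sums_le[OF _ sums_single[of n "\<lambda>i. inverse (fact i) * y ^ i"], rotated]) (use assms in auto)
  then show ?thesis by (simp add: field_simps)
qed

lemma flat_nonneg: "flat k x \<ge> 0"
  by (simp add: flat_def)

text \<open>Apply y^n <= n! exp y at y = 1/x. The free exponent m gives boundedness for m = 0 and a
  quadratic zero at the origin for m = 2.\<close>

lemma flat_bound: "flat k x \<le> fact (k + m) * \<bar>x\<bar> ^ m"
proof (cases "x > 0")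
  case True
  have "(1/x) ^ (k + m) \<le> fact (k + m) * exp (1/x)"
    using power_le_fact_exp[of "1/x" "k+m"] True by simp
  then have "exp (- 1 / x) * (1/x) ^ k * (1/x) ^ m \<le> fact (k + m)"
    using True by (simp add: exp_minus power_add divide_simps mult_ac)
  then have "exp (- 1 / x) * (1/x) ^ k * ((1/x) ^ m * x ^ m) \<le> fact (k + m) * x ^ m"
    using True by (simp add: mult_right_mono flip: mult.assoc)
  then show ?thesis using True by (simp add: flat_def field_simps)
qed (auto simp: flat_def)

lemma flat_deriv: "(flat k has_real_derivative flat (k + 2) x - k * flat (k + 1) x) (at x)"
proof -
  consider "x > 0" | "x < 0" | "x = 0" by linarith
  then show ?thesis
  proof cases
    case 1
    have "((\<lambda>x. exp (- 1 / x) / x ^ k) has_real_derivative flat (k + 2) x - k * flat (k + 1) x) (at x)"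
    proof -
      \<comment> \<open>Writing k x^(k-1) as k x^k / x avoids the truncated difference k - 1 at k =
        0.\<close>
      have p: "((\<lambda>x. x ^ k) has_real_derivative k * x ^ k / x) (at x)"
        by (rule DERIV_cong[OF DERIV_pow]) (use 1 in \<open>cases k; simp\<close>)
      have e: "((\<lambda>x. exp (- 1 / x)) has_real_derivative exp (- 1 / x) / x\<^sup>2) (at x)"
        using 1 by (auto intro!: derivative_eq_intros simp: field_simps power2_eq_square)
      show ?thesis
        by (rule DERIV_cong[OF DERIV_divide[OF e p]])
          (use 1 in \<open>auto simp: flat_def field_simps power2_eq_square\<close>)
    qed
    then show ?thesis
      by (rule has_field_derivative_transform_within_open[of _ _ _ "{0<..}"]) (use 1 in \<open>auto simp: flat_def\<close>)
  next
    case 2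
    have "((\<lambda>x. 0) has_real_derivative flat (k + 2) x - k * flat (k + 1) x) (at x)"
      using 2 by (auto simp: flat_def)
    then show ?thesis
      by (rule has_field_derivative_transform_within_open[of _ _ _ "{..<0}"]) (use 2 in \<open>auto simp: flat_def\<close>)
  next
    case 3
    \<comment> \<open>The quadratic bound makes the difference quotient at the junction
      O(|h|).\<close>
    have "((\<lambda>h. flat k h / h) \<longlongrightarrow> 0) (at 0)"
    proof (rule Lim_null_comparison)
      show "\<forall>\<^sub>F h in at 0. norm (flat k h / h) \<le> fact (k + 2) * \<bar>h\<bar>"
      proof (rule always_eventually, rule allI)
        fix h :: real
        show "norm (flat k h / h) \<le> fact (k + 2) * \<bar>h\<bar>"
        proof (cases "h = 0")
          case False
          have "flat k h \<le> (fact (k + 2) * \<bar>h\<bar>) * \<bar>h\<bar>"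
            using flat_bound[of k h 2] by (simp only: power2_eq_square mult.assoc)
          then have "flat k h / \<bar>h\<bar> \<le> fact (k + 2) * \<bar>h\<bar>"
            using False by (simp only: pos_divide_le_eq zero_less_abs_iff not_False_eq_True)
          then show ?thesis using flat_nonneg[of k h] by (simp only: real_norm_def abs_divide abs_of_nonneg)
        qed simp
      qed
      show "((\<lambda>h. fact (k + 2) * \<bar>h\<bar>) \<longlongrightarrow> 0) (at (0::real))"
        by (auto intro!: tendsto_eq_intros)
    qed
    then show ?thesis using 3 by (simp add: has_field_derivative_iff flat_def)
  qed
qed

section \<open>Polynomial growth of a function and its derivatives\<close>

definition pgrow :: "(real \<Rightarrow> real) \<Rightarrow> bool" where
  "pgrow f \<longleftrightarrow> (\<exists>C k. \<forall>x. \<bar>f x\<bar> \<le> C * (1 + \<bar>x\<bar>) ^ k)"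

lemma pgrow_const: "pgrow (\<lambda>x. c)"
  unfolding pgrow_def by (intro exI[of _ "\<bar>c\<bar>"] exI[of _ 0]) auto

lemma pgrow_id: "pgrow (\<lambda>x. x)"
  unfolding pgrow_def by (intro exI[of _ 1] exI[of _ 1]) auto

lemma pgrowE:
  assumes "pgrow f"
  obtains C k where "C \<ge> 0" "\<And>x m. m \<ge> k \<Longrightarrow> \<bar>f x\<bar> \<le> C * (1 + \<bar>x\<bar>) ^ m"
proof -
  obtain C k where *: "\<And>x. \<bar>f x\<bar> \<le> C * (1 + \<bar>x\<bar>) ^ k" using assms by (auto simp: pgrow_def)
  have C: "C \<ge> 0" using *[of 0] by simp
  have "\<bar>f x\<bar> \<le> C * (1 + \<bar>x\<bar>) ^ m" if "m \<ge> k" for x m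
    using *[of x] mult_left_mono[OF power_increasing[OF that, of "1 + \<bar>x\<bar>"] C] by simp
  with C show ?thesis using that by blast
qed

lemma pgrow_add: "pgrow f \<Longrightarrow> pgrow g \<Longrightarrow> pgrow (\<lambda>x. f x + g x)"
proof -
  assume "pgrow f" "pgrow g"
  obtain C k where 1: "\<And>x m. m \<ge> k \<Longrightarrow> \<bar>f x\<bar> \<le> C * (1 + \<bar>x\<bar>) ^ m" using \<open>pgrow f\<close> by (rule pgrowE) blast
  obtain D l where 2: "\<And>x m. m \<ge> l \<Longrightarrow> \<bar>g x\<bar> \<le> D * (1 + \<bar>x\<bar>) ^ m" using \<open>pgrow g\<close> by (rule pgrowE) blast
  have "\<bar>f x + g x\<bar> \<le> (C + D) * (1 + \<bar>x\<bar>) ^ (k + l)" for x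
    using 1[of "k+l" x] 2[of "k+l" x] unfolding distrib_right by linarith
  then show ?thesis unfolding pgrow_def by blast
qed

lemma pgrow_mult: "pgrow f \<Longrightarrow> pgrow g \<Longrightarrow> pgrow (\<lambda>x. f x * g x)"
proof -
  assume "pgrow f" "pgrow g"
  obtain C k where 1: "C \<ge> 0" "\<And>x m. m \<ge> k \<Longrightarrow> \<bar>f x\<bar> \<le> C * (1 + \<bar>x\<bar>) ^ m" using \<open>pgrow f\<close> by (rule pgrowE) blast
  obtain D l where 2: "D \<ge> 0" "\<And>x m. m \<ge> l \<Longrightarrow> \<bar>g x\<bar> \<le> D * (1 + \<bar>x\<bar>) ^ m" using \<open>pgrow g\<close> by (rule pgrowE) blast
  have "\<bar>f x * g x\<bar> \<le> (C * D) * (1 + \<bar>x\<bar>) ^ (k + l)" for x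
    using mult_mono[OF 1(2)[of k x] 2(2)[of l x]] 1(1) by (simp add: abs_mult power_add mult_ac)
  then show ?thesis unfolding pgrow_def by blast
qed

text \<open>Functions that may be differentiated n times under an integral against an exponentially
  decaying weight. The derivative is existentially bound, so that a closed form can be supplied at
  each order.\<close>

fun tempered :: "nat \<Rightarrow> (real \<Rightarrow> real) \<Rightarrow> bool" where
  "tempered 0 f = (pgrow f \<and> continuous_on UNIV f)"
| "tempered (Suc n) f = (pgrow f \<and> (\<exists>f'. (\<forall>x. (f has_real_derivative f' x) (at x)) \<and> tempered n f'))"

lemma tempered_pgrow: "tempered n f \<Longrightarrow> pgrow f"
  by (cases n) auto

lemma tempered_SucI:
  "pgrow f \<Longrightarrow> (\<And>x. (f has_real_derivative f' x) (at x)) \<Longrightarrow> tempered n f' \<Longrightarrow> tempered (Suc n) f"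
  by auto

lemma tempered_SucE:
  assumes "tempered (Suc n) f"
  obtains f' where "\<And>x. (f has_real_derivative f' x) (at x)" "tempered n f'"
  using assms by auto

lemma tempered_SucD: "tempered (Suc n) f \<Longrightarrow> tempered n f"
proof (induction n arbitrary: f)
  case 0
  then show ?case by (auto intro!: continuous_at_imp_continuous_on dest!: DERIV_continuous)
next
  case (Suc n)
  from Suc.prems obtain f' where "\<And>x. (f has_real_derivative f' x) (at x)" "tempered (Suc n) f'"
    by (rule tempered_SucE) blast
  then show ?case using Suc.IH[of f'] tempered_pgrow[OF Suc.prems] tempered_SucI[of f f' n] by blast
qed

lemma tempered_const: "tempered n (\<lambda>x. c)"
proof (induction n arbitrary: c)
  case (Suc n)
  show ?case by (rule tempered_SucI[of _ "\<lambda>_. 0"]) (auto intro: pgrow_const Suc)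
qed (auto intro: pgrow_const)

lemma tempered_id: "tempered n (\<lambda>x. x)"
  by (cases n) (auto intro!: pgrow_id exI[of _ "\<lambda>_. 1"] tempered_const)

lemma tempered_add: "tempered n f \<Longrightarrow> tempered n g \<Longrightarrow> tempered n (\<lambda>x. f x + g x)"
proof (induction n arbitrary: f g)
  case 0
  then show ?case by (auto intro: pgrow_add continuous_on_add)
next
  case (Suc n)
  obtain f' where 1: "\<And>x. (f has_real_derivative f' x) (at x)" "tempered n f'" using Suc.prems(1) by (rule tempered_SucE) blast
  obtain g' where 2: "\<And>x. (g has_real_derivative g' x) (at x)" "tempered n g'" using Suc.prems(2) by (rule tempered_SucE) blast
  show ?case using 1 2 Suc.IH tempered_pgrow[OF Suc.prems(1)] tempered_pgrow[OF Suc.prems(2)]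
    by (intro tempered_SucI[of _ "\<lambda>x. f' x + g' x"]) (auto intro!: derivative_intros pgrow_add)
qed

lemma tempered_mult: "tempered n f \<Longrightarrow> tempered n g \<Longrightarrow> tempered n (\<lambda>x. f x * g x)"
proof (induction n arbitrary: f g)
  case 0
  then show ?case by (auto intro: pgrow_mult continuous_on_mult)
next
  case (Suc n)
  obtain f' where 1: "\<And>x. (f has_real_derivative f' x) (at x)" "tempered n f'" using Suc.prems(1) by (rule tempered_SucE) blast
  obtain g' where 2: "\<And>x. (g has_real_derivative g' x) (at x)" "tempered n g'" using Suc.prems(2) by (rule tempered_SucE) blast
  show ?case
  proof (rule tempered_SucI)
    show "pgrow (\<lambda>x. f x * g x)" using Suc.prems by (intro pgrow_mult tempered_pgrow)
    show "((\<lambda>x. f x * g x) has_real_derivative f' x * g x + g' x * f x) (at x)" for x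
      using DERIV_mult[OF 1(1) 2(1)] .
    show "tempered n (\<lambda>x. f' x * g x + g' x * f x)"
      using Suc.IH[OF 1(2) tempered_SucD[OF Suc.prems(2)]] Suc.IH[OF 2(2) tempered_SucD[OF Suc.prems(1)]]
      by (rule tempered_add)
  qed
qed

lemma tempered_flat_reflect: "tempered n (\<lambda>x. flat k (- x))"
proof (induction n arbitrary: k)
  have pg: "pgrow (\<lambda>x. flat k (- x))" for k
    unfolding pgrow_def using flat_bound[of k _ 0] flat_nonneg by (intro exI[of _ "fact k"] exI[of _ 0]) auto
  have d: "((\<lambda>x. flat k (- x)) has_real_derivative (- 1) * flat (k + 2) (- x) + k * flat (k + 1) (- x)) (at x)" for k x
    by (rule DERIV_cong[OF DERIV_chain2[OF flat_deriv]]) (auto intro!: derivative_eq_intros)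
  {
    case 0
    show ?case using pg d by (auto intro!: continuous_at_imp_continuous_on DERIV_isCont)
  next
    case (Suc n)
    show ?case using pg d by (rule tempered_SucI) (intro tempered_add tempered_mult tempered_const Suc)
  }
qed

text \<open>A positive smooth function which agrees with \<open>(1 + v)\<^sup>2\<close> for \<open>v \<ge> 0\<close>: its powers extend
  \<open>(1 + v) powr b\<close> smoothly beyond the singularity at \<open>v = -1\<close>.\<close>

definition base_ext :: "real \<Rightarrow> real" where
  "base_ext v = (1 + v)\<^sup>2 + flat 0 (- v)"

definition powr_ext :: "real \<Rightarrow> real \<Rightarrow> real" where
  "powr_ext b v = base_ext v powr (b / 2)"

lemma powr_ext_eq: "v \<ge> 0 \<Longrightarrow> powr_ext b v = (1 + v) powr b"
proof -
  assume v: "v \<ge> 0"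
  have "powr_ext b v = ((1 + v)\<^sup>2) powr (b / 2)" using v by (simp add: powr_ext_def base_ext_def flat_def)
  also have "\<dots> = ((1 + v) powr 2) powr (b / 2)" using v by (simp add: powr_numeral)
  finally show ?thesis by (simp add: powr_powr)
qed

text \<open>Left of -1/2 the flat term is exp(1/v) >= exp(-2) >= 1/9, as e <= 3; right of it the
  square is at least 1/4. A positive lower bound keeps real powers of either sign smooth.\<close>

lemma base_ext_pos: "base_ext v \<ge> 1/9"
proof (cases "v \<ge> - (1/2)")
  case True
  then have "(1/2)\<^sup>2 \<le> (1 + v)\<^sup>2" by (intro power_mono) auto
  then show ?thesis using flat_nonneg[of 0 "-v"] by (simp add: base_ext_def power2_eq_square)
next
  case False
  have "flat 0 (- v) = exp (1 / v)" using False by (simp add: flat_def)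
  moreover have "1 / v \<ge> -2" using False by (simp add: field_simps)
  moreover have "exp (2::real) \<le> 9"
  proof -
    have "exp (2::real) = exp 1 * exp 1" by (simp flip: exp_add)
    also have "\<dots> \<le> 3 * 3" using exp_le by (intro mult_mono) auto
    finally show ?thesis by simp
  qed
  then have "exp (-2::real) \<ge> 1/9" by (simp add: exp_minus field_simps)
  ultimately have "flat 0 (- v) \<ge> 1/9" by (smt (verit) exp_le_cancel_iff)
  then show ?thesis by (simp add: base_ext_def add_increasing)
qed

lemma base_ext_deriv: "(base_ext has_real_derivative 2 + 2 * v + - 1 * flat 2 (- v)) (at v)"
  unfolding base_ext_def
  by (rule derivative_eq_intros refl DERIV_chain2[OF flat_deriv])+ (auto simp: numeral_2_eq_2)

text \<open>For b >= 0 the base is bounded above by a quadratic polynomial in |v|, for b < 0 it is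
  bounded below by 1/9.\<close>

lemma pgrow_powr_ext: "pgrow (powr_ext b)"
proof (cases "b \<ge> 0")
  case True
  define k where "k = nat \<lceil>b\<rceil>"
  have "\<bar>powr_ext b v\<bar> \<le> 2 ^ k * (1 + \<bar>v\<bar>) ^ (2 * k)" for v
  proof -
    have f: "flat 0 (-v) \<le> 1" using flat_bound[of 0 "-v" 0] by simp
    have "(1 + v)\<^sup>2 \<le> (1 + \<bar>v\<bar>)\<^sup>2" by (rule power2_le_iff_abs_le[THEN iffD2]) auto
    moreover have "1 \<le> (1 + \<bar>v\<bar>)\<^sup>2" by (rule one_le_power) auto
    ultimately have 1: "base_ext v \<le> 2 * (1 + \<bar>v\<bar>)\<^sup>2" using f unfolding base_ext_def by linarith
    have g: "1 \<le> 2 * (1 + \<bar>v\<bar>)\<^sup>2" using \<open>1 \<le> (1 + \<bar>v\<bar>)\<^sup>2\<close> by linarith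
    have "powr_ext b v \<le> (2 * (1 + \<bar>v\<bar>)\<^sup>2) powr (b / 2)"
      unfolding powr_ext_def using True 1 base_ext_pos[of v] by (intro powr_mono2) auto
    also have "\<dots> \<le> (2 * (1 + \<bar>v\<bar>)\<^sup>2) powr real k"
      using g True by (intro powr_mono) (auto simp: k_def, linarith)
    also have "\<dots> = (2 * (1 + \<bar>v\<bar>)\<^sup>2) ^ k" using g by (intro powr_realpow) linarith
    also have "\<dots> = 2 ^ k * (1 + \<bar>v\<bar>) ^ (2 * k)" by (simp add: power_mult_distrib flip: power_mult)
    finally show ?thesis by (simp add: powr_ext_def)
  qed
  then show ?thesis unfolding pgrow_def by blast
next
  case False
  have "\<bar>powr_ext b v\<bar> \<le> (1/9) powr (b/2) * (1 + \<bar>v\<bar>) ^ 0" for v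
    unfolding powr_ext_def using False base_ext_pos[of v] by (auto intro!: powr_mono2')
  then show ?thesis unfolding pgrow_def by blast
qed

lemma powr_ext_deriv:
  "(powr_ext b has_real_derivative (b / 2 * (2 + 2 * v + - 1 * flat 2 (- v))) * powr_ext (b - 2) v) (at v)"
proof -
  have "base_ext v > 0" using base_ext_pos[of v] by linarith
  then have "((\<lambda>v. base_ext v powr (b / 2)) has_real_derivative
     b / 2 * base_ext v powr (b / 2 - 1) * (2 + 2 * v + - 1 * flat 2 (- v))) (at v)"
    by (intro DERIV_chain2[OF has_real_derivative_powr base_ext_deriv])
  then show ?thesis unfolding powr_ext_def[abs_def] by (simp add: diff_divide_distrib mult_ac)
qed

lemma tempered_powr_ext: "tempered n (powr_ext b)"
proof (induction n arbitrary: b)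
  case 0
  show ?case by (auto intro!: pgrow_powr_ext continuous_at_imp_continuous_on DERIV_isCont powr_ext_deriv)
next
  case (Suc n)
  show ?case using pgrow_powr_ext powr_ext_deriv
    by (rule tempered_SucI)
      (intro tempered_mult tempered_add tempered_const tempered_id tempered_flat_reflect Suc)
qed

section \<open>Differentiation under the integral sign, and transforms with the Gamma weight\<close>

lemma has_derivative_under_integral:
  fixes f f' :: "real \<Rightarrow> 'a \<Rightarrow> real"
  assumes r: "r > 0" and int: "\<And>w. integrable M (f w)"
    and der: "\<And>w s. \<bar>w - w0\<bar> < r \<Longrightarrow> s \<in> space M \<Longrightarrow> ((\<lambda>w. f w s) has_real_derivative f' w s) (at w)"
    and meas: "f' w0 \<in> borel_measurable M"
    and bound: "\<And>w s. \<bar>w - w0\<bar> < r \<Longrightarrow> s \<in> space M \<Longrightarrow> \<bar>f' w s\<bar> \<le> g s" and g: "integrable M g"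
  shows "((\<lambda>w. integral\<^sup>L M (f w)) has_real_derivative integral\<^sup>L M (f' w0)) (at w0)"
proof -
  \<comment> \<open>The quotient is set to 0 for |h| >= r, so that g dominates every member of the
    sequence and not just all but finitely many.\<close>
  define Q where "Q h s = (if \<bar>h\<bar> < r then (f (w0 + h) s - f w0 s) / h else 0)" for h s
  have Qint: "integrable M (Q h)" for h unfolding Q_def using int by (cases "\<bar>h\<bar> < r") auto
  have "((\<lambda>h. integral\<^sup>L M (Q h)) \<longlongrightarrow> integral\<^sup>L M (f' w0)) (at 0)"
    unfolding tendsto_at_iff_sequentially o_def
  proof (intro allI impI)
    fix X :: "nat \<Rightarrow> real" assume X: "\<forall>i. X i \<in> UNIV - {0}" "X \<longlonglongrightarrow> 0"
    show "(\<lambda>i. integral\<^sup>L M (Q (X i))) \<longlonglongrightarrow> integral\<^sup>L M (f' w0)"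
    proof (rule integral_dominated_convergence[where w = g])
      show "Q (X i) \<in> borel_measurable M" for i using Qint by auto
      show "AE s in M. (\<lambda>i. Q (X i) s) \<longlonglongrightarrow> f' w0 s"
      proof (rule AE_I2)
        fix s assume s: "s \<in> space M"
        have "((\<lambda>h. (f (w0 + h) s - f w0 s) / h) \<longlongrightarrow> f' w0 s) (at 0)"
          using der[of w0 s] s r by (simp add: DERIV_def)
        moreover have "filterlim X (at 0) sequentially" using X by (auto simp: filterlim_at)
        ultimately have "(\<lambda>i. (f (w0 + X i) s - f w0 s) / X i) \<longlonglongrightarrow> f' w0 s"
          by (rule filterlim_compose)
        moreover have "\<forall>\<^sub>F i in sequentially. \<bar>X i\<bar> < r"
          using X(2) r by (auto simp: tendsto_iff dist_real_def)
        then have "\<forall>\<^sub>F i in sequentially. (f (w0 + X i) s - f w0 s) / X i = Q (X i) s"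
          by eventually_elim (simp add: Q_def)
        ultimately show "(\<lambda>i. Q (X i) s) \<longlonglongrightarrow> f' w0 s"
          by (rule Lim_transform_eventually)
      qed
      show "AE s in M. norm (Q (X i) s) \<le> g s" for i
      proof (rule AE_I2)
        fix s assume s: "s \<in> space M"
        show "norm (Q (X i) s) \<le> g s"
        proof (cases "\<bar>X i\<bar> < r")
          case True
          have "norm (f (w0 + X i) s - f w0 s) \<le> g s * norm (w0 + X i - w0)"
          proof (rule field_differentiable_bound[of "ball w0 r" "\<lambda>w. f w s" "\<lambda>w. f' w s"])
            show "((\<lambda>w. f w s) has_field_derivative f' w s) (at w within ball w0 r)" if "w \<in> ball w0 r" for w
              using der[of w s] that s by (auto simp: dist_real_def abs_minus_commute intro: has_field_derivative_at_within)
            show "norm (f' w s) \<le> g s" if "w \<in> ball w0 r" for w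
              using bound[of w s] that s by (auto simp: dist_real_def abs_minus_commute)
          qed (use True r in \<open>auto simp: dist_real_def\<close>)
          then show ?thesis using X(1) True by (auto simp: Q_def field_simps)
        next
          case False
          then show ?thesis using bound[of w0 s] r s by (auto simp: Q_def)
        qed
      qed
    qed (use meas g in auto)
  qed
  moreover have "\<forall>\<^sub>F h in at 0. integral\<^sup>L M (Q h) = (integral\<^sup>L M (f (w0 + h)) - integral\<^sup>L M (f w0)) / h"
  proof -
    have "\<forall>\<^sub>F h in at (0::real). \<bar>h\<bar> < r" using r by (auto simp: eventually_at dist_real_def)
    then show ?thesis
    proof eventually_elim
      case (elim h)
      then have "Q h = (\<lambda>s. (f (w0 + h) s - f w0 s) / h)" by (auto simp: Q_def)
      then show ?case using int by (simp add: Bochner_Integration.integral_diff)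
    qed
  qed
  ultimately show ?thesis
    unfolding DERIV_def by (rule Lim_transform_eventually)
qed

text \<open>The integrand of Euler's Gamma integral, zero on the left half line. Multiplication by s
  raises a by one, so differentiating a transform in its argument stays within this family.\<close>

definition gkern :: "real \<Rightarrow> real \<Rightarrow> real" where
  "gkern a s = indicator {0<..} s * (exp (- s) * s powr (a - 1))"

lemma gkern_nonneg: "gkern a s \<ge> 0"
  by (simp add: gkern_def)

lemma gkern_measurable [measurable]: "gkern a \<in> borel_measurable borel"
  unfolding gkern_def by measurable

lemma gkern_Suc: "s * gkern a s = gkern (a + 1) s"
proof (cases "s > 0")
  case True
  then show ?thesis using powr_mult_base[of s "a - 1"] by (simp add: gkern_def mult_ac)
qed (simp add: gkern_def)

lemma has_bochner_integral_gkern: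
  assumes "a > 0"
  shows "has_bochner_integral lborel (gkern a) (Gamma a)"
proof (rule has_bochner_integral_nn_integral)
  have "ennreal (Gamma a) = (\<integral>\<^sup>+x. ennreal (indicator {0..} x * (x powr (a - 1) / exp x)) \<partial>lborel)"
    using nn_integral_has_integral_lebesgue[OF _ Gamma_integral_real[OF assms]] by simp
  also have "\<dots> = (\<integral>\<^sup>+x. ennreal (gkern a x) \<partial>lborel)"
    by (intro nn_integral_cong) (auto simp: gkern_def exp_minus field_simps split: split_indicator)
  finally show "(\<integral>\<^sup>+x. ennreal (gkern a x) \<partial>lborel) = ennreal (Gamma a)" ..
qed (use assms in \<open>auto simp: gkern_nonneg intro: less_imp_le Gamma_real_pos\<close>)

lemma integrable_gkern: "a > 0 \<Longrightarrow> integrable lborel (gkern a)"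
  and integral_gkern: "a > 0 \<Longrightarrow> integral\<^sup>L lborel (gkern a) = Gamma a"
  using has_bochner_integral_gkern by (auto simp: has_bochner_integral_iff)

lemma integrable_gkern_power: "a > 0 \<Longrightarrow> integrable lborel (\<lambda>s. gkern a s * (1 + s) ^ k)"
proof (induction k arbitrary: a)
  case 0
  then show ?case by (simp add: integrable_gkern)
next
  case (Suc k)
  have "gkern a s * (1 + s) ^ Suc k = gkern a s * (1 + s) ^ k + gkern (a + 1) s * (1 + s) ^ k" for s
    unfolding gkern_Suc[symmetric] by (simp add: algebra_simps)
  then show ?case using Suc by (simp add: Bochner_Integration.integrable_add)
qed

text \<open>For |w| <= B and s > 0 one has 1 + |s w| <= (1 + B)(1 + s), so a single integrable
  majorant serves all such w, as domination near a fixed argument requires.\<close>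

lemma gkern_pgrow_bound:
  assumes "pgrow q" "B \<ge> 0" "a > 0"
  obtains g where "integrable lborel g" "\<And>w s. \<bar>w\<bar> \<le> B \<Longrightarrow> \<bar>gkern a s * q (s * w)\<bar> \<le> g s"
proof -
  obtain C k where C: "C \<ge> 0" "\<And>x m. m \<ge> k \<Longrightarrow> \<bar>q x\<bar> \<le> C * (1 + \<bar>x\<bar>) ^ m" using assms(1) by (rule pgrowE) blast
  have "\<bar>gkern a s * q (s * w)\<bar> \<le> (C * (1 + B) ^ k) * (gkern a s * (1 + s) ^ k)" if w: "\<bar>w\<bar> \<le> B" for w s
  proof (cases "s > 0")
    case True
    have "1 + \<bar>s * w\<bar> \<le> 1 + s * B" using True w by (simp add: abs_mult mult_left_mono)
    also have "\<dots> \<le> (1 + B) * (1 + s)" using True assms(2) by (simp add: algebra_simps)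
    finally have "(1 + \<bar>s * w\<bar>) ^ k \<le> ((1 + B) * (1 + s)) ^ k" by (intro power_mono) auto
    then have "\<bar>q (s * w)\<bar> \<le> C * ((1 + B) * (1 + s)) ^ k"
      using C(2)[of k "s * w"] mult_left_mono[OF _ C(1)] by (meson order_trans order_refl)
    then have "gkern a s * \<bar>q (s * w)\<bar> \<le> gkern a s * (C * ((1 + B) * (1 + s)) ^ k)"
      by (intro mult_left_mono gkern_nonneg)
    then show ?thesis by (simp add: abs_mult gkern_nonneg power_mult_distrib mult_ac)
  qed (simp add: gkern_def)
  moreover have "integrable lborel (\<lambda>s. (C * (1 + B) ^ k) * (gkern a s * (1 + s) ^ k))"
    using integrable_gkern_power[OF assms(3)] by simp
  ultimately show ?thesis using that by blast
qed

definition gtransform :: "real \<Rightarrow> (real \<Rightarrow> real) \<Rightarrow> real \<Rightarrow> real" where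
  "gtransform a q w = (\<integral>s. gkern a s * q (s * w) \<partial>lborel)"

lemma integrable_gtransform:
  assumes "a > 0" "tempered n q"
  shows "integrable lborel (\<lambda>s. gkern a s * q (s * w))"
proof -
  have "continuous_on UNIV q"
    using assms(2) by (cases n) (auto intro!: continuous_at_imp_continuous_on dest!: DERIV_isCont)
  then have [measurable]: "q \<in> borel_measurable borel" by (rule borel_measurable_continuous_onI)
  obtain g where g: "integrable lborel g" "\<And>v s. \<bar>v\<bar> \<le> \<bar>w\<bar> \<Longrightarrow> \<bar>gkern a s * q (s * v)\<bar> \<le> g s"
    using gkern_pgrow_bound[OF tempered_pgrow[OF assms(2)], of "\<bar>w\<bar>" a] assms(1) by auto
  show ?thesis
  proof (rule Bochner_Integration.integrable_bound[OF g(1)])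
    show "AE s in lborel. norm (gkern a s * q (s * w)) \<le> norm (g s)"
      using g(2)[of w] by (intro AE_I2) (fastforce intro: order_trans)
  qed measurable
qed

lemma gtransform_deriv:
  assumes a: "a > 0" and q: "tempered n q" and q': "tempered m q'"
    and d: "\<And>x. (q has_real_derivative q' x) (at x)"
  shows "(gtransform a q has_real_derivative gtransform (a + 1) q' w) (at w)"
proof -
  obtain g where g: "integrable lborel g" "\<And>v s. \<bar>v\<bar> \<le> \<bar>w\<bar> + 1 \<Longrightarrow> \<bar>gkern (a + 1) s * q' (s * v)\<bar> \<le> g s"
    using gkern_pgrow_bound[OF tempered_pgrow[OF q'], of "\<bar>w\<bar> + 1" "a + 1"] a by auto
  show ?thesis unfolding gtransform_def[abs_def]
  proof (rule has_derivative_under_integral[OF zero_less_one])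
    show "integrable lborel (\<lambda>s. gkern a s * q (s * w))" for w by (rule integrable_gtransform[OF a q])
    show "((\<lambda>w. gkern a s * q (s * w)) has_real_derivative gkern (a + 1) s * q' (s * v)) (at v)" for v s
      unfolding gkern_Suc[symmetric]
      by (rule DERIV_cong[OF DERIV_cmult[OF DERIV_chain2[OF d]]]) (auto intro!: derivative_eq_intros)
    show "(\<lambda>s. gkern (a + 1) s * q' (s * w)) \<in> borel_measurable lborel"
      using integrable_gtransform[OF _ q', of "a + 1" w] a by auto
    show "\<bar>gkern (a + 1) s * q' (s * v)\<bar> \<le> g s" if "\<bar>v - w\<bar> < 1" for v s
      by (rule g(2)) (use that in linarith)
  qed (rule g(1))
qed

text \<open>One derivative of q is spent in the base case, where continuity of the transform is
  deduced from its differentiability.\<close>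

lemma Cn_on_gtransform: "a > 0 \<Longrightarrow> tempered (Suc n) q \<Longrightarrow> Cn_on n UNIV (gtransform a q)"
proof (induction n arbitrary: a q)
  case 0
  obtain q' where "\<And>x. (q has_real_derivative q' x) (at x)" "tempered 0 q'" using 0(2) by (rule tempered_SucE) blast
  from gtransform_deriv[OF 0 this(2,1)] show ?case
    by (auto intro!: continuous_at_imp_continuous_on DERIV_isCont)
next
  case (Suc n)
  obtain q' where q': "\<And>x. (q has_real_derivative q' x) (at x)" "tempered (Suc n) q'" using Suc.prems(2) by (rule tempered_SucE) blast
  from gtransform_deriv[OF Suc.prems this(2,1)] Suc.IH[of "a + 1" q'] Suc.prems(1) q'(2) show ?case
    by (intro Cn_on_derivI[of _ _ "gtransform (a + 1) q'"]) auto
qed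

text \<open>For \<open>w \<ge> 0\<close> this is the integral of \<open>exp (- s) * s powr (a - 1) * (1 + s * w) powr b\<close> over \<open>s > 0\<close>.\<close>

definition Jint :: "real \<Rightarrow> real \<Rightarrow> real \<Rightarrow> real" where
  "Jint a b = gtransform a (powr_ext b)"

lemma gkern_cong: "(s > 0 \<Longrightarrow> f = g) \<Longrightarrow> gkern a s * f = gkern a s * g"
  by (cases "s > 0") (auto simp: gkern_def)

lemma gkern_powr_ext: "w \<ge> 0 \<Longrightarrow> gkern a s * powr_ext b (s * w) = gkern a s * (1 + s * w) powr b"
  by (rule gkern_cong) (simp add: powr_ext_eq)

lemma Jint_eq: "w \<ge> 0 \<Longrightarrow> Jint a b w = (\<integral>s. gkern a s * (1 + s * w) powr b \<partial>lborel)"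
  by (simp add: Jint_def gtransform_def gkern_powr_ext)

lemma integrable_Jint:
  assumes "a > 0" "w \<ge> 0" shows "integrable lborel (\<lambda>s. gkern a s * (1 + s * w) powr b)"
  using integrable_gtransform[OF assms(1) tempered_powr_ext[of 0 b], of w] assms(2)
  by (simp add: gkern_powr_ext)

lemma Cn_on_Jint: "a > 0 \<Longrightarrow> Cn_on n UNIV (Jint a b)"
  unfolding Jint_def by (intro Cn_on_gtransform tempered_powr_ext)

text \<open>The extension is invisible at w >= 0: all s w are then nonnegative, where the flat
  correction vanishes. The derivative is nevertheless two-sided, even at w = 0.\<close>

lemma Jint_deriv:
  assumes "a > 0" "w \<ge> 0"
  shows "(Jint a b has_real_derivative b * Jint (a + 1) (b - 1) w) (at w)"
proof -
  let ?q = "\<lambda>v. (b / 2 * (2 + 2 * v + - 1 * flat 2 (- v))) * powr_ext (b - 2) v"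
  have t: "tempered 0 ?q"
    by (intro tempered_mult tempered_add tempered_const tempered_id tempered_flat_reflect tempered_powr_ext)
  have "(Jint a b has_real_derivative gtransform (a + 1) ?q w) (at w)"
    unfolding Jint_def by (rule gtransform_deriv[OF assms(1) tempered_powr_ext t powr_ext_deriv])
  also have "gtransform (a + 1) ?q w = (\<integral>s. b * (gkern (a + 1) s * (1 + s * w) powr (b - 1)) \<partial>lborel)"
    unfolding gtransform_def
  proof (rule Bochner_Integration.integral_cong[OF refl])
    fix s
    have "gkern (a + 1) s * ?q (s * w) = gkern (a + 1) s * (b * (1 + s * w) powr (b - 1))"
    proof (rule gkern_cong)
      assume s: "s > 0"
      have p: "(1 + s * w) > 0" using s assms(2) by (simp add: add_pos_nonneg)
      have e: "(1 + s * w) * (1 + s * w) powr (b - 2) = (1 + s * w) powr (b - 1)"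
        using p powr_mult_base[of "1 + s * w" "b - 2"] by simp
      have fl: "flat 2 (- (s * w)) = 0" unfolding flat_def
        by (rule if_not_P) (use mult_nonneg_nonneg[of s w] s assms(2) in linarith)
      have "?q (s * w) = b * ((1 + s * w) * (1 + s * w) powr (b - 2))"
        using s assms(2) fl by (simp add: powr_ext_eq algebra_simps)
      then show "?q (s * w) = b * (1 + s * w) powr (b - 1)" unfolding e .
    qed
    then show "gkern (a + 1) s * ?q (s * w) = b * (gkern (a + 1) s * (1 + s * w) powr (b - 1))" by simp
  qed
  also have "\<dots> = b * Jint (a + 1) (b - 1) w" using assms by (simp add: Jint_eq)
  finally show ?thesis .
qed

text \<open>Split off one factor 1 + s w. For w > 0, \<open>Jint a b w\<close> is Gamma(a) w^(-a)
  times Tricomi's U(a, a+b+1, 1/w); this contiguous relation and \<open>Jint_parts\<close> are the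
  ones by which the ODE is checked.\<close>

lemma Jint_split:
  assumes "a > 0" "w \<ge> 0"
  shows "Jint a b w = Jint a (b - 1) w + w * Jint (a + 1) (b - 1) w"
proof -
  have "gkern a s * (1 + s * w) powr b =
      gkern a s * (1 + s * w) powr (b - 1) + w * (gkern (a + 1) s * (1 + s * w) powr (b - 1))" for s
  proof -
    have "gkern a s * (1 + s * w) powr b = gkern a s * ((1 + s * w) * (1 + s * w) powr (b - 1))"
    proof (rule gkern_cong)
      assume "s > 0"
      then have p: "(1 + s * w) > 0" using assms(2) by (simp add: add_pos_nonneg)
      then show "(1 + s * w) powr b = (1 + s * w) * (1 + s * w) powr (b - 1)"
        using powr_mult_base[of "1 + s * w" "b - 1"] by simp
    qed
    then show ?thesis unfolding gkern_Suc[symmetric] by (simp add: algebra_simps)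
  qed
  then have "Jint a b w = (\<integral>s. gkern a s * (1 + s * w) powr (b - 1) + w * (gkern (a + 1) s * (1 + s * w) powr (b - 1)) \<partial>lborel)"
    using assms by (simp add: Jint_eq)
  also have "\<dots> = Jint a (b - 1) w + w * Jint (a + 1) (b - 1) w"
    using assms by (subst Bochner_Integration.integral_add) (auto simp: Jint_eq integrable_Jint)
  finally show ?thesis .
qed

text \<open>Supplies the boundary term at infinity in \<open>Jint_parts\<close>; both powers are
  dominated by integer powers of 1 + s.\<close>

lemma tendsto_exp_powr_powr:
  assumes "w \<ge> 0"
  shows "((\<lambda>s::real. exp (- s) * s powr a * (1 + s * w) powr b) \<longlongrightarrow> 0) at_top"
proof -
  define k where "k = nat \<lceil>\<bar>a\<bar>\<rceil>"
  define l where "l = nat \<lceil>\<bar>b\<bar>\<rceil>"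
  have k: "a \<le> real k" unfolding k_def by linarith
  have l: "b \<le> real l" unfolding l_def by linarith
  have "((\<lambda>s::real. (1 + s) ^ (k + l) / exp (1 + s)) \<longlongrightarrow> 0) at_top"
    by (rule filterlim_compose[OF tendsto_power_div_exp_0]) (rule filterlim_tendsto_add_at_top[OF tendsto_const filterlim_ident])
  then have lim: "((\<lambda>s::real. (1 + w) ^ l * exp 1 * ((1 + s) ^ (k + l) / exp (1 + s))) \<longlongrightarrow> 0) at_top"
    by (rule tendsto_mult_right_zero)
  show ?thesis
  proof (rule Lim_null_comparison[OF _ lim])
    show "\<forall>\<^sub>F s in at_top. norm (exp (- s) * s powr a * (1 + s * w) powr b) \<le> (1 + w) ^ l * exp 1 * ((1 + s) ^ (k + l) / exp (1 + s))"
      using eventually_ge_at_top[of 1]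
    proof eventually_elim
      case (elim s)
      have "s powr a \<le> s powr real k" using elim k by (intro powr_mono) auto
      also have "\<dots> = s ^ k" using elim by (simp add: powr_realpow)
      also have "\<dots> \<le> (1 + s) ^ k" using elim by (intro power_mono) auto
      finally have 1: "s powr a \<le> (1 + s) ^ k" .
      have p: "1 \<le> 1 + s * w" using elim assms by simp
      have "(1 + s * w) powr b \<le> (1 + s * w) powr real l" using p l by (intro powr_mono) auto
      also have "\<dots> = (1 + s * w) ^ l" using p by (intro powr_realpow) linarith
      also have "\<dots> \<le> ((1 + w) * (1 + s)) ^ l" using elim assms by (intro power_mono) (auto simp: algebra_simps)
      finally have 2: "(1 + s * w) powr b \<le> (1 + w) ^ l * (1 + s) ^ l" by (simp add: power_mult_distrib)
      have "s powr a * (1 + s * w) powr b \<le> (1 + s) ^ k * ((1 + w) ^ l * (1 + s) ^ l)"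
        using 1 2 elim by (intro mult_mono) auto
      then have "exp (- s) * (s powr a * (1 + s * w) powr b) \<le> exp (- s) * ((1 + s) ^ k * ((1 + w) ^ l * (1 + s) ^ l))"
        by (intro mult_left_mono) auto
      then show ?case by (simp add: abs_mult power_add exp_add exp_minus field_simps)
    qed
  qed
qed

text \<open>Integrate the derivative of exp(-s) s^a (1 + s w)^b over the half line; the boundary
  term at 0 vanishes because a > 0.\<close>

lemma Jint_parts:
  assumes a: "a > 0" and w: "w \<ge> 0"
  shows "Jint (a + 1) b w = a * Jint a b w + b * w * Jint (a + 1) (b - 1) w"
proof -
  define F where "F s = exp (- s) * s powr a * (1 + s * w) powr b" for s
  define f where "f s = - (exp (- s) * s powr a * (1 + s * w) powr b) + a * (exp (- s) * s powr (a - 1) * (1 + s * w) powr b)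
      + b * w * (exp (- s) * s powr a * (1 + s * w) powr (b - 1))" for s
  define g where "g s = - (gkern (a + 1) s * (1 + s * w) powr b) + a * (gkern a s * (1 + s * w) powr b)
      + b * w * (gkern (a + 1) s * (1 + s * w) powr (b - 1))" for s
  have fg: "indicator {0<..} s *\<^sub>R f s = g s" for s
    by (cases "s > 0") (auto simp: f_def g_def gkern_def)
  have gint: "integrable lborel g"
    unfolding g_def using a w
    by (intro Bochner_Integration.integrable_add Bochner_Integration.integrable_minus integrable_mult_right integrable_Jint) auto
  have pos: "1 + s * w > 0" if "s > 0" for s using that w by (simp add: add_pos_nonneg)
  have E: "einterval 0 \<infinity> = {0<..}" by (auto simp: einterval_def zero_ereal_def)
  have "(LBINT x=0..\<infinity>. f x) = 0 - 0"
  proof (rule interval_integral_FTC_integrable)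
    show "(0::ereal) < \<infinity>" by simp
    show "(F has_vector_derivative f x) (at x)" if "0 < ereal x" "ereal x < \<infinity>" for x
    proof -
      have x: "x > 0" using that by simp
      have "(F has_real_derivative f x) (at x)"
        unfolding F_def
        by (rule derivative_eq_intros refl DERIV_chain2[OF has_real_derivative_powr] x pos[OF x])+
          (simp add: f_def algebra_simps)
      then show ?thesis by (simp add: has_real_derivative_iff_has_vector_derivative)
    qed
    show "isCont f x" if "0 < ereal x" "ereal x < \<infinity>" for x
    proof -
      have x: "x > 0" using that by simp
      show ?thesis unfolding f_def
        using x pos[OF x] by (intro continuous_intros) auto
    qed
    show "set_integrable lborel (einterval 0 \<infinity>) f"
      unfolding E set_integrable_def fg by (rule gint)
    show "((F \<circ> real_of_ereal) \<longlongrightarrow> 0) (at_right 0)"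
    proof -
      have "(F \<longlongrightarrow> exp (-0) * 0 powr a * (1 + 0 * w) powr b) (at_right 0)"
        unfolding F_def using a by (intro tendsto_intros) (auto simp: eventually_at_filter)
      then show ?thesis unfolding zero_ereal_def ereal_tendsto_simps1 by simp
    qed
    show "((F \<circ> real_of_ereal) \<longlongrightarrow> 0) (at_left \<infinity>)"
      unfolding ereal_tendsto_simps1 F_def using w by (rule tendsto_exp_powr_powr)
  qed
  then have "integral\<^sup>L lborel g = 0"
    unfolding interval_lebesgue_integral_def E set_lebesgue_integral_def fg by simp
  moreover have "integral\<^sup>L lborel g = - Jint (a + 1) b w + a * Jint a b w + b * w * Jint (a + 1) (b - 1) w"
    unfolding g_def using a w
    by (simp add: Jint_eq integrable_Jint Bochner_Integration.integral_add Bochner_Integration.integrable_add integrable_mult_right)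
  ultimately show ?thesis by simp
qed

section \<open>Limits of the integral for large argument\<close>

lemma gkern_mult_powr: "gkern a s * s powr b = gkern (a + b) s"
  by (cases "s > 0") (auto simp: gkern_def algebra_simps simp flip: powr_add)

text \<open>Since (1 + s w)^b = w^b (1/w + s)^b, the weight becomes exp(-s) s^(a+b-1) in the limit;
  a + b > 0 makes it integrable at 0.\<close>

lemma Jint_tendsto_Gamma:
  assumes a: "a > 0" and ab: "a + b > 0"
  shows "((\<lambda>w. w powr (- b) * Jint a b w) \<longlongrightarrow> Gamma (a + b)) at_top"
proof -
  \<comment> \<open>The majorant depends on the sign of b: for b >= 0 the power is largest at w = 1,
    for b < 0 in the limit.\<close>
  obtain g where g: "integrable lborel g" "\<And>w s. w \<ge> 1 \<Longrightarrow> \<bar>gkern a s * (1 / w + s) powr b\<bar> \<le> g s"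
  proof (cases "b \<ge> 0")
    case True
    define k where "k = nat \<lceil>b\<rceil>"
    have k: "b \<le> real k" unfolding k_def by linarith
    show ?thesis
    proof (rule that[OF integrable_gkern_power[OF a, of k]])
      fix w s :: real assume w: "w \<ge> 1"
      show "\<bar>gkern a s * (1 / w + s) powr b\<bar> \<le> gkern a s * (1 + s) ^ k"
      proof (cases "s > 0")
        case s: True
        have "(1 / w + s) powr b \<le> (1 + s) powr b" using w s True by (intro powr_mono2) auto
        also have "\<dots> \<le> (1 + s) powr real k" using s k by (intro powr_mono) auto
        also have "\<dots> = (1 + s) ^ k" using s by (intro powr_realpow) auto
        finally show ?thesis by (simp add: abs_mult gkern_nonneg mult_left_mono)
      qed (simp add: gkern_def)
    qed
  next
    case False
    show ?thesis
    proof (rule that[OF integrable_gkern[OF ab]])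
      fix w s :: real assume w: "w \<ge> 1"
      show "\<bar>gkern a s * (1 / w + s) powr b\<bar> \<le> gkern (a + b) s"
      proof (cases "s > 0")
        case s: True
        have "(1 / w + s) powr b \<le> s powr b" using w s False by (intro powr_mono2') auto
        then show ?thesis by (simp add: abs_mult gkern_nonneg mult_left_mono flip: gkern_mult_powr)
      qed (simp add: gkern_def)
    qed
  qed
  have "((\<lambda>w. \<integral>s. gkern a s * (1 / w + s) powr b \<partial>lborel) \<longlongrightarrow> (\<integral>s. gkern (a + b) s \<partial>lborel)) at_top"
  proof (rule integral_dominated_convergence_at_top[OF _ _ g(1)])
    show "AE s in lborel. ((\<lambda>w. gkern a s * (1 / w + s) powr b) \<longlongrightarrow> gkern (a + b) s) at_top"
    proof (rule AE_I2)
      fix s :: real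
      show "((\<lambda>w. gkern a s * (1 / w + s) powr b) \<longlongrightarrow> gkern (a + b) s) at_top"
      proof (cases "s > 0")
        case True
        have "((\<lambda>w::real. 1 / w) \<longlongrightarrow> 0) at_top"
          using tendsto_inverse_0_at_top[OF filterlim_ident] by (simp add: inverse_eq_divide)
        then have "((\<lambda>w. gkern a s * (1 / w + s) powr b) \<longlongrightarrow> gkern a s * (0 + s) powr b) at_top"
          using True by (intro tendsto_intros) auto
        then show ?thesis by (simp add: gkern_mult_powr)
      qed (simp add: gkern_def)
    qed
    show "\<forall>\<^sub>F w in at_top. AE s in lborel. norm (gkern a s * (1 / w + s) powr b) \<le> g s"
      using eventually_ge_at_top[of 1] by eventually_elim (use g(2) in auto)
  qed auto
  then have "((\<lambda>w. \<integral>s. gkern a s * (1 / w + s) powr b \<partial>lborel) \<longlongrightarrow> Gamma (a + b)) at_top"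
    using integral_gkern[OF ab] by simp
  moreover have "\<forall>\<^sub>F w in at_top. (\<integral>s. gkern a s * (1 / w + s) powr b \<partial>lborel) = w powr (- b) * Jint a b w"
    using eventually_gt_at_top[of 0]
  proof eventually_elim
    case (elim w)
    have "gkern a s * (1 / w + s) powr b = w powr (- b) * (gkern a s * (1 + s * w) powr b)" for s
    proof -
      have "1 / w + s = inverse w * (1 + s * w)" using elim by (simp add: field_simps)
      then have "(1 / w + s) powr b = inverse w powr b * (1 + s * w) powr b" by (simp add: powr_mult)
      also have "inverse w powr b = w powr (- b)" using elim by (simp add: powr_minus inverse_powr)
      finally show ?thesis by simp
    qed
    then show ?case using elim by (simp only: integral_mult_right_zero Jint_eq less_imp_le)
  qed
  ultimately show ?thesis by (rule Lim_transform_eventually)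
qed

text \<open>Substitute s = t / (1 - t), which maps (0, 1) onto the half line and turns the integrand
  into that of the Beta function.\<close>

lemma has_bochner_integral_Beta_halfline:
  assumes a: "a > (0::real)" and ab: "a + b < 0"
  shows "has_bochner_integral lborel (\<lambda>s. indicator {0<..} s * (s powr (a - 1) * (1 + s) powr b)) (Beta a (- a - b))"
proof -
  define f where "f s = s powr (a - 1) * (1 + s) powr b" for s :: real
  define h where "h t = t powr (a - 1) * (1 - t) powr (- a - b - 1)" for t :: real
  have E1: "einterval 0 1 = {0<..<1}" by (auto simp: einterval_def zero_ereal_def one_ereal_def)
  have E2: "einterval 0 \<infinity> = {0<..}" by (auto simp: einterval_def zero_ereal_def)
  have eq: "f (t / (1 - t)) * (1 / (1 - t)\<^sup>2) = h t" if t: "0 < t" "t < 1" for t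
  proof -
    have "f (t / (1 - t)) = (t / (1 - t)) powr (a - 1) * (1 / (1 - t)) powr b"
    proof -
      have "1 + t / (1 - t) = 1 / (1 - t)" using t by (simp add: field_simps)
      then show ?thesis by (simp add: f_def)
    qed
    also have "\<dots> = t powr (a - 1) * ((1 - t) powr (- (a - 1)) * (1 - t) powr (- b))"
      using t powr_minus[of "1 - t" "a - 1"] powr_minus[of "1 - t" b] by (simp add: powr_mult inverse_powr divide_inverse mult_ac)
    finally have "f (t / (1 - t)) * (1 / (1 - t)\<^sup>2) = t powr (a - 1) * ((1 - t) powr (- (a - 1)) * (1 - t) powr (- b) * (1 - t) powr (-2))"
      using t by (simp add: powr_minus powr_numeral field_simps)
    also have "(1 - t) powr (- (a - 1)) * (1 - t) powr (- b) * (1 - t) powr (-2) = (1 - t) powr (- a - b - 1)"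
      unfolding powr_add[symmetric] by (rule arg_cong2[of _ _ _ _ "(powr)"]) auto
    finally show ?thesis by (simp add: h_def)
  qed
  have hint: "set_integrable lborel {0<..<1} h"
    unfolding h_def by (rule set_integrable_subset[OF integrable_Beta[of a "- a - b"]]) (use a ab in auto)
  have h1: "((\<lambda>t. t / (1 - t)) has_real_derivative 1 / (1 - x)\<^sup>2) (at x)" if "0 < ereal x" "ereal x < 1" for x
    proof -
      have "x < 1" using that by simp
      then show ?thesis by (auto intro!: derivative_eq_intros simp: power2_eq_square)
    qed
  have h2: "isCont f (x / (1 - x))" if "0 < ereal x" "ereal x < 1" for x
    proof -
      have x: "0 < x" "x < 1" using that by auto
      then have "0 < x / (1 - x)" by simp
      then show ?thesis unfolding f_def by (intro continuous_intros) auto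
    qed
  have h3: "isCont (\<lambda>t. 1 / (1 - t)\<^sup>2) x" if "0 < ereal x" "ereal x < 1" for x
      using that by (intro continuous_intros) auto
  have h4: "0 \<le> f (x / (1 - x))" for x by (simp add: f_def)
  have h5: "0 \<le> 1 / (1 - x)\<^sup>2" for x :: real by simp
  have h6: "((ereal \<circ> (\<lambda>t. t / (1 - t)) \<circ> real_of_ereal) \<longlongrightarrow> 0) (at_right 0)"
    proof -
      have "((\<lambda>t::real. t / (1 - t)) \<longlongrightarrow> 0 / (1 - 0)) (at_right 0)" by (intro tendsto_intros) auto
      then show ?thesis unfolding zero_ereal_def ereal_tendsto_simps by (simp add: ereal_tendsto_simps)
    qed
  have h7: "((ereal \<circ> (\<lambda>t. t / (1 - t)) \<circ> real_of_ereal) \<longlongrightarrow> \<infinity>) (at_left 1)"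
    proof -
      have "filterlim (\<lambda>t::real. 1 - t) (at_right 0) (at_left 1)"
        unfolding filterlim_at by (auto simp: eventually_at_filter intro!: tendsto_eq_intros)
      moreover have "((\<lambda>t::real. t) \<longlongrightarrow> 1) (at_left 1)" by simp
      ultimately have "filterlim (\<lambda>t::real. t * inverse (1 - t)) at_top (at_left 1)"
        by (intro filterlim_tendsto_pos_mult_at_top[of _ 1] filterlim_compose[OF filterlim_inverse_at_top_right]) auto
      then have "filterlim (\<lambda>t::real. t / (1 - t)) at_top (at_left 1)" by (simp add: divide_inverse)
      then show ?thesis unfolding one_ereal_def ereal_tendsto_simps by (simp add: ereal_tendsto_simps)
    qed
  have h8: "set_integrable lborel (einterval 0 1) (\<lambda>x. f (x / (1 - x)) * (1 / (1 - x)\<^sup>2))"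
      unfolding E1 by (rule set_integrable_cong[THEN iffD2, OF refl refl _ hint]) (use eq in auto)
  have S: "set_integrable lborel (einterval 0 \<infinity>) f"
    "(LBINT x=0..\<infinity>. f x) = (LBINT x=0..1. (f (x / (1 - x)) * (1 / (1 - x)\<^sup>2)))"
    by (rule interval_integral_substitution_nonneg[of 0 1 "\<lambda>t. t / (1 - t)" "\<lambda>t. 1 / (1 - t)\<^sup>2" f,
      OF _ h1 h2 h3 h4 h5 h6 h7 h8]; simp)+
  have "(LBINT x=0..1. (f (x / (1 - x)) * (1 / (1 - x)\<^sup>2))) = (LINT x:{0<..<1}|lborel. h x)"
    unfolding interval_lebesgue_integral_def E1 by (simp, rule set_lebesgue_integral_cong) (use eq in auto)
  also have "\<dots> = integral {0<..<1} h" by (rule set_borel_integral_eq_integral(2)[OF hint])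
  also have "\<dots> = integral {0..1} h" by (rule integral_open_interval_real[symmetric])
  also have "\<dots> = Beta a (- a - b)"
    using has_integral_Beta_real[of a "- a - b"] a ab by (simp add: h_def[abs_def] integral_unique)
  finally have "(LINT x:{0<..}|lborel. f x) = Beta a (- a - b)"
    using S(2) by (simp add: interval_lebesgue_integral_def E2)
  then show ?thesis using S(1) unfolding E2
    by (simp add: has_bochner_integral_iff set_integrable_def set_lebesgue_integral_def f_def)
qed

text \<open>Complementary to \<open>Jint_tendsto_Gamma\<close>: rescaling s by 1/w leaves the factor
  exp(-s/w), which tends to 1, and a + b < 0 makes the remaining integrand integrable at
  infinity.\<close>

lemma Jint_tendsto_Beta:
  assumes a: "a > 0" and ab: "a + b < 0"
  shows "((\<lambda>w. w powr a * Jint a b w) \<longlongrightarrow> Beta a (- a - b)) at_top"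
proof -
  let ?f = "\<lambda>s. indicator {0<..} s * (s powr (a - 1) * (1 + s) powr b)"
  note B = has_bochner_integral_Beta_halfline[OF assms, unfolded has_bochner_integral_iff]
  have "((\<lambda>w. \<integral>s. exp (- s / w) * ?f s \<partial>lborel) \<longlongrightarrow> (\<integral>s. ?f s \<partial>lborel)) at_top"
  proof (rule integral_dominated_convergence_at_top[OF _ _ conjunct1[OF B]])
    show "AE s in lborel. ((\<lambda>w. exp (- s / w) * ?f s) \<longlongrightarrow> ?f s) at_top"
    proof (rule AE_I2)
      fix s :: real
      have "((\<lambda>w::real. 1 / w) \<longlongrightarrow> 0) at_top"
        using tendsto_inverse_0_at_top[OF filterlim_ident] by (simp add: inverse_eq_divide)
      then have "((\<lambda>w. exp (- s * (1 / w)) * ?f s) \<longlongrightarrow> exp (- s * 0) * ?f s) at_top"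
        by (intro tendsto_intros)
      then show "((\<lambda>w. exp (- s / w) * ?f s) \<longlongrightarrow> ?f s) at_top" by simp
    qed
    show "\<forall>\<^sub>F w in at_top. AE s in lborel. norm (exp (- s / w) * ?f s) \<le> ?f s"
      using eventually_gt_at_top[of 0]
    proof eventually_elim
      case (elim w)
      have "norm (exp (- s / w) * ?f s) \<le> ?f s" for s
      proof (cases "s > 0")
        case True
        then have "exp (- s / w) \<le> 1" using elim by simp
        then have "exp (- s / w) * ?f s \<le> 1 * ?f s" by (intro mult_right_mono) auto
        then show ?thesis by (simp add: abs_mult)
      qed simp
      then show ?case by simp
    qed
  qed auto
  then have "((\<lambda>w. \<integral>s. exp (- s / w) * ?f s \<partial>lborel) \<longlongrightarrow> Beta a (- a - b)) at_top"
    using B by simp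
  moreover have "\<forall>\<^sub>F w in at_top. (\<integral>s. exp (- s / w) * ?f s \<partial>lborel) = w powr a * Jint a b w"
    using eventually_gt_at_top[of 0]
  proof eventually_elim
    case (elim w)
    have "Jint a b w = (\<integral>s. gkern a s * (1 + s * w) powr b \<partial>lborel)" using elim by (simp add: Jint_eq)
    also have "\<dots> = \<bar>1/w\<bar> *\<^sub>R (\<integral>s. gkern a (0 + 1/w * s) * (1 + (0 + 1/w * s) * w) powr b \<partial>lborel)"
      using elim by (intro lborel_integral_real_affine) auto
    also have "\<dots> = (1/w) * (\<integral>s. w powr (1 - a) * (exp (- s / w) * ?f s) \<partial>lborel)"
    proof -
      have "gkern a (0 + 1/w * s) * (1 + (0 + 1/w * s) * w) powr b = w powr (1 - a) * (exp (- s / w) * ?f s)" for s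
      proof (cases "s > 0")
        case True
        have "(s / w) powr (a - 1) = w powr (1 - a) * s powr (a - 1)"
          using True elim powr_minus[of w "a - 1"] by (simp add: powr_divide field_simps)
        then show ?thesis using True elim by (simp add: gkern_def)
      qed (use elim in \<open>auto simp: gkern_def not_less divide_nonpos_pos\<close>)
      then show ?thesis using elim by (simp only: ) simp
    qed
    also have "\<dots> = w powr (- a) * (\<integral>s. exp (- s / w) * ?f s \<partial>lborel)"
    proof -
      have "(1/w) * w powr (1 - a) = w powr (- a)"
        using elim powr_mult_base[of w "- a"] by (simp add: field_simps)
      then show ?thesis by (subst integral_mult_right_zero) (simp only: mult.assoc[symmetric])
    qed
    finally show ?case using elim by (simp add: powr_minus field_simps)
  qed
  ultimately show ?thesis by (rule Lim_transform_eventually)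
qed

subsection \<open>The similarity profile\<close>

definition kummer_coeff :: "real \<Rightarrow> real \<Rightarrow> nat \<Rightarrow> real" where
  "kummer_coeff a b n = pochhammer a n / (pochhammer b n * fact n)"

lemma kummerM_eq: "kummerM a b z = (\<Sum>n. kummer_coeff a b n * z ^ n)"
  unfolding kummerM_def kummer_coeff_def by (simp add: field_simps)

lemma kummer_coeff_Suc:
  assumes "b > 0"
  shows "(real n + 1) * (b + real n) * kummer_coeff a b (Suc n) = (a + real n) * kummer_coeff a b n"
proof -
  have "pochhammer b n > 0" using assms by (simp add: pochhammer_pos)
  then show ?thesis using assms by (simp add: kummer_coeff_def pochhammer_Suc divide_simps add_pos_nonneg) 
qed

text \<open>As |a + n| <= (|a|/b + 1)(b + n), consecutive terms have ratio at most K/(n + 1), which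
  is at most 1/2 once n + 1 >= 2 K.\<close>

lemma summable_kummer:
  assumes "b > 0"
  shows "summable (\<lambda>n. kummer_coeff a b n * z ^ n)"
proof -
  define K where "K = (\<bar>a\<bar> / b + 1) * \<bar>z\<bar>"
  have K: "K \<ge> 0" using assms by (simp add: K_def)
  show ?thesis
  proof (rule summable_ratio_test[of "1/2" "nat \<lceil>2 * K\<rceil>"])
    fix n assume "n \<ge> nat \<lceil>2 * K\<rceil>"
    then have n: "2 * K \<le> real n + 1" by linarith
    have bn: "b + real n > 0" using assms by simp
    have "\<bar>a + real n\<bar> \<le> (\<bar>a\<bar> / b + 1) * (b + real n)"
    proof -
      have "(\<bar>a\<bar> / b + 1) * (b + real n) = \<bar>a\<bar> + b + (\<bar>a\<bar> / b) * real n + real n"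
        using assms by (simp add: field_simps)
      moreover have "(\<bar>a\<bar> / b) * real n \<ge> 0" using assms by simp
      ultimately show ?thesis using assms by linarith
    qed
    then have "\<bar>a + real n\<bar> * \<bar>z\<bar> \<le> K * (b + real n)"
      unfolding K_def by (metis abs_ge_zero mult.commute mult.left_commute mult_left_mono)
    also have "\<dots> \<le> (real n + 1) / 2 * (b + real n)" using n bn by (intro mult_right_mono) auto
    finally have 1: "\<bar>a + real n\<bar> * \<bar>z\<bar> \<le> (real n + 1) / 2 * (b + real n)" .
    have "(real n + 1) * (b + real n) * \<bar>kummer_coeff a b (Suc n)\<bar> = \<bar>a + real n\<bar> * \<bar>kummer_coeff a b n\<bar>"
      using arg_cong[OF kummer_coeff_Suc[OF assms, of n a], of abs] bn by (simp add: abs_mult)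
    then have "(real n + 1) * (b + real n) * (\<bar>kummer_coeff a b (Suc n)\<bar> * \<bar>z\<bar>) = (\<bar>a + real n\<bar> * \<bar>z\<bar>) * \<bar>kummer_coeff a b n\<bar>"
      by (metis mult.assoc mult.commute)
    also have "\<dots> \<le> (real n + 1) / 2 * (b + real n) * \<bar>kummer_coeff a b n\<bar>"
      using 1 by (intro mult_right_mono) auto
    finally have "((real n + 1) * (b + real n)) * (\<bar>kummer_coeff a b (Suc n)\<bar> * \<bar>z\<bar>) \<le> ((real n + 1) * (b + real n)) * (1/2 * \<bar>kummer_coeff a b n\<bar>)"
      by (simp add: algebra_simps)
    then have "\<bar>kummer_coeff a b (Suc n)\<bar> * \<bar>z\<bar> \<le> 1/2 * \<bar>kummer_coeff a b n\<bar>"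
      using bn by (subst (asm) mult_le_cancel_left_pos) auto
    from mult_right_mono[OF this, of "\<bar>z\<bar> ^ n"]
    show "norm (kummer_coeff a b (Suc n) * z ^ Suc n) \<le> 1/2 * norm (kummer_coeff a b n * z ^ n)"
      by (simp add: abs_mult power_abs mult_ac)
  qed simp
qed

lemma diffs_kummer_coeff:
  assumes "b > 0"
  shows "diffs (kummer_coeff a b) = (\<lambda>n. a / b * kummer_coeff (a + 1) (b + 1) n)"
proof
  fix n
  have "pochhammer b n > 0" "pochhammer (b + 1) n > 0" using assms by (simp_all add: pochhammer_pos)
  then show "diffs (kummer_coeff a b) n = a / b * kummer_coeff (a + 1) (b + 1) n"
    using assms by (simp add: diffs_def kummer_coeff_def pochhammer_rec divide_simps)
qed

lemma kummerM_deriv: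
  assumes "b > 0"
  shows "(kummerM a b has_real_derivative a / b * kummerM (a + 1) (b + 1) z) (at z)"
proof -
  have "((\<lambda>z. \<Sum>n. kummer_coeff a b n * z ^ n) has_real_derivative (\<Sum>n. diffs (kummer_coeff a b) n * z ^ n)) (at z)"
    by (rule termdiffs_strong_converges_everywhere) (rule summable_kummer[OF assms])
  also have "(\<Sum>n. diffs (kummer_coeff a b) n * z ^ n) = a / b * kummerM (a + 1) (b + 1) z"
    unfolding diffs_kummer_coeff[OF assms] kummerM_eq mult.assoc
    by (rule suminf_mult, rule summable_kummer) (use assms in simp)
  finally show ?thesis by (simp add: kummerM_eq[abs_def])
qed

lemma kummerM_0: "kummerM a b 0 = 1"
  unfolding kummerM_eq powser_zero by (simp add: kummer_coeff_def)

text \<open>Kummer's equation z M'' + (b - z) M' - a M = 0, with the derivatives written as shifted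
  Kummer functions. Comparing coefficients leaves exactly \<open>kummer_coeff_Suc\<close>.\<close>

lemma kummer_ode:
  assumes b: "b > 0"
  shows "z * (a / b * ((a + 1) / (b + 1) * kummerM (a + 2) (b + 2) z))
     + (b - z) * (a / b * kummerM (a + 1) (b + 1) z) - a * kummerM a b z = 0"
proof -
  let ?c = "kummer_coeff a b"
  have s0: "(\<lambda>n. ?c n * z ^ n) sums kummerM a b z"
    unfolding kummerM_eq by (rule summable_sums[OF summable_kummer[OF b]])
  have s1: "(\<lambda>n. diffs ?c n * z ^ n) sums (a / b * kummerM (a + 1) (b + 1) z)"
    unfolding diffs_kummer_coeff[OF b] kummerM_eq mult.assoc
    by (intro sums_mult summable_sums summable_kummer) (use b in auto)
  have s2: "(\<lambda>n. diffs (diffs ?c) n * z ^ n) sums (a / b * ((a + 1) / (b + 1) * kummerM (a + 2) (b + 2) z))"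
  proof -
    have "diffs (diffs ?c) = (\<lambda>n. a / b * ((a + 1) / (b + 1) * kummer_coeff (a + 2) (b + 2) n))"
    proof
      fix n
      have "diffs (diffs ?c) n = a / b * diffs (kummer_coeff (a + 1) (b + 1)) n"
        unfolding diffs_kummer_coeff[OF b] by (simp add: diffs_def)
      then show "diffs (diffs ?c) n = a / b * ((a + 1) / (b + 1) * kummer_coeff (a + 2) (b + 2) n)"
        using b diffs_kummer_coeff[of "b + 1" "a + 1"] by (simp add: add.assoc)
    qed
    then show ?thesis unfolding kummerM_eq
      by (simp only: mult.assoc, intro sums_mult summable_sums summable_kummer) (use b in auto)
  qed
  have "(\<lambda>n. z * (diffs (diffs ?c) n * z ^ n)) sums (z * (a / b * ((a + 1) / (b + 1) * kummerM (a + 2) (b + 2) z)))"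
    by (rule sums_mult[OF s2])
  also have "(\<lambda>n. z * (diffs (diffs ?c) n * z ^ n)) = (\<lambda>n. real (Suc n) * diffs ?c (Suc n) * z ^ Suc n)"
    unfolding diffs_def[of "diffs ?c"] by (simp add: mult_ac)
  \<comment> \<open>The factor n annihilates the term of index 0, so shifting the summation index
    adds nothing.\<close>
  finally have "(\<lambda>n. real n * diffs ?c n * z ^ n) sums (z * (a / b * ((a + 1) / (b + 1) * kummerM (a + 2) (b + 2) z)))"
    by (intro sums_Suc_imp[where f = "\<lambda>n. real n * diffs ?c n * z ^ n"]) simp_all
  moreover have "(\<lambda>n. real n * ?c n * z ^ n) sums (z * (a / b * kummerM (a + 1) (b + 1) z))"
  proof -
    have "(\<lambda>n. z * (diffs ?c n * z ^ n)) = (\<lambda>n. real (Suc n) * ?c (Suc n) * z ^ Suc n)"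
      unfolding diffs_def by (simp add: mult_ac)
    with sums_mult[OF s1, of z] have "(\<lambda>n. real (Suc n) * ?c (Suc n) * z ^ Suc n) sums (z * (a / b * kummerM (a + 1) (b + 1) z))"
      by simp
    then show ?thesis
      by (intro sums_Suc_imp[where f = "\<lambda>n. real n * ?c n * z ^ n"]) simp_all
  qed
  ultimately have "(\<lambda>n. real n * diffs ?c n * z ^ n + (b * (diffs ?c n * z ^ n) - real n * ?c n * z ^ n) - a * (?c n * z ^ n)) sums
     (z * (a / b * ((a + 1) / (b + 1) * kummerM (a + 2) (b + 2) z)) +
     (b * (a / b * kummerM (a + 1) (b + 1) z) - z * (a / b * kummerM (a + 1) (b + 1) z)) - a * kummerM a b z)"
    by (intro sums_add sums_diff sums_mult s0 s1)
  moreover have "real n * diffs ?c n * z ^ n + (b * (diffs ?c n * z ^ n) - real n * ?c n * z ^ n) - a * (?c n * z ^ n) = 0" for n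
  proof -
    have "real n * diffs ?c n * z ^ n + (b * (diffs ?c n * z ^ n) - real n * ?c n * z ^ n) - a * (?c n * z ^ n)
      = ((real n + 1) * (b + real n) * ?c (Suc n) - (a + real n) * ?c n) * z ^ n"
      by (simp add: diffs_def algebra_simps)
    then show ?thesis using kummer_coeff_Suc[OF b, of n a] by simp
  qed
  ultimately have "(\<lambda>n. 0) sums
     (z * (a / b * ((a + 1) / (b + 1) * kummerM (a + 2) (b + 2) z)) +
     (b * (a / b * kummerM (a + 1) (b + 1) z) - z * (a / b * kummerM (a + 1) (b + 1) z)) - a * kummerM a b z)"
    by simp
  from sums_unique2[OF this sums_zero] show ?thesis by (simp only: left_diff_distrib)
qed

text \<open>The profile of the homogeneous solution \<open>x\<^sup>1\<^sup>/\<^sup>6 G (z x\<^sup>-\<^sup>1\<^sup>/\<^sup>3)\<close>; it is \<open>(1 + t\<^sup>2)\<^sup>1\<^sup>/\<^sup>4 Lambda0 t\<close>.\<close>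

definition G0 :: "real \<Rightarrow> real" where
  "G0 t = 9 powr (1/6) *
     (Gamma (1/3) / Gamma (1/6) * kummerM (-1/6) (2/3) (- (t ^ 3) / 9)
      - t / 9 powr (1/3) * (Gamma (-1/3) / Gamma (-1/6)) * kummerM (1/6) (4/3) (- (t ^ 3) / 9))"

definition G1 :: "real \<Rightarrow> real" where
  "G1 t = 9 powr (1/6) *
     (Gamma (1/3) / Gamma (1/6) * (t\<^sup>2 / 12 * kummerM (5/6) (5/3) (- (t ^ 3) / 9))
      - (1 / 9 powr (1/3) * (Gamma (-1/3) / Gamma (-1/6)) * kummerM (1/6) (4/3) (- (t ^ 3) / 9)
       + t / 9 powr (1/3) * (Gamma (-1/3) / Gamma (-1/6)) * (- t\<^sup>2 / 24 * kummerM (7/6) (7/3) (- (t ^ 3) / 9))))"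

lemma Lambda0_eq: "Lambda0 t = (1 + t\<^sup>2) powr (-1/4) * G0 t"
  unfolding Lambda0_def G0_def by simp

lemma cube_deriv: "((\<lambda>t::real. - (t ^ 3) / 9) has_real_derivative - t\<^sup>2 / 3) (at t)"
  by (auto intro!: derivative_eq_intros simp: power2_eq_square)

lemma kummer_cube_deriv:
  "b > 0 \<Longrightarrow> ((\<lambda>t. kummerM a b (- (t ^ 3) / 9)) has_real_derivative
     a / b * kummerM (a + 1) (b + 1) (- (t ^ 3) / 9) * (- t\<^sup>2 / 3)) (at t)"
  by (rule DERIV_chain2[OF kummerM_deriv cube_deriv])

lemma G0_deriv: "(G0 has_real_derivative G1 t) (at t)"
proof -
  have 1: "((\<lambda>t. kummerM (-1/6) (2/3) (- (t ^ 3) / 9)) has_real_derivative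
     t\<^sup>2 / 12 * kummerM (5/6) (5/3) (- (t ^ 3) / 9)) (at t)"
    using kummer_cube_deriv[of "2/3" "-1/6" t] by (simp add: mult_ac)
  have 2: "((\<lambda>t. kummerM (1/6) (4/3) (- (t ^ 3) / 9)) has_real_derivative
     - t\<^sup>2 / 24 * kummerM (7/6) (7/3) (- (t ^ 3) / 9)) (at t)"
    using kummer_cube_deriv[of "4/3" "1/6" t] by (simp add: mult_ac)
  have gen: "((\<lambda>t. c * (A * f t - t / d * B * g t)) has_real_derivative c * (A * f' - (1 / d * B * g t + t / d * B * g'))) (at t)"
    if "(f has_real_derivative f') (at t)" "(g has_real_derivative g') (at t)" "d \<noteq> 0" for c A B d f' g' t :: real and f g
    using that by (auto intro!: derivative_eq_intros simp: algebra_simps add_divide_distrib)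
  show ?thesis unfolding G0_def G1_def by (rule gen[OF 1 2]) simp
qed

text \<open>The ODE of the profile, in the first-order form that \<open>linear_ode_zero\<close>
  expects; it is Kummer's equation at the argument -t^3/9.\<close>

lemma G1_deriv: "(G1 has_real_derivative - (t\<^sup>2 / 3) * G1 t + t / 6 * G0 t) (at t)"
proof -
  let ?z = "- (t ^ 3) / 9"
  let ?A = "Gamma (1/3) / Gamma (1/6) :: real" and ?B = "1 / 9 powr (1/3) * (Gamma (-1/3) / Gamma (-1/6)) :: real"
  have 1: "((\<lambda>t. kummerM (5/6) (5/3) (- (t ^ 3) / 9)) has_real_derivative
     - t\<^sup>2 / 6 * kummerM (11/6) (8/3) ?z) (at t)"
    using kummer_cube_deriv[of "5/3" "5/6" t] by (simp add: mult_ac)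
  have 2: "((\<lambda>t. kummerM (1/6) (4/3) (- (t ^ 3) / 9)) has_real_derivative
     - t\<^sup>2 / 24 * kummerM (7/6) (7/3) ?z) (at t)"
    using kummer_cube_deriv[of "4/3" "1/6" t] by (simp add: mult_ac)
  have 3: "((\<lambda>t. kummerM (7/6) (7/3) (- (t ^ 3) / 9)) has_real_derivative
     - t\<^sup>2 / 6 * kummerM (13/6) (10/3) ?z) (at t)"
    using kummer_cube_deriv[of "7/3" "7/6" t] by (simp add: mult_ac)
  have o1: "?z * (- 1/8 * kummerM (11/6) (8/3) ?z) + (2/3 - ?z) * (- 1/4 * kummerM (5/6) (5/3) ?z) + 1/6 * kummerM (-1/6) (2/3) ?z = 0"
    using kummer_ode[of "2/3" ?z "-1/6"] by simp
  have o2: "?z * (1/16 * kummerM (13/6) (10/3) ?z) + (4/3 - ?z) * (1/8 * kummerM (7/6) (7/3) ?z) - 1/6 * kummerM (1/6) (4/3) ?z = 0"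
    using kummer_ode[of "4/3" ?z "1/6"] by simp
  have gen: "((\<lambda>t. c * (A * (t\<^sup>2 / 12 * f t) - (1 / d * B * g t + t / d * B * (- t\<^sup>2 / 24 * h t)))) has_real_derivative
      c * (A * (t / 6 * f t + t\<^sup>2 / 12 * f') - 1 / d * B * (g' - t\<^sup>2 / 8 * h t - t ^ 3 / 24 * h'))) (at t)"
    if "(f has_real_derivative f') (at t)" "(g has_real_derivative g') (at t)" "(h has_real_derivative h') (at t)" "d \<noteq> 0"
    for c A B d f' g' h' t :: real and f g h
    using that by (auto intro!: derivative_eq_intros simp: algebra_simps add_divide_distrib diff_divide_distrib power2_eq_square power3_eq_cube)
  have d: "(G1 has_real_derivative 9 powr (1/6) *
     (?A * (t / 6 * kummerM (5/6) (5/3) ?z + t\<^sup>2 / 12 * (- t\<^sup>2 / 6 * kummerM (11/6) (8/3) ?z))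
      - ?B * (- t\<^sup>2 / 24 * kummerM (7/6) (7/3) ?z - t\<^sup>2 / 8 * kummerM (7/6) (7/3) ?z
        - t ^ 3 / 24 * (- t\<^sup>2 / 6 * kummerM (13/6) (10/3) ?z)))) (at t)"
    unfolding G1_def by (rule gen[OF 1 2 3]) simp
  \<comment> \<open>Kummer's equation for b = 2/3 is multiplied by t, the one for b = 4/3 by t^2
    because its solution carries an extra factor t.\<close>
  have e1: "t / 6 * kummerM (5/6) (5/3) ?z + t\<^sup>2 / 12 * (- t\<^sup>2 / 6 * kummerM (11/6) (8/3) ?z)
     = - (t\<^sup>2 / 3) * (t\<^sup>2 / 12 * kummerM (5/6) (5/3) ?z) + t / 6 * kummerM (-1/6) (2/3) ?z"
    using arg_cong[OF o1, of "\<lambda>x. t * x"] by (simp add: field_simps power2_eq_square power3_eq_cube)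
  have e2: "- t\<^sup>2 / 24 * kummerM (7/6) (7/3) ?z - t\<^sup>2 / 8 * kummerM (7/6) (7/3) ?z
        - t ^ 3 / 24 * (- t\<^sup>2 / 6 * kummerM (13/6) (10/3) ?z) =
     - (t\<^sup>2 / 3) * (kummerM (1/6) (4/3) ?z + t * (- t\<^sup>2 / 24 * kummerM (7/6) (7/3) ?z)) + t / 6 * (t * kummerM (1/6) (4/3) ?z)"
    using arg_cong[OF o2, of "\<lambda>x. t * t * x"] by (simp add: field_simps power2_eq_square power3_eq_cube)
  have "9 powr (1/6) *
     (?A * (t / 6 * kummerM (5/6) (5/3) ?z + t\<^sup>2 / 12 * (- t\<^sup>2 / 6 * kummerM (11/6) (8/3) ?z))
      - ?B * (- t\<^sup>2 / 24 * kummerM (7/6) (7/3) ?z - t\<^sup>2 / 8 * kummerM (7/6) (7/3) ?z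
        - t ^ 3 / 24 * (- t\<^sup>2 / 6 * kummerM (13/6) (10/3) ?z)))
     = - (t\<^sup>2 / 3) * G1 t + t / 6 * G0 t"
    unfolding e1 e2 G0_def G1_def by (simp add: algebra_simps)
  with d show ?thesis by simp
qed

lemma Cn_on_G: "Cn_on n UNIV G0 \<and> Cn_on n UNIV G1"
proof (induction n)
  case 0
  show ?case using G0_deriv G1_deriv by (auto intro!: continuous_at_imp_continuous_on DERIV_isCont)
next
  case (Suc n)
  have "Cn_on n UNIV (\<lambda>t. - (t\<^sup>2 / 3) * G1 t + t / 6 * G0 t)"
    using Suc Cn_on_mult[of n UNIV "\<lambda>t. 1/3" "\<lambda>t. t\<^sup>2"] Cn_on_mult[of n UNIV "\<lambda>t. 1/6" "\<lambda>t. t"]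
    by (intro Cn_on_add Cn_on_mult Cn_on_uminus) (auto simp: Cn_on_id Cn_on_power)
  then show ?case using Suc G0_deriv G1_deriv
    by (auto intro!: Cn_on_derivI[of UNIV G0 G1] Cn_on_derivI[of UNIV G1] simp del: Cn_on.simps)
qed

lemma G0_0: "G0 0 = 9 powr (1/6) * (Gamma (1/3) / Gamma (1/6))"
  by (simp add: G0_def kummerM_0)

lemma minus_third_sixth_not_nonpos_Ints: "(-1/3::real) \<notin> \<int>\<^sub>\<le>\<^sub>0" "(-1/6::real) \<notin> \<int>\<^sub>\<le>\<^sub>0"
proof -
  have "3 * k \<noteq> -1" "6 * k \<noteq> -1" for k :: int by presburger+
  moreover have "3 * k = -1" if "(-1/3::real) = of_int k" for k
  proof -
    have "real_of_int (3 * k) = real_of_int (-1)" using that by simp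
    then show ?thesis by (simp only: of_int_eq_iff)
  qed
  moreover have "6 * k = -1" if "(-1/6::real) = of_int k" for k
  proof -
    have "real_of_int (6 * k) = real_of_int (-1)" using that by simp
    then show ?thesis by (simp only: of_int_eq_iff)
  qed
  ultimately show "(-1/3::real) \<notin> \<int>\<^sub>\<le>\<^sub>0" "(-1/6::real) \<notin> \<int>\<^sub>\<le>\<^sub>0"
    unfolding nonpos_Ints_def by blast+
qed

text \<open>The recursion of Gamma moves both negative arguments to 2/3 and 5/6, the values that the
  integral representations produce.\<close>

lemma G1_0: "G1 0 = - (1/2) * 9 powr (-1/6) * (Gamma (2/3) / Gamma (5/6))"
proof -
  have 1: "Gamma (2/3 :: real) = - (1/3) * Gamma (-1/3)"
    using Gamma_plus1[OF minus_third_sixth_not_nonpos_Ints(1)] by simp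
  have 2: "Gamma (5/6 :: real) = - (1/6) * Gamma (-1/6)"
    using Gamma_plus1[OF minus_third_sixth_not_nonpos_Ints(2)] by simp
  have "(9::real) powr (1/6) / 9 powr (1/3) = 9 powr (-1/6)" by (simp flip: powr_diff)
  moreover have "G1 0 = - (9 powr (1/6) / 9 powr (1/3)) * (Gamma (-1/3) / Gamma (-1/6))"
    by (simp add: G1_def kummerM_0)
  ultimately have "G1 0 = - (9 powr (-1/6)) * (Gamma (-1/3) / Gamma (-1/6))" by (simp only:)
  also have "Gamma (-1/3) / Gamma (-1/6) = 1/2 * (Gamma (2/3) / Gamma (5/6 :: real))"
    unfolding 1 2 by simp
  finally show ?thesis by simp
qed

text \<open>Gronwall's inequality for D^2 + D1^2. The initial data are one-sided limits at 0, since
  the integral representations are meaningful for t > 0 only.\<close>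

lemma linear_ode_zero:
  fixes D D1 p r :: "real \<Rightarrow> real"
  assumes D: "\<And>t. t > 0 \<Longrightarrow> (D has_real_derivative D1 t) (at t)"
    and D1: "\<And>t. t > 0 \<Longrightarrow> (D1 has_real_derivative p t * D1 t + r t * D t) (at t)"
    and K: "\<And>t. 0 < t \<Longrightarrow> t \<le> T \<Longrightarrow> \<bar>p t\<bar> \<le> K" "\<And>t. 0 < t \<Longrightarrow> t \<le> T \<Longrightarrow> \<bar>r t\<bar> \<le> K"
    and lim: "(D \<longlongrightarrow> 0) (at_right 0)" "(D1 \<longlongrightarrow> 0) (at_right 0)" and T: "T > 0"
  shows "D T = 0"
proof -
  \<comment> \<open>In the derivative of \<open>E\<close> the cross term contributes 1, the term
    with p contributes 2 K and the term with r contributes K.\<close>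
  define C where "C = 1 + 3 * K"
  define E where "E t = (D t)\<^sup>2 + (D1 t)\<^sup>2" for t
  define E' where "E' t = 2 * D t * D1 t + 2 * D1 t * (p t * D1 t + r t * D t)" for t
  have E: "(E has_real_derivative E' t) (at t)" if "t > 0" for t
    unfolding E_def E'_def using D[OF that] D1[OF that]
    by (auto intro!: derivative_eq_intros simp: power2_eq_square)
  have E'_le: "E' t \<le> C * E t" if t: "0 < t" "t \<le> T" for t
  proof -
    have 1: "\<bar>2 * D t * D1 t\<bar> \<le> E t"
      using sum_squares_bound[of "\<bar>D t\<bar>" "\<bar>D1 t\<bar>"] by (simp add: E_def abs_mult)
    have K0: "K \<ge> 0" using K(1)[OF t] by linarith
    have "2 * D1 t * (r t * D t) \<le> \<bar>r t\<bar> * \<bar>2 * D t * D1 t\<bar>" by (simp add: abs_mult mult_ac abs_le_iff) (metis abs_mult abs_ge_self mult.commute mult.left_commute)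
    also have "\<dots> \<le> K * E t" using K(2)[OF t] 1 K0 by (intro mult_mono) auto
    finally have 2: "2 * D1 t * (r t * D t) \<le> K * E t" .
    have "p t * (D1 t)\<^sup>2 \<le> K * E t"
    proof -
      have "p t * (D1 t)\<^sup>2 \<le> K * (D1 t)\<^sup>2" using K(1)[OF t] by (intro mult_right_mono) auto
      also have "\<dots> \<le> K * E t" using K0 by (intro mult_left_mono) (auto simp: E_def)
      finally show ?thesis .
    qed
    then have 3: "2 * D1 t * (p t * D1 t) \<le> 2 * (K * E t)" by (simp add: power2_eq_square mult_ac)
    have "E' t = 2 * D t * D1 t + 2 * D1 t * (p t * D1 t) + 2 * D1 t * (r t * D t)"
      by (simp add: E'_def algebra_simps)
    also have "\<dots> \<le> E t + 2 * (K * E t) + K * E t" using 1 2 3 by linarith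
    finally show ?thesis by (simp add: C_def algebra_simps)
  qed
  have mono: "E T * exp (- C * T) \<le> E s * exp (- C * s)" if s: "0 < s" "s \<le> T" for s
  proof (rule DERIV_nonpos_imp_nonincreasing[OF s(2), of "\<lambda>t. E t * exp (- C * t)"])
    fix t assume t: "s \<le> t" "t \<le> T"
    have "((\<lambda>t. E t * exp (- C * t)) has_real_derivative (E' t - C * E t) * exp (- C * t)) (at t)"
      using E[of t] t s by (auto intro!: derivative_eq_intros simp: algebra_simps)
    moreover have "(E' t - C * E t) * exp (- C * t) \<le> 0"
      using E'_le[of t] t s by (intro mult_nonpos_nonneg) auto
    ultimately show "\<exists>y. ((\<lambda>t. E t * exp (- C * t)) has_real_derivative y) (at t) \<and> y \<le> 0" by blast
  qed
  have "((\<lambda>s. E s * exp (- C * s)) \<longlongrightarrow> (0\<^sup>2 + 0\<^sup>2) * exp (- C * 0)) (at_right 0)"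
    unfolding E_def by (intro tendsto_intros lim)
  then have "((\<lambda>s. E s * exp (- C * s)) \<longlongrightarrow> 0) (at_right 0)" by simp
  moreover have "\<forall>\<^sub>F s in at_right 0. E T * exp (- C * T) \<le> E s * exp (- C * s)"
    unfolding eventually_at_right_field using T mono by (intro exI[of _ T]) auto
  ultimately have "E T * exp (- C * T) \<le> 0"
    by (rule tendsto_lowerbound) simp
  then have "E T \<le> 0" by (simp add: mult_le_0_iff)
  then have "(D T)\<^sup>2 \<le> 0" using zero_le_power2[of "D1 T"] unfolding E_def by linarith
  then show ?thesis by simp
qed

section \<open>Integral representations of the profile on both half lines\<close>

lemma filterlim_nine_over_cube: "filterlim (\<lambda>t::real. 9 / t ^ 3) at_top (at_right 0)"
proof -
  have "filterlim (\<lambda>t::real. t ^ 3) (at_right 0) (at_right 0)"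
    unfolding filterlim_at by (auto simp: eventually_at_filter intro!: tendsto_eq_intros)
  then have "filterlim (\<lambda>t::real. 9 * inverse (t ^ 3)) at_top (at_right 0)"
    by (intro filterlim_tendsto_pos_mult_at_top[OF tendsto_const] filterlim_compose[OF filterlim_inverse_at_top_right]) auto
  then show ?thesis by (simp add: divide_inverse)
qed

lemma nine_over_cube_powr:
  fixes t :: real assumes "t > 0"
  shows "(9 / t ^ 3) powr a = 9 powr a * t powr (- 3 * a)"
proof -
  have "t ^ 3 = t powr 3" using assms by (simp add: powr_numeral)
  then have "(9 / t ^ 3) powr a = 9 powr a / (t powr 3) powr a"
    using assms by (simp add: powr_divide)
  then show ?thesis using powr_minus[of t "3 * a"] by (simp add: powr_powr divide_inverse)
qed

lemma nine_over_cube_deriv: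
  fixes t :: real assumes "t > 0"
  shows "((\<lambda>t. 9 / t ^ 3) has_real_derivative - 27 / t ^ 4) (at t)"
  using assms by (auto intro!: derivative_eq_intros simp: field_simps power_numeral_reduce)

lemma Jint_cube_deriv:
  fixes t :: real assumes "t > 0" "a > 0"
  shows "((\<lambda>t. Jint a b (9 / t ^ 3)) has_real_derivative b * Jint (a + 1) (b - 1) (9 / t ^ 3) * (- 27 / t ^ 4)) (at t)"
  by (rule DERIV_chain2[OF Jint_deriv nine_over_cube_deriv]) (use assms in auto)

text \<open>Both sides solve the reflected ODE. At t -> 0 the two initial data fall on different
  sides of a + b = 0: the value is a Gamma limit (1/6 + 1/6 > 0), the derivative a Beta limit (1/6 -
  5/6 < 0).\<close>

lemma G0_neg:
  assumes t: "t > 0"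
  shows "G0 (- t) = t powr (1/2) * Jint (1/6) (1/6) (9 / t ^ 3) / Gamma (1/6)"
proof -
  define g :: real where "g = Gamma (1/6)"
  have g: "g > 0" by (simp add: g_def)
  define A where "A t = t powr (1/2) * Jint (1/6) (1/6) (9 / t ^ 3) / g" for t :: real
  \<comment> \<open>The derivative of \<open>A\<close>, reduced by \<open>Jint_split\<close> to a
    single integral.\<close>
  define A1 where "A1 t = 1/2 * t powr (-1/2) * Jint (1/6) (-5/6) (9 / t ^ 3) / g" for t :: real
  have G: "Gamma (1/6 :: real) > 0" "Gamma (5/6 :: real) > 0" "Gamma (2/3 :: real) > 0" by (auto intro: Gamma_real_pos)
  then have nz: "Gamma (1/6 :: real) \<noteq> 0" "Gamma (5/6 :: real) \<noteq> 0" "Gamma (2/3 :: real) \<noteq> 0" by linarith+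
  have A: "(A has_real_derivative A1 t) (at t)" if t: "t > 0" for t
  proof -
    have d: "((\<lambda>t. Jint (1/6) (1/6) (9 / t ^ 3)) has_real_derivative 1/6 * Jint (7/6) (-5/6) (9 / t ^ 3) * (- 27 / t ^ 4)) (at t)"
      using Jint_cube_deriv[OF t, of "1/6" "1/6"] by simp
    have p: "((\<lambda>t. t powr (1/2)) has_real_derivative 1/2 * t powr (-1/2)) (at t)"
      using has_real_derivative_powr[OF t, of "1/2"] by simp
    have q: "t powr (1/2) = t * t powr (-1/2)" using powr_mult_base[of t "-1/2"] t by simp
    have s: "Jint (1/6) (1/6) (9 / t ^ 3) = Jint (1/6) (-5/6) (9 / t ^ 3) + 9 / t ^ 3 * Jint (7/6) (-5/6) (9 / t ^ 3)"
      using Jint_split[of "1/6" "9 / t ^ 3" "1/6"] t by simp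
    show ?thesis unfolding A_def
      by (rule DERIV_cong[OF DERIV_cdivide[OF DERIV_mult[OF p d]]])
        (unfold A1_def q s, use t in \<open>simp add: field_simps power_numeral_reduce\<close>)
  qed
  have A1: "(A1 has_real_derivative t\<^sup>2 / 3 * A1 t + - (t / 6) * A t) (at t)" if t: "t > 0" for t
  proof -
    let ?w = "9 / t ^ 3"
    have d: "((\<lambda>t. Jint (1/6) (-5/6) (9 / t ^ 3)) has_real_derivative -5/6 * Jint (7/6) (-11/6) ?w * (- 27 / t ^ 4)) (at t)"
      using Jint_cube_deriv[OF t, of "1/6" "-5/6"] by simp
    have p: "((\<lambda>t. 1/2 * t powr (-1/2)) has_real_derivative 1/2 * (-1/2 * t powr (-3/2))) (at t)"
      using DERIV_cmult[OF has_real_derivative_powr[OF t, of "-1/2"], of "1/2"] by simp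
    have q: "t powr (-1/2) = t * t powr (-3/2)" "t powr (1/2) = t * (t * t powr (-3/2))"
      using powr_mult_base[of t "-1/2"] powr_mult_base[of t "-3/2"] t by simp_all
    have s: "Jint (1/6) (1/6) ?w = Jint (1/6) (-5/6) ?w + ?w * Jint (7/6) (-5/6) ?w"
      using Jint_split[of "1/6" ?w "1/6"] t by simp
    have s': "Jint (7/6) (-5/6) ?w = 1/6 * Jint (1/6) (-5/6) ?w - 5/6 * ?w * Jint (7/6) (-11/6) ?w"
      using Jint_parts[of "1/6" ?w "-5/6"] t by simp
    show ?thesis unfolding A1_def
      by (rule DERIV_cong[OF DERIV_cdivide[OF DERIV_mult[OF p d]]])
        (unfold A_def q s s', use t g in \<open>simp add: field_simps power_numeral_reduce\<close>)
  qed
  have limA: "(A \<longlongrightarrow> G0 0) (at_right 0)"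
  proof -
    have "((\<lambda>w. w powr (-1/6) * Jint (1/6) (1/6) w) \<longlongrightarrow> Gamma (1/3)) at_top"
      using Jint_tendsto_Gamma[of "1/6" "1/6"] by simp
    then have "((\<lambda>t. (9 / t ^ 3) powr (-1/6) * Jint (1/6) (1/6) (9 / t ^ 3)) \<longlongrightarrow> Gamma (1/3)) (at_right 0)"
      by (rule filterlim_compose[OF _ filterlim_nine_over_cube])
    then have "((\<lambda>t. 9 powr (1/6) * ((9 / t ^ 3) powr (-1/6) * Jint (1/6) (1/6) (9 / t ^ 3)) / Gamma (1/6)) \<longlongrightarrow> 9 powr (1/6) * Gamma (1/3) / Gamma (1/6)) (at_right 0)"
      using nz by (intro tendsto_intros) auto
    then have "((\<lambda>t. 9 powr (1/6) * ((9 / t ^ 3) powr (-1/6) * Jint (1/6) (1/6) (9 / t ^ 3)) / Gamma (1/6)) \<longlongrightarrow> G0 0) (at_right 0)"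
      by (simp add: G0_0)
    moreover have "\<forall>\<^sub>F t in at_right 0. 9 powr (1/6) * ((9 / t ^ 3) powr (-1/6) * Jint (1/6) (1/6) (9 / t ^ 3)) / Gamma (1/6) = A t"
      using eventually_at_right_less
    proof eventually_elim
      case (elim t)
      have "9 powr (1/6) * (9 / t ^ 3) powr (-1/6) = t powr (1/2)"
        using elim nine_over_cube_powr[of t "-1/6"] by (simp add: powr_minus field_simps)
      then show ?case by (simp add: A_def g_def flip: mult.assoc)
    qed
    ultimately show ?thesis by (rule Lim_transform_eventually)
  qed
  have limA1: "(A1 \<longlongrightarrow> - G1 0) (at_right 0)"
  proof -
    have "((\<lambda>w. w powr (1/6) * Jint (1/6) (-5/6) w) \<longlongrightarrow> Beta (1/6) (2/3)) at_top"
      using Jint_tendsto_Beta[of "1/6" "-5/6"] by simp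
    then have "((\<lambda>t. (9 / t ^ 3) powr (1/6) * Jint (1/6) (-5/6) (9 / t ^ 3)) \<longlongrightarrow> Beta (1/6) (2/3)) (at_right 0)"
      by (rule filterlim_compose[OF _ filterlim_nine_over_cube])
    then have "((\<lambda>t. 1/2 * 9 powr (-1/6) * ((9 / t ^ 3) powr (1/6) * Jint (1/6) (-5/6) (9 / t ^ 3)) / Gamma (1/6)) \<longlongrightarrow> 1/2 * 9 powr (-1/6) * Beta (1/6) (2/3) / Gamma (1/6)) (at_right 0)"
      using nz by (intro tendsto_intros) auto
    moreover have "1/2 * 9 powr (-1/6) * Beta (1/6) (2/3) / Gamma (1/6) = - G1 0"
      using nz by (simp add: G1_0 Beta_def)
    moreover have "\<forall>\<^sub>F t in at_right 0. 1/2 * 9 powr (-1/6) * ((9 / t ^ 3) powr (1/6) * Jint (1/6) (-5/6) (9 / t ^ 3)) / Gamma (1/6) = A1 t"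
      using eventually_at_right_less
    proof eventually_elim
      case (elim t)
      have "9 powr (-1/6) * (9 / t ^ 3) powr (1/6) = t powr (-1/2)"
        using elim nine_over_cube_powr[of t "1/6"] by (simp add: powr_minus field_simps)
      then have "1/2 * (9 powr (-1/6) * (9 / t ^ 3) powr (1/6)) = 1/2 * t powr (-1/2)" by simp
      then show ?case by (simp only: A1_def g_def mult.assoc[symmetric])
    qed
    ultimately show ?thesis by (simp add: Lim_transform_eventually)
  qed
  have "G0 (- t) - A t = 0"
  proof (rule linear_ode_zero[of "\<lambda>t. G0 (- t) - A t" "\<lambda>t. - G1 (- t) - A1 t" "\<lambda>t. t\<^sup>2 / 3" "\<lambda>t. - (t / 6)" t "t\<^sup>2 / 3 + t / 6"])
    show "((\<lambda>t. G0 (- t) - A t) has_real_derivative - G1 (- t) - A1 t) (at t)" if "t > 0" for t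
      by (rule DERIV_cong[OF DERIV_diff[OF DERIV_chain2[OF G0_deriv DERIV_minus[OF DERIV_ident]] A[OF that]]]) simp
    show "((\<lambda>t. - G1 (- t) - A1 t) has_real_derivative t\<^sup>2 / 3 * (- G1 (- t) - A1 t) + - (t / 6) * (G0 (- t) - A t)) (at t)" if "t > 0" for t
      by (rule DERIV_cong[OF DERIV_diff[OF DERIV_minus[OF DERIV_chain2[OF G1_deriv DERIV_minus[OF DERIV_ident]]] A1[OF that]]])
        (simp add: field_simps)
    show "\<bar>s\<^sup>2 / 3\<bar> \<le> t\<^sup>2 / 3 + t / 6" if "0 < s" "s \<le> t" for s
    proof -
      have "s\<^sup>2 \<le> t\<^sup>2" using that by (intro power_mono) auto
      then show ?thesis using that zero_le_power2[of s] by (simp only: abs_minus_cancel abs_of_nonneg zero_le_divide_iff)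
    qed
    show "\<bar>- (s / 6)\<bar> \<le> t\<^sup>2 / 3 + t / 6" if "0 < s" "s \<le> t" for s
      using that zero_le_power2[of t] by linarith
    have c: "isCont (\<lambda>t. G0 (- t)) 0" "isCont (\<lambda>t. - G1 (- t)) 0"
      by (intro continuous_intros isCont_o2[OF _ DERIV_isCont[OF G0_deriv]] isCont_o2[OF _ DERIV_isCont[OF G1_deriv]])+
    have "((\<lambda>t. G0 (- t)) \<longlongrightarrow> G0 0) (at_right 0)" "((\<lambda>t. - G1 (- t)) \<longlongrightarrow> - G1 0) (at_right 0)"
      using c by (auto simp: isCont_def intro: tendsto_within_subset)
    from tendsto_diff[OF this(1) limA] tendsto_diff[OF this(2) limA1]
    show "((\<lambda>t. G0 (- t) - A t) \<longlongrightarrow> 0) (at_right 0)" "((\<lambda>t. - G1 (- t) - A1 t) \<longlongrightarrow> 0) (at_right 0)" by simp_all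
  qed (rule t)
  then show ?thesis by (simp add: A_def g_def)
qed

text \<open>The scheme of \<open>G0_neg\<close> with the two limits exchanged: now the value at 0 is
  a Beta limit and the derivative a Gamma limit.\<close>

lemma G0_pos:
  assumes t: "t > 0"
  shows "G0 t = 3 / (2 * Gamma (5/6)) * (t powr (-5/2) * exp (- (t ^ 3) / 9) * Jint (5/6) (-7/6) (9 / t ^ 3))"
proof -
  \<comment> \<open>k is forced by the derivative at 0. That the value at 0 then agrees as well,
    through Gamma(7/6) = Gamma(1/6)/6, is the special feature of the exponent 1/6.\<close>
  define k :: real where "k = 3 / (2 * Gamma (5/6))"
  define B where "B t = k * (t powr (-5/2) * exp (- (t ^ 3) / 9) * Jint (5/6) (-7/6) (9 / t ^ 3))" for t :: real
  define B1 where "B1 t = - (k / 3) * (t powr (-1/2) * exp (- (t ^ 3) / 9) * Jint (5/6) (-1/6) (9 / t ^ 3))" for t :: real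
  have G: "Gamma (1/6 :: real) > 0" "Gamma (5/6 :: real) > 0" "Gamma (2/3 :: real) > 0" by (auto intro: Gamma_real_pos)
  then have nz: "Gamma (1/6 :: real) \<noteq> 0" "Gamma (5/6 :: real) \<noteq> 0" "Gamma (2/3 :: real) \<noteq> 0" by linarith+
  have ex: "((\<lambda>t::real. exp (- (t ^ 3) / 9)) has_real_derivative exp (- (t ^ 3) / 9) * (- t\<^sup>2 / 3)) (at t)" for t
    by (rule DERIV_chain2[OF DERIV_exp cube_deriv])
  have B: "(B has_real_derivative B1 t) (at t)" if t: "t > 0" for t
  proof -
    let ?w = "9 / t ^ 3"
    have d: "((\<lambda>t. Jint (5/6) (-7/6) (9 / t ^ 3)) has_real_derivative -7/6 * Jint (11/6) (-13/6) ?w * (- 27 / t ^ 4)) (at t)"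
      using Jint_cube_deriv[OF t, of "5/6" "-7/6"] by simp
    have p: "((\<lambda>t. t powr (-5/2)) has_real_derivative -5/2 * t powr (-7/2)) (at t)"
      using has_real_derivative_powr[OF t, of "-5/2"] by simp
    have q: "t powr (-5/2) = t * t powr (-7/2)" "t powr (-1/2) = t * (t * (t * t powr (-7/2)))"
      using powr_mult_base[of t "-7/2"] powr_mult_base[of t "-5/2"] powr_mult_base[of t "-3/2"] t by simp_all
    have s: "Jint (5/6) (-1/6) ?w = Jint (5/6) (-7/6) ?w + ?w * (5/6 * Jint (5/6) (-7/6) ?w - 7/6 * ?w * Jint (11/6) (-13/6) ?w)"
      using Jint_split[of "5/6" ?w "-1/6"] Jint_parts[of "5/6" ?w "-7/6"] t by simp
    show ?thesis unfolding B_def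
      by (rule DERIV_cong[OF DERIV_cmult[OF DERIV_mult[OF DERIV_mult[OF p ex] d]]])
        (unfold B1_def q s, use t in \<open>simp add: field_simps power_numeral_reduce\<close>)
  qed
  have B1: "(B1 has_real_derivative - (t\<^sup>2 / 3) * B1 t + t / 6 * B t) (at t)" if t: "t > 0" for t
  proof -
    let ?w = "9 / t ^ 3"
    have d: "((\<lambda>t. Jint (5/6) (-1/6) (9 / t ^ 3)) has_real_derivative -1/6 * Jint (11/6) (-7/6) ?w * (- 27 / t ^ 4)) (at t)"
      using Jint_cube_deriv[OF t, of "5/6" "-1/6"] by simp
    have p: "((\<lambda>t. t powr (-1/2)) has_real_derivative -1/2 * t powr (-3/2)) (at t)"
      using has_real_derivative_powr[OF t, of "-1/2"] by simp
    have q: "t powr (-3/2) = t * t powr (-5/2)" "t powr (-1/2) = t * (t * t powr (-5/2))"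
      using powr_mult_base[of t "-5/2"] powr_mult_base[of t "-3/2"] t by simp_all
    have s: "Jint (5/6) (-1/6) ?w = Jint (5/6) (-7/6) ?w + ?w * Jint (11/6) (-7/6) ?w"
      using Jint_split[of "5/6" ?w "-1/6"] t by simp
    show ?thesis unfolding B1_def
      by (rule DERIV_cong[OF DERIV_cmult[OF DERIV_mult[OF DERIV_mult[OF p ex] d]]])
        (unfold B_def q s, use t in \<open>simp add: field_simps power_numeral_reduce\<close>)
  qed
  have elim0: "((\<lambda>t::real. exp (- (t ^ 3) / 9)) \<longlongrightarrow> 1) (at_right 0)"
    by (auto intro!: tendsto_eq_intros)
  have limB: "(B \<longlongrightarrow> G0 0) (at_right 0)"
  proof -
    have "((\<lambda>w. w powr (5/6) * Jint (5/6) (-7/6) w) \<longlongrightarrow> Beta (5/6) (1/3)) at_top"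
      using Jint_tendsto_Beta[of "5/6" "-7/6"] by simp
    then have "((\<lambda>t. (9 / t ^ 3) powr (5/6) * Jint (5/6) (-7/6) (9 / t ^ 3)) \<longlongrightarrow> Beta (5/6) (1/3)) (at_right 0)"
      by (rule filterlim_compose[OF _ filterlim_nine_over_cube])
    from tendsto_mult[OF tendsto_const[of "k * 9 powr (-5/6)"] tendsto_mult[OF elim0 this]]
    have "((\<lambda>t. k * 9 powr (-5/6) * (exp (- (t ^ 3) / 9) * ((9 / t ^ 3) powr (5/6) * Jint (5/6) (-7/6) (9 / t ^ 3)))) \<longlongrightarrow> k * 9 powr (-5/6) * Beta (5/6) (1/3)) (at_right 0)"
      by simp
    moreover have "k * 9 powr (-5/6) * Beta (5/6) (1/3) = G0 0"
    proof -
      have "Gamma (7/6 :: real) = 1/6 * Gamma (1/6)"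
        using Gamma_plus1[of "1/6 :: real"] nonpos_Ints_nonpos[of "1/6 :: real"] by auto
      moreover have "(9::real) powr (1/6) = 9 * 9 powr (-5/6)" using powr_mult_base[of "9::real" "-5/6"] by simp
      ultimately show ?thesis using nz unfolding G0_0 Beta_def k_def by (simp add: divide_simps)
    qed
    moreover have "\<forall>\<^sub>F t in at_right 0. k * 9 powr (-5/6) * (exp (- (t ^ 3) / 9) * ((9 / t ^ 3) powr (5/6) * Jint (5/6) (-7/6) (9 / t ^ 3))) = B t"
      using eventually_at_right_less
    proof eventually_elim
      case (elim t)
      have "9 powr (-5/6) * (9 / t ^ 3) powr (5/6) = t powr (-5/2)"
        using elim nine_over_cube_powr[of t "5/6"] by (simp add: powr_minus field_simps)
      from this[symmetric] show ?case unfolding B_def by (simp only: mult_ac)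
    qed
    ultimately show ?thesis by (simp add: Lim_transform_eventually)
  qed
  have limB1: "(B1 \<longlongrightarrow> G1 0) (at_right 0)"
  proof -
    have "((\<lambda>w. w powr (1/6) * Jint (5/6) (-1/6) w) \<longlongrightarrow> Gamma (2/3)) at_top"
      using Jint_tendsto_Gamma[of "5/6" "-1/6"] by simp
    then have "((\<lambda>t. (9 / t ^ 3) powr (1/6) * Jint (5/6) (-1/6) (9 / t ^ 3)) \<longlongrightarrow> Gamma (2/3)) (at_right 0)"
      by (rule filterlim_compose[OF _ filterlim_nine_over_cube])
    from tendsto_mult[OF tendsto_const[of "- (k / 3) * 9 powr (-1/6)"] tendsto_mult[OF elim0 this]]
    have "((\<lambda>t. - (k / 3) * 9 powr (-1/6) * (exp (- (t ^ 3) / 9) * ((9 / t ^ 3) powr (1/6) * Jint (5/6) (-1/6) (9 / t ^ 3)))) \<longlongrightarrow> - (k / 3) * 9 powr (-1/6) * Gamma (2/3)) (at_right 0)"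
      by simp
    moreover have "- (k / 3) * 9 powr (-1/6) * Gamma (2/3) = G1 0"
      using nz by (simp add: G1_0 k_def field_simps)
    moreover have "\<forall>\<^sub>F t in at_right 0. - (k / 3) * 9 powr (-1/6) * (exp (- (t ^ 3) / 9) * ((9 / t ^ 3) powr (1/6) * Jint (5/6) (-1/6) (9 / t ^ 3))) = B1 t"
      using eventually_at_right_less
    proof eventually_elim
      case (elim t)
      have "9 powr (-1/6) * (9 / t ^ 3) powr (1/6) = t powr (-1/2)"
        using elim nine_over_cube_powr[of t "1/6"] by (simp add: powr_minus field_simps)
      from this[symmetric] show ?case unfolding B1_def by (simp only: mult_ac)
    qed
    ultimately show ?thesis by (simp add: Lim_transform_eventually)
  qed
  have "G0 t - B t = 0"
  proof (rule linear_ode_zero[of "\<lambda>t. G0 t - B t" "\<lambda>t. G1 t - B1 t" "\<lambda>t. - (t\<^sup>2 / 3)" "\<lambda>t. t / 6" t "t\<^sup>2 / 3 + t / 6"])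
    show "((\<lambda>t. G0 t - B t) has_real_derivative G1 t - B1 t) (at t)" if "t > 0" for t
      by (rule DERIV_diff[OF G0_deriv B[OF that]])
    show "((\<lambda>t. G1 t - B1 t) has_real_derivative - (t\<^sup>2 / 3) * (G1 t - B1 t) + t / 6 * (G0 t - B t)) (at t)" if "t > 0" for t
      by (rule DERIV_cong[OF DERIV_diff[OF G1_deriv B1[OF that]]]) (simp add: field_simps)
    show "\<bar>- (s\<^sup>2 / 3)\<bar> \<le> t\<^sup>2 / 3 + t / 6" if "0 < s" "s \<le> t" for s
    proof -
      have "s\<^sup>2 \<le> t\<^sup>2" using that by (intro power_mono) auto
      then show ?thesis using that zero_le_power2[of s] by (simp only: abs_minus_cancel abs_of_nonneg zero_le_divide_iff)
    qed
    show "\<bar>s / 6\<bar> \<le> t\<^sup>2 / 3 + t / 6" if "0 < s" "s \<le> t" for s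
      using that zero_le_power2[of t] by linarith
    have "(G0 \<longlongrightarrow> G0 0) (at_right 0)" "(G1 \<longlongrightarrow> G1 0) (at_right 0)"
      using DERIV_isCont[OF G0_deriv[of 0]] DERIV_isCont[OF G1_deriv[of 0]]
      by (auto simp: isCont_def intro: tendsto_within_subset)
    from tendsto_diff[OF this(1) limB] tendsto_diff[OF this(2) limB1]
    show "((\<lambda>t. G0 t - B t) \<longlongrightarrow> 0) (at_right 0)" "((\<lambda>t. G1 t - B1 t) \<longlongrightarrow> 0) (at_right 0)" by simp_all
  qed (rule t)
  then show ?thesis by (simp add: B_def k_def)
qed

lemma Cn_on_flat: "Cn_on n UNIV (flat k)"
proof (induction n arbitrary: k)
  case 0
  show ?case using flat_deriv by (auto intro!: continuous_at_imp_continuous_on DERIV_isCont)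
next
  case (Suc n)
  show ?case
    by (rule Cn_on_derivI[OF flat_deriv]) (intro Cn_on_diff Cn_on_mult Cn_on_const Suc)
qed

subsection \<open>The similarity solution\<close>

definition usim :: "real \<times> real \<Rightarrow> real" where
  "usim p = fst p powr (1/6) * G0 (snd p * fst p powr (-1/3))"

lemma smooth_on_usim: "smooth_on {p. fst p > 0} usim"
proof -
  have o: "open {p::real\<times>real. fst p > 0}" by (intro open_Collect_less continuous_intros)
  have pw: "Ck_on k {p. fst p > 0} (\<lambda>p. fst p powr a)" for k a
    by (rule Ck_on_compose1[OF o Ck_on_fst[OF o] Cn_on_powr]) auto
  have "Ck_on k {p. fst p > 0} (\<lambda>p. G0 (snd p * fst p powr (-1/3)))" for k
    by (rule Ck_on_compose1[OF o _ conjunct1[OF Cn_on_G]]) (auto intro!: Ck_on_mult Ck_on_snd pw o)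
  then show ?thesis unfolding smooth_on_def usim_def using o pw by (auto intro!: Ck_on_mult)
qed

text \<open>In terms of w = 9 s |z|^(-3) the powers of s cancel, and the right-hand side is smooth
  in s across s = 0.\<close>

lemma usim_neg:
  assumes "fst p > 0" "snd p < 0"
  shows "usim p = (- snd p) powr (1/2) / Gamma (1/6) * Jint (1/6) (1/6) (9 * fst p * (- snd p) powr (-3))"
proof -
  let ?s = "fst p" and ?y = "- snd p"
  have y: "?y > 0" using assms by simp
  let ?t = "?y * ?s powr (-1/3)"
  have t: "?t > 0" by (rule mult_pos_pos) (use y assms in auto)
  have "snd p * ?s powr (-1/3) = - ?t" by simp
  then have "usim p = ?s powr (1/6) * G0 (- ?t)" by (simp only: usim_def)
  also have "\<dots> = ?s powr (1/6) * (?t powr (1/2) * Jint (1/6) (1/6) (9 / ?t ^ 3) / Gamma (1/6))"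
    by (simp only: G0_neg[OF t])
  also have "?t powr (1/2) = ?y powr (1/2) * ?s powr (-1/6)"
    by (simp only: powr_mult powr_powr) simp
  also have "9 / ?t ^ 3 = 9 * ?s * ?y powr (-3)"
  proof -
    have "?t ^ 3 = ?t powr 3" using t by (simp add: powr_numeral)
    also have "\<dots> = ?y powr 3 * ?s powr (-1)" by (simp only: powr_mult powr_powr) simp
    finally show ?thesis using assms y by (simp add: powr_minus field_simps)
  qed
  finally show ?thesis using assms by (simp add: powr_minus field_simps)
qed

text \<open>Here exp(-t^3/9) = exp(-1/w) is the flat function of w = 9 s z^(-3), so the formula
  continues smoothly by zero to s <= 0.\<close>

lemma usim_pos:
  assumes "fst p > 0" "snd p > 0"
  shows "usim p = 3 / (2 * Gamma (5/6)) * (fst p * snd p powr (-5/2) * flat 0 (9 * fst p * snd p powr (-3))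
     * Jint (5/6) (-7/6) (9 * fst p * snd p powr (-3)))"
proof -
  let ?s = "fst p" and ?y = "snd p"
  let ?t = "?y * ?s powr (-1/3)"
  have t: "?t > 0" using assms by simp
  have "?t ^ 3 = ?t powr 3" using t by (simp add: powr_numeral)
  also have "\<dots> = ?y powr 3 * ?s powr (-1)" by (simp only: powr_mult powr_powr) simp
  finally have t3: "?t ^ 3 = ?y powr 3 * ?s powr (-1)" .
  have e: "exp (- (?t ^ 3) / 9) = flat 0 (9 * ?s * ?y powr (-3))"
    unfolding t3 using assms by (simp add: flat_def powr_minus field_simps)
  have w: "9 / ?t ^ 3 = 9 * ?s * ?y powr (-3)"
    unfolding t3 using assms by (simp add: powr_minus field_simps)
  have p: "?s powr (1/6) * ?t powr (-5/2) = ?s * ?y powr (-5/2)"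
  proof -
    have "?t powr (-5/2) = ?y powr (-5/2) * ?s powr (5/6)" by (simp only: powr_mult powr_powr) simp
    then have "?s powr (1/6) * ?t powr (-5/2) = (?s powr (1/6) * ?s powr (5/6)) * ?y powr (-5/2)"
      by (simp only: mult_ac)
    also have "?s powr (1/6) * ?s powr (5/6) = ?s" using assms by (simp flip: powr_add)
    finally show ?thesis .
  qed
  have "usim p = ?s powr (1/6) * (3 / (2 * Gamma (5/6)) * (?t powr (-5/2) * exp (- (?t ^ 3) / 9) * Jint (5/6) (-7/6) (9 / ?t ^ 3)))"
    unfolding usim_def using G0_pos[OF t] by (simp only:)
  also have "\<dots> = 3 / (2 * Gamma (5/6)) * ((?s powr (1/6) * ?t powr (-5/2)) * exp (- (?t ^ 3) / 9) * Jint (5/6) (-7/6) (9 / ?t ^ 3))"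
    by (simp only: mult_ac)
  finally show ?thesis unfolding p e w .
qed

text \<open>The half planes s > 0, z < 0 and z > 0 cover everything but the corner, and on each of
  them one of the formulas is smooth.\<close>

lemma smooth_upto_usim: "smooth_upto {p. fst p > 0} ({p. fst p \<ge> 0} - {(0, 0)}) usim"
  unfolding smooth_upto_def
proof
  fix p :: "real \<times> real" assume p: "p \<in> {p. fst p \<ge> 0} - {(0, 0)}"
  consider "fst p > 0" | "snd p < 0" | "snd p > 0" using p by (cases p) force
  then show "\<exists>U g. open U \<and> p \<in> U \<and> smooth_on U g \<and> (\<forall>q\<in>U \<inter> {p. fst p > 0}. g q = usim q)"
  proof cases
    case 1
    then show ?thesis using smooth_on_usim by (intro exI[of _ "{p. fst p > 0}"] exI[of _ usim]) (auto simp: smooth_on_def)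
  next
    case 2
    let ?U = "{p::real\<times>real. snd p < 0}"
    let ?g = "\<lambda>p. (- snd p) powr (1/2) / Gamma (1/6) * Jint (1/6) (1/6) (9 * fst p * (- snd p) powr (-3))"
    have o: "open ?U" by (intro open_Collect_less continuous_intros)
    have pw: "Ck_on k ?U (\<lambda>p. (- snd p) powr a)" for k a
      by (rule Ck_on_compose1[OF o Ck_on_uminus[OF o Ck_on_snd[OF o]] Cn_on_powr]) auto
    have "Ck_on k ?U (\<lambda>p. (- snd p) powr (1/2) * (1 / Gamma (1/6)) * Jint (1/6) (1/6) (9 * fst p * (- snd p) powr (-3)))" for k
      by (intro Ck_on_mult o pw Ck_on_const Ck_on_fst Ck_on_compose1[OF o _ Cn_on_Jint]) auto
    then have "smooth_on ?U ?g" unfolding smooth_on_def using o by simp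
    then show ?thesis using o 2 usim_neg by (intro exI[of _ ?U] exI[of _ ?g]) auto
  next
    case 3
    let ?U = "{p::real\<times>real. snd p > 0}"
    let ?g = "\<lambda>p. 3 / (2 * Gamma (5/6)) * (fst p * snd p powr (-5/2) * flat 0 (9 * fst p * snd p powr (-3))
     * Jint (5/6) (-7/6) (9 * fst p * snd p powr (-3)))"
    have o: "open ?U" by (intro open_Collect_less continuous_intros)
    have pw: "Ck_on k ?U (\<lambda>p. snd p powr a)" for k a
      by (rule Ck_on_compose1[OF o Ck_on_snd[OF o] Cn_on_powr]) auto
    have "Ck_on k ?U ?g" for k
      by (intro Ck_on_mult o pw Ck_on_const Ck_on_fst Ck_on_compose1[OF o _ Cn_on_Jint] Ck_on_compose1[OF o _ Cn_on_flat]) auto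
    then have "smooth_on ?U ?g" unfolding smooth_on_def using o by simp
    then show ?thesis using o 3 usim_pos by (intro exI[of _ ?U] exI[of _ ?g]) auto
  qed
qed

text \<open>The second derivative of \<open>G0\<close>, by \<open>G1_deriv\<close>.\<close>

definition G2 :: "real \<Rightarrow> real" where
  "G2 t = - (t\<^sup>2 / 3) * G1 t + t / 6 * G0 t"

lemma usim_partials:
  assumes s: "fst p > 0"
  defines "t \<equiv> snd p * fst p powr (-1/3)"
  shows "dz usim p = fst p powr (-1/6) * G1 t"
    and "dz (dz usim) p = fst p powr (-1/2) * G2 t"
    and "dx usim p = fst p powr (-5/6) * (G0 t / 6 - t / 3 * G1 t)"
proof -
  have dz1: "dz usim q = fst q powr (-1/6) * G1 (snd q * fst q powr (-1/3))" if q: "fst q > 0" for q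
  proof -
    have "((\<lambda>y. fst q powr (1/6) * G0 (y * fst q powr (-1/3))) has_real_derivative
       fst q powr (1/6) * (G1 (snd q * fst q powr (-1/3)) * fst q powr (-1/3))) (at (snd q))"
      by (intro DERIV_cmult DERIV_chain2[OF G0_deriv]) (auto intro!: derivative_eq_intros)
    moreover have "fst q powr (-1/6) = fst q powr (1/6) * fst q powr (-1/3)" by (simp flip: powr_add)
    ultimately have "((\<lambda>y. fst q powr (1/6) * G0 (y * fst q powr (-1/3))) has_real_derivative
       fst q powr (-1/6) * G1 (snd q * fst q powr (-1/3))) (at (snd q))" by (simp only: mult_ac)
    then show ?thesis unfolding dz_def usim_def by (simp add: DERIV_imp_deriv)
  qed
  then show "dz usim p = fst p powr (-1/6) * G1 t" using s by (simp add: t_def)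
  have "((\<lambda>y. fst p powr (-1/6) * G1 (y * fst p powr (-1/3))) has_real_derivative
       fst p powr (-1/6) * (G2 t * fst p powr (-1/3))) (at (snd p))"
    unfolding t_def G2_def by (intro DERIV_cmult DERIV_chain2[OF G1_deriv]) (auto intro!: derivative_eq_intros)
  moreover have "fst p powr (-1/2) = fst p powr (-1/6) * fst p powr (-1/3)" by (simp flip: powr_add)
  ultimately have "((\<lambda>y. fst p powr (-1/6) * G1 (y * fst p powr (-1/3))) has_real_derivative
       fst p powr (-1/2) * G2 t) (at (snd p))" by (simp only: mult_ac)
  then show "dz (dz usim) p = fst p powr (-1/2) * G2 t"
    unfolding dz_def[of "dz usim"] using s by (simp add: dz1 DERIV_imp_deriv)
  have "((\<lambda>s. s powr (-1/3)) has_real_derivative -1/3 * fst p powr (-4/3)) (at (fst p))"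
    using has_real_derivative_powr[OF s, of "-1/3"] by simp
  then have "((\<lambda>s. snd p * s powr (-1/3)) has_real_derivative snd p * (-1/3 * fst p powr (-4/3))) (at (fst p))"
    by (rule DERIV_cmult)
  from DERIV_mult[OF has_real_derivative_powr[OF s, of "1/6"] DERIV_chain2[OF G0_deriv this]]
  have "((\<lambda>s. s powr (1/6) * G0 (snd p * s powr (-1/3))) has_real_derivative
     1/6 * fst p powr (-5/6) * G0 t + G1 t * (snd p * (-1/3 * fst p powr (-4/3))) * fst p powr (1/6)) (at (fst p))"
    by (simp add: t_def)
  moreover have "snd p * fst p powr (-4/3) * fst p powr (1/6) = t * fst p powr (-5/6)"
    unfolding t_def mult.assoc by (simp flip: powr_add)
  then have "1/6 * fst p powr (-5/6) * G0 t + G1 t * (snd p * (-1/3 * fst p powr (-4/3))) * fst p powr (1/6)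
     = fst p powr (-5/6) * (G0 t / 6 - t / 3 * G1 t)"
    by (simp add: algebra_simps)
  ultimately show "dx usim p = fst p powr (-5/6) * (G0 t / 6 - t / 3 * G1 t)"
    unfolding dx_def usim_def by (simp add: DERIV_imp_deriv)
qed

lemma usim_pde:
  assumes s: "fst p > 0" shows "snd p * dx usim p = dz (dz usim) p"
proof -
  define t where "t = snd p * fst p powr (-1/3)"
  have "fst p powr (-1/3) * fst p powr (1/3) = 1" using s by (simp flip: powr_add)
  then have y: "snd p = t * fst p powr (1/3)" by (simp add: t_def mult.assoc)
  have h: "fst p powr (-1/2) = fst p powr (1/3) * fst p powr (-5/6)" by (simp flip: powr_add)
  have "snd p * dx usim p = t * fst p powr (-1/2) * (G0 t / 6 - t / 3 * G1 t)"
    unfolding usim_partials[OF s] t_def[symmetric] h by (subst y) (simp only: mult_ac)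
  also have "\<dots> = dz (dz usim) p"
    unfolding usim_partials[OF s] t_def[symmetric] G2_def by (simp add: algebra_simps power2_eq_square)
  finally show ?thesis .
qed

section \<open>Functions smooth up to part of the boundary, and growth of the profile\<close>

lemma smooth_uptoE:
  assumes "smooth_upto Om S f" "p \<in> S"
  obtains U g where "open U" "p \<in> U" "smooth_on U g" "\<And>q. q \<in> U \<inter> Om \<Longrightarrow> g q = f q"
proof -
  obtain U g where *: "open U \<and> p \<in> U \<and> smooth_on U g \<and> (\<forall>q\<in>U \<inter> Om. g q = f q)"
    using bspec[OF assms(1)[unfolded smooth_upto_def] assms(2)] by (elim exE)
  show ?thesis by (rule that[of U g]) (use * in auto)
qed

lemma smooth_upto_bounded:
  assumes "smooth_upto Om S f" "compact S"
  shows "\<exists>C. \<forall>p\<in>Om \<inter> S. \<bar>f p\<bar> \<le> C"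
proof -
  have "\<exists>V C. open V \<and> p \<in> V \<and> (\<forall>q\<in>V \<inter> Om. \<bar>f q\<bar> \<le> C)" if p: "p \<in> S" for p
  proof -
    obtain U g where U: "open U" "p \<in> U" "smooth_on U g" "\<And>q. q \<in> U \<inter> Om \<Longrightarrow> g q = f q"
      using assms(1) p by (rule smooth_uptoE) blast
    have "isCont g p" using smooth_on_continuous[OF U(3)] U(1,2) by (simp add: continuous_on_eq_continuous_at)
    then have "((\<lambda>q. \<bar>g q\<bar>) \<longlongrightarrow> \<bar>g p\<bar>) (nhds p)" by (intro tendsto_intros) (simp add: isCont_def tendsto_at_iff_tendsto_nhds)
    then have "\<forall>\<^sub>F q in nhds p. \<bar>g q\<bar> < \<bar>g p\<bar> + 1" by (rule order_tendstoD) simp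
    then obtain V where V: "open V" "p \<in> V" "\<And>q. q \<in> V \<Longrightarrow> \<bar>g q\<bar> < \<bar>g p\<bar> + 1"
      unfolding eventually_nhds by blast
    show ?thesis
    proof (intro exI[of _ "U \<inter> V"] exI[of _ "\<bar>g p\<bar> + 1"] conjI ballI)
      fix q assume "q \<in> U \<inter> V \<inter> Om"
      then show "\<bar>f q\<bar> \<le> \<bar>g p\<bar> + 1" using V(3)[of q] U(4)[of q] by auto
    qed (use U V in auto)
  qed
  then obtain V C where V: "\<And>p. p \<in> S \<Longrightarrow> open (V p)" "\<And>p. p \<in> S \<Longrightarrow> p \<in> V p"
    "\<And>p q. p \<in> S \<Longrightarrow> q \<in> V p \<inter> Om \<Longrightarrow> \<bar>f q\<bar> \<le> C p" by metis
  have "S \<subseteq> (\<Union>p\<in>S. V p)" using V(2) by blast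
  then obtain T where T: "T \<subseteq> S" "finite T" "S \<subseteq> (\<Union>p\<in>T. V p)"
    using compactE_image[OF assms(2), of S V] V(1) by metis
  show ?thesis
  proof (intro exI[of _ "\<Sum>p\<in>T. \<bar>C p\<bar>"] ballI)
    fix q assume q: "q \<in> Om \<inter> S"
    then obtain p where p: "p \<in> T" "q \<in> V p" using T by blast
    have "\<bar>f q\<bar> \<le> \<bar>C p\<bar>" using V(3)[of p q] p T q by fastforce
    also have "\<dots> \<le> (\<Sum>p\<in>T. \<bar>C p\<bar>)" using T p by (intro member_le_sum) auto
    finally show "\<bar>f q\<bar> \<le> (\<Sum>p\<in>T. \<bar>C p\<bar>)" .
  qed
qed

lemma smooth_upto_partials:
  assumes "smooth_upto Om S f" "open Om"
  shows "smooth_upto Om S (dx f)" "smooth_upto Om S (dz f)"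
proof -
  have "\<exists>U g. open U \<and> p \<in> U \<and> smooth_on U g \<and> (\<forall>q\<in>U \<inter> Om. g q = dx f q)"
    "\<exists>U g. open U \<and> p \<in> U \<and> smooth_on U g \<and> (\<forall>q\<in>U \<inter> Om. g q = dz f q)" if p: "p \<in> S" for p
  proof -
    obtain U g where U: "open U" "p \<in> U" "smooth_on U g" "\<And>q. q \<in> U \<inter> Om \<Longrightarrow> g q = f q"
      using assms(1) p by (rule smooth_uptoE) blast
    have "dx g q = dx f q" "dz g q = dz f q" if "q \<in> U \<inter> Om" for q
      using partials_cong[of "U \<inter> Om" q g f] that U assms(2) by auto
    then show "\<exists>U g. open U \<and> p \<in> U \<and> smooth_on U g \<and> (\<forall>q\<in>U \<inter> Om. g q = dx f q)"
      "\<exists>U g. open U \<and> p \<in> U \<and> smooth_on U g \<and> (\<forall>q\<in>U \<inter> Om. g q = dz f q)"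
      using U smooth_on_dx[OF U(3)] smooth_on_dz[OF U(3)] by blast+
  qed
  then show "smooth_upto Om S (dx f)" "smooth_upto Om S (dz f)" unfolding smooth_upto_def by blast+
qed

lemma smooth_upto_subset: "smooth_upto Om S f \<Longrightarrow> Om' \<subseteq> Om \<Longrightarrow> S' \<subseteq> S \<Longrightarrow> smooth_upto Om' S' f"
  unfolding smooth_upto_def by (rule ballI, drule bspec, erule subsetD, assumption) blast

lemma smooth_upto_binop:
  assumes "\<And>U f g. smooth_on U f \<Longrightarrow> smooth_on U g \<Longrightarrow> smooth_on U (\<lambda>p. F (f p) (g p))"
    and "smooth_upto Om S f" "smooth_upto Om S g"
  shows "smooth_upto Om S (\<lambda>p. F (f p) (g p))"
  unfolding smooth_upto_def
proof
  fix p assume p: "p \<in> S"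
  obtain U f' where U: "open U" "p \<in> U" "smooth_on U f'" "\<And>q. q \<in> U \<inter> Om \<Longrightarrow> f' q = f q"
    using assms(2) p by (rule smooth_uptoE) blast
  obtain V g' where V: "open V" "p \<in> V" "smooth_on V g'" "\<And>q. q \<in> V \<inter> Om \<Longrightarrow> g' q = g q"
    using assms(3) p by (rule smooth_uptoE) blast
  have "smooth_on (U \<inter> V) (\<lambda>p. F (f' p) (g' p))"
    using U V by (intro assms(1) smooth_on_subset[OF U(3)] smooth_on_subset[OF V(3)]) auto
  then show "\<exists>U h. open U \<and> p \<in> U \<and> smooth_on U h \<and> (\<forall>q\<in>U \<inter> Om. h q = F (f q) (g q))"
    using U V by (intro exI[of _ "U \<inter> V"] exI[of _ "\<lambda>p. F (f' p) (g' p)"]) auto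
qed


lemma smooth_on_if_smooth_upto:
  assumes "smooth_upto Om S f" "open Om" "Om \<subseteq> S"
  shows "smooth_on Om f"
proof (rule smooth_on_local[OF assms(2)])
  fix p assume p: "p \<in> Om"
  then have "p \<in> S" using assms(3) by blast
  with assms(1) obtain U g where U: "open U" "p \<in> U" "smooth_on U g" "\<And>q. q \<in> U \<inter> Om \<Longrightarrow> g q = f q"
    by (rule smooth_uptoE) blast
  have "smooth_on (U \<inter> Om) g" using U assms(2) by (intro smooth_on_subset[OF U(3)]) auto
  then have "smooth_on (U \<inter> Om) f" using U(4) by (rule smooth_on_cong)
  then show "\<exists>V. p \<in> V \<and> smooth_on V f" using p U(2) by blast
qed

text \<open>Growth is read off from the solution itself: on the lines z = 1 and z = -1 it is smooth
  up to s = 0, hence bounded there, with its z-derivatives, for s <= 1.\<close>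

lemma G_asymp_bounds:
  "\<exists>C. \<forall>t. \<bar>t\<bar> \<ge> 1 \<longrightarrow> \<bar>G0 t\<bar> \<le> C * \<bar>t\<bar> powr (1/2) \<and> \<bar>G1 t\<bar> \<le> C * \<bar>t\<bar> powr (-1/2) \<and> \<bar>G2 t\<bar> \<le> C * \<bar>t\<bar> powr (-3/2)"
proof -
  let ?O = "{p::real\<times>real. fst p > 0}" and ?S = "{0..1::real} \<times> {-1, 1::real}"
  have o: "open ?O" by (intro open_Collect_less continuous_intros)
  have S: "compact ?S" by (intro compact_Times compact_Icc) auto
  have u0: "smooth_upto ?O ?S usim" by (rule smooth_upto_subset[OF smooth_upto_usim]) auto
  note u1 = smooth_upto_partials(2)[OF u0 o]
  note u2 = smooth_upto_partials(2)[OF u1 o]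
  obtain C0 where C0: "\<And>p. p \<in> ?O \<inter> ?S \<Longrightarrow> \<bar>usim p\<bar> \<le> C0" using smooth_upto_bounded[OF u0 S] by blast
  obtain C1 where C1: "\<And>p. p \<in> ?O \<inter> ?S \<Longrightarrow> \<bar>dz usim p\<bar> \<le> C1" using smooth_upto_bounded[OF u1 S] by blast
  obtain C2 where C2: "\<And>p. p \<in> ?O \<inter> ?S \<Longrightarrow> \<bar>dz (dz usim) p\<bar> \<le> C2" using smooth_upto_bounded[OF u2 S] by blast
  define C where "C = max C0 (max C1 C2)"
  have "\<bar>G0 t\<bar> \<le> C * \<bar>t\<bar> powr (1/2) \<and> \<bar>G1 t\<bar> \<le> C * \<bar>t\<bar> powr (-1/2) \<and> \<bar>G2 t\<bar> \<le> C * \<bar>t\<bar> powr (-3/2)"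
    if t: "\<bar>t\<bar> \<ge> 1" for t
  proof -
    \<comment> \<open>The point with |z| = 1 whose similarity variable is t.\<close>
    define p where "p = (\<bar>t\<bar> powr (-3), sgn t)"
    have t0: "\<bar>t\<bar> > 0" using t by linarith
    have "\<bar>t\<bar> powr (-3) \<le> \<bar>t\<bar> powr 0" using t by (intro powr_mono) auto
    then have p: "p \<in> ?O \<inter> ?S" using t t0 by (auto simp: p_def sgn_if)
    have s: "fst p > 0" using p by auto
    have te: "snd p * fst p powr (-1/3) = t" using t0 by (simp add: p_def powr_powr sgn_mult_abs)
    have "\<bar>t\<bar> powr (-1/2) * \<bar>G0 t\<bar> \<le> C"
      using C0[OF p] te by (simp add: usim_def abs_mult C_def) (simp add: p_def powr_powr)
    moreover have "\<bar>t\<bar> powr (1/2) * \<bar>G1 t\<bar> \<le> C"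
      using C1[OF p] te unfolding usim_partials[OF s] by (simp add: abs_mult C_def) (simp add: p_def powr_powr)
    moreover have "\<bar>t\<bar> powr (3/2) * \<bar>G2 t\<bar> \<le> C"
      using C2[OF p] te unfolding usim_partials[OF s] by (simp add: abs_mult C_def) (simp add: p_def powr_powr)
    moreover have "x \<le> C * \<bar>t\<bar> powr (- a)" if "\<bar>t\<bar> powr a * x \<le> C" for x a
    proof -
      have "x = \<bar>t\<bar> powr a * x * \<bar>t\<bar> powr (- a)" using t0 by (simp add: powr_minus)
      also have "\<dots> \<le> C * \<bar>t\<bar> powr (- a)" by (rule mult_right_mono[OF that]) simp
      finally show ?thesis .
    qed
    ultimately show ?thesis by (metis minus_divide_left minus_minus)
  qed
  then show ?thesis by blast
qed

lemma continuous_G: "continuous_on UNIV G0" "continuous_on UNIV G1" "continuous_on UNIV G2"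
proof -
  show 0: "continuous_on UNIV G0" "continuous_on UNIV G1" using Cn_on_G[of 0] by auto
  show "continuous_on UNIV G2" unfolding G2_def by (intro continuous_intros 0) auto
qed

lemma continuous_bounded_Icc:
  fixes f :: "real \<Rightarrow> real"
  assumes "continuous_on UNIV f" shows "\<exists>C. \<forall>t\<in>{a..b}. \<bar>f t\<bar> \<le> C"
proof -
  have "compact (f ` {a..b})"
    by (rule compact_continuous_image[OF continuous_on_subset[OF assms] compact_Icc]) simp
  then have "bounded (f ` {a..b})" by (rule compact_imp_bounded)
  then show ?thesis unfolding bounded_iff by auto
qed

text \<open>Needed on the inflow side, where t >= 0: growth like t^(1/2) would only give u =
  O(|z|^(1/2)) there, which does not force a zero trace.\<close>

lemma G0_bounded_pos: "\<exists>C. \<forall>t\<ge>0. \<bar>G0 t\<bar> \<le> C"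
proof -
  obtain C1 where C1: "\<And>t. t \<in> {0..1} \<Longrightarrow> \<bar>G0 t\<bar> \<le> C1"
    using continuous_bounded_Icc[OF continuous_G(1), of 0 1] by blast
  have "continuous_on UNIV (Jint (5/6) (-7/6))" using Cn_on_Jint[of "5/6" 0 "-7/6"] by simp
  from continuous_bounded_Icc[OF this, of 0 9]
  obtain C2 where C2: "\<And>w. w \<in> {0..9} \<Longrightarrow> \<bar>Jint (5/6) (-7/6) w\<bar> \<le> C2" by blast
  define k :: real where "k = 3 / (2 * Gamma (5/6))"
  have "\<bar>G0 t\<bar> \<le> max C1 (\<bar>k\<bar> * C2)" if "t \<ge> 0" for t
  proof (cases "t \<le> 1")
    case True
    then show ?thesis using C1[of t] that by simp
  next
    case False
    then have t: "t > 1" by simp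
    have "t ^ 3 \<ge> 1" using t by (intro one_le_power) simp
    then have w: "9 / t ^ 3 \<in> {0..9}" using t by (auto simp: divide_simps)
    have "t powr (-5/2) \<le> t powr 0" using t by (intro powr_mono) auto
    then have 1: "t powr (-5/2) \<le> 1" using t by simp
    have 2: "exp (- (t ^ 3) / 9) \<le> 1" using t by simp
    have "\<bar>t powr (-5/2) * exp (- (t ^ 3) / 9) * Jint (5/6) (-7/6) (9 / t ^ 3)\<bar> \<le> 1 * 1 * C2"
      unfolding abs_mult using 1 2 C2[OF w] by (intro mult_mono) auto
    then have "\<bar>k * (t powr (-5/2) * exp (- (t ^ 3) / 9) * Jint (5/6) (-7/6) (9 / t ^ 3))\<bar> \<le> \<bar>k\<bar> * C2"
      unfolding abs_mult[of k] by (intro mult_left_mono) auto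
    then show ?thesis using G0_pos[of t] t by (simp add: k_def)
  qed
  then show ?thesis by blast
qed

subsection \<open>Weak derivatives and test functions\<close>

text \<open>The weak formulations use the completed measure, while Fubini is applied to
  \<open>lborel\<close>; for Borel integrands nothing is lost in between.\<close>

lemma set_integral_lebesgue_eq_lborel:
  fixes f :: "'a::euclidean_space \<Rightarrow> real"
  assumes "(\<lambda>p. indicator A p * f p) \<in> borel_measurable borel"
  shows "(LINT p:A|lebesgue. f p) = (\<integral>p. indicator A p * f p \<partial>lborel)"
    "set_integrable lebesgue A f \<longleftrightarrow> integrable lborel (\<lambda>p. indicator A p * f p)"
  using assms integral_completion[of "\<lambda>p. indicator A p * f p" lborel] integrable_completion[of "\<lambda>p. indicator A p * f p" lborel]
  by (simp_all add: set_lebesgue_integral_def set_integrable_def)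

lemma integrable_compact_support:
  fixes F :: "'a::euclidean_space \<Rightarrow> real"
  assumes "continuous_on UNIV F" "compact K" "\<And>p. p \<notin> K \<Longrightarrow> F p = 0"
  shows "integrable lborel F"
proof -
  have "integrable lborel (\<lambda>x. indicator K x *\<^sub>R F x)"
    by (rule borel_integrable_compact[OF assms(2) continuous_on_subset[OF assms(1)]]) simp
  moreover have "(\<lambda>x. indicator K x *\<^sub>R F x) = F" using assms(3) by (auto simp: fun_eq_iff indicator_def)
  ultimately show ?thesis by simp
qed

lemma integral_deriv_compact_support:
  fixes f :: "real \<Rightarrow> real"
  assumes "\<And>x. (F has_real_derivative f x) (at x)" "continuous_on UNIV f" "\<And>x. x \<notin> {-M..M} \<Longrightarrow> F x = 0" "M > 0"
  shows "integral\<^sup>L lborel f = 0"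
proof -
  have f0: "f x = 0" if "x \<notin> {-M..M}" for x
  proof -
    have "open (- {-M..M})" by (intro open_Compl closed_atLeastAtMost)
    then have "((\<lambda>x. 0) has_real_derivative f x) (at x)"
      by (rule has_field_derivative_transform_within_open[OF assms(1)]) (use that assms(3) in auto)
    then show ?thesis using DERIV_unique DERIV_const by metis
  qed
  \<comment> \<open>One unit is added on both sides, so that \<open>F\<close> vanishes at the two
    endpoints directly by hypothesis.\<close>
  have "integral\<^sup>L lborel f = (\<integral>x. indicator {-(M+1)..M+1} x *\<^sub>R f x \<partial>lborel)"
  proof (intro Bochner_Integration.integral_cong refl)
    fix x show "f x = indicator {-(M+1)..M+1} x *\<^sub>R f x"
      using f0[of x] by (cases "x \<in> {-M..M}") (auto simp: indicator_def)
  qed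
  also have "\<dots> = F (M + 1) - F (-(M + 1))"
  proof (rule integral_FTC_atLeastAtMost)
    show "(F has_vector_derivative f x) (at x within {-(M+1)..M+1})" for x
      using assms(1)[of x] by (simp add: has_real_derivative_iff_has_vector_derivative has_vector_derivative_at_within)
  qed (use assms(2,4) in \<open>auto intro: continuous_on_subset\<close>)
  also have "\<dots> = 0" using assms(3)[of "M + 1"] assms(3)[of "-(M + 1)"] by simp
  finally show ?thesis .
qed

lemma compact_subset_square:
  fixes K :: "(real \<times> real) set" assumes "compact K"
  obtains M where "M > 0" "\<And>p. p \<in> K \<Longrightarrow> \<bar>fst p\<bar> \<le> M \<and> \<bar>snd p\<bar> \<le> M"
proof -
  obtain M where M: "M > 0" "\<And>p. p \<in> K \<Longrightarrow> norm p \<le> M"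
    using compact_imp_bounded[OF assms] bounded_pos[of K] by blast
  have "\<bar>fst p\<bar> \<le> M \<and> \<bar>snd p\<bar> \<le> M" if "p \<in> K" for p
    using M(2)[OF that] norm_fst_le[of "fst p" "snd p"] norm_snd_le[of "snd p" "fst p"] by simp
  with M(1) show ?thesis by (rule that)
qed

lemma partials_zero_outside:
  assumes "closed K" "\<And>p. p \<notin> K \<Longrightarrow> F p = 0" "p \<notin> K"
  shows "dx F p = 0" "dz F p = 0"
  using partials_cong[of "- K" p F "\<lambda>_. 0"] assms by (auto simp: dx_def dz_def)

lemma integral_partials_compact_support:
  assumes F: "smooth_on UNIV F" and K: "compact K" "\<And>p. p \<notin> K \<Longrightarrow> F p = 0"
  shows "integral\<^sup>L lborel (dx F) = 0" "integral\<^sup>L lborel (dz F) = 0"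
proof -
  obtain M where M: "M > 0" "\<And>p. p \<in> K \<Longrightarrow> \<bar>fst p\<bar> \<le> M \<and> \<bar>snd p\<bar> \<le> M" using compact_subset_square[OF K(1)] by blast
  have c: "continuous_on UNIV (dx F)" "continuous_on UNIV (dz F)"
    using smooth_on_continuous[OF smooth_on_dx[OF F]] smooth_on_continuous[OF smooth_on_dz[OF F]] by auto
  have i: "integrable lborel (dx F)" "integrable lborel (dz F)"
    using integrable_compact_support[OF c(1) K(1)] integrable_compact_support[OF c(2) K(1)]
      partials_zero_outside[OF compact_imp_closed[OF K(1)] K(2)] by auto
  have F0: "F (x, y) = 0" if "\<bar>x\<bar> > M \<or> \<bar>y\<bar> > M" for x y using M(2)[of "(x, y)"] K(2)[of "(x, y)"] that by force
  have "(\<integral>x. dx F (x, y) \<partial>lborel) = 0" for y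
  proof (rule integral_deriv_compact_support[of "\<lambda>x. F (x, y)" "\<lambda>x. dx F (x, y)" M])
    show "((\<lambda>x. F (x, y)) has_real_derivative dx F (x, y)) (at x)" for x
      using smooth_on_has_partials(1)[OF F, of "(x, y)"] by simp
    show "continuous_on UNIV (\<lambda>x. dx F (x, y))"
      by (rule continuous_on_compose2[OF c(1)]) (auto intro!: continuous_intros)
  qed (use M F0 in auto)
  moreover have "integral\<^sup>L lborel (dx F) = (\<integral>y. (\<integral>x. dx F (x, y) \<partial>lborel) \<partial>lborel)"
    using lborel_pair.integral_snd[of "\<lambda>x y. dx F (x, y)"] i(1) by (simp add: lborel_prod case_prod_unfold)
  ultimately show "integral\<^sup>L lborel (dx F) = 0" by simp
  have "(\<integral>y. dz F (x, y) \<partial>lborel) = 0" for x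
  proof (rule integral_deriv_compact_support[of "\<lambda>y. F (x, y)" "\<lambda>y. dz F (x, y)" M])
    show "((\<lambda>y. F (x, y)) has_real_derivative dz F (x, y)) (at y)" for y
      using smooth_on_has_partials(2)[OF F, of "(x, y)"] by simp
    show "continuous_on UNIV (\<lambda>y. dz F (x, y))"
      by (rule continuous_on_compose2[OF c(2)]) (auto intro!: continuous_intros)
  qed (use M F0 in auto)
  moreover have "integral\<^sup>L lborel (dz F) = (\<integral>x. (\<integral>y. dz F (x, y) \<partial>lborel) \<partial>lborel)"
    using lborel_pair.integral_fst'[of "dz F"] i(2) by (simp add: lborel_prod)
  ultimately show "integral\<^sup>L lborel (dz F) = 0" by simp
qed

lemma test_fn_partials:
  assumes "test_fn Om \<phi>" shows "test_fn Om (dx \<phi>)" "test_fn Om (dz \<phi>)"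
proof -
  obtain K where K: "smooth_on UNIV \<phi>" "compact K" "K \<subseteq> Om" "\<forall>p. p \<notin> K \<longrightarrow> \<phi> p = 0"
    using assms by (auto simp: test_fn_def)
  have "dx \<phi> p = 0" "dz \<phi> p = 0" if "p \<notin> K" for p
    using partials_zero_outside[OF compact_imp_closed[OF K(2)], of \<phi> p] K(4) that by auto
  then show "test_fn Om (dx \<phi>)" "test_fn Om (dz \<phi>)"
    using K smooth_on_dx[OF K(1)] smooth_on_dz[OF K(1)] unfolding test_fn_def by blast+
qed

text \<open>The compact support of \<phi> lies inside \<open>Om\<close>, so extending the product by
  zero loses no smoothness, whatever u does near the boundary.\<close>

lemma test_fn_extension:
  assumes Om: "open Om" and u: "smooth_on Om u" and t: "test_fn Om \<phi>"
  defines "F \<equiv> \<lambda>p. if p \<in> Om then u p * \<phi> p else 0"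
  obtains K where "smooth_on UNIV F" "compact K" "\<And>p. p \<notin> K \<Longrightarrow> F p = 0"
proof -
  obtain K where K: "smooth_on UNIV \<phi>" "compact K" "K \<subseteq> Om" "\<And>p. p \<notin> K \<Longrightarrow> \<phi> p = 0"
    using t by (auto simp: test_fn_def)
  have cl: "closed K" using K(2) by (rule compact_imp_closed)
  have "smooth_on UNIV F"
  proof (rule smooth_on_local)
    fix p :: "real \<times> real"
    show "\<exists>V. p \<in> V \<and> smooth_on V F"
    proof (cases "p \<in> Om")
      case True
      have "smooth_on Om (\<lambda>p. u p * \<phi> p)"
        by (intro smooth_on_mult u smooth_on_subset[OF K(1)] Om) auto
      then have "smooth_on Om F" by (rule smooth_on_cong) (simp add: F_def)
      then show ?thesis using True by blast
    next
      case False
      have "smooth_on (- K) (\<lambda>p. 0)" using cl by (simp add: smooth_on_def open_Compl)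
      then have "smooth_on (- K) F" by (rule smooth_on_cong) (use K(4) in \<open>auto simp: F_def\<close>)
      then show ?thesis using False K(3) by blast
    qed
  qed simp
  then show ?thesis using K by (intro that[of K]) (auto simp: F_def)
qed

lemma set_integrable_test_fn:
  assumes "open Om" "smooth_on Om u" "test_fn Om \<phi>"
  shows "set_integrable lebesgue Om (\<lambda>p. u p * \<phi> p)"
proof -
  define F where "F = (\<lambda>p. if p \<in> Om then u p * \<phi> p else 0)"
  obtain K where K: "smooth_on UNIV F" "compact K" "\<And>p. p \<notin> K \<Longrightarrow> F p = 0"
    using test_fn_extension[OF assms] unfolding F_def by blast
  have "integrable lborel F" by (rule integrable_compact_support[OF smooth_on_continuous[OF K(1)] K(2,3)])
  moreover have "F = (\<lambda>p. indicator Om p * (u p * \<phi> p))" by (auto simp: F_def indicator_def)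
  ultimately show ?thesis by (subst set_integral_lebesgue_eq_lborel(2)) auto
qed

text \<open>The product, extended by zero, is smooth with compact support, so its partial
  derivatives have integral zero over the plane.\<close>

lemma integration_by_parts_test_fn:
  assumes Om: "open Om" and u: "smooth_on Om u" and t: "test_fn Om \<phi>"
  shows "(LINT p:Om|lebesgue. u p * dx \<phi> p) = - (LINT p:Om|lebesgue. dx u p * \<phi> p)"
    "(LINT p:Om|lebesgue. u p * dz \<phi> p) = - (LINT p:Om|lebesgue. dz u p * \<phi> p)"
proof -
  define F where "F = (\<lambda>p. if p \<in> Om then u p * \<phi> p else 0)"
  obtain K where K: "smooth_on UNIV F" "compact K" "\<And>p. p \<notin> K \<Longrightarrow> F p = 0"
    using test_fn_extension[OF assms] unfolding F_def by blast
  have phi: "smooth_on UNIV \<phi>" using t by (simp add: test_fn_def)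
  have prod: "dx F p = u p * dx \<phi> p + dx u p * \<phi> p" "dz F p = u p * dz \<phi> p + dz u p * \<phi> p" if p: "p \<in> Om" for p
  proof -
    have "dx F p = dx (\<lambda>p. u p * \<phi> p) p" "dz F p = dz (\<lambda>p. u p * \<phi> p) p"
      using partials_cong[OF Om p, of F "\<lambda>p. u p * \<phi> p"] by (auto simp: F_def)
    moreover have "((\<lambda>p. u p * \<phi> p) has_derivative (\<lambda>h. (u p * dx \<phi> p + dx u p * \<phi> p) * fst h + (u p * dz \<phi> p + dz u p * \<phi> p) * snd h)) (at p)"
      using has_derivative_mult[OF has_derivative_partials[OF smooth_on_differentiable[OF u p]]
          has_derivative_partials[OF smooth_on_differentiable[OF phi UNIV_I, of p]]]
      by (simp add: algebra_simps)
    note partials_of_has_derivative(3,4)[OF this]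
    ultimately show "dx F p = u p * dx \<phi> p + dx u p * \<phi> p" "dz F p = u p * dz \<phi> p + dz u p * \<phi> p" by simp_all
  qed
  have out: "dx F p = 0" "dz F p = 0" if "p \<notin> Om" for p
  proof -
    obtain K' where K': "compact K'" "K' \<subseteq> Om" "\<And>p. p \<notin> K' \<Longrightarrow> \<phi> p = 0" using t by (auto simp: test_fn_def)
    then have "F p = 0" if "p \<notin> K'" for p using that by (simp add: F_def)
    then show "dx F p = 0" "dz F p = 0"
      using partials_zero_outside[OF compact_imp_closed[OF K'(1)], of F p] that K'(2) by auto
  qed
  have key: "(LINT p:Om|lebesgue. u p * d1 p) = - (LINT p:Om|lebesgue. d2 p * \<phi> p)"
    if "integral\<^sup>L lborel dF = 0" and dF: "\<And>p. p \<in> Om \<Longrightarrow> dF p = u p * d1 p + d2 p * \<phi> p" "\<And>p. p \<notin> Om \<Longrightarrow> dF p = 0"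
      "continuous_on UNIV dF" and d1: "test_fn Om d1" and d2: "smooth_on Om d2" for dF d1 d2
  proof -
    have i1: "set_integrable lebesgue Om (\<lambda>p. u p * d1 p)" by (rule set_integrable_test_fn[OF Om u d1])
    have i2: "set_integrable lebesgue Om (\<lambda>p. d2 p * \<phi> p)" by (rule set_integrable_test_fn[OF Om d2 t])
    have "(LINT p:Om|lebesgue. u p * d1 p) + (LINT p:Om|lebesgue. d2 p * \<phi> p) = (LINT p:Om|lebesgue. u p * d1 p + d2 p * \<phi> p)"
      by (rule set_integral_add(2)[OF i1 i2, symmetric])
    also have "\<dots> = integral\<^sup>L lebesgue dF"
      unfolding set_lebesgue_integral_def
      by (intro Bochner_Integration.integral_cong refl) (use dF in \<open>auto simp: indicator_def\<close>)
    also have "\<dots> = integral\<^sup>L lborel dF"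
      by (rule integral_completion) (use borel_measurable_continuous_onI[OF dF(3)] in simp)
    finally show ?thesis using that(1) by simp
  qed
  show "(LINT p:Om|lebesgue. u p * dx \<phi> p) = - (LINT p:Om|lebesgue. dx u p * \<phi> p)"
    by (rule key[OF integral_partials_compact_support(1)[OF K] prod(1) out(1)])
      (auto intro: smooth_on_continuous smooth_on_dx K test_fn_partials t u)
  show "(LINT p:Om|lebesgue. u p * dz \<phi> p) = - (LINT p:Om|lebesgue. dz u p * \<phi> p)"
    by (rule key[OF integral_partials_compact_support(2)[OF K] prod(2) out(2)])
      (auto intro: smooth_on_continuous smooth_on_dz K test_fn_partials t u)
qed

lemma smooth_on_snd: "open U \<Longrightarrow> smooth_on U snd"
  by (simp add: smooth_on_def Ck_on_snd)

text \<open>Test functions vanish near the boundary, so no growth condition at the corner enters;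
  square integrability of these derivatives is a separate matter.\<close>

lemma weak_partials_smooth:
  assumes Om: "open Om" and u: "smooth_on Om u"
  shows "weak_dz Om u (dz u)" "weak_dx Om u (dx u)" "weak_dzz Om u (dz (dz u))"
    "weak_zdx Om u (\<lambda>p. snd p * dx u p)"
    "weak_eq Om u (\<lambda>\<phi> p. - (snd p * dx \<phi> p) - dz (dz \<phi>) p) (\<lambda>p. snd p * dx u p - dz (dz u) p)"
proof -
  note ux = smooth_on_dx[OF u] and uz = smooth_on_dz[OF u] and uzz = smooth_on_dz[OF smooth_on_dz[OF u]]
  have neg: "set_integrable lebesgue Om (\<lambda>p. u p * - g p)" "(LINT p:Om|lebesgue. u p * - g p) = - (LINT p:Om|lebesgue. u p * g p)"
    if "set_integrable lebesgue Om (\<lambda>p. u p * g p)" for g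
    using that by (simp_all add: set_integrable_def set_lebesgue_integral_def)
  show "weak_dz Om u (dz u)" "weak_dx Om u (dx u)"
    unfolding weak_dz_def weak_dx_def weak_eq_def
    using neg set_integrable_test_fn[OF Om] test_fn_partials integration_by_parts_test_fn[OF Om u] u ux uz by auto
  show dzz: "weak_dzz Om u (dz (dz u))"
    unfolding weak_dzz_def weak_eq_def
    using set_integrable_test_fn[OF Om] test_fn_partials integration_by_parts_test_fn(2)[OF Om u]
      integration_by_parts_test_fn(2)[OF Om uz] u uzz by auto
  show zdx: "weak_zdx Om u (\<lambda>p. snd p * dx u p)"
    unfolding weak_zdx_def weak_eq_def
  proof (intro allI impI)
    fix \<phi> assume t: "test_fn Om \<phi>"
    have zu: "smooth_on Om (\<lambda>p. u p * snd p)" by (intro smooth_on_mult u smooth_on_snd Om)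
    have zux: "smooth_on Om (\<lambda>p. snd p * dx u p)" by (intro smooth_on_mult ux smooth_on_snd Om)
    have e: "dx (\<lambda>p. u p * snd p) p = snd p * dx u p" if p: "p \<in> Om" for p
      using DERIV_imp_deriv[OF DERIV_cmult_right[OF smooth_on_has_partials(1)[OF u p], of "snd p"]]
      by (simp add: dx_def mult.commute)
    have i: "set_integrable lebesgue Om (\<lambda>p. u p * (snd p * dx \<phi> p))"
      using set_integrable_test_fn[OF Om zu test_fn_partials(1)[OF t]] by (simp add: mult.assoc)
    have "(LINT p:Om|lebesgue. u p * (snd p * dx \<phi> p)) = - (LINT p:Om|lebesgue. dx (\<lambda>p. u p * snd p) p * \<phi> p)"
      using integration_by_parts_test_fn(1)[OF Om zu t] by (simp add: mult.assoc)
    also have "(LINT p:Om|lebesgue. dx (\<lambda>p. u p * snd p) p * \<phi> p) = (LINT p:Om|lebesgue. snd p * dx u p * \<phi> p)"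
      unfolding set_lebesgue_integral_def by (intro Bochner_Integration.integral_cong refl) (auto simp: e indicator_def)
    finally show "set_integrable lebesgue Om (\<lambda>p. u p * - (snd p * dx \<phi> p)) \<and> set_integrable lebesgue Om (\<lambda>p. snd p * dx u p * \<phi> p) \<and>
      (LINT p:Om|lebesgue. u p * - (snd p * dx \<phi> p)) = (LINT p:Om|lebesgue. snd p * dx u p * \<phi> p)"
      using neg[OF i] set_integrable_test_fn[OF Om zux t] by simp
  qed
  show "weak_eq Om u (\<lambda>\<phi> p. - (snd p * dx \<phi> p) - dz (dz \<phi>) p) (\<lambda>p. snd p * dx u p - dz (dz u) p)"
    unfolding weak_eq_def
  proof (intro allI impI)
    fix \<phi> assume t: "test_fn Om \<phi>"
    have 1: "set_integrable lebesgue Om (\<lambda>p. u p * - (snd p * dx \<phi> p))" "set_integrable lebesgue Om (\<lambda>p. snd p * dx u p * \<phi> p)"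
      "(LINT p:Om|lebesgue. u p * - (snd p * dx \<phi> p)) = (LINT p:Om|lebesgue. snd p * dx u p * \<phi> p)"
      using zdx t unfolding weak_zdx_def weak_eq_def by blast+
    have 2: "set_integrable lebesgue Om (\<lambda>p. u p * dz (dz \<phi>) p)" "set_integrable lebesgue Om (\<lambda>p. dz (dz u) p * \<phi> p)"
      "(LINT p:Om|lebesgue. u p * dz (dz \<phi>) p) = (LINT p:Om|lebesgue. dz (dz u) p * \<phi> p)"
      using dzz t unfolding weak_dzz_def weak_eq_def by blast+
    show "set_integrable lebesgue Om (\<lambda>p. u p * (- (snd p * dx \<phi> p) - dz (dz \<phi>) p)) \<and>
       set_integrable lebesgue Om (\<lambda>p. (snd p * dx u p - dz (dz u) p) * \<phi> p) \<and>
       (LINT p:Om|lebesgue. u p * (- (snd p * dx \<phi> p) - dz (dz \<phi>) p)) = (LINT p:Om|lebesgue. (snd p * dx u p - dz (dz u) p) * \<phi> p)"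
      unfolding right_diff_distrib left_diff_distrib
      using set_integral_diff[OF 1(1) 2(1)] set_integral_diff[OF 1(2) 2(2)] 1(3) 2(3) by simp
  qed
qed

section \<open>One-dimensional test functions and the fundamental lemma\<close>

definition tf1 :: "real \<Rightarrow> real \<Rightarrow> (real \<Rightarrow> real) \<Rightarrow> bool" where
  "tf1 a b \<phi> \<longleftrightarrow> (\<forall>n. Cn_on n UNIV \<phi>) \<and> (\<exists>c d. a < c \<and> d < b \<and> (\<forall>x. x \<notin> {c..d} \<longrightarrow> \<phi> x = 0))"

lemma tf1_continuous: "tf1 a b \<phi> \<Longrightarrow> continuous_on UNIV \<phi>"
  using Cn_on.simps(1)[of UNIV \<phi>] unfolding tf1_def by blast

lemma tf1_outside: "tf1 a b \<phi> \<Longrightarrow> x \<notin> {a<..<b} \<Longrightarrow> \<phi> x = 0"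
  unfolding tf1_def by force

lemma test_fn_tensor:
  assumes a: "tf1 x0 x1 \<alpha>" and b: "tf1 (-1) 1 \<beta>"
  shows "test_fn (Omega x0 x1) (\<lambda>p. \<alpha> (fst p) * \<beta> (snd p))"
proof -
  obtain c d where cd: "x0 < c" "d < x1" "\<And>x. x \<notin> {c..d} \<Longrightarrow> \<alpha> x = 0" using a unfolding tf1_def by blast
  obtain e f where ef: "-1 < e" "f < 1" "\<And>x. x \<notin> {e..f} \<Longrightarrow> \<beta> x = 0" using b unfolding tf1_def by blast
  have "Ck_on k UNIV (\<lambda>p. \<alpha> (fst p) * \<beta> (snd p))" for k
    using a b unfolding tf1_def
    by (intro Ck_on_mult Ck_on_compose1[of UNIV k fst UNIV \<alpha>] Ck_on_compose1[of UNIV k snd UNIV \<beta>] Ck_on_fst Ck_on_snd) auto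
  moreover have "compact ({c..d} \<times> {e..f})" by (intro compact_Times compact_Icc)
  moreover have "{c..d} \<times> {e..f} \<subseteq> Omega x0 x1" using cd ef by (auto simp: Omega_def)
  moreover have "\<alpha> (fst p) * \<beta> (snd p) = 0" if "p \<notin> {c..d} \<times> {e..f}" for p
    using that cd(3)[of "fst p"] ef(3)[of "snd p"] by (cases p) auto
  ultimately show ?thesis unfolding test_fn_def smooth_on_def by blast
qed

text \<open>A smooth approximation of the indicator of (a, b) from below: the factors tend to 1 on
  the interval, and the shift by -1 keeps the support at distance 1/n from the endpoints.\<close>

definition bump :: "real \<Rightarrow> real \<Rightarrow> nat \<Rightarrow> real \<Rightarrow> real" where
  "bump a b n x = flat 0 (real n * (x - a) - 1) * flat 0 (real n * (b - x) - 1)"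

lemma tf1_bump:
  assumes "a \<le> p" "q \<le> b" shows "tf1 a b (bump p q (Suc n))"
proof -
  have "Cn_on k UNIV (bump p q (Suc n))" for k
    unfolding bump_def
    by (intro Cn_on_mult Cn_on_compose[OF _ Cn_on_flat] Cn_on_diff Cn_on_const Cn_on_id) auto
  moreover have "bump p q (Suc n) x = 0" if "x \<notin> {p + 1 / Suc n..q - 1 / Suc n}" for x
  proof -
    have "x < p + 1 / Suc n \<or> q - 1 / Suc n < x" using that by auto
    then show ?thesis
    proof
      assume "x < p + 1 / Suc n"
      then have "real (Suc n) * (x - p) - 1 \<le> 0" by (simp add: field_simps)
      then show ?thesis by (simp add: bump_def flat_def)
    next
      assume "q - 1 / Suc n < x"
      then have "real (Suc n) * (q - x) - 1 \<le> 0" by (simp add: field_simps)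
      then show ?thesis by (simp add: bump_def flat_def)
    qed
  qed
  moreover have "a < p + 1 / Suc n" "q - 1 / Suc n < b"
    using assms divide_pos_pos[of 1 "real (Suc n)"] by linarith+
  ultimately show ?thesis unfolding tf1_def by blast
qed

lemma flat_0_le_1: "flat 0 x \<le> 1"
  using flat_bound[of 0 x 0] by simp

lemma bump_bounds: "0 \<le> bump a b n x" "bump a b n x \<le> 1"
  unfolding bump_def by (auto intro!: mult_nonneg_nonneg flat_nonneg mult_le_one flat_0_le_1)

lemma bump_tendsto: "(\<lambda>n. bump a b (Suc n) x) \<longlonglongrightarrow> indicator {a<..<b} x"
proof -
  have lim: "(\<lambda>n. flat 0 (real (Suc n) * y - 1)) \<longlonglongrightarrow> (if y > 0 then 1 else 0)" for y :: real
  proof (cases "y > 0")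
    case True
    have "filterlim (\<lambda>n. real (Suc n) * y) at_top sequentially"
      using True by (intro filterlim_at_top_mult_tendsto_pos[OF tendsto_const] filterlim_compose[OF filterlim_real_sequentially filterlim_Suc]) auto
    then have "filterlim (\<lambda>n. real (Suc n) * y - 1) at_top sequentially"
      using filterlim_tendsto_add_at_top[OF tendsto_const[of "-1::real"]] by (simp add: add.commute)
    then have l: "filterlim (\<lambda>n. real (Suc n) * y - 1) at_top sequentially" .
    have "(\<lambda>n. exp (- inverse (real (Suc n) * y - 1))) \<longlonglongrightarrow> exp (- 0)"
      by (intro tendsto_intros tendsto_inverse_0_at_top l)
    moreover have "\<forall>\<^sub>F n in sequentially. exp (- inverse (real (Suc n) * y - 1)) = flat 0 (real (Suc n) * y - 1)"
      using l[unfolded filterlim_at_top_dense, rule_format, of 0]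
      by eventually_elim (simp add: flat_def inverse_eq_divide)
    ultimately show ?thesis using True by (simp add: Lim_transform_eventually)
  next
    case False
    have "real (Suc n) * y - 1 \<le> 0" for n
      using False mult_nonneg_nonpos[of "real (Suc n)" y] by linarith
    then have "flat 0 (real (Suc n) * y - 1) = 0" for n by (simp add: flat_def not_less)
    then show ?thesis using False by simp
  qed
  have "(\<lambda>n. bump a b (Suc n) x) \<longlonglongrightarrow> (if x - a > 0 then 1 else 0) * (if b - x > 0 then 1 else 0)"
    unfolding bump_def by (intro tendsto_mult lim)
  then show ?thesis by (auto simp: indicator_def split: if_splits)
qed

text \<open>Boxes form an intersection-stable generator of the Borel sets; the total integral is
  assumed separately to pass to complements.\<close>

lemma AE_zero_if_box_integrals_zero:
  fixes F :: "'a::euclidean_space \<Rightarrow> real"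
  assumes F: "integrable lborel F"
    and box: "\<And>a b. (LINT p:box a b|lborel. F p) = 0" and tot: "integral\<^sup>L lborel F = 0"
  shows "AE p in lborel. F p = 0"
proof -
  have si: "set_integrable lborel A F" if "A \<in> sets borel" for A
    unfolding set_integrable_def using integrable_mult_indicator[OF _ F, of A] that by simp
  have zero: "(LINT p:A|lborel. F p) = 0" if "A \<in> sets borel" for A
  proof -
    have "Int_stable (range (\<lambda>(a, b). box a b :: 'a set))" by (auto simp: Int_stable_def box_Int_box)
    moreover have "(range (\<lambda>(a, b). box a b :: 'a set)) \<subseteq> Pow UNIV" by auto
    moreover have "A \<in> sigma_sets UNIV (range (\<lambda>(a, b). box a b))" using that unfolding borel_eq_box by simp
    ultimately show ?thesis
    proof (induction rule: sigma_sets_induct_disjoint)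
      case (basic A)
      then show ?case using box by auto
    next
      case empty
      show ?case by (simp add: set_lebesgue_integral_def)
    next
      case (compl A)
      then have A: "A \<in> sets borel" unfolding borel_eq_box by simp
      have "(LINT p:UNIV - A|lborel. F p) + (LINT p:A|lborel. F p) = (LINT p:(UNIV - A) \<union> A|lborel. F p)"
        using A by (intro set_integral_Un[symmetric] si) auto
      also have "\<dots> = 0" using tot by (simp add: set_lebesgue_integral_def)
      finally show ?case using compl by simp
    next
      case (union A)
      then have A: "A i \<in> sets borel" for i unfolding borel_eq_box by auto
      have "(LINT p:(\<Union>i. A i)|lborel. F p) = (\<Sum>i. (LINT p:A i|lborel. F p))"
        using A union(1) by (intro lebesgue_integral_countable_add si) (auto simp: disjoint_family_on_def)
      then show ?case using union by simp
    qed
  qed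
  have nonpos: "AE p in lborel. f p \<le> 0" if f: "integrable lborel f" "\<And>A. A \<in> sets borel \<Longrightarrow> (LINT p:A|lborel. f p) = 0" for f :: "'a \<Rightarrow> real"
  proof -
    have [measurable]: "f \<in> borel_measurable borel" using f(1) by auto
    let ?A = "{p. f p > 0}"
    have A: "?A \<in> sets borel" by measurable
    have "integrable lborel (\<lambda>p. indicator ?A p *\<^sub>R f p)" using integrable_mult_indicator[OF _ f(1), of ?A] A by simp
    moreover have "(\<integral>p. indicator ?A p *\<^sub>R f p \<partial>lborel) = 0" using f(2)[OF A] by (simp add: set_lebesgue_integral_def)
    ultimately have "AE p in lborel. indicator ?A p *\<^sub>R f p = 0"
      by (subst integral_nonneg_eq_0_iff_AE[symmetric]) (auto simp: indicator_def)
    then show ?thesis by eventually_elim (auto simp: indicator_def split: if_splits)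
  qed
  have "AE p in lborel. F p \<le> 0" using nonpos[OF F] zero by blast
  moreover have "AE p in lborel. - F p \<le> 0" using zero F by (intro nonpos) (auto simp: set_lebesgue_integral_def)
  ultimately show ?thesis by eventually_elim auto
qed

lemma measurable_fst_snd_borel [measurable]:
  "(fst :: real \<times> real \<Rightarrow> real) \<in> borel_measurable borel" "(snd :: real \<times> real \<Rightarrow> real) \<in> borel_measurable borel"
  by (intro borel_measurable_continuous_onI continuous_intros)+

text \<open>Tensor products of test functions suffice: products of bumps converge to the indicator
  of any box in the rectangle, and F vanishes outside the rectangle.\<close>

lemma tensor_fundamental_lemma:
  fixes F :: "real \<times> real \<Rightarrow> real"
  assumes F: "integrable lborel F" and out: "\<And>p. p \<notin> {a<..<b} \<times> {c<..<d} \<Longrightarrow> F p = 0"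
    and test: "\<And>\<alpha> \<beta>. tf1 a b \<alpha> \<Longrightarrow> tf1 c d \<beta> \<Longrightarrow> (\<integral>p. F p * (\<alpha> (fst p) * \<beta> (snd p)) \<partial>lborel) = 0"
  shows "AE p in lborel. F p = 0"
proof -
  have [measurable]: "F \<in> borel_measurable borel" using F by auto
  have bump_meas [measurable]: "bump p q n \<in> borel_measurable borel" for p q n
    unfolding bump_def flat_def by measurable
  have box: "(\<integral>p. F p * indicator ({p1<..<q1} \<times> {p2<..<q2}) p \<partial>lborel) = 0"
    if "a \<le> p1" "q1 \<le> b" "c \<le> p2" "q2 \<le> d" for p1 q1 p2 q2
  proof -
    have "(\<lambda>n. \<integral>p. F p * (bump p1 q1 (Suc n) (fst p) * bump p2 q2 (Suc n) (snd p)) \<partial>lborel)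
       \<longlonglongrightarrow> (\<integral>p. F p * indicator ({p1<..<q1} \<times> {p2<..<q2}) p \<partial>lborel)"
    proof (rule integral_dominated_convergence[where w = "\<lambda>p. \<bar>F p\<bar>"])
      show "AE p in lborel. (\<lambda>n. F p * (bump p1 q1 (Suc n) (fst p) * bump p2 q2 (Suc n) (snd p))) \<longlonglongrightarrow> F p * indicator ({p1<..<q1} \<times> {p2<..<q2}) p"
        unfolding indicator_times by (intro AE_I2 tendsto_mult tendsto_const bump_tendsto)
      show "AE p in lborel. norm (F p * (bump p1 q1 (Suc n) (fst p) * bump p2 q2 (Suc n) (snd p))) \<le> \<bar>F p\<bar>" for n
      proof (rule AE_I2)
        fix p
        have "\<bar>bump p1 q1 (Suc n) (fst p) * bump p2 q2 (Suc n) (snd p)\<bar> \<le> 1"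
          using bump_bounds by (simp add: abs_mult mult_le_one)
        then show "norm (F p * (bump p1 q1 (Suc n) (fst p) * bump p2 q2 (Suc n) (snd p))) \<le> \<bar>F p\<bar>"
          unfolding real_norm_def abs_mult[of "F p"] by (rule mult_left_le) simp
      qed
      have "{p1<..<q1} \<times> {p2<..<q2} \<in> sets borel" by (intro borel_open open_Times) auto
      then show "(\<lambda>p. F p * indicator ({p1<..<q1} \<times> {p2<..<q2}) p) \<in> borel_measurable lborel" by measurable
      show "(\<lambda>p. F p * (bump p1 q1 (Suc n) (fst p) * bump p2 q2 (Suc n) (snd p))) \<in> borel_measurable lborel" for n
        by measurable
    qed (use F in auto)
    moreover have "(\<integral>p. F p * (bump p1 q1 (Suc n) (fst p) * bump p2 q2 (Suc n) (snd p)) \<partial>lborel) = 0" for n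
      using that by (intro test tf1_bump)
    ultimately have "(\<lambda>n. 0) \<longlonglongrightarrow> (\<integral>p. F p * indicator ({p1<..<q1} \<times> {p2<..<q2}) p \<partial>lborel)" by simp
    from LIMSEQ_unique[OF this tendsto_const] show ?thesis .
  qed
  show ?thesis
  proof (rule AE_zero_if_box_integrals_zero[OF F])
    fix u v :: "real \<times> real"
    have "(LINT p:box u v|lborel. F p) = (\<integral>p. F p * indicator ({max a (fst u)<..<min b (fst v)} \<times> {max c (snd u)<..<min d (snd v)}) p \<partial>lborel)"
      unfolding set_lebesgue_integral_def
    proof (intro Bochner_Integration.integral_cong refl)
      fix p
      have "p \<in> box u v \<longleftrightarrow> fst p \<in> {fst u<..<fst v} \<and> snd p \<in> {snd u<..<snd v}"
        by (cases u; cases v; cases p) (auto simp: box_def Basis_prod_def)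
      then show "indicator (box u v) p *\<^sub>R F p = F p * indicator ({max a (fst u)<..<min b (fst v)} \<times> {max c (snd u)<..<min d (snd v)}) p"
        using out[of p] by (cases p) (auto simp: indicator_def)
    qed
    then show "(LINT p:box u v|lborel. F p) = 0" using box by simp
  next
    have "integral\<^sup>L lborel F = (\<integral>p. F p * indicator ({a<..<b} \<times> {c<..<d}) p \<partial>lborel)"
      by (intro Bochner_Integration.integral_cong refl) (use out in \<open>auto simp: indicator_def\<close>)
    then show "integral\<^sup>L lborel F = 0" using box[of a b c d] by simp
  qed
qed

text \<open>Fubini: the product of the two integrals splits along the diagonal.\<close>

lemma indefinite_integral_by_parts:
  fixes f g :: "real \<Rightarrow> real"
  assumes f: "integrable lborel f" and g: "integrable lborel g"
  shows "(\<integral>z. f z * (\<integral>y. (if y \<le> z then g y else 0) \<partial>lborel) \<partial>lborel) + (\<integral>y. g y * (\<integral>z. (if z \<le> y then f z else 0) \<partial>lborel) \<partial>lborel)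
     = integral\<^sup>L lborel f * integral\<^sup>L lborel g"
    and "integrable lborel (\<lambda>z. f z * (\<integral>y. (if y \<le> z then g y else 0) \<partial>lborel))"
proof -
  have [measurable]: "f \<in> borel_measurable borel" "g \<in> borel_measurable borel" using f g by auto
  define H where "H p = f (fst p) * g (snd p)" for p :: "real \<times> real"
  have H: "integrable (lborel \<Otimes>\<^sub>M lborel) H"
  proof (rule lborel_pair.Fubini_integrable)
    show "H \<in> borel_measurable (lborel \<Otimes>\<^sub>M lborel)" unfolding H_def by measurable
    have "(\<lambda>x. \<integral>y. norm (H (x, y)) \<partial>lborel) = (\<lambda>x. \<bar>f x\<bar> * (\<integral>y. \<bar>g y\<bar> \<partial>lborel))"
      by (simp add: H_def abs_mult)
    then show "integrable lborel (\<lambda>x. \<integral>y. norm (H (x, y)) \<partial>lborel)" using f by simp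
    show "AE x in lborel. integrable lborel (\<lambda>y. H (x, y))" unfolding H_def using g by simp
  qed
  have m1: "(\<lambda>p. if snd p \<le> fst p then H p else 0) \<in> borel_measurable (lborel \<Otimes>\<^sub>M lborel)"
    "(\<lambda>p. if snd p \<le> fst p then 0 else H p) \<in> borel_measurable (lborel \<Otimes>\<^sub>M lborel)"
    unfolding H_def by measurable
  have H1: "integrable (lborel \<Otimes>\<^sub>M lborel) (\<lambda>p. if snd p \<le> fst p then H p else 0)"
    by (rule Bochner_Integration.integrable_bound[OF H m1(1)]) auto
  have H2: "integrable (lborel \<Otimes>\<^sub>M lborel) (\<lambda>p. if snd p \<le> fst p then 0 else H p)"
    by (rule Bochner_Integration.integrable_bound[OF H m1(2)]) auto
  have e1: "(\<integral>y. (if y \<le> z then H (z, y) else 0) \<partial>lborel) = f z * (\<integral>y. (if y \<le> z then g y else 0) \<partial>lborel)" for z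
  proof -
    have "(if y \<le> z then H (z, y) else 0) = f z * (if y \<le> z then g y else 0)" for y by (simp add: H_def)
    then show ?thesis by (simp only: integral_mult_right_zero)
  qed
  have e2: "(\<integral>z. (if y \<le> z then 0 else H (z, y)) \<partial>lborel) = g y * (\<integral>z. (if z \<le> y then f z else 0) \<partial>lborel)" for y
  proof -
    \<comment> \<open>The two conditions differ only on the diagonal z = y, a null set on each
      slice.\<close>
    have "(\<integral>z. (if y \<le> z then 0 else H (z, y)) \<partial>lborel) = (\<integral>z. g y * (if z \<le> y then f z else 0) \<partial>lborel)"
    proof (rule integral_cong_AE)
      show "AE z in lborel. (if y \<le> z then 0 else H (z, y)) = g y * (if z \<le> y then f z else 0)"
        using AE_lborel_singleton[of y] by eventually_elim (auto simp: H_def)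
    qed (unfold H_def, measurable)
    then show ?thesis by (simp only: integral_mult_right_zero)
  qed
  show "integrable lborel (\<lambda>z. f z * (\<integral>y. (if y \<le> z then g y else 0) \<partial>lborel))"
    using lborel_pair.integrable_fst'[OF H1] by (simp add: e1)
  have "integral\<^sup>L lborel f * integral\<^sup>L lborel g = integral\<^sup>L (lborel \<Otimes>\<^sub>M lborel) H"
    using lborel_pair.integral_fst'[OF H] by (simp add: H_def)
  also have "\<dots> = (\<integral>p. (if snd p \<le> fst p then H p else 0) + (if snd p \<le> fst p then 0 else H p) \<partial>(lborel \<Otimes>\<^sub>M lborel))"
    by (intro Bochner_Integration.integral_cong) auto
  also have "\<dots> = (\<integral>p. (if snd p \<le> fst p then H p else 0) \<partial>(lborel \<Otimes>\<^sub>M lborel)) + (\<integral>p. (if snd p \<le> fst p then 0 else H p) \<partial>(lborel \<Otimes>\<^sub>M lborel))"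
    by (rule Bochner_Integration.integral_add[OF H1 H2])
  also have "(\<integral>p. (if snd p \<le> fst p then H p else 0) \<partial>(lborel \<Otimes>\<^sub>M lborel)) = (\<integral>z. f z * (\<integral>y. (if y \<le> z then g y else 0) \<partial>lborel) \<partial>lborel)"
    using lborel_pair.integral_fst'[OF H1] by (simp add: e1)
  also have "(\<integral>p. (if snd p \<le> fst p then 0 else H p) \<partial>(lborel \<Otimes>\<^sub>M lborel)) = (\<integral>y. g y * (\<integral>z. (if z \<le> y then f z else 0) \<partial>lborel) \<partial>lborel)"
    using lborel_pair.integral_snd[of "\<lambda>z y. if y \<le> z then 0 else H (z, y)"] H2 by (simp add: e2 case_prod_unfold cong: if_cong)
  finally show "(\<integral>z. f z * (\<integral>y. (if y \<le> z then g y else 0) \<partial>lborel) \<partial>lborel) + (\<integral>y. g y * (\<integral>z. (if z \<le> y then f z else 0) \<partial>lborel) \<partial>lborel)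
     = integral\<^sup>L lborel f * integral\<^sup>L lborel g" by simp
qed

lemma tf1_integrable: "tf1 a b \<phi> \<Longrightarrow> integrable lborel \<phi>"
proof -
  assume t: "tf1 a b \<phi>"
  then obtain c d where "\<And>x. x \<notin> {c..d} \<Longrightarrow> \<phi> x = 0" unfolding tf1_def by blast
  then show ?thesis using integrable_compact_support[OF tf1_continuous[OF t], of "{c..d}"] by auto
qed

lemma tf1_bounded: "tf1 a b \<phi> \<Longrightarrow> \<exists>C. \<forall>x. \<bar>\<phi> x\<bar> \<le> C"
proof -
  assume t: "tf1 a b \<phi>"
  obtain c d where cd: "\<And>x. x \<notin> {c..d} \<Longrightarrow> \<phi> x = 0" using t unfolding tf1_def by blast
  obtain C where C: "\<And>x. x \<in> {c..d} \<Longrightarrow> \<bar>\<phi> x\<bar> \<le> C"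
    using continuous_bounded_Icc[OF tf1_continuous[OF t], of c d] by blast
  have "\<bar>\<phi> x\<bar> \<le> max C 0" for x
  proof (cases "x \<in> {c..d}")
    case True then show ?thesis using C[of x] by simp
  next
    case False then show ?thesis using cd[of x] by simp
  qed
  then show ?thesis by blast
qed

lemma tf1_integral_of_deriv:
  assumes b: "tf1 c d \<beta>" and b': "tf1 c d \<beta>'" and der: "\<And>x. (\<beta> has_real_derivative \<beta>' x) (at x)"
  shows "(\<integral>y. (if y \<le> z then \<beta>' y else 0) \<partial>lborel) = \<beta> z"
proof -
  define m where "m = min c z - 1"
  have "(\<integral>y. (if y \<le> z then \<beta>' y else 0) \<partial>lborel) = (\<integral>y. indicator {m..z} y *\<^sub>R \<beta>' y \<partial>lborel)"
  proof (intro Bochner_Integration.integral_cong refl)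
    fix y
    have "\<beta>' y = 0" if "y < m" by (rule tf1_outside[OF b']) (use that in \<open>auto simp: m_def\<close>)
    then show "(if y \<le> z then \<beta>' y else 0) = indicator {m..z} y *\<^sub>R \<beta>' y"
      by (cases "y < m") (auto simp: indicator_def)
  qed
  also have "\<dots> = \<beta> z - \<beta> m"
  proof (rule integral_FTC_atLeastAtMost)
    show "(\<beta> has_vector_derivative \<beta>' x) (at x within {m..z})" for x
      using der[of x] by (simp add: has_real_derivative_iff_has_vector_derivative has_vector_derivative_at_within)
    show "continuous_on {m..z} \<beta>'" using tf1_continuous[OF b'] continuous_on_subset by blast
  qed (simp add: m_def)
  also have "\<beta> m = 0" by (rule tf1_outside[OF b]) (auto simp: m_def min_def)
  finally show ?thesis by simp
qed

text \<open>The primitive of a test function is constant beyond the support; zero mean makes this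
  constant 0, so the primitive is again a test function.\<close>

lemma tf1_antiderivative:
  assumes t: "tf1 c d \<psi>" and zero: "integral\<^sup>L lborel \<psi> = 0"
  defines "\<beta> \<equiv> \<lambda>z. \<integral>y. (if y \<le> z then \<psi> y else 0) \<partial>lborel"
  shows "tf1 c d \<beta>" "\<And>x. (\<beta> has_real_derivative \<psi> x) (at x)"
proof -
  obtain e f where ef: "c < e" "f < d" "\<And>x. x \<notin> {e..f} \<Longrightarrow> \<psi> x = 0" using t unfolding tf1_def by blast
  have cont: "continuous_on UNIV \<psi>" using t by (rule tf1_continuous)
  have b0: "\<beta> z = 0" if "z < e" for z
  proof -
    have "(\<lambda>y. if y \<le> z then \<psi> y else 0) = (\<lambda>y. 0)" using that ef(3) by fastforce
    then show ?thesis by (simp add: \<beta>_def)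
  qed
  have b1: "\<beta> z = 0" if "z > f" for z
  proof -
    have "(\<lambda>y. if y \<le> z then \<psi> y else 0) = \<psi>" using that ef(3) by fastforce
    then show ?thesis by (simp add: \<beta>_def zero)
  qed
  have bi: "\<beta> z = integral {e - 1..z} \<psi>" for z
  proof -
    have si: "set_integrable lborel {e - 1..z} \<psi>"
      by (rule borel_integrable_atLeastAtMost') (rule continuous_on_subset[OF cont], simp)
    have "\<beta> z = (LINT y:{e - 1..z}|lborel. \<psi> y)"
      unfolding \<beta>_def set_lebesgue_integral_def
      by (intro Bochner_Integration.integral_cong refl) (use ef(3) in \<open>auto simp: indicator_def\<close>)
    then show ?thesis using set_borel_integral_eq_integral(2)[OF si] by simp
  qed
  show der: "(\<beta> has_real_derivative \<psi> x) (at x)" for x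
  proof (cases "x < e")
    case True
    have "((\<lambda>x. 0) has_real_derivative \<psi> x) (at x)" using ef(3)[of x] True by simp
    then show ?thesis
      by (rule has_field_derivative_transform_within_open[of _ _ _ "{..<e}"]) (use True b0 in auto)
  next
    case False
    have "((\<lambda>z. integral {e - 1..z} \<psi>) has_real_derivative \<psi> x) (at x within {e - 1..x + 1})"
      by (rule integral_has_real_derivative[OF continuous_on_subset[OF cont]]) (use False in auto)
    then have "(\<beta> has_real_derivative \<psi> x) (at x within {e - 1..x + 1})" unfolding ext[of \<beta> "\<lambda>z. integral {e - 1..z} \<psi>", OF bi] .
    moreover have "at x within {e - 1..x + 1} = at x" by (rule at_within_interior) (use False in auto)
    ultimately show ?thesis by simp
  qed
  have "Cn_on n UNIV \<beta>" for n
  proof (cases n)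
    case 0
    then show ?thesis using der by (auto intro!: continuous_at_imp_continuous_on DERIV_isCont)
  next
    case (Suc m)
    then show ?thesis using der t by (auto intro!: Cn_on_derivI[of UNIV \<beta> \<psi>] simp: tf1_def simp del: Cn_on.simps)
  qed
  moreover have "\<beta> x = 0" if "x \<notin> {e..f}" for x using that b0[of x] b1[of x] by force
  ultimately show "tf1 c d \<beta>" unfolding tf1_def using ef by blast
qed

lemma tf1_unit_integral:
  assumes "c < d" obtains \<rho> where "tf1 c d \<rho>" "integral\<^sup>L lborel \<rho> = 1"
proof -
  have [measurable]: "bump p q n \<in> borel_measurable borel" for p q n
    unfolding bump_def flat_def by measurable
  have "(\<lambda>n. integral\<^sup>L lborel (bump c d (Suc n))) \<longlonglongrightarrow> (\<integral>x. indicator {c<..<d} x \<partial>lborel)"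
  proof (rule integral_dominated_convergence[where w = "indicator {c<..<d}"])
    show "AE x in lborel. (\<lambda>n. bump c d (Suc n) x) \<longlonglongrightarrow> indicator {c<..<d} x" by (intro AE_I2 bump_tendsto)
    show "AE x in lborel. norm (bump c d (Suc n) x) \<le> indicator {c<..<d} x" for n
    proof (rule AE_I2)
      fix x show "norm (bump c d (Suc n) x) \<le> indicator {c<..<d} x"
        using bump_bounds[of c d "Suc n" x] tf1_outside[OF tf1_bump[of c c d d n], of x]
        by (cases "x \<in> {c<..<d}") auto
    qed
    show "integrable lborel (indicator {c<..<d} :: real \<Rightarrow> real)" using assms by (intro integrable_real_indicator) auto
  qed auto
  moreover have "(\<integral>x. indicator {c<..<d} x \<partial>lborel) > (0::real)" using assms by simp
  ultimately have "\<forall>\<^sub>F n in sequentially. integral\<^sup>L lborel (bump c d (Suc n)) > 0" by (rule order_tendstoD(1))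
  then obtain n where n: "integral\<^sup>L lborel (bump c d (Suc n)) > 0" by (auto simp: eventually_sequentially)
  let ?I = "integral\<^sup>L lborel (bump c d (Suc n))"
  have b: "tf1 c d (bump c d (Suc n))" by (rule tf1_bump) auto
  define k where "k = 1 / ?I"
  have "Cn_on m UNIV (\<lambda>x. k * bump c d (Suc n) x)" for m
    using b unfolding tf1_def by (intro Cn_on_mult Cn_on_const) blast
  then have "tf1 c d (\<lambda>x. k * bump c d (Suc n) x)" using b unfolding tf1_def by fastforce
  moreover have "(\<integral>x. k * bump c d (Suc n) x \<partial>lborel) = 1" using n by (simp add: k_def)
  ultimately show ?thesis by (rule that)
qed

lemma integrable_tensor_bound:
  fixes F :: "real \<times> real \<Rightarrow> real"
  assumes [measurable]: "F \<in> borel_measurable borel" and N: "integrable lborel N" and k: "integrable lborel k"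
    and bound: "AE x in lborel. \<forall>z. \<bar>F (x, z)\<bar> \<le> N x * k z"
  shows "integrable lborel F"
proof -
  have [measurable]: "N \<in> borel_measurable borel" "k \<in> borel_measurable borel" using N k by auto
  have m: "F \<in> borel_measurable (lborel \<Otimes>\<^sub>M lborel)" by (simp add: lborel_prod)
  have ae: "AE x in lborel. integrable lborel (\<lambda>z. F (x, z))"
    using bound
  proof eventually_elim
    case (elim x)
    have "integrable lborel (\<lambda>z. N x * k z)" using k by simp
    then show ?case by (rule Bochner_Integration.integrable_bound) (use elim in \<open>auto intro: order_trans abs_ge_self\<close>)
  qed
  have "integrable (lborel \<Otimes>\<^sub>M lborel) F"
  proof (rule lborel_pair.Fubini_integrable[OF m _ ae])
    have "integrable lborel (\<lambda>x. N x * integral\<^sup>L lborel k)" using N by simp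
    then show "integrable lborel (\<lambda>x. \<integral>z. norm (F (x, z)) \<partial>lborel)"
    proof (rule Bochner_Integration.integrable_bound)
      show "(\<lambda>x. \<integral>z. norm (F (x, z)) \<partial>lborel) \<in> borel_measurable lborel"
        using m by measurable
      show "AE x in lborel. norm (\<integral>z. norm (F (x, z)) \<partial>lborel) \<le> norm (N x * integral\<^sup>L lborel k)"
        using bound ae
      proof eventually_elim
        case (elim x)
        have "(\<integral>z. norm (F (x, z)) \<partial>lborel) \<le> (\<integral>z. N x * k z \<partial>lborel)"
          using elim k by (intro integral_mono) auto
        then show ?case by simp
      qed
    qed
  qed
  then show ?thesis by (simp add: lborel_prod)
qed

subsection \<open>Weak derivatives and traces on slices\<close>

lemma integral_iterated:
  fixes h :: "real \<times> real \<Rightarrow> real"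
  assumes "integrable lborel h"
  shows "integral\<^sup>L lborel h = (\<integral>x. (\<integral>z. h (x, z) \<partial>lborel) \<partial>lborel)"
    and "integrable lborel (\<lambda>x. \<integral>z. h (x, z) \<partial>lborel)"
    and "AE x in lborel. integrable lborel (\<lambda>z. h (x, z))"
  using lborel_pair.integral_fst'[of h] lborel_pair.integrable_fst'[of h] lborel_pair.AE_integrable_fst'[of h] assms
  by (simp_all add: lborel_prod)

lemma AE_slices:
  fixes Q :: "real \<times> real \<Rightarrow> bool"
  assumes "AE p in lborel. Q p" shows "AE x in lborel. AE z in lborel. Q (x, z)"
  by (rule lborel_pair.AE_pair) (use assms in \<open>simp only: lborel_prod\<close>)

lemma integrable_mult_tensor:
  fixes F :: "real \<times> real \<Rightarrow> real"
  assumes F: "integrable lborel F" and a: "tf1 a b \<alpha>" and b: "tf1 c d \<beta>"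
  shows "integrable lborel (\<lambda>p. F p * (\<alpha> (fst p) * \<beta> (snd p)))"
proof -
  have [measurable]: "\<alpha> \<in> borel_measurable borel" "\<beta> \<in> borel_measurable borel" "F \<in> borel_measurable borel"
    using tf1_continuous[OF a] tf1_continuous[OF b] F borel_measurable_continuous_onI by auto
  obtain A where A: "\<And>x. \<bar>\<alpha> x\<bar> \<le> A" using tf1_bounded[OF a] by blast
  obtain B where B: "\<And>x. \<bar>\<beta> x\<bar> \<le> B" using tf1_bounded[OF b] by blast
  have "integrable lborel (\<lambda>p. (A * B) * F p)" using F by simp
  then show ?thesis
  proof (rule Bochner_Integration.integrable_bound)
    show "AE p in lborel. norm (F p * (\<alpha> (fst p) * \<beta> (snd p))) \<le> norm ((A * B) * F p)"
    proof (rule AE_I2)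
      fix p
      have "\<bar>\<alpha> (fst p)\<bar> * \<bar>\<beta> (snd p)\<bar> \<le> A * B" using A[of "fst p"] B[of "snd p"] by (intro mult_mono) auto
      then have "\<bar>F p\<bar> * (\<bar>\<alpha> (fst p)\<bar> * \<bar>\<beta> (snd p)\<bar>) \<le> \<bar>F p\<bar> * \<bar>A * B\<bar>" by (intro mult_left_mono) auto
      then show "norm (F p * (\<alpha> (fst p) * \<beta> (snd p))) \<le> norm ((A * B) * F p)" by (simp add: abs_mult mult_ac)
    qed
  qed measurable
qed

text \<open>The lemma of du Bois-Reymond with a parameter: F minus the indefinite integral of g is
  orthogonal to every product of \<alpha> with a derivative \<beta>', hence depends on the first
  variable only. Tensor test functions handle all slices at once and leave a single exceptional null
  set.\<close>

lemma weak_deriv_slices: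
  fixes F g :: "real \<times> real \<Rightarrow> real"
  assumes cd: "c < d" and F: "integrable lborel F" and g: "integrable lborel g"
    and outF: "\<And>p. p \<notin> {a<..<b} \<times> {c<..<d} \<Longrightarrow> F p = 0"
    and weak: "\<And>\<alpha> \<beta> \<beta>'. tf1 a b \<alpha> \<Longrightarrow> tf1 c d \<beta> \<Longrightarrow> tf1 c d \<beta>' \<Longrightarrow> (\<And>x. (\<beta> has_real_derivative \<beta>' x) (at x)) \<Longrightarrow>
      (\<integral>p. F p * (\<alpha> (fst p) * \<beta>' (snd p)) \<partial>lborel) = - (\<integral>p. g p * (\<alpha> (fst p) * \<beta> (snd p)) \<partial>lborel)"
  shows "AE x in lborel. integrable lborel (\<lambda>z. g (x, z)) \<and> (x \<in> {a<..<b} \<longrightarrow>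
     (\<exists>k. AE z in lborel. z \<in> {c<..<d} \<longrightarrow> F (x, z) = k + (\<integral>y. (if y \<le> z then g (x, y) else 0) \<partial>lborel)))"
proof -
  define R where "R = {a<..<b} \<times> {c<..<d}"
  have [measurable]: "R \<in> sets borel" unfolding R_def by (intro borel_open open_Times) auto
  have [measurable]: "F \<in> borel_measurable borel" "g \<in> borel_measurable borel" using F g by auto
  have [measurable]: "g \<in> borel_measurable (borel \<Otimes>\<^sub>M borel)" by (simp add: borel_prod)
  define \<Gamma> where "\<Gamma> p = (\<integral>y. (if y \<le> snd p then g (fst p, y) else 0) \<partial>lborel)" for p
  have \<Gamma>_pair: "\<Gamma> (x, z) = (\<integral>y. (if y \<le> z then g (x, y) else 0) \<partial>lborel)" for x z
    by (simp only: \<Gamma>_def fst_conv snd_conv)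
  define N where "N x = (\<integral>y. \<bar>g (x, y)\<bar> \<partial>lborel)" for x
  have \<Gamma>_meas [measurable]: "\<Gamma> \<in> borel_measurable borel"
    unfolding \<Gamma>_def by (intro lborel.borel_measurable_lebesgue_integral) measurable
  have N: "integrable lborel N" unfolding N_def using integral_iterated(2)[of "\<lambda>p. \<bar>g p\<bar>"] g by simp
  have gx: "AE x in lborel. integrable lborel (\<lambda>z. g (x, z))" by (rule integral_iterated(3)[OF g])
  have \<Gamma>_bound: "AE x in lborel. \<forall>z. \<bar>\<Gamma> (x, z)\<bar> \<le> N x"
    using gx
  proof eventually_elim
    case (elim x)
    show ?case
    proof
      fix z
      have i: "integrable lborel (\<lambda>y. if y \<le> z then g (x, y) else 0)"
      proof -
        have "(\<lambda>y. indicator {..z} y *\<^sub>R g (x, y)) = (\<lambda>y. if y \<le> z then g (x, y) else 0)" by (auto simp: indicator_def)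
        then show ?thesis using integrable_mult_indicator[OF _ elim, of "{..z}"] by simp
      qed
      have "\<bar>\<Gamma> (x, z)\<bar> \<le> (\<integral>y. \<bar>if y \<le> z then g (x, y) else 0\<bar> \<partial>lborel)"
        unfolding \<Gamma>_def fst_conv snd_conv by (rule integral_abs_bound)
      also have "\<dots> \<le> N x" unfolding N_def using i elim by (intro integral_mono) auto
      finally show "\<bar>\<Gamma> (x, z)\<bar> \<le> N x" .
    qed
  qed
  have ind: "integrable lborel (indicator {c<..<d} :: real \<Rightarrow> real)" by (cases "c \<le> d") (auto intro!: integrable_real_indicator)
  \<comment> \<open>Cut off to the rectangle, since the indefinite integral does not decay beyond it
    and need not be integrable over the plane.\<close>
  define \<Gamma>R where "\<Gamma>R p = (if p \<in> R then \<Gamma> p else 0)" for p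
  have \<Gamma>R_meas [measurable]: "\<Gamma>R \<in> borel_measurable borel" unfolding \<Gamma>R_def by measurable
  have \<Gamma>R: "integrable lborel \<Gamma>R"
  proof (rule integrable_tensor_bound[OF \<Gamma>R_meas N ind])
    show "AE x in lborel. \<forall>z. \<bar>\<Gamma>R (x, z)\<bar> \<le> N x * indicator {c<..<d} z"
      using \<Gamma>_bound
    proof eventually_elim
      case (elim x)
      have "N x \<ge> 0" unfolding N_def by simp
      then show ?case using elim by (auto simp: \<Gamma>R_def R_def indicator_def)
    qed
  qed
  define V where "V p = F p - \<Gamma>R p" for p
  have V: "integrable lborel V" unfolding V_def using F \<Gamma>R by auto
  have [measurable]: "V \<in> borel_measurable borel" using V by auto
  \<comment> \<open>\<open>indefinite_integral_by_parts\<close> moves the derivative from \<beta>'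
    onto the indefinite integral; the product term vanishes because \<beta>' has mean zero.\<close>
  have V_orth: "(\<integral>p. V p * (\<alpha> (fst p) * \<beta>' (snd p)) \<partial>lborel) = 0"
    if a: "tf1 a b \<alpha>" and b: "tf1 c d \<beta>" and b': "tf1 c d \<beta>'" and der: "\<And>x. (\<beta> has_real_derivative \<beta>' x) (at x)" for \<alpha> \<beta> \<beta>'
  proof -
    have b'0: "integral\<^sup>L lborel \<beta>' = 0"
    proof -
      have "integral\<^sup>L lborel \<beta>' = (\<integral>y. (if y \<le> d then \<beta>' y else 0) \<partial>lborel)"
        by (intro Bochner_Integration.integral_cong refl) (use tf1_outside[OF b'] in auto)
      also have "\<dots> = \<beta> d" by (rule tf1_integral_of_deriv[OF b b' der])
      also have "\<dots> = 0" by (rule tf1_outside[OF b]) simp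
      finally show ?thesis .
    qed
    note iG = integrable_mult_tensor[OF \<Gamma>R a b'] and ig = integrable_mult_tensor[OF g a b] and iF = integrable_mult_tensor[OF F a b']
    have "(\<integral>p. \<Gamma>R p * (\<alpha> (fst p) * \<beta>' (snd p)) \<partial>lborel) = (\<integral>x. (\<integral>z. \<Gamma>R (x, z) * (\<alpha> x * \<beta>' z) \<partial>lborel) \<partial>lborel)"
      using integral_iterated(1)[OF iG] by simp
    also have "\<dots> = (\<integral>x. - (\<integral>z. g (x, z) * (\<alpha> x * \<beta> z) \<partial>lborel) \<partial>lborel)"
    proof (rule integral_cong_AE)
      show "(\<lambda>x. \<integral>z. \<Gamma>R (x, z) * (\<alpha> x * \<beta>' z) \<partial>lborel) \<in> borel_measurable lborel"
        using integral_iterated(2)[OF iG] by auto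
      show "(\<lambda>x. - (\<integral>z. g (x, z) * (\<alpha> x * \<beta> z) \<partial>lborel)) \<in> borel_measurable lborel"
        using integral_iterated(2)[OF ig] by auto
      show "AE x in lborel. (\<integral>z. \<Gamma>R (x, z) * (\<alpha> x * \<beta>' z) \<partial>lborel) = - (\<integral>z. g (x, z) * (\<alpha> x * \<beta> z) \<partial>lborel)"
        using gx
      proof eventually_elim
        case (elim x)
        have "(\<integral>z. \<Gamma>R (x, z) * (\<alpha> x * \<beta>' z) \<partial>lborel) = (\<integral>z. \<alpha> x * (\<beta>' z * (\<integral>y. (if y \<le> z then g (x, y) else 0) \<partial>lborel)) \<partial>lborel)"
          by (intro Bochner_Integration.integral_cong refl)
            (use tf1_outside[OF a] tf1_outside[OF b'] in \<open>auto simp: \<Gamma>R_def R_def \<Gamma>_pair\<close>)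
        also have "\<dots> = \<alpha> x * (\<integral>z. \<beta>' z * (\<integral>y. (if y \<le> z then g (x, y) else 0) \<partial>lborel) \<partial>lborel)" by simp
        also have "(\<integral>z. \<beta>' z * (\<integral>y. (if y \<le> z then g (x, y) else 0) \<partial>lborel) \<partial>lborel) = - (\<integral>y. g (x, y) * \<beta> y \<partial>lborel)"
          using indefinite_integral_by_parts(1)[OF tf1_integrable[OF b'] elim] b'0 tf1_integral_of_deriv[OF b b' der] by simp
        also have "\<alpha> x * - (\<integral>y. g (x, y) * \<beta> y \<partial>lborel) = - (\<integral>z. \<alpha> x * (g (x, z) * \<beta> z) \<partial>lborel)" by simp
        finally show ?case by (simp add: mult_ac)
      qed
    qed
    also have "\<dots> = - (\<integral>p. g p * (\<alpha> (fst p) * \<beta> (snd p)) \<partial>lborel)" using integral_iterated(1)[OF ig] by simp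
    finally have "(\<integral>p. \<Gamma>R p * (\<alpha> (fst p) * \<beta>' (snd p)) \<partial>lborel) = (\<integral>p. F p * (\<alpha> (fst p) * \<beta>' (snd p)) \<partial>lborel)"
      using weak[OF a b b' der] by simp
    then show ?thesis unfolding V_def left_diff_distrib using Bochner_Integration.integral_diff[OF iF iG] by simp
  qed
  obtain \<rho> where \<rho>: "tf1 c d \<rho>" "integral\<^sup>L lborel \<rho> = 1" using tf1_unit_integral[OF cd] .
  have \<rho>_meas [measurable]: "\<rho> \<in> borel_measurable borel" using tf1_integrable[OF \<rho>(1)] by auto
  \<comment> \<open>If V is constant along a slice, testing with a function of unit mass recovers
    the constant.\<close>
  define C where "C x = (\<integral>z. V (x, z) * \<rho> z \<partial>lborel)" for x
  obtain B where B: "\<And>z. \<bar>\<rho> z\<bar> \<le> B" using tf1_bounded[OF \<rho>(1)] by blast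
  have "integrable lborel (\<lambda>p. B * V p)" using V by simp
  then have iV\<rho>: "integrable lborel (\<lambda>p. V p * \<rho> (snd p))"
  proof (rule Bochner_Integration.integrable_bound)
    show "AE p in lborel. norm (V p * \<rho> (snd p)) \<le> norm (B * V p)"
    proof (rule AE_I2)
      fix p
      have "\<bar>V p\<bar> * \<bar>\<rho> (snd p)\<bar> \<le> \<bar>V p\<bar> * \<bar>B\<bar>" using B[of "snd p"] by (intro mult_left_mono) auto
      then show "norm (V p * \<rho> (snd p)) \<le> norm (B * V p)" by (simp add: abs_mult mult.commute)
    qed
  qed measurable
  have C: "integrable lborel C" unfolding C_def using integral_iterated(2)[OF iV\<rho>] by simp
  have [measurable]: "C \<in> borel_measurable borel" using C by auto
  define CR where "CR p = (if p \<in> R then C (fst p) else 0)" for p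
  have CR_meas [measurable]: "CR \<in> borel_measurable borel" unfolding CR_def by measurable
  have CR: "integrable lborel CR"
  proof (rule integrable_tensor_bound[OF CR_meas _ ind])
    show "integrable lborel (\<lambda>x. \<bar>C x\<bar>)" using C by simp
  qed (auto simp: CR_def R_def indicator_def)
  have "AE p in lborel. V p - CR p = 0"
  proof (rule tensor_fundamental_lemma[of _ a b c d])
    show "integrable lborel (\<lambda>p. V p - CR p)" using V CR by auto
    show "V p - CR p = 0" if "p \<notin> {a<..<b} \<times> {c<..<d}" for p
      using outF[OF that] that by (simp add: V_def \<Gamma>R_def CR_def R_def)
    fix \<alpha> \<psi> assume a: "tf1 a b \<alpha>" and p: "tf1 c d \<psi>"
    \<comment> \<open>Subtracting \<kappa> \<rho> removes the mean of \<psi>, so that the difference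
      has a test function as primitive and \<open>V_orth\<close> applies.\<close>
    define \<kappa> where "\<kappa> = integral\<^sup>L lborel \<psi>"
    have t: "tf1 c d (\<lambda>z. \<psi> z - \<kappa> * \<rho> z)"
    proof -
      have "Cn_on n UNIV (\<lambda>z. \<psi> z - \<kappa> * \<rho> z)" for n
        using p \<rho>(1) unfolding tf1_def by (intro Cn_on_diff Cn_on_mult Cn_on_const) auto
      moreover obtain e f where ef: "c < e" "f < d" "\<And>x. x \<notin> {e..f} \<Longrightarrow> \<psi> x = 0" using p unfolding tf1_def by blast
      obtain e' f' where ef': "c < e'" "f' < d" "\<And>x. x \<notin> {e'..f'} \<Longrightarrow> \<rho> x = 0" using \<rho>(1) unfolding tf1_def by blast
      have "c < min e e'" "max f f' < d" using ef ef' by auto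
      moreover have "\<psi> x - \<kappa> * \<rho> x = 0" if "x \<notin> {min e e'..max f f'}" for x
        using ef(3)[of x] ef'(3)[of x] that by fastforce
      ultimately show ?thesis unfolding tf1_def by blast
    qed
    have z: "integral\<^sup>L lborel (\<lambda>z. \<psi> z - \<kappa> * \<rho> z) = 0"
      using tf1_integrable[OF p] tf1_integrable[OF \<rho>(1)] \<rho>(2) by (simp add: \<kappa>_def)
    note V0 = V_orth[OF a tf1_antiderivative(1)[OF t z] t tf1_antiderivative(2)[OF t z]]
    note i1 = integrable_mult_tensor[OF V a p] and i2 = integrable_mult_tensor[OF V a \<rho>(1)] and i3 = integrable_mult_tensor[OF CR a p]
    have "(\<integral>p. V p * (\<alpha> (fst p) * \<psi> (snd p)) \<partial>lborel) = \<kappa> * (\<integral>p. V p * (\<alpha> (fst p) * \<rho> (snd p)) \<partial>lborel)"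
    proof -
      have "V p * (\<alpha> (fst p) * (\<psi> (snd p) - \<kappa> * \<rho> (snd p))) = V p * (\<alpha> (fst p) * \<psi> (snd p)) - \<kappa> * (V p * (\<alpha> (fst p) * \<rho> (snd p)))" for p
        by (simp add: algebra_simps)
      then show ?thesis using V0 i1 i2 by (simp add: Bochner_Integration.integral_diff)
    qed
    also have "(\<integral>p. V p * (\<alpha> (fst p) * \<rho> (snd p)) \<partial>lborel) = (\<integral>x. \<alpha> x * C x \<partial>lborel)"
    proof -
      have "(\<integral>z. V (x, z) * (\<alpha> x * \<rho> z) \<partial>lborel) = \<alpha> x * C x" for x
      proof -
        have "(\<integral>z. V (x, z) * (\<alpha> x * \<rho> z) \<partial>lborel) = (\<integral>z. \<alpha> x * (V (x, z) * \<rho> z) \<partial>lborel)" by (simp add: mult_ac)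
        then show ?thesis by (simp add: C_def)
      qed
      then show ?thesis using integral_iterated(1)[OF i2] by simp
    qed
    finally have 1: "(\<integral>p. V p * (\<alpha> (fst p) * \<psi> (snd p)) \<partial>lborel) = \<kappa> * (\<integral>x. \<alpha> x * C x \<partial>lborel)" .
    have "(\<integral>z. CR (x, z) * (\<alpha> x * \<psi> z) \<partial>lborel) = \<kappa> * (\<alpha> x * C x)" for x
    proof -
      have "(\<integral>z. CR (x, z) * (\<alpha> x * \<psi> z) \<partial>lborel) = (\<integral>z. \<alpha> x * C x * \<psi> z \<partial>lborel)"
        by (intro Bochner_Integration.integral_cong refl)
          (use tf1_outside[OF a] tf1_outside[OF p] in \<open>auto simp: CR_def R_def\<close>)
      then show ?thesis by (simp add: \<kappa>_def)
    qed
    then have 2: "(\<integral>p. CR p * (\<alpha> (fst p) * \<psi> (snd p)) \<partial>lborel) = \<kappa> * (\<integral>x. \<alpha> x * C x \<partial>lborel)"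
      using integral_iterated(1)[OF i3] by simp
    show "(\<integral>p. (V p - CR p) * (\<alpha> (fst p) * \<psi> (snd p)) \<partial>lborel) = 0"
      unfolding left_diff_distrib using Bochner_Integration.integral_diff[OF i1 i3] 1 2 by simp
  qed
  then have "AE x in lborel. AE z in lborel. V (x, z) - CR (x, z) = 0"
    by (rule AE_slices)
  then show ?thesis using gx
  proof eventually_elim
    case (elim x)
    show ?case
    proof (intro conjI impI elim(2) exI[of _ "C x"])
      assume x: "x \<in> {a<..<b}"
      show "AE z in lborel. z \<in> {c<..<d} \<longrightarrow> F (x, z) = C x + (\<integral>y. (if y \<le> z then g (x, y) else 0) \<partial>lborel)"
        using elim(1) by eventually_elim (use x in \<open>auto simp: V_def CR_def \<Gamma>R_def \<Gamma>_pair R_def\<close>)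
    qed
  qed
qed

section \<open>Integrability, endpoint values and traces along slices\<close>

lemma integrable_mult_of_squares:
  fixes f g :: "'a \<Rightarrow> real"
  assumes [measurable]: "f \<in> borel_measurable M" "g \<in> borel_measurable M"
    and f: "integrable M (\<lambda>p. (f p)\<^sup>2)" and g: "integrable M (\<lambda>p. (g p)\<^sup>2)"
  shows "integrable M (\<lambda>p. f p * g p)"
proof (rule Bochner_Integration.integrable_bound)
  show "integrable M (\<lambda>p. (f p)\<^sup>2 + (g p)\<^sup>2)" using f g by simp
  show "AE p in M. norm (f p * g p) \<le> norm ((f p)\<^sup>2 + (g p)\<^sup>2)"
  proof (rule AE_I2)
    fix p
    have "2 * (\<bar>f p\<bar> * \<bar>g p\<bar>) \<le> (f p)\<^sup>2 + (g p)\<^sup>2" using sum_squares_bound[of "\<bar>f p\<bar>" "\<bar>g p\<bar>"] by (simp add: mult.assoc)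
    moreover have "\<bar>f p\<bar> * \<bar>g p\<bar> \<ge> 0" by simp
    ultimately have "\<bar>f p\<bar> * \<bar>g p\<bar> \<le> (f p)\<^sup>2 + (g p)\<^sup>2" by linarith
    then show "norm (f p * g p) \<le> norm ((f p)\<^sup>2 + (g p)\<^sup>2)" by (simp add: abs_mult)
  qed
qed measurable

lemma integrable_of_square_on_bounded:
  fixes f :: "'a::euclidean_space \<Rightarrow> real"
  assumes [measurable]: "f \<in> borel_measurable borel" and f: "integrable lborel (\<lambda>p. (f p)\<^sup>2)"
    and S: "S \<in> sets borel" "emeasure lborel S < \<infinity>" and out: "\<And>p. p \<notin> S \<Longrightarrow> f p = 0"
  shows "integrable lborel f"
proof -
  have "(indicator S p :: real)\<^sup>2 = indicator S p" for p by (simp add: indicator_def)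
  then have "integrable lborel (\<lambda>p. f p * indicator S p)"
    using S f by (intro integrable_mult_of_squares) (auto intro: integrable_real_indicator)
  moreover have "f p * indicator S p = f p" for p using out[of p] by (auto simp: indicator_def)
  ultimately show ?thesis by simp
qed

lemma continuous_indefinite_integral:
  fixes g :: "real \<Rightarrow> real"
  assumes g: "integrable lborel g"
  shows "continuous_on UNIV (\<lambda>z. \<integral>y. (if y \<le> z then g y else 0) \<partial>lborel)"
  unfolding continuous_on_sequentially o_def
proof (intro allI ballI impI, elim conjE)
  fix X :: "nat \<Rightarrow> real" and z assume X: "X \<longlonglongrightarrow> z"
  have [measurable]: "g \<in> borel_measurable borel" using g by auto
  show "(\<lambda>n. \<integral>y. (if y \<le> X n then g y else 0) \<partial>lborel) \<longlonglongrightarrow> (\<integral>y. (if y \<le> z then g y else 0) \<partial>lborel)"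
  proof (rule integral_dominated_convergence[where w = "\<lambda>y. \<bar>g y\<bar>"])
    show "AE y in lborel. (\<lambda>n. if y \<le> X n then g y else 0) \<longlonglongrightarrow> (if y \<le> z then g y else 0)"
      using AE_lborel_singleton[of z]
    proof eventually_elim
      case (elim y)
      have "\<forall>\<^sub>F n in sequentially. (if y \<le> X n then g y else 0) = (if y \<le> z then g y else 0)"
      proof (cases "y < z")
        case True
        from order_tendstoD(1)[OF X True] show ?thesis by eventually_elim (use True in auto)
      next
        case False
        then have "z < y" using elim by simp
        from order_tendstoD(2)[OF X this] show ?thesis by eventually_elim (use \<open>z < y\<close> in auto)
      qed
      then show ?case by (rule tendsto_eventually)
    qed
  qed (use g in auto)
qed

lemma AE_interval_witness:
  fixes a b :: real
  assumes "AE z in lborel. z \<in> {a<..<b} \<longrightarrow> P z" "a < b"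
  obtains z where "z \<in> {a<..<b}" "P z"
proof -
  have "\<exists>z. z \<in> {a<..<b} \<and> P z"
  proof (rule ccontr)
    assume "\<nexists>z. z \<in> {a<..<b} \<and> P z"
    then have "AE z in lborel. z \<notin> {a<..<b}" using assms(1) by (auto elim: eventually_mono)
    moreover have "{z \<in> space lborel. \<not> z \<notin> {a<..<b}} = {a<..<b}" by auto
    ultimately have "emeasure lborel {a<..<b} = 0"
      using AE_iff_measurable[of "{a<..<b}" lborel "\<lambda>z. z \<notin> {a<..<b}"] by (simp only: sets_lborel borel_open open_greaterThanLessThan)
    then show False using assms(2) by simp
  qed
  then show ?thesis using that by blast
qed

text \<open>Every one-sided neighbourhood of an endpoint has positive measure, hence contains a zero
  of D; continuity up to the endpoint does the rest.\<close>

lemma continuous_AE_zero_endpoints: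
  fixes D :: "real \<Rightarrow> real"
  assumes D: "continuous_on {a..b} D" and ae: "AE z in lborel. z \<in> {a<..<b} \<longrightarrow> D z = 0" and ab: "a < b"
  shows "D a = 0" "D b = 0"
proof -
  have "\<exists>z. z \<in> {a<..<min b (a + 1 / Suc n)} \<and> D z = 0" for n
  proof -
    have "AE z in lborel. z \<in> {a<..<min b (a + 1 / Suc n)} \<longrightarrow> D z = 0" using ae by eventually_elim auto
    then show ?thesis by (rule AE_interval_witness) (use ab in auto)
  qed
  then obtain X where X: "\<And>n. X n \<in> {a<..<min b (a + 1 / Suc n)}" "\<And>n. D (X n) = 0" by metis
  have "X \<longlonglongrightarrow> a"
  proof (rule tendsto_sandwich[of "\<lambda>_. a" _ _ "\<lambda>n. a + 1 / Suc n"])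
    show "(\<lambda>n. a + 1 / real (Suc n)) \<longlonglongrightarrow> a" using tendsto_add[OF tendsto_const LIMSEQ_Suc[OF lim_1_over_n], of a] by simp
  qed (use X in \<open>auto intro!: always_eventually less_imp_le\<close>)
  then have "(\<lambda>n. D (X n)) \<longlonglongrightarrow> D a"
    using continuous_on_tendsto_compose[OF D, of X a] X(1) ab by (auto intro!: always_eventually less_imp_le)
  then have "(\<lambda>n. 0) \<longlonglongrightarrow> D a" by (simp add: X(2))
  from LIMSEQ_unique[OF this tendsto_const] show "D a = 0" .
  have "\<exists>z. z \<in> {max a (b - 1 / Suc n)<..<b} \<and> D z = 0" for n
  proof -
    have "AE z in lborel. z \<in> {max a (b - 1 / Suc n)<..<b} \<longrightarrow> D z = 0" using ae by eventually_elim auto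
    then show ?thesis by (rule AE_interval_witness) (use ab in auto)
  qed
  then obtain Y where Y: "\<And>n. Y n \<in> {max a (b - 1 / Suc n)<..<b}" "\<And>n. D (Y n) = 0" by metis
  have "Y \<longlonglongrightarrow> b"
  proof (rule tendsto_sandwich[of "\<lambda>n. b - 1 / Suc n" _ _ "\<lambda>_. b"])
    show "(\<lambda>n. b - 1 / real (Suc n)) \<longlonglongrightarrow> b" using tendsto_diff[OF tendsto_const LIMSEQ_Suc[OF lim_1_over_n], of b] by simp
  qed (use Y in \<open>auto intro!: always_eventually less_imp_le\<close>)
  then have "(\<lambda>n. D (Y n)) \<longlonglongrightarrow> D b"
    using continuous_on_tendsto_compose[OF D, of Y b] Y(1) ab by (auto intro!: always_eventually less_imp_le)
  then have "(\<lambda>n. 0) \<longlonglongrightarrow> D b" by (simp add: Y(2))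
  from LIMSEQ_unique[OF this tendsto_const] show "D b = 0" .
qed

text \<open>Only convergence of both ends to \<xi> is asked, so intervals that start or end at \<xi>
  are covered; these are the strips at the two lateral sides.\<close>

lemma average_tendsto:
  fixes q :: "real \<Rightarrow> real"
  assumes q: "continuous_on UNIV q" and ab: "\<And>n. a n < b n" and lim: "a \<longlonglongrightarrow> \<xi>" "b \<longlonglongrightarrow> \<xi>"
  shows "(\<lambda>n. 1 / (b n - a n) * (\<integral>x. indicator {a n<..<b n} x * q x \<partial>lborel)) \<longlonglongrightarrow> q \<xi>"
proof (rule tendstoI)
  fix e :: real assume e: "e > 0"
  have [measurable]: "q \<in> borel_measurable borel" using q by (rule borel_measurable_continuous_onI)
  have "isCont q \<xi>" using q by (simp add: continuous_on_eq_continuous_at)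
  then obtain \<delta> where \<delta>: "\<delta> > 0" "\<And>x. \<bar>x - \<xi>\<bar> < \<delta> \<Longrightarrow> \<bar>q x - q \<xi>\<bar> < e / 2"
    using e unfolding continuous_at_eps_delta dist_real_def by (meson half_gt_zero)
  have "\<forall>\<^sub>F n in sequentially. \<bar>a n - \<xi>\<bar> < \<delta>" "\<forall>\<^sub>F n in sequentially. \<bar>b n - \<xi>\<bar> < \<delta>"
    using lim \<delta>(1) by (auto simp: tendsto_iff dist_real_def)
  then show "\<forall>\<^sub>F n in sequentially. dist (1 / (b n - a n) * (\<integral>x. indicator {a n<..<b n} x * q x \<partial>lborel)) (q \<xi>) < e"
  proof eventually_elim
    case (elim n)
    let ?I = "indicator {a n<..<b n} :: real \<Rightarrow> real"
    have bd: "\<bar>?I x * q x - ?I x * q \<xi>\<bar> \<le> e / 2 * ?I x" for x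
    proof (cases "x \<in> {a n<..<b n}")
      case True
      then have "\<bar>x - \<xi>\<bar> < \<delta>" using elim by auto
      then show ?thesis using \<delta>(2)[of x] True by simp
    qed simp
    have I: "integrable lborel ?I" "integral\<^sup>L lborel ?I = b n - a n" using ab[of n] by (auto intro!: integrable_real_indicator)
    have i0: "integrable lborel (\<lambda>x. ?I x * q \<xi>)" using I(1) by simp
    have i1: "integrable lborel (\<lambda>x. ?I x * q x - ?I x * q \<xi>)"
    proof (rule Bochner_Integration.integrable_bound)
      show "integrable lborel (\<lambda>x. e / 2 * ?I x)" using I(1) by simp
      show "AE x in lborel. norm (?I x * q x - ?I x * q \<xi>) \<le> norm (e / 2 * ?I x)"
        using bd by (intro AE_I2) (metis abs_ge_self order_trans real_norm_def)
    qed measurable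
    have i2: "integrable lborel (\<lambda>x. ?I x * q x)" using Bochner_Integration.integrable_add[OF i1 i0] by simp
    have "\<bar>(\<integral>x. ?I x * q x - ?I x * q \<xi> \<partial>lborel)\<bar> \<le> (\<integral>x. \<bar>?I x * q x - ?I x * q \<xi>\<bar> \<partial>lborel)" by (rule integral_abs_bound)
    also have "\<dots> \<le> (\<integral>x. e / 2 * ?I x \<partial>lborel)" using bd i1 I(1) by (intro integral_mono) auto
    also have "\<dots> = e / 2 * (b n - a n)" using I(2) by simp
    finally have "\<bar>(\<integral>x. ?I x * q x \<partial>lborel) - (b n - a n) * q \<xi>\<bar> \<le> e / 2 * (b n - a n)"
      using Bochner_Integration.integral_diff[OF i2 i0] I(2) by simp
    then have "\<bar>(\<integral>x. ?I x * q x \<partial>lborel) - (b n - a n) * q \<xi>\<bar> / (b n - a n) \<le> e / 2"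
      using ab[of n] by (simp add: divide_le_eq)
    moreover have "1 / (b n - a n) * (\<integral>x. ?I x * q x \<partial>lborel) - q \<xi> = ((\<integral>x. ?I x * q x \<partial>lborel) - (b n - a n) * q \<xi>) / (b n - a n)"
      using ab[of n] by (simp add: field_simps)
    ultimately have "\<bar>1 / (b n - a n) * (\<integral>x. ?I x * q x \<partial>lborel) - q \<xi>\<bar> \<le> e / 2" using ab[of n] by (simp add: abs_divide)
    then show ?case using e by (simp add: dist_real_def)
  qed
qed

text \<open>Fatou's lemma passes the averaged trace condition to the slices.\<close>

lemma trace_zero_slices:
  fixes W :: "real \<times> real \<Rightarrow> real"
  assumes [measurable]: "W \<in> borel_measurable borel" "Z \<in> sets borel" and W2: "integrable lborel (\<lambda>p. (W p)\<^sup>2)"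
    and Z: "Z \<subseteq> {-1<..<1}" and ab: "\<And>n. a n < b n" "\<And>n. x0 \<le> a n" "\<And>n. b n \<le> x1"
    and lim: "a \<longlonglongrightarrow> \<xi>" "b \<longlonglongrightarrow> \<xi>"
    and tr: "(\<lambda>n. 1 / (b n - a n) * (\<integral>p. indicator ({a n<..<b n} \<times> Z) p * (\<bar>snd p\<bar> * (W p)\<^sup>2) \<partial>lborel)) \<longlonglongrightarrow> 0"
  shows "AE z in lborel. z \<in> Z \<and> z \<noteq> 0 \<longrightarrow>
    (\<forall>m. continuous_on UNIV m \<longrightarrow> (AE x in lborel. x \<in> {x0<..<x1} \<longrightarrow> z * W (x, z) = m x) \<longrightarrow> m \<xi> = 0)"
proof -
  have ZJ: "{a n<..<b n} \<times> Z \<in> sets borel" for n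
  proof -
    have "{a n<..<b n} \<times> Z \<in> sets (borel \<Otimes>\<^sub>M borel)" by (intro pair_measureI) measurable
    then show ?thesis unfolding borel_prod .
  qed
  define Q where "Q n p = indicator ({a n<..<b n} \<times> Z) p * (\<bar>snd p\<bar> * (W p)\<^sup>2)" for n and p :: "real \<times> real"
  have Q_meas: "Q n \<in> borel_measurable borel" for n unfolding Q_def using ZJ by measurable
  have Q_int: "integrable lborel (Q n)" for n
  proof (rule Bochner_Integration.integrable_bound[OF W2])
    show "AE p in lborel. norm (Q n p) \<le> norm ((W p)\<^sup>2)"
    proof (rule AE_I2)
      fix p
      show "norm (Q n p) \<le> norm ((W p)\<^sup>2)"
      proof (cases "p \<in> {a n<..<b n} \<times> Z")
        case True
        then have "\<bar>snd p\<bar> \<le> 1" using Z by (cases p) force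
        then have "\<bar>snd p\<bar> * (W p)\<^sup>2 \<le> 1 * (W p)\<^sup>2" by (intro mult_right_mono) auto
        then show ?thesis using True by (simp add: Q_def)
      qed (simp add: Q_def)
    qed
  qed (simp add: Q_meas)
  define \<phi> where "\<phi> n z = 1 / (b n - a n) * (\<integral>x. Q n (x, z) \<partial>lborel)" for n z
  have Qp: "integrable (lborel \<Otimes>\<^sub>M lborel) (\<lambda>(x, z). Q n (x, z))" for n using Q_int by (simp add: lborel_prod)
  have \<phi>_int: "integrable lborel (\<phi> n)" for n
    unfolding \<phi>_def using lborel_pair.integrable_snd[OF Qp] by simp
  have \<phi>_nonneg: "\<phi> n z \<ge> 0" for n z
    unfolding \<phi>_def using ab(1)[of n] by (intro mult_nonneg_nonneg integral_nonneg_AE) (auto simp: Q_def)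
  have \<phi>_integral: "integral\<^sup>L lborel (\<phi> n) = 1 / (b n - a n) * (\<integral>p. Q n p \<partial>lborel)" for n
    unfolding \<phi>_def using lborel_pair.integral_snd[OF Qp, of n] by (simp add: lborel_prod)
  have [measurable]: "\<phi> n \<in> borel_measurable borel" for n using \<phi>_int[of n] by auto
  have "(\<integral>\<^sup>+z. liminf (\<lambda>n. ennreal (\<phi> n z)) \<partial>lborel) \<le> liminf (\<lambda>n. \<integral>\<^sup>+z. ennreal (\<phi> n z) \<partial>lborel)"
    by (rule nn_integral_liminf) measurable
  also have "(\<lambda>n. \<integral>\<^sup>+z. ennreal (\<phi> n z) \<partial>lborel) = (\<lambda>n. ennreal (1 / (b n - a n) * (\<integral>p. Q n p \<partial>lborel)))"
    using \<phi>_int \<phi>_nonneg \<phi>_integral by (simp add: nn_integral_eq_integral)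
  also have "liminf \<dots> = 0"
  proof (rule lim_imp_Liminf)
    show "(\<lambda>n. ennreal (1 / (b n - a n) * (\<integral>p. Q n p \<partial>lborel))) \<longlonglongrightarrow> 0"
      using tendsto_ennrealI[OF tr] unfolding Q_def by simp
  qed simp
  finally have "(\<integral>\<^sup>+z. liminf (\<lambda>n. ennreal (\<phi> n z)) \<partial>lborel) = 0" by simp
  then have "AE z in lborel. liminf (\<lambda>n. ennreal (\<phi> n z)) = 0"
    by (subst (asm) nn_integral_0_iff_AE) auto
  then show ?thesis
  proof eventually_elim
    case (elim z)
    show ?case
    proof (intro impI allI)
      fix m assume z: "z \<in> Z \<and> z \<noteq> 0" and m: "continuous_on UNIV m" and ae: "AE x in lborel. x \<in> {x0<..<x1} \<longrightarrow> z * W (x, z) = m x"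
      \<comment> \<open>On the slice m represents z W, so the weighted square |z| W^2 equals m^2 /
        |z|, a continuous function whose averages converge to its value at \<xi>.\<close>
      have "\<phi> n z = 1 / (b n - a n) * (\<integral>x. indicator {a n<..<b n} x * ((m x)\<^sup>2 / \<bar>z\<bar>) \<partial>lborel)" for n
      proof -
        have [measurable]: "m \<in> borel_measurable borel" using m by (rule borel_measurable_continuous_onI)
        have "(\<integral>x. Q n (x, z) \<partial>lborel) = (\<integral>x. indicator {a n<..<b n} x * ((m x)\<^sup>2 / \<bar>z\<bar>) \<partial>lborel)"
        proof (rule integral_cong_AE)
          have "(\<lambda>x. (x, z)) \<in> borel \<rightarrow>\<^sub>M borel" by (intro borel_measurable_continuous_onI continuous_intros)
          from measurable_compose[OF this Q_meas] show "(\<lambda>x. Q n (x, z)) \<in> borel_measurable lborel" by simp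
          show "AE x in lborel. Q n (x, z) = indicator {a n<..<b n} x * ((m x)\<^sup>2 / \<bar>z\<bar>)"
            using ae
          proof eventually_elim
            case (elim x)
            show ?case
            proof (cases "x \<in> {a n<..<b n}")
              case True
              then have "x \<in> {x0<..<x1}" using ab[of n] by (auto intro: le_less_trans less_le_trans)
              then have "m x = z * W (x, z)" using elim by simp
              then have "(m x)\<^sup>2 = \<bar>z\<bar> * \<bar>z\<bar> * (W (x, z))\<^sup>2"
                by (simp only: power_mult_distrib power2_eq_square[symmetric] power2_abs)
              then have "(m x)\<^sup>2 / \<bar>z\<bar> = \<bar>z\<bar> * (W (x, z))\<^sup>2"
                using nonzero_mult_div_cancel_left[of "\<bar>z\<bar>" "\<bar>z\<bar> * (W (x, z))\<^sup>2"] z by (simp only: mult.assoc abs_eq_0 not_False_eq_True)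
              then show ?thesis using True z by (simp add: Q_def)
            qed (auto simp: Q_def indicator_def)
          qed
        qed measurable
        then show ?thesis by (simp add: \<phi>_def)
      qed
      then have "(\<lambda>n. \<phi> n z) \<longlonglongrightarrow> (m \<xi>)\<^sup>2 / \<bar>z\<bar>"
        using average_tendsto[OF _ ab(1) lim, of "\<lambda>x. (m x)\<^sup>2 / \<bar>z\<bar>"] m z
        by (simp add: continuous_on_divide continuous_on_power)
      then have "(\<lambda>n. ennreal (\<phi> n z)) \<longlonglongrightarrow> ennreal ((m \<xi>)\<^sup>2 / \<bar>z\<bar>)" by (rule tendsto_ennrealI)
      then have "liminf (\<lambda>n. ennreal (\<phi> n z)) = ennreal ((m \<xi>)\<^sup>2 / \<bar>z\<bar>)" by (intro lim_imp_Liminf) auto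
      then have "ennreal ((m \<xi>)\<^sup>2 / \<bar>z\<bar>) = 0" using elim by simp
      then have "(m \<xi>)\<^sup>2 / \<bar>z\<bar> \<le> 0" by (simp only: ennreal_eq_0_iff)
      then show "m \<xi> = 0" using z by (simp add: divide_le_0_iff)
    qed
  qed
qed

lemma lborel_swap:
  fixes h :: "real \<times> real \<Rightarrow> real"
  assumes "h \<in> borel_measurable borel"
  shows "(\<integral>q. h (snd q, fst q) \<partial>lborel) = integral\<^sup>L lborel h"
    and "integrable lborel h \<Longrightarrow> integrable lborel (\<lambda>q. h (snd q, fst q))"
  using lborel_pair.integral_product_swap[of h] lborel_pair.integrable_product_swap[of h] assms
  by (simp_all add: lborel_prod case_prod_unfold)

subsection \<open>Uniqueness\<close>

text \<open>W and A are, up to constants, indefinite integrals of A and B. The zero boundary values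
  of W force k = 0 and mean zero of A, and the latter also removes the unknown constant l.\<close>

lemma energy_z_slice:
  fixes A B W :: "real \<Rightarrow> real"
  assumes A: "integrable lborel A" and B: "integrable lborel B" and A2: "integrable lborel (\<lambda>z. (A z)\<^sup>2)"
    and out: "\<And>z. z \<notin> {-1<..<1} \<Longrightarrow> A z = 0" "\<And>z. z \<notin> {-1<..<1} \<Longrightarrow> B z = 0"
    and W: "AE z in lborel. z \<in> {-1<..<1} \<longrightarrow> W z = k + (\<integral>y. (if y \<le> z then A y else 0) \<partial>lborel)"
    and AB: "AE z in lborel. z \<in> {-1<..<1} \<longrightarrow> A z = l + (\<integral>y. (if y \<le> z then B y else 0) \<partial>lborel)"
    and g: "continuous_on {-1..1} g" "g (-1) = 0" "g 1 = 0" "AE z in lborel. z \<in> {-1<..<1} \<longrightarrow> W z = g z"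
    and [measurable]: "W \<in> borel_measurable borel"
  shows "(\<integral>z. W z * B z \<partial>lborel) = - (\<integral>z. (A z)\<^sup>2 \<partial>lborel)"
    and "AE z in lborel. z \<in> {-1<..<1} \<longrightarrow> W z = (\<integral>y. (if y \<le> z then A y else 0) \<partial>lborel)"
proof -
  have [measurable]: "A \<in> borel_measurable borel" "B \<in> borel_measurable borel" using A B by auto
  define P where "P z = (\<integral>y. (if y \<le> z then A y else 0) \<partial>lborel)" for z
  have P: "continuous_on UNIV P" unfolding P_def by (rule continuous_indefinite_integral[OF A])
  \<comment> \<open>k + P and g are continuous representatives of the same function, so they agree
    at -1 and 1 as well.\<close>
  have cont: "continuous_on {-1..1} (\<lambda>z. k + P z - g z)"
    by (intro continuous_intros g continuous_on_subset[OF P]) auto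
  have ae: "AE z in lborel. z \<in> {-1<..<1} \<longrightarrow> k + P z - g z = 0" using W g(4) by eventually_elim (auto simp: P_def)
  have Pm: "P (-1) = 0"
  proof -
    have "(\<lambda>y. if y \<le> -1 then A y else 0) = (\<lambda>y. 0)" using out(1) by fastforce
    then show ?thesis by (simp add: P_def)
  qed
  have P1: "P 1 = integral\<^sup>L lborel A" unfolding P_def
    by (intro Bochner_Integration.integral_cong refl) (use out(1) in auto)
  have k: "k = 0" using continuous_AE_zero_endpoints(1)[OF cont ae] Pm g(2) by simp
  have A0: "integral\<^sup>L lborel A = 0" using continuous_AE_zero_endpoints(2)[OF cont ae] P1 g(3) k by simp
  show "AE z in lborel. z \<in> {-1<..<1} \<longrightarrow> W z = (\<integral>y. (if y \<le> z then A y else 0) \<partial>lborel)"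
    using W by eventually_elim (simp add: k)
  have Pmeas [measurable]: "P \<in> borel_measurable borel" by (rule borel_measurable_continuous_onI[OF P])
  have "(\<integral>z. W z * B z \<partial>lborel) = (\<integral>z. B z * P z \<partial>lborel)"
  proof (rule integral_cong_AE)
    show "AE z in lborel. W z * B z = B z * P z"
      using W
    proof eventually_elim
      case (elim z)
      then show ?case using out(2)[of z] k by (cases "z \<in> {-1<..<1}") (auto simp: P_def)
    qed
  qed measurable
  also have "\<dots> = - (\<integral>z. A z * (\<integral>y. (if y \<le> z then B y else 0) \<partial>lborel) \<partial>lborel)"
    using indefinite_integral_by_parts(1)[OF B A] A0 by (simp add: P_def)
  also have "(\<integral>z. A z * (\<integral>y. (if y \<le> z then B y else 0) \<partial>lborel) \<partial>lborel) = (\<integral>z. (A z)\<^sup>2 - l * A z \<partial>lborel)"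
  proof (rule integral_cong_AE)
    have "continuous_on UNIV (\<lambda>z. \<integral>y. (if y \<le> z then B y else 0) \<partial>lborel)" by (rule continuous_indefinite_integral[OF B])
    from borel_measurable_continuous_onI[OF this]
    show "(\<lambda>z. A z * (\<integral>y. (if y \<le> z then B y else 0) \<partial>lborel)) \<in> borel_measurable lborel" by simp
    show "AE z in lborel. A z * (\<integral>y. (if y \<le> z then B y else 0) \<partial>lborel) = (A z)\<^sup>2 - l * A z"
      using AB
    proof eventually_elim
      case (elim z)
      show ?case
      proof (cases "z \<in> {-1<..<1}")
        case True
        then have "(\<integral>y. (if y \<le> z then B y else 0) \<partial>lborel) = A z - l" using elim by simp
        then show ?thesis by (simp only: power2_eq_square right_diff_distrib mult.commute)
      next
        case False
        then show ?thesis using out(1)[of z] by simp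
      qed
    qed
  qed measurable
  also have "\<dots> = (\<integral>z. (A z)\<^sup>2 \<partial>lborel)" using A A2 A0 by simp
  finally show "(\<integral>z. W z * B z \<partial>lborel) = - (\<integral>z. (A z)\<^sup>2 \<partial>lborel)" .
qed

text \<open>Twice z times the integral is m(x1)^2 - m(x0)^2 for the continuous representative m = k
  + P of z W. The inflow condition removes the end with the unfavourable sign: x0 for z > 0, x1 for
  z < 0.\<close>

lemma energy_x_slice:
  fixes B W :: "real \<Rightarrow> real"
  assumes B: "integrable lborel B" and x: "x0 < x1" and z: "z \<noteq> 0"
    and out: "\<And>x. x \<notin> {x0<..<x1} \<Longrightarrow> B x = 0"
    and W: "AE x in lborel. x \<in> {x0<..<x1} \<longrightarrow> z * W x = k + (\<integral>y. (if y \<le> x then B y else 0) \<partial>lborel)"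
    and tr: "\<And>m. continuous_on UNIV m \<Longrightarrow> AE x in lborel. x \<in> {x0<..<x1} \<longrightarrow> z * W x = m x \<Longrightarrow> (z > 0 \<longrightarrow> m x0 = 0) \<and> (z < 0 \<longrightarrow> m x1 = 0)"
    and [measurable]: "W \<in> borel_measurable borel"
  shows "(\<integral>x. W x * B x \<partial>lborel) \<ge> 0"
proof -
  have [measurable]: "B \<in> borel_measurable borel" using B by auto
  define I where "I = integral\<^sup>L lborel B"
  define P where "P x = (\<integral>y. (if y \<le> x then B y else 0) \<partial>lborel)" for x
  have P: "continuous_on UNIV P" unfolding P_def by (rule continuous_indefinite_integral[OF B])
  have Pmeas [measurable]: "P \<in> borel_measurable borel" by (rule borel_measurable_continuous_onI[OF P])
  have P0: "P x0 = 0"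
  proof -
    have "(\<lambda>y. if y \<le> x0 then B y else 0) = (\<lambda>y. 0)" using out by fastforce
    then show ?thesis by (simp add: P_def)
  qed
  have P1: "P x1 = I" unfolding P_def I_def
    by (intro Bochner_Integration.integral_cong refl) (use out in auto)
  have "continuous_on UNIV (\<lambda>x. k + P x)" by (intro continuous_intros P)
  then have kt: "(z > 0 \<longrightarrow> k = 0) \<and> (z < 0 \<longrightarrow> k + I = 0)"
    using tr[of "\<lambda>x. k + P x"] W P0 P1 by (simp add: P_def)
  have iBP: "integrable lborel (\<lambda>x. B x * P x)" unfolding P_def by (rule indefinite_integral_by_parts(2)[OF B B])
  have "z * (\<integral>x. W x * B x \<partial>lborel) = (\<integral>x. z * (W x * B x) \<partial>lborel)" by simp
  also have "\<dots> = (\<integral>x. k * B x + B x * P x \<partial>lborel)"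
  proof (rule integral_cong_AE)
    show "AE x in lborel. z * (W x * B x) = k * B x + B x * P x"
      using W
    proof eventually_elim
      case (elim x)
      show ?case
      proof (cases "x \<in> {x0<..<x1}")
        case True
        then have "z * W x = k + P x" using elim by (simp add: P_def)
        then have "z * W x * B x = (k + P x) * B x" by simp
        then show ?thesis by (simp only: mult.assoc distrib_right mult.commute[of "P x"])
      next
        case False
        then show ?thesis using out[of x] by simp
      qed
    qed
  qed measurable
  also have "\<dots> = k * I + (\<integral>x. B x * P x \<partial>lborel)" using B iBP by (simp add: I_def)
  \<comment> \<open>This is \<open>indefinite_integral_by_parts\<close> with both functions equal to
    B.\<close>
  also have "(\<integral>x. B x * P x \<partial>lborel) = I * I / 2"
    using indefinite_integral_by_parts(1)[OF B B] by (simp add: P_def I_def)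
  finally have e: "z * (\<integral>x. W x * B x \<partial>lborel) = k * I + I * I / 2" .
  show ?thesis
  proof (cases "z > 0")
    case True
    then have "k * I + I * I / 2 \<ge> 0" using kt by simp
    then have "z * (\<integral>x. W x * B x \<partial>lborel) \<ge> 0" unfolding e .
    then show ?thesis using True by (simp add: zero_le_mult_iff)
  next
    case False
    then have zn: "z < 0" using z by simp
    then have "k = - I" using kt by simp
    then have "k * I + I * I / 2 = - (I * I) / 2" by (simp add: field_simps)
    then have "k * I + I * I / 2 \<le> 0" using zero_le_square[of I] by linarith
    then have "z * (\<integral>x. W x * B x \<partial>lborel) \<le> 0" unfolding e .
    then show ?thesis using zn by (simp add: mult_le_0_iff)
  qed
qed

lemma borel_measurable_slices:
  fixes h :: "real \<times> real \<Rightarrow> real"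
  assumes "h \<in> borel_measurable borel"
  shows "(\<lambda>z. h (x, z)) \<in> borel_measurable borel" "(\<lambda>x. h (x, z)) \<in> borel_measurable borel"
proof -
  have "(\<lambda>z. (x, z)) \<in> borel \<rightarrow>\<^sub>M borel" "(\<lambda>x. (x, z)) \<in> borel \<rightarrow>\<^sub>M borel"
    by (intro borel_measurable_continuous_onI continuous_intros)+
  from measurable_compose[OF this(1) assms] measurable_compose[OF this(2) assms]
  show "(\<lambda>z. h (x, z)) \<in> borel_measurable borel" "(\<lambda>x. h (x, z)) \<in> borel_measurable borel" .
qed

lemma Omega_eq_box: "Omega x0 x1 = box (x0, -1) (x1, 1)"
  by (auto simp: Omega_def box_def Basis_prod_def)

lemma Omega_open [simp]: "open (Omega x0 x1)"
  unfolding Omega_eq_box by (rule open_box)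

lemma Omega_borel [measurable]: "Omega x0 x1 \<in> sets borel"
  by (intro borel_open Omega_open)

text \<open>The three functions are Borel and vanish outside the domain, so slices are measurable
  and integrals run over the whole line. A is the weak z-derivative of W; B enters twice, as
  z-derivative of A and as x-derivative of z W, which encodes the homogeneous equation.\<close>

lemma homogeneous_solution_zero:
  fixes W A B :: "real \<times> real \<Rightarrow> real"
  assumes x: "x0 < x1"
    and meas [measurable]: "W \<in> borel_measurable borel" "A \<in> borel_measurable borel" "B \<in> borel_measurable borel"
    and sq: "integrable lborel (\<lambda>p. (W p)\<^sup>2)" "integrable lborel (\<lambda>p. (A p)\<^sup>2)" "integrable lborel (\<lambda>p. (B p)\<^sup>2)"
    and out: "\<And>p. p \<notin> Omega x0 x1 \<Longrightarrow> W p = 0" "\<And>p. p \<notin> Omega x0 x1 \<Longrightarrow> A p = 0" "\<And>p. p \<notin> Omega x0 x1 \<Longrightarrow> B p = 0"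
    and wz: "\<And>\<alpha> \<beta> \<beta>'. tf1 x0 x1 \<alpha> \<Longrightarrow> tf1 (-1) 1 \<beta> \<Longrightarrow> tf1 (-1) 1 \<beta>' \<Longrightarrow> (\<And>x. (\<beta> has_real_derivative \<beta>' x) (at x)) \<Longrightarrow>
      (\<integral>p. W p * (\<alpha> (fst p) * \<beta>' (snd p)) \<partial>lborel) = - (\<integral>p. A p * (\<alpha> (fst p) * \<beta> (snd p)) \<partial>lborel)"
    and wzz: "\<And>\<alpha> \<beta> \<beta>'. tf1 x0 x1 \<alpha> \<Longrightarrow> tf1 (-1) 1 \<beta> \<Longrightarrow> tf1 (-1) 1 \<beta>' \<Longrightarrow> (\<And>x. (\<beta> has_real_derivative \<beta>' x) (at x)) \<Longrightarrow>
      (\<integral>p. A p * (\<alpha> (fst p) * \<beta>' (snd p)) \<partial>lborel) = - (\<integral>p. B p * (\<alpha> (fst p) * \<beta> (snd p)) \<partial>lborel)"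
    and wx: "\<And>\<alpha> \<alpha>' \<beta>. tf1 x0 x1 \<alpha> \<Longrightarrow> tf1 x0 x1 \<alpha>' \<Longrightarrow> (\<And>x. (\<alpha> has_real_derivative \<alpha>' x) (at x)) \<Longrightarrow> tf1 (-1) 1 \<beta> \<Longrightarrow>
      (\<integral>p. (snd p * W p) * (\<alpha>' (fst p) * \<beta> (snd p)) \<partial>lborel) = - (\<integral>p. B p * (\<alpha> (fst p) * \<beta> (snd p)) \<partial>lborel)"
    and s0: "((\<lambda>h. 1 / h * (\<integral>p. indicator ({x0<..<x0+h} \<times> {0<..<1}) p * (\<bar>snd p\<bar> * (W p)\<^sup>2) \<partial>lborel)) \<longlongrightarrow> 0) (at_right 0)"
    and s1: "((\<lambda>h. 1 / h * (\<integral>p. indicator ({x1-h<..<x1} \<times> {-1<..<0}) p * (\<bar>snd p\<bar> * (W p)\<^sup>2) \<partial>lborel)) \<longlongrightarrow> 0) (at_right 0)"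
    and tb: "AE x in lborel. x \<in> {x0<..<x1} \<longrightarrow> (\<exists>g. continuous_on {-1..1} g \<and> g (-1) = 0 \<and> g 1 = 0 \<and>
       (AE z in lborel. z \<in> {-1<..<1} \<longrightarrow> W (x, z) = g z))"
  shows "AE p in lborel. W p = 0"
proof -
  have fin: "emeasure lborel (Omega x0 x1) < \<infinity>" unfolding Omega_eq_box by (rule emeasure_lborel_box_finite)
  have iW: "integrable lborel W" by (rule integrable_of_square_on_bounded[OF meas(1) sq(1) Omega_borel fin out(1)])
  have iA: "integrable lborel A" by (rule integrable_of_square_on_bounded[OF meas(2) sq(2) Omega_borel fin out(2)])
  have iB: "integrable lborel B" by (rule integrable_of_square_on_bounded[OF meas(3) sq(3) Omega_borel fin out(3)])
  have iWB: "integrable lborel (\<lambda>p. W p * B p)" by (rule integrable_mult_of_squares) (use sq in auto)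
  note outW = out(1)[unfolded Omega_def] and outA = out(2)[unfolded Omega_def] and outB = out(3)[unfolded Omega_def]
  have sl1: "AE x in lborel. integrable lborel (\<lambda>z. A (x, z)) \<and> (x \<in> {x0<..<x1} \<longrightarrow>
     (\<exists>k. AE z in lborel. z \<in> {-1<..<1} \<longrightarrow> W (x, z) = k + (\<integral>y. (if y \<le> z then A (x, y) else 0) \<partial>lborel)))"
    by (rule weak_deriv_slices[OF _ iW iA outW wz]) auto
  have sl2: "AE x in lborel. integrable lborel (\<lambda>z. B (x, z)) \<and> (x \<in> {x0<..<x1} \<longrightarrow>
     (\<exists>k. AE z in lborel. z \<in> {-1<..<1} \<longrightarrow> A (x, z) = k + (\<integral>y. (if y \<le> z then B (x, y) else 0) \<partial>lborel)))"
    by (rule weak_deriv_slices[OF _ iA iB outA wzz]) auto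
  have slz: "AE x in lborel. (\<integral>z. W (x, z) * B (x, z) \<partial>lborel) = - (\<integral>z. (A (x, z))\<^sup>2 \<partial>lborel) \<and>
     (x \<in> {x0<..<x1} \<longrightarrow> (AE z in lborel. z \<in> {-1<..<1} \<longrightarrow> W (x, z) = (\<integral>y. (if y \<le> z then A (x, y) else 0) \<partial>lborel)))"
    using sl1 sl2 integral_iterated(3)[OF sq(2)] tb
  proof eventually_elim
    case (elim x)
    show ?case
    proof (cases "x \<in> {x0<..<x1}")
      case True
      obtain k where k: "AE z in lborel. z \<in> {-1<..<1} \<longrightarrow> W (x, z) = k + (\<integral>y. (if y \<le> z then A (x, y) else 0) \<partial>lborel)"
        using elim(1) True by blast
      obtain l where l: "AE z in lborel. z \<in> {-1<..<1} \<longrightarrow> A (x, z) = l + (\<integral>y. (if y \<le> z then B (x, y) else 0) \<partial>lborel)"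
        using elim(2) True by blast
      obtain g where g: "continuous_on {-1..1} g" "g (-1) = 0" "g 1 = 0" "AE z in lborel. z \<in> {-1<..<1} \<longrightarrow> W (x, z) = g z"
        using elim(4) True by blast
      have oA: "A (x, z) = 0" if "z \<notin> {-1<..<1}" for z by (rule outA) (use that in auto)
      have oB: "B (x, z) = 0" if "z \<notin> {-1<..<1}" for z by (rule outB) (use that in auto)
      note E = energy_z_slice[OF conjunct1[OF elim(1)] conjunct1[OF elim(2)] elim(3) oA oB k l g borel_measurable_slices(1)[OF meas(1)]]
      show ?thesis using E by blast
    next
      case False
      then have "A (x, z) = 0" "B (x, z) = 0" for z using outA[of "(x, z)"] outB[of "(x, z)"] by auto
      then show ?thesis using False by auto
    qed
  qed
  have "(\<integral>p. W p * B p \<partial>lborel) = (\<integral>x. (\<integral>z. W (x, z) * B (x, z) \<partial>lborel) \<partial>lborel)"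
    by (rule integral_iterated(1)[OF iWB])
  also have "\<dots> = (\<integral>x. - (\<integral>z. (A (x, z))\<^sup>2 \<partial>lborel) \<partial>lborel)"
  proof (rule integral_cong_AE)
    show "(\<lambda>x. \<integral>z. W (x, z) * B (x, z) \<partial>lborel) \<in> borel_measurable lborel" using integral_iterated(2)[OF iWB] by auto
    show "(\<lambda>x. - (\<integral>z. (A (x, z))\<^sup>2 \<partial>lborel)) \<in> borel_measurable lborel" using integral_iterated(2)[OF sq(2)] by auto
    show "AE x in lborel. (\<integral>z. W (x, z) * B (x, z) \<partial>lborel) = - (\<integral>z. (A (x, z))\<^sup>2 \<partial>lborel)"
      using slz by eventually_elim blast
  qed
  also have "\<dots> = - (\<integral>p. (A p)\<^sup>2 \<partial>lborel)" using integral_iterated(1)[OF sq(2)] by simp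
  finally have neg: "(\<integral>p. W p * B p \<partial>lborel) = - (\<integral>p. (A p)\<^sup>2 \<partial>lborel)" .

  define zW where "zW p = snd p * W p" for p :: "real \<times> real"
  have zW_meas [measurable]: "zW \<in> borel_measurable borel" unfolding zW_def by measurable
  have izW: "integrable lborel zW"
  proof (rule Bochner_Integration.integrable_bound[OF iW])
    show "AE p in lborel. norm (zW p) \<le> norm (W p)"
    proof (rule AE_I2)
      fix p
      show "norm (zW p) \<le> norm (W p)"
      proof (cases "p \<in> Omega x0 x1")
        case True
        then have "\<bar>snd p\<bar> \<le> 1" by (auto simp: Omega_def)
        then have "\<bar>snd p\<bar> * \<bar>W p\<bar> \<le> 1 * \<bar>W p\<bar>" by (intro mult_right_mono) auto
        then show ?thesis by (simp add: zW_def abs_mult)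
      next
        case False
        then show ?thesis using out(1)[OF False] by (simp add: zW_def)
      qed
    qed
  qed simp
  \<comment> \<open>\<open>weak_deriv_slices\<close> concerns derivatives in the second variable, so
    the coordinates are exchanged to use it in x.\<close>
  have slx: "AE z in lborel. integrable lborel (\<lambda>x. B (snd (z, x), fst (z, x))) \<and> (z \<in> {-1<..<1} \<longrightarrow>
     (\<exists>k. AE x in lborel. x \<in> {x0<..<x1} \<longrightarrow> zW (snd (z, x), fst (z, x)) = k + (\<integral>y. (if y \<le> x then B (snd (z, y), fst (z, y)) else 0) \<partial>lborel)))"
  proof (rule weak_deriv_slices[OF x, where F = "\<lambda>q. zW (snd q, fst q)" and g = "\<lambda>q. B (snd q, fst q)"])
    show "integrable lborel (\<lambda>q. zW (snd q, fst q))" by (rule lborel_swap(2)[OF zW_meas izW])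
    show "integrable lborel (\<lambda>q. B (snd q, fst q))" by (rule lborel_swap(2)[OF meas(3) iB])
    show "zW (snd q, fst q) = 0" if "q \<notin> {-1<..<1} \<times> {x0<..<x1}" for q
    proof -
      have "(snd q, fst q) \<notin> Omega x0 x1" using that by (cases q) (auto simp: Omega_def)
      then show ?thesis using out(1) by (simp add: zW_def)
    qed
    fix \<alpha> \<beta> \<beta>' assume a: "tf1 (-1) 1 \<alpha>" and b: "tf1 x0 x1 \<beta>" and b': "tf1 x0 x1 \<beta>'" and der: "\<And>x. (\<beta> has_real_derivative \<beta>' x) (at x)"
    have m: "(\<lambda>p. zW p * (\<beta>' (fst p) * \<alpha> (snd p))) \<in> borel_measurable borel" using integrable_mult_tensor[OF izW b' a] by auto
    have m': "(\<lambda>p. B p * (\<beta> (fst p) * \<alpha> (snd p))) \<in> borel_measurable borel" using integrable_mult_tensor[OF iB b a] by auto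
    have "(\<integral>q. zW (snd q, fst q) * (\<alpha> (fst q) * \<beta>' (snd q)) \<partial>lborel) = (\<integral>p. zW p * (\<beta>' (fst p) * \<alpha> (snd p)) \<partial>lborel)"
      using lborel_swap(1)[OF m] by (simp add: mult.commute[of "\<alpha> _"])
    also have "\<dots> = - (\<integral>p. B p * (\<beta> (fst p) * \<alpha> (snd p)) \<partial>lborel)" unfolding zW_def by (rule wx[OF b b' der a])
    also have "(\<integral>p. B p * (\<beta> (fst p) * \<alpha> (snd p)) \<partial>lborel) = (\<integral>q. B (snd q, fst q) * (\<alpha> (fst q) * \<beta> (snd q)) \<partial>lborel)"
      using lborel_swap(1)[OF m'] by (simp add: mult.commute[of "\<alpha> _"])
    finally show "(\<integral>q. zW (snd q, fst q) * (\<alpha> (fst q) * \<beta>' (snd q)) \<partial>lborel) = - (\<integral>q. B (snd q, fst q) * (\<alpha> (fst q) * \<beta> (snd q)) \<partial>lborel)" .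
  qed
  \<comment> \<open>A sequence of widths, as Fatou's lemma asks for; starting from x1 - x0 keeps all
    strips inside the domain.\<close>
  define h where "h n = (x1 - x0) / real (Suc n)" for n
  have h: "h n > 0" "h n \<le> x1 - x0" for n
  proof -
    show "h n > 0" using x by (simp add: h_def)
    show "h n \<le> x1 - x0" unfolding h_def using x by (simp add: divide_le_eq mult_le_cancel_left1)
  qed
  have h0: "h \<longlonglongrightarrow> 0"
    unfolding h_def using tendsto_mult[OF tendsto_const[of "x1 - x0"] LIMSEQ_Suc[OF lim_1_over_n]] by simp
  have hr: "filterlim h (at_right 0) sequentially" unfolding filterlim_at using h0 h(1) by (auto simp: less_imp_neq[symmetric])
  have t0: "AE z in lborel. z \<in> {0<..<1} \<and> z \<noteq> 0 \<longrightarrow>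
    (\<forall>m. continuous_on UNIV m \<longrightarrow> (AE x in lborel. x \<in> {x0<..<x1} \<longrightarrow> z * W (x, z) = m x) \<longrightarrow> m x0 = 0)"
  proof (rule trace_zero_slices[OF meas(1) _ sq(1), where a = "\<lambda>n. x0" and b = "\<lambda>n. x0 + h n"])
    show "(\<lambda>n. x0 + h n) \<longlonglongrightarrow> x0" using tendsto_add[OF tendsto_const[of x0] h0] by simp
    show "(\<lambda>n. 1 / (x0 + h n - x0) * (\<integral>p. indicator ({x0<..<x0 + h n} \<times> {0<..<1}) p * (\<bar>snd p\<bar> * (W p)\<^sup>2) \<partial>lborel)) \<longlonglongrightarrow> 0"
      using filterlim_compose[OF s0 hr] by simp
    show "x0 + h n \<le> x1" for n using h(2)[of n] by simp
  qed (use h(1) in auto)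
  have t1: "AE z in lborel. z \<in> {-1<..<0} \<and> z \<noteq> 0 \<longrightarrow>
    (\<forall>m. continuous_on UNIV m \<longrightarrow> (AE x in lborel. x \<in> {x0<..<x1} \<longrightarrow> z * W (x, z) = m x) \<longrightarrow> m x1 = 0)"
  proof (rule trace_zero_slices[OF meas(1) _ sq(1), where a = "\<lambda>n. x1 - h n" and b = "\<lambda>n. x1"])
    show "(\<lambda>n. x1 - h n) \<longlonglongrightarrow> x1" using tendsto_diff[OF tendsto_const[of x1] h0] by simp
    show "(\<lambda>n. 1 / (x1 - (x1 - h n)) * (\<integral>p. indicator ({x1 - h n<..<x1} \<times> {-1<..<0}) p * (\<bar>snd p\<bar> * (W p)\<^sup>2) \<partial>lborel)) \<longlonglongrightarrow> 0"
      using filterlim_compose[OF s1 hr] by simp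
    show "x0 \<le> x1 - h n" for n using h(2)[of n] by simp
  qed (use h(1) in auto)
  have "AE z in lborel. (\<integral>x. W (x, z) * B (x, z) \<partial>lborel) \<ge> 0"
    using slx t0 t1 AE_lborel_singleton[of 0]
  proof eventually_elim
    case (elim z)
    show ?case
    proof (cases "z \<in> {-1<..<1}")
      case True
      obtain k where k: "AE x in lborel. x \<in> {x0<..<x1} \<longrightarrow> z * W (x, z) = k + (\<integral>y. (if y \<le> x then B (y, z) else 0) \<partial>lborel)"
        using elim(1) True unfolding zW_def fst_conv snd_conv by blast
      have oB: "B (x, z) = 0" if "x \<notin> {x0<..<x1}" for x by (rule outB) (use that in auto)
      have "(z > 0 \<longrightarrow> m x0 = 0) \<and> (z < 0 \<longrightarrow> m x1 = 0)"
        if "continuous_on UNIV m" "AE x in lborel. x \<in> {x0<..<x1} \<longrightarrow> z * W (x, z) = m x" for m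
        using elim(2,3) True that by auto
      then show ?thesis
        using energy_x_slice[OF _ x elim(4) oB k _ borel_measurable_slices(2)[OF meas(1)]] elim(1) by simp
    next
      case False
      then have "B (x, z) = 0" for x using outB[of "(x, z)"] by auto
      then show ?thesis by simp
    qed
  qed
  then have "(\<integral>z. (\<integral>x. W (x, z) * B (x, z) \<partial>lborel) \<partial>lborel) \<ge> 0" by (rule integral_nonneg_AE)
  moreover have "(\<integral>z. (\<integral>x. W (x, z) * B (x, z) \<partial>lborel) \<partial>lborel) = (\<integral>p. W p * B p \<partial>lborel)"
    using lborel_pair.integral_snd[of "\<lambda>x z. W (x, z) * B (x, z)"] iWB by (simp add: lborel_prod case_prod_unfold)
  \<comment> \<open>The two evaluations of the integral of W B have opposite signs, so the norm of A
    is zero.\<close>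
  ultimately have "(\<integral>p. (A p)\<^sup>2 \<partial>lborel) = 0" using neg integral_nonneg_AE[of "\<lambda>p. (A p)\<^sup>2" lborel] by fastforce
  then have "AE p in lborel. (A p)\<^sup>2 = 0" by (subst (asm) integral_nonneg_eq_0_iff_AE[OF sq(2)]) auto
  from AE_slices[OF this] slz
  have "AE x in lborel. AE z in lborel. W (x, z) = 0"
  proof eventually_elim
    case (elim x)
    show ?case
    proof (cases "x \<in> {x0<..<x1}")
      case True
      have "(\<integral>y. (if y \<le> z then A (x, y) else 0) \<partial>lborel) = 0" for z
      proof (rule integral_eq_zero_AE)
        show "AE y in lborel. (if y \<le> z then A (x, y) else 0) = 0" using elim(1) by eventually_elim simp
      qed
      then have "AE z in lborel. z \<in> {-1<..<1} \<longrightarrow> W (x, z) = 0" using elim(2) True by simp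
      then show ?thesis
      proof eventually_elim
        case (elim z)
        then show ?case using outW[of "(x, z)"] by auto
      qed
    next
      case False
      then show ?thesis using outW by auto
    qed
  qed
  moreover have "{p \<in> space (lborel \<Otimes>\<^sub>M lborel). W p = 0} \<in> sets (lborel \<Otimes>\<^sub>M lborel)"
    unfolding lborel_prod by measurable
  ultimately have "AE p in lborel \<Otimes>\<^sub>M lborel. W p = 0" by (intro lborel_pair.AE_pair_measure) auto
  then show ?thesis unfolding lborel_prod .
qed

section \<open>Reduction of uniqueness to Borel representatives\<close>

lemma L2_on_diff_borel:
  assumes u: "L2_on (Omega x0 x1) u" and v: "L2_on (Omega x0 x1) v"
  obtains W where "W \<in> borel_measurable borel" "integrable lborel (\<lambda>p. (W p)\<^sup>2)"
    "\<And>p. p \<notin> Omega x0 x1 \<Longrightarrow> W p = 0" "AE p in lborel. p \<in> Omega x0 x1 \<longrightarrow> v p - u p = W p"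
proof -
  let ?Om = "Omega x0 x1"
  define W0 where "W0 p = indicator ?Om p * v p - indicator ?Om p * u p" for p
  have mu: "(\<lambda>p. indicator ?Om p * u p) \<in> borel_measurable lebesgue" and mv: "(\<lambda>p. indicator ?Om p * v p) \<in> borel_measurable lebesgue"
    using u v by (auto simp: L2_on_def)
  have m0: "W0 \<in> borel_measurable lebesgue" unfolding W0_def using mu mv by measurable
  have "integrable lebesgue (\<lambda>p. (W0 p)\<^sup>2)"
  proof (rule Bochner_Integration.integrable_bound)
    show "integrable lebesgue (\<lambda>p. 2 * (indicator ?Om p * (v p)\<^sup>2) + 2 * (indicator ?Om p * (u p)\<^sup>2))"
      using u v by (auto simp: L2_on_def)
    show "(\<lambda>p. (W0 p)\<^sup>2) \<in> borel_measurable lebesgue" using m0 by measurable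
    show "AE p in lebesgue. norm ((W0 p)\<^sup>2) \<le> norm (2 * (indicator ?Om p * (v p)\<^sup>2) + 2 * (indicator ?Om p * (u p)\<^sup>2))"
    proof (rule AE_I2)
      fix p
      have "(v p - u p)\<^sup>2 \<le> 2 * (v p)\<^sup>2 + 2 * (u p)\<^sup>2"
        using zero_le_power2[of "v p + u p"] by (simp add: power2_eq_square algebra_simps)
      then show "norm ((W0 p)\<^sup>2) \<le> norm (2 * (indicator ?Om p * (v p)\<^sup>2) + 2 * (indicator ?Om p * (u p)\<^sup>2))"
        by (simp add: W0_def indicator_def)
    qed
  qed
  note i0 = this
  \<comment> \<open>Slices of a Lebesgue measurable function need not be measurable; a Borel
    function that agrees with it almost everywhere avoids this.\<close>
  obtain W1 where W1: "W1 \<in> borel_measurable lborel" "AE p in lborel. W0 p = W1 p"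
    using completion_ex_borel_measurable_real[OF m0] by auto
  define W where "W p = indicator ?Om p * W1 p" for p
  have mW: "W \<in> borel_measurable borel" unfolding W_def using W1(1) Omega_borel[of x0 x1] by measurable
  have ae: "AE p in lborel. W0 p = W p" using W1(2) by eventually_elim (auto simp: W_def W0_def indicator_def)
  have "integrable lebesgue (\<lambda>p. (W p)\<^sup>2)"
  proof (rule integrable_cong_AE_imp[OF i0])
    show "(\<lambda>p. (W p)\<^sup>2) \<in> borel_measurable lebesgue" using mW by (intro measurable_completion) simp
    show "AE p in lebesgue. (W0 p)\<^sup>2 = (W p)\<^sup>2" using AE_completion[OF ae] by eventually_elim simp
  qed
  then have "integrable lborel (\<lambda>p. (W p)\<^sup>2)" using mW by (subst (asm) integrable_completion) auto
  moreover have "AE p in lborel. p \<in> ?Om \<longrightarrow> v p - u p = W p" using ae by eventually_elim (auto simp: W0_def)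
  ultimately show ?thesis using mW by (intro that[of W]) (auto simp: W_def)
qed

text \<open>The means of subtracting two weak identities, one for each solution: the result is
  expressed through the Borel representative of the difference.\<close>

lemma set_integral_diff_borel:
  fixes u v W \<psi> :: "real \<times> real \<Rightarrow> real"
  assumes W: "W \<in> borel_measurable borel" "\<And>p. p \<notin> Om \<Longrightarrow> W p = 0" "AE p in lborel. p \<in> Om \<longrightarrow> v p - u p = W p"
    and \<psi>: "\<psi> \<in> borel_measurable borel"
    and i: "set_integrable lebesgue Om (\<lambda>p. u p * \<psi> p)" "set_integrable lebesgue Om (\<lambda>p. v p * \<psi> p)"
  shows "(LINT p:Om|lebesgue. v p * \<psi> p) - (LINT p:Om|lebesgue. u p * \<psi> p) = (\<integral>p. W p * \<psi> p \<partial>lborel)"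
proof -
  have i': "set_integrable lebesgue Om (\<lambda>p. v p * \<psi> p - u p * \<psi> p)" by (rule set_integral_diff(1)[OF i(2,1)])
  have "(LINT p:Om|lebesgue. v p * \<psi> p) - (LINT p:Om|lebesgue. u p * \<psi> p) = (LINT p:Om|lebesgue. v p * \<psi> p - u p * \<psi> p)"
    by (rule set_integral_diff(2)[OF i(2,1), symmetric])
  also have "\<dots> = (\<integral>p. W p * \<psi> p \<partial>lebesgue)"
    unfolding set_lebesgue_integral_def
  proof (rule integral_cong_AE)
    show "(\<lambda>p. indicator Om p *\<^sub>R (v p * \<psi> p - u p * \<psi> p)) \<in> borel_measurable lebesgue"
      using i' by (auto simp: set_integrable_def)
    show "(\<lambda>p. W p * \<psi> p) \<in> borel_measurable lebesgue" using W(1) \<psi> by (intro measurable_completion) simp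
    show "AE p in lebesgue. indicator Om p *\<^sub>R (v p * \<psi> p - u p * \<psi> p) = W p * \<psi> p"
      using AE_completion[OF W(3)]
    proof eventually_elim
      case (elim p)
      show ?case
      proof (cases "p \<in> Om")
        case True
        then have "W p = v p - u p" using elim by simp
        then show ?thesis using True by (simp add: left_diff_distrib)
      next
        case False
        then show ?thesis using W(2)[OF False] by simp
      qed
    qed
  qed
  also have "\<dots> = (\<integral>p. W p * \<psi> p \<partial>lborel)" by (rule integral_completion) (use W(1) \<psi> in simp)
  finally show ?thesis .
qed

lemma tensor_partials:
  assumes "\<And>x. (\<alpha> has_real_derivative \<alpha>' x) (at x)" "\<And>x. (\<beta> has_real_derivative \<beta>' x) (at x)"
  shows "dx (\<lambda>p. \<alpha> (fst p) * \<beta> (snd p)) = (\<lambda>p. \<alpha>' (fst p) * \<beta> (snd p))"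
    "dz (\<lambda>p. \<alpha> (fst p) * \<beta> (snd p)) = (\<lambda>p. \<alpha> (fst p) * \<beta>' (snd p))"
proof -
  show "dx (\<lambda>p. \<alpha> (fst p) * \<beta> (snd p)) = (\<lambda>p. \<alpha>' (fst p) * \<beta> (snd p))"
    unfolding dx_def fst_conv snd_conv by (intro ext DERIV_imp_deriv DERIV_cmult_right assms)
  show "dz (\<lambda>p. \<alpha> (fst p) * \<beta> (snd p)) = (\<lambda>p. \<alpha> (fst p) * \<beta>' (snd p))"
    unfolding dz_def fst_conv snd_conv by (intro ext DERIV_imp_deriv DERIV_cmult assms)
qed

lemma tf1_deriv:
  assumes "tf1 a b \<phi>" obtains \<phi>' where "\<And>x. (\<phi> has_real_derivative \<phi>' x) (at x)"
proof -
  have "Cn_on (Suc 0) UNIV \<phi>" using assms unfolding tf1_def by blast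
  then show ?thesis using that by auto
qed

text \<open>This follows from (v - u)^2 <= 2 v^2 + 2 u^2. The bound h0 keeps the strips inside the
  domain, where |z| <= 1 makes the weighted integrals finite.\<close>

lemma trace_zero_diff:
  assumes u: "L2_on Om u" and v: "L2_on Om v" and h0: "h0 > 0"
    and R: "\<And>h. 0 < h \<Longrightarrow> h < h0 \<Longrightarrow> R h \<subseteq> Om" "\<And>h. R h \<in> sets borel" and z: "\<And>p. p \<in> Om \<Longrightarrow> \<bar>snd p\<bar> \<le> 1"
    and W: "W \<in> borel_measurable borel" "AE p in lborel. p \<in> Om \<longrightarrow> v p - u p = W p"
    and tu: "((\<lambda>h. (1 / h) * (LINT p:R h|lebesgue. \<bar>snd p\<bar> * (u p)\<^sup>2)) \<longlongrightarrow> 0) (at_right 0)"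
    and tv: "((\<lambda>h. (1 / h) * (LINT p:R h|lebesgue. \<bar>snd p\<bar> * (v p)\<^sup>2)) \<longlongrightarrow> 0) (at_right 0)"
  shows "((\<lambda>h. 1 / h * (\<integral>p. indicator (R h) p * (\<bar>snd p\<bar> * (W p)\<^sup>2) \<partial>lborel)) \<longlongrightarrow> 0) (at_right 0)"
proof (rule tendsto_sandwich)
  have int: "integrable lebesgue (\<lambda>p. indicator (R h) p * (\<bar>snd p\<bar> * (w p)\<^sup>2))" if h: "0 < h" "h < h0" and w: "L2_on Om w" for h w
  proof (rule Bochner_Integration.integrable_bound)
    show "integrable lebesgue (\<lambda>p. indicator Om p * (w p)\<^sup>2)" using w by (simp add: L2_on_def)
    have ww: "(\<lambda>p. indicator Om p * w p) \<in> borel_measurable lebesgue" using w by (simp add: L2_on_def)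
    have m1: "(\<lambda>p. indicator (R h) p * \<bar>snd p\<bar>) \<in> borel_measurable lebesgue"
      using R(2)[of h] by (intro measurable_completion) simp
    have "indicator (R h) p * (\<bar>snd p\<bar> * (w p)\<^sup>2) = (indicator (R h) p * \<bar>snd p\<bar>) * (indicator Om p * w p)\<^sup>2" for p
      using R(1)[OF h] by (auto simp: indicator_def)
    then have "(\<lambda>p. indicator (R h) p * (\<bar>snd p\<bar> * (w p)\<^sup>2)) = (\<lambda>p. (indicator (R h) p * \<bar>snd p\<bar>) * (indicator Om p * w p)\<^sup>2)"
      by (rule ext)
    then show "(\<lambda>p. indicator (R h) p * (\<bar>snd p\<bar> * (w p)\<^sup>2)) \<in> borel_measurable lebesgue"
      using borel_measurable_times[OF m1 borel_measurable_power[OF ww, of 2]] by (simp only:)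
    show "AE p in lebesgue. norm (indicator (R h) p * (\<bar>snd p\<bar> * (w p)\<^sup>2)) \<le> norm (indicator Om p * (w p)\<^sup>2)"
    proof (rule AE_I2)
      fix p
      show "norm (indicator (R h) p * (\<bar>snd p\<bar> * (w p)\<^sup>2)) \<le> norm (indicator Om p * (w p)\<^sup>2)"
      proof (cases "p \<in> R h")
        case True
        then have p: "p \<in> Om" using R(1)[OF h] by blast
        then have "\<bar>snd p\<bar> * (w p)\<^sup>2 \<le> 1 * (w p)\<^sup>2" using z by (intro mult_right_mono) auto
        then show ?thesis using True p by simp
      qed simp
    qed
  qed
  show "\<forall>\<^sub>F h in at_right 0. 0 \<le> 1 / h * (\<integral>p. indicator (R h) p * (\<bar>snd p\<bar> * (W p)\<^sup>2) \<partial>lborel)"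
    using eventually_at_right_less[of "0::real"]
    by eventually_elim (auto intro!: mult_nonneg_nonneg integral_nonneg_AE)
  show "((\<lambda>h. 2 * ((1 / h) * (LINT p:R h|lebesgue. \<bar>snd p\<bar> * (v p)\<^sup>2)) + 2 * ((1 / h) * (LINT p:R h|lebesgue. \<bar>snd p\<bar> * (u p)\<^sup>2))) \<longlongrightarrow> 0) (at_right 0)"
    using tendsto_add[OF tendsto_mult[OF tendsto_const[of 2] tv] tendsto_mult[OF tendsto_const[of 2] tu]] by simp
  have "\<forall>\<^sub>F h in at_right 0. h < h0" using h0 by (auto simp: eventually_at_right_field)
  then show "\<forall>\<^sub>F h in at_right 0. 1 / h * (\<integral>p. indicator (R h) p * (\<bar>snd p\<bar> * (W p)\<^sup>2) \<partial>lborel) \<le>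
     2 * ((1 / h) * (LINT p:R h|lebesgue. \<bar>snd p\<bar> * (v p)\<^sup>2)) + 2 * ((1 / h) * (LINT p:R h|lebesgue. \<bar>snd p\<bar> * (u p)\<^sup>2))"
    using eventually_at_right_less[of "0::real"]
  proof eventually_elim
    case (elim h)
    have m: "(\<lambda>p. indicator (R h) p * (\<bar>snd p\<bar> * (W p)\<^sup>2)) \<in> borel_measurable borel" using W(1) R(2)[of h] by measurable
    have "(\<integral>p. indicator (R h) p * (\<bar>snd p\<bar> * (W p)\<^sup>2) \<partial>lborel) = (\<integral>p. indicator (R h) p * (\<bar>snd p\<bar> * (W p)\<^sup>2) \<partial>lebesgue)"
      by (rule integral_completion[symmetric]) (use m in simp)
    also have "\<dots> \<le> (\<integral>p. 2 * (indicator (R h) p * (\<bar>snd p\<bar> * (v p)\<^sup>2)) + 2 * (indicator (R h) p * (\<bar>snd p\<bar> * (u p)\<^sup>2)) \<partial>lebesgue)"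
    proof (rule integral_mono_AE')
      show "integrable lebesgue (\<lambda>p. 2 * (indicator (R h) p * (\<bar>snd p\<bar> * (v p)\<^sup>2)) + 2 * (indicator (R h) p * (\<bar>snd p\<bar> * (u p)\<^sup>2)))"
        using int[OF elim(2,1) u] int[OF elim(2,1) v] by simp
      show "AE p in lebesgue. indicator (R h) p * (\<bar>snd p\<bar> * (W p)\<^sup>2) \<le> 2 * (indicator (R h) p * (\<bar>snd p\<bar> * (v p)\<^sup>2)) + 2 * (indicator (R h) p * (\<bar>snd p\<bar> * (u p)\<^sup>2))"
        using AE_completion[OF W(2)]
      proof eventually_elim
        case elim2: (elim p)
        show ?case
        proof (cases "p \<in> R h")
          case True
          then have "W p = v p - u p" using elim2 R(1)[OF elim(2,1)] by auto
          moreover have "(v p - u p)\<^sup>2 \<le> 2 * (v p)\<^sup>2 + 2 * (u p)\<^sup>2"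
            using zero_le_power2[of "v p + u p"] by (simp add: power2_eq_square algebra_simps)
          ultimately have "(W p)\<^sup>2 \<le> 2 * (v p)\<^sup>2 + 2 * (u p)\<^sup>2" by simp
          then have "\<bar>snd p\<bar> * (W p)\<^sup>2 \<le> \<bar>snd p\<bar> * (2 * (v p)\<^sup>2 + 2 * (u p)\<^sup>2)" by (intro mult_left_mono) auto
          then show ?thesis using True by (simp add: algebra_simps)
        qed simp
      qed
    qed auto
    also have "\<dots> = 2 * (LINT p:R h|lebesgue. \<bar>snd p\<bar> * (v p)\<^sup>2) + 2 * (LINT p:R h|lebesgue. \<bar>snd p\<bar> * (u p)\<^sup>2)"
      using int[OF elim(2,1) u] int[OF elim(2,1) v] by (simp add: set_lebesgue_integral_def)
    finally have "(\<integral>p. indicator (R h) p * (\<bar>snd p\<bar> * (W p)\<^sup>2) \<partial>lborel) \<le> 2 * (LINT p:R h|lebesgue. \<bar>snd p\<bar> * (v p)\<^sup>2) + 2 * (LINT p:R h|lebesgue. \<bar>snd p\<bar> * (u p)\<^sup>2)" .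
    from mult_left_mono[OF this, of "1 / h"] show ?case using elim(2) by (simp add: algebra_simps)
  qed
qed simp

lemma Z0_bvp_unique:
  assumes x: "x0 < x1" and Zu: "Z0 x0 x1 u" and Su: "solves_bvp x0 x1 f u" and Zv: "Z0 x0 x1 v" and Sv: "solves_bvp x0 x1 f v"
  shows "AE p in lebesgue. p \<in> Omega x0 x1 \<longrightarrow> v p = u p"
proof -
  let ?Om = "Omega x0 x1"
  obtain gu ku where u: "L2_on ?Om u" "L2_on ?Om gu" "weak_dz ?Om u gu" "L2_on ?Om ku" "weak_dzz ?Om u ku"
    using Zu unfolding Z0_def by blast
  obtain gv kv where v: "L2_on ?Om v" "L2_on ?Om gv" "weak_dz ?Om v gv" "L2_on ?Om kv" "weak_dzz ?Om v kv"
    using Zv unfolding Z0_def by blast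
  obtain W where W: "W \<in> borel_measurable borel" "integrable lborel (\<lambda>p. (W p)\<^sup>2)"
    "\<And>p. p \<notin> ?Om \<Longrightarrow> W p = 0" "AE p in lborel. p \<in> ?Om \<longrightarrow> v p - u p = W p" using L2_on_diff_borel[OF u(1) v(1)] by blast
  obtain A where A: "A \<in> borel_measurable borel" "integrable lborel (\<lambda>p. (A p)\<^sup>2)"
    "\<And>p. p \<notin> ?Om \<Longrightarrow> A p = 0" "AE p in lborel. p \<in> ?Om \<longrightarrow> gv p - gu p = A p" using L2_on_diff_borel[OF u(2) v(2)] by blast
  obtain B where B: "B \<in> borel_measurable borel" "integrable lborel (\<lambda>p. (B p)\<^sup>2)"
    "\<And>p. p \<notin> ?Om \<Longrightarrow> B p = 0" "AE p in lborel. p \<in> ?Om \<longrightarrow> kv p - ku p = B p" using L2_on_diff_borel[OF u(4) v(4)] by blast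
  have tm: "\<phi> \<in> borel_measurable borel" if "test_fn ?Om \<phi>" for \<phi>
    using that smooth_on_continuous[of UNIV \<phi>] borel_measurable_continuous_onI by (auto simp: test_fn_def)
  have Wz: "(\<integral>p. W p * dz \<phi> p \<partial>lborel) = - (\<integral>p. A p * \<phi> p \<partial>lborel)" if t: "test_fn ?Om \<phi>" for \<phi>
  proof -
    have m: "(\<lambda>p. - dz \<phi> p) \<in> borel_measurable borel" using tm[OF test_fn_partials(2)[OF t]] by simp
    note 1 = u(3)[unfolded weak_dz_def weak_eq_def, rule_format, OF t] and 2 = v(3)[unfolded weak_dz_def weak_eq_def, rule_format, OF t]
    have "(\<integral>p. W p * - dz \<phi> p \<partial>lborel) = (\<integral>p. A p * \<phi> p \<partial>lborel)"
      using set_integral_diff_borel[OF W(1,3,4) m] set_integral_diff_borel[OF A(1,3,4) tm[OF t]] 1 2 by simp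
    then show ?thesis by simp
  qed
  have Wzz: "(\<integral>p. W p * dz (dz \<phi>) p \<partial>lborel) = (\<integral>p. B p * \<phi> p \<partial>lborel)" if t: "test_fn ?Om \<phi>" for \<phi>
  proof -
    have m: "dz (dz \<phi>) \<in> borel_measurable borel" using tm[OF test_fn_partials(2)[OF test_fn_partials(2)[OF t]]] .
    note 1 = u(5)[unfolded weak_dzz_def weak_eq_def, rule_format, OF t] and 2 = v(5)[unfolded weak_dzz_def weak_eq_def, rule_format, OF t]
    show ?thesis using set_integral_diff_borel[OF W(1,3,4) m] set_integral_diff_borel[OF B(1,3,4) tm[OF t]] 1 2 by simp
  qed
  have fin: "emeasure lborel ?Om < \<infinity>" unfolding Omega_eq_box by (rule emeasure_lborel_box_finite)
  have iW: "integrable lborel W" by (rule integrable_of_square_on_bounded[OF W(1,2) Omega_borel fin W(3)])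
  have izW: "integrable lborel (\<lambda>p. snd p * W p)"
  proof (rule Bochner_Integration.integrable_bound[OF iW])
    show "AE p in lborel. norm (snd p * W p) \<le> norm (W p)"
    proof (rule AE_I2)
      fix p
      show "norm (snd p * W p) \<le> norm (W p)"
      proof (cases "p \<in> ?Om")
        case True
        then have "\<bar>snd p\<bar> \<le> 1" by (auto simp: Omega_def)
        then have "\<bar>snd p\<bar> * \<bar>W p\<bar> \<le> 1 * \<bar>W p\<bar>" by (intro mult_right_mono) auto
        then show ?thesis by (simp add: abs_mult)
      qed (use W(3) in simp)
    qed
  qed (use W(1) in simp)
  have Wpde: "(\<integral>p. W p * (- (snd p * dx \<phi> p) - dz (dz \<phi>) p) \<partial>lborel) = 0" if t: "test_fn ?Om \<phi>" for \<phi>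
  proof -
    have m: "(\<lambda>p. - (snd p * dx \<phi> p) - dz (dz \<phi>) p) \<in> borel_measurable borel"
      using tm[OF test_fn_partials(1)[OF t]] tm[OF test_fn_partials(2)[OF test_fn_partials(2)[OF t]]] by simp
    have 1: "weak_eq ?Om u (\<lambda>\<phi> p. - (snd p * dx \<phi> p) - dz (dz \<phi>) p) f" and 2: "weak_eq ?Om v (\<lambda>\<phi> p. - (snd p * dx \<phi> p) - dz (dz \<phi>) p) f"
      using Su Sv by (auto simp: solves_bvp_def)
    show ?thesis
      using set_integral_diff_borel[OF W(1,3,4) m] 1[unfolded weak_eq_def, rule_format, OF t] 2[unfolded weak_eq_def, rule_format, OF t] by simp
  qed
  have "AE p in lborel. W p = 0"
  proof (rule homogeneous_solution_zero[OF x W(1) A(1) B(1) W(2) A(2) B(2) W(3) A(3) B(3)])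
    fix \<alpha> \<beta> \<beta>' assume a: "tf1 x0 x1 \<alpha>" and b: "tf1 (-1) 1 \<beta>" and b': "tf1 (-1) 1 \<beta>'" and der: "\<And>x. (\<beta> has_real_derivative \<beta>' x) (at x)"
    obtain \<alpha>' where a': "\<And>x. (\<alpha> has_real_derivative \<alpha>' x) (at x)" using tf1_deriv[OF a] by blast
    note dzt = tensor_partials(2)[OF a' der]
    have t: "test_fn ?Om (\<lambda>p. \<alpha> (fst p) * \<beta> (snd p))" "test_fn ?Om (\<lambda>p. \<alpha> (fst p) * \<beta>' (snd p))" using a b b' by (auto intro: test_fn_tensor)
    show "(\<integral>p. W p * (\<alpha> (fst p) * \<beta>' (snd p)) \<partial>lborel) = - (\<integral>p. A p * (\<alpha> (fst p) * \<beta> (snd p)) \<partial>lborel)"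
      using Wz[OF t(1)] unfolding dzt .
    show "(\<integral>p. A p * (\<alpha> (fst p) * \<beta>' (snd p)) \<partial>lborel) = - (\<integral>p. B p * (\<alpha> (fst p) * \<beta> (snd p)) \<partial>lborel)"
      using Wz[OF t(2)] Wzz[OF t(1)] unfolding dzt by simp
  next
    fix \<alpha> \<alpha>' \<beta> assume a: "tf1 x0 x1 \<alpha>" and a': "tf1 x0 x1 \<alpha>'" and der: "\<And>x. (\<alpha> has_real_derivative \<alpha>' x) (at x)" and b: "tf1 (-1) 1 \<beta>"
    obtain \<beta>' where b': "\<And>x. (\<beta> has_real_derivative \<beta>' x) (at x)" using tf1_deriv[OF b] by blast
    let ?\<phi> = "\<lambda>p. \<alpha> (fst p) * \<beta> (snd p)"
    have t: "test_fn ?Om ?\<phi>" using a b by (rule test_fn_tensor)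
    note dxt = tensor_partials(1)[OF der b']
    have i1: "integrable lborel (\<lambda>p. (snd p * W p) * (\<alpha>' (fst p) * \<beta> (snd p)))" by (rule integrable_mult_tensor[OF izW a' b])
    have i2: "integrable lborel (\<lambda>p. W p * dz (dz ?\<phi>) p)"
    proof -
      obtain K where K: "smooth_on UNIV (dz (dz ?\<phi>))" "compact K" "\<And>p. p \<notin> K \<Longrightarrow> dz (dz ?\<phi>) p = 0"
        using test_fn_partials(2)[OF test_fn_partials(2)[OF t]] unfolding test_fn_def by blast
      have c: "continuous_on UNIV (dz (dz ?\<phi>))" by (rule smooth_on_continuous[OF K(1)])
      have "bounded (dz (dz ?\<phi>) ` K)" by (intro compact_imp_bounded compact_continuous_image continuous_on_subset[OF c] K(2)) auto
      then obtain M where M: "\<And>p. p \<in> K \<Longrightarrow> \<bar>dz (dz ?\<phi>) p\<bar> \<le> M" unfolding bounded_iff by auto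
      have M': "\<bar>dz (dz ?\<phi>) p\<bar> \<le> \<bar>M\<bar>" for p using M[of p] K(3)[of p] by (cases "p \<in> K") auto
      have "integrable lborel (\<lambda>p. \<bar>M\<bar> * W p)" using iW by simp
      then show ?thesis
      proof (rule Bochner_Integration.integrable_bound)
        show "(\<lambda>p. W p * dz (dz ?\<phi>) p) \<in> borel_measurable lborel"
          using W(1) borel_measurable_continuous_onI[OF c] by simp
        show "AE p in lborel. norm (W p * dz (dz ?\<phi>) p) \<le> norm (\<bar>M\<bar> * W p)"
        proof (rule AE_I2)
          fix p
          have "\<bar>W p\<bar> * \<bar>dz (dz ?\<phi>) p\<bar> \<le> \<bar>W p\<bar> * \<bar>M\<bar>" by (rule mult_left_mono[OF M']) simp
          then show "norm (W p * dz (dz ?\<phi>) p) \<le> norm (\<bar>M\<bar> * W p)" by (simp add: abs_mult mult.commute)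
        qed
      qed
    qed
    \<comment> \<open>Splitting the weak equation and inserting \<open>Wzz\<close> turns it into the
      statement that z W has weak x-derivative B.\<close>
    have "(\<lambda>p. W p * (- (snd p * dx ?\<phi> p) - dz (dz ?\<phi>) p)) = (\<lambda>p. - ((snd p * W p) * (\<alpha>' (fst p) * \<beta> (snd p))) - W p * dz (dz ?\<phi>) p)"
      unfolding dxt by (simp add: algebra_simps)
    then have "(\<integral>p. - ((snd p * W p) * (\<alpha>' (fst p) * \<beta> (snd p))) - W p * dz (dz ?\<phi>) p \<partial>lborel) = 0" using Wpde[OF t] by simp
    then have "- (\<integral>p. (snd p * W p) * (\<alpha>' (fst p) * \<beta> (snd p)) \<partial>lborel) - (\<integral>p. W p * dz (dz ?\<phi>) p \<partial>lborel) = 0"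
      using i1 i2 by (simp add: Bochner_Integration.integral_diff)
    then show "(\<integral>p. (snd p * W p) * (\<alpha>' (fst p) * \<beta> (snd p)) \<partial>lborel) = - (\<integral>p. B p * (\<alpha> (fst p) * \<beta> (snd p)) \<partial>lborel)"
      using Wzz[OF t] by simp
  next
    have z: "\<bar>snd p\<bar> \<le> 1" if "p \<in> ?Om" for p using that by (auto simp: Omega_def)
    have x': "x1 - x0 > 0" using x by simp
    show "((\<lambda>h. 1 / h * (\<integral>p. indicator ({x0<..<x0+h} \<times> {0<..<1}) p * (\<bar>snd p\<bar> * (W p)\<^sup>2) \<partial>lborel)) \<longlongrightarrow> 0) (at_right 0)"
    proof (rule trace_zero_diff[OF u(1) v(1) x' _ _ z W(1,4)])
      show "{x0<..<x0+h} \<times> {0<..<1} \<subseteq> ?Om" if "0 < h" "h < x1 - x0" for h using that by (auto simp: Omega_def)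
      show "{x0<..<x0+h} \<times> {0<..<1::real} \<in> sets borel" for h by (intro borel_open open_Times) auto
    qed (use Su Sv in \<open>auto simp: solves_bvp_def trace_zero_Sigma0_def\<close>)
    show "((\<lambda>h. 1 / h * (\<integral>p. indicator ({x1-h<..<x1} \<times> {-1<..<0}) p * (\<bar>snd p\<bar> * (W p)\<^sup>2) \<partial>lborel)) \<longlongrightarrow> 0) (at_right 0)"
    proof (rule trace_zero_diff[OF u(1) v(1) x' _ _ z W(1,4)])
      show "{x1-h<..<x1} \<times> {-1<..<0} \<subseteq> ?Om" if "0 < h" "h < x1 - x0" for h using that by (auto simp: Omega_def)
      show "{x1-h<..<x1} \<times> {-1<..<0::real} \<in> sets borel" for h by (intro borel_open open_Times) auto
    qed (use Su Sv in \<open>auto simp: solves_bvp_def trace_zero_Sigma1_def\<close>)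
    have tu: "AE x in lborel. x \<in> {x0<..<x1} \<longrightarrow> (\<exists>g. continuous_on {-1..1} g \<and> g (-1) = 0 \<and> g 1 = 0 \<and>
       (AE z in lborel. z \<in> {-1<..<1} \<longrightarrow> u (x, z) = g z))"
      and tv: "AE x in lborel. x \<in> {x0<..<x1} \<longrightarrow> (\<exists>g. continuous_on {-1..1} g \<and> g (-1) = 0 \<and> g 1 = 0 \<and>
       (AE z in lborel. z \<in> {-1<..<1} \<longrightarrow> v (x, z) = g z))"
      using Su Sv by (auto simp: solves_bvp_def trace_zero_top_bottom_def)
    show "AE x in lborel. x \<in> {x0<..<x1} \<longrightarrow> (\<exists>g. continuous_on {-1..1} g \<and> g (-1) = 0 \<and> g 1 = 0 \<and>
       (AE z in lborel. z \<in> {-1<..<1} \<longrightarrow> W (x, z) = g z))"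
      using tu tv AE_slices[OF W(4)]
    proof eventually_elim
      case (elim x)
      show ?case
      proof
        assume xx: "x \<in> {x0<..<x1}"
        obtain g where g: "continuous_on {-1..1} g" "g (-1) = 0" "g 1 = 0" "AE z in lborel. z \<in> {-1<..<1} \<longrightarrow> u (x, z) = g z"
          using elim(1) xx by blast
        obtain g' where g': "continuous_on {-1..1} g'" "g' (-1) = 0" "g' 1 = 0" "AE z in lborel. z \<in> {-1<..<1} \<longrightarrow> v (x, z) = g' z"
          using elim(2) xx by blast
        have "AE z in lborel. z \<in> {-1<..<1} \<longrightarrow> W (x, z) = g' z - g z"
          using g(4) g'(4) elim(3) by eventually_elim (use xx in \<open>auto simp: Omega_def\<close>)
        then show "\<exists>g. continuous_on {-1..1} g \<and> g (-1) = 0 \<and> g 1 = 0 \<and> (AE z in lborel. z \<in> {-1<..<1} \<longrightarrow> W (x, z) = g z)"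
          using g g' by (intro exI[of _ "\<lambda>z. g' z - g z"]) (auto intro!: continuous_intros)
      qed
    qed
  qed
  then have "AE p in lborel. p \<in> ?Om \<longrightarrow> v p = u p" using W(4) by eventually_elim auto
  then show ?thesis by (rule AE_completion)
qed

subsection \<open>Square integrability of the similarity solution\<close>

text \<open>One power |t|^(-1/2) majorizes the squares of both derivatives: it is at least 1 for 0 <
  |t| < 1, and beyond it decays more slowly than |t|^(-1) and |t|^(-3).\<close>

lemma G_square_bounds:
  "\<exists>K\<ge>0. \<forall>t. (G0 t)\<^sup>2 \<le> K * (1 + \<bar>t\<bar>) \<and>
     (t \<noteq> 0 \<longrightarrow> (G1 t)\<^sup>2 \<le> K * \<bar>t\<bar> powr (-1/2) \<and> (G2 t)\<^sup>2 \<le> K * \<bar>t\<bar> powr (-1/2))"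
proof -
  obtain C where C: "\<And>t. \<bar>t\<bar> \<ge> 1 \<Longrightarrow> \<bar>G0 t\<bar> \<le> C * \<bar>t\<bar> powr (1/2)" "\<And>t. \<bar>t\<bar> \<ge> 1 \<Longrightarrow> \<bar>G1 t\<bar> \<le> C * \<bar>t\<bar> powr (-1/2)"
    "\<And>t. \<bar>t\<bar> \<ge> 1 \<Longrightarrow> \<bar>G2 t\<bar> \<le> C * \<bar>t\<bar> powr (-3/2)" using G_asymp_bounds by blast
  obtain D0 where D0: "\<And>t. t \<in> {-1..1} \<Longrightarrow> \<bar>G0 t\<bar> \<le> D0" using continuous_bounded_Icc[OF continuous_G(1), of "-1" 1] by blast
  obtain D1 where D1: "\<And>t. t \<in> {-1..1} \<Longrightarrow> \<bar>G1 t\<bar> \<le> D1" using continuous_bounded_Icc[OF continuous_G(2), of "-1" 1] by blast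
  obtain D2 where D2: "\<And>t. t \<in> {-1..1} \<Longrightarrow> \<bar>G2 t\<bar> \<le> D2" using continuous_bounded_Icc[OF continuous_G(3), of "-1" 1] by blast
  define K where "K = C\<^sup>2 + (D0\<^sup>2 + D1\<^sup>2 + D2\<^sup>2)"
  have K: "K \<ge> 0" "C\<^sup>2 \<le> K" "D0\<^sup>2 \<le> K" "D1\<^sup>2 \<le> K" "D2\<^sup>2 \<le> K"
    using zero_le_power2[of C] zero_le_power2[of D0] zero_le_power2[of D1] zero_le_power2[of D2] unfolding K_def by linarith+
  have sq: "x\<^sup>2 \<le> y\<^sup>2" if "\<bar>x\<bar> \<le> y" for x y :: real using power_mono[OF that abs_ge_zero, of 2] by simp
  have "(G0 t)\<^sup>2 \<le> K * (1 + \<bar>t\<bar>) \<and> (t \<noteq> 0 \<longrightarrow> (G1 t)\<^sup>2 \<le> K * \<bar>t\<bar> powr (-1/2) \<and> (G2 t)\<^sup>2 \<le> K * \<bar>t\<bar> powr (-1/2))" for t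
  proof (cases "\<bar>t\<bar> \<ge> 1")
    case True
    have pw: "(\<bar>t\<bar> powr a)\<^sup>2 = \<bar>t\<bar> powr (2 * a)" for a
      using True by (simp add: powr_powr powr_numeral[symmetric] mult.commute)
    have "(G0 t)\<^sup>2 \<le> C\<^sup>2 * \<bar>t\<bar>"
      using sq[OF C(1)[OF True]] pw[of "1/2"] True by (simp add: power_mult_distrib)
    also have "\<dots> \<le> K * (1 + \<bar>t\<bar>)" using K by (intro mult_mono) auto
    finally have 0: "(G0 t)\<^sup>2 \<le> K * (1 + \<bar>t\<bar>)" .
    have "(G1 t)\<^sup>2 \<le> C\<^sup>2 * \<bar>t\<bar> powr (-1)"
      using sq[OF C(2)[OF True]] pw[of "-1/2"] by (simp add: power_mult_distrib)
    also have "\<dots> \<le> K * \<bar>t\<bar> powr (-1/2)" using K True by (intro mult_mono powr_mono) auto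
    finally have 1: "(G1 t)\<^sup>2 \<le> K * \<bar>t\<bar> powr (-1/2)" .
    have "(G2 t)\<^sup>2 \<le> C\<^sup>2 * \<bar>t\<bar> powr (-3)"
      using sq[OF C(3)[OF True]] pw[of "-3/2"] by (simp add: power_mult_distrib)
    also have "\<dots> \<le> K * \<bar>t\<bar> powr (-1/2)" using K True by (intro mult_mono powr_mono) auto
    finally show ?thesis using 0 1 by blast
  next
    case False
    then have t: "t \<in> {-1..1}" by auto
    have "(G0 t)\<^sup>2 \<le> K * 1" using sq[OF D0[OF t]] K by linarith
    also have "\<dots> \<le> K * (1 + \<bar>t\<bar>)" using K by (intro mult_left_mono) auto
    finally have 0: "(G0 t)\<^sup>2 \<le> K * (1 + \<bar>t\<bar>)" .
    have "K * 1 \<le> K * \<bar>t\<bar> powr (-1/2)" if "t \<noteq> 0"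
    proof (intro mult_left_mono K)
      have "\<bar>t\<bar> powr 0 \<le> \<bar>t\<bar> powr (-1/2)" using False by (intro powr_mono') auto
      then show "1 \<le> \<bar>t\<bar> powr (-1/2)" using that by simp
    qed
    then show ?thesis using 0 sq[OF D1[OF t]] sq[OF D2[OF t]] K by fastforce
  qed
  then show ?thesis using K(1) by blast
qed

text \<open>Since |t|^(-1/2) = s^(1/6) |y|^(-1/2), the worst term s^(-1) (G2 t)^2 is of order
  s^(-5/6) |y|^(-1/2). Both exponents exceed -1, which is why the solution lies in
  \<open>Z0\<close>.\<close>

lemma usim_square_bounds:
  "\<exists>K\<ge>0. \<forall>s y. 0 < s \<longrightarrow> s \<le> 1 \<longrightarrow> \<bar>y\<bar> \<le> 1 \<longrightarrow> y \<noteq> 0 \<longrightarrow>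
     (usim (s, y))\<^sup>2 \<le> K * (1 + s powr (-5/6) * \<bar>y\<bar> powr (-1/2)) \<and>
     (dz usim (s, y))\<^sup>2 \<le> K * (1 + s powr (-5/6) * \<bar>y\<bar> powr (-1/2)) \<and>
     (dz (dz usim) (s, y))\<^sup>2 \<le> K * (1 + s powr (-5/6) * \<bar>y\<bar> powr (-1/2))"
proof -
  obtain K where K: "K \<ge> 0" "\<And>t. (G0 t)\<^sup>2 \<le> K * (1 + \<bar>t\<bar>)" "\<And>t. t \<noteq> 0 \<Longrightarrow> (G1 t)\<^sup>2 \<le> K * \<bar>t\<bar> powr (-1/2)"
    "\<And>t. t \<noteq> 0 \<Longrightarrow> (G2 t)\<^sup>2 \<le> K * \<bar>t\<bar> powr (-1/2)" using G_square_bounds by blast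
  have "(usim (s, y))\<^sup>2 \<le> 2 * K * (1 + s powr (-5/6) * \<bar>y\<bar> powr (-1/2)) \<and>
     (dz usim (s, y))\<^sup>2 \<le> 2 * K * (1 + s powr (-5/6) * \<bar>y\<bar> powr (-1/2)) \<and>
     (dz (dz usim) (s, y))\<^sup>2 \<le> 2 * K * (1 + s powr (-5/6) * \<bar>y\<bar> powr (-1/2))"
    if s: "0 < s" "s \<le> 1" and y: "\<bar>y\<bar> \<le> 1" "y \<noteq> 0" for s y
  proof -
    define t where "t = y * s powr (-1/3)"
    define M where "M = s powr (-5/6) * \<bar>y\<bar> powr (-1/2)"
    have M: "M \<ge> 0" by (simp add: M_def)
    have t0: "t \<noteq> 0" using s y by (simp add: t_def)
    have at: "\<bar>t\<bar> = \<bar>y\<bar> * s powr (-1/3)" by (simp add: t_def abs_mult)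
    have pw: "(s powr a)\<^sup>2 = s powr (2 * a)" for a
      using s by (simp add: powr_powr powr_numeral[symmetric] mult.commute)
    have tp: "\<bar>t\<bar> powr (-1/2) = s powr (1/6) * \<bar>y\<bar> powr (-1/2)"
      unfolding at powr_mult powr_powr by (simp add: mult.commute)
    note parts = usim_partials[of "(s, y)", unfolded fst_conv snd_conv, OF s(1), folded t_def]
    have "(usim (s, y))\<^sup>2 = s powr (1/3) * (G0 t)\<^sup>2"
      using pw[of "1/6"] by (simp add: usim_def t_def power_mult_distrib)
    also have "\<dots> \<le> s powr (1/3) * (K * (1 + \<bar>t\<bar>))" by (intro mult_left_mono K) auto
    also have "\<dots> = K * (s powr (1/3) + s powr (1/3) * \<bar>t\<bar>)" by (simp add: algebra_simps)
    also have "s powr (1/3) * \<bar>t\<bar> = \<bar>y\<bar>"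
    proof -
      have "s powr (1/3) * \<bar>t\<bar> = \<bar>y\<bar> * (s powr (1/3) * s powr (-1/3))" by (simp only: at mult_ac)
      also have "s powr (1/3) * s powr (-1/3) = 1" using s by (simp flip: powr_add)
      finally show ?thesis by simp
    qed
    also have "K * (s powr (1/3) + \<bar>y\<bar>) \<le> K * (1 + 1)"
      using s y powr_mono2[of "1/3" s 1] by (intro mult_left_mono K add_mono) auto
    also have "\<dots> \<le> 2 * K * (1 + M)" using K(1) M mult_nonneg_nonneg[OF K(1) M] by (simp add: algebra_simps)
    finally have 0: "(usim (s, y))\<^sup>2 \<le> 2 * K * (1 + M)" .
    have KM: "K * M \<le> 2 * K * (1 + M)" using K(1) M mult_nonneg_nonneg[OF K(1) M] by (simp add: algebra_simps)
    have "(dz usim (s, y))\<^sup>2 = s powr (-1/3) * (G1 t)\<^sup>2"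
      unfolding parts using pw[of "-1/6"] by (simp add: power_mult_distrib)
    also have "\<dots> \<le> s powr (-1/3) * (K * \<bar>t\<bar> powr (-1/2))" by (intro mult_left_mono K t0) auto
    also have "\<dots> = K * ((s powr (-1/3) * s powr (1/6)) * \<bar>y\<bar> powr (-1/2))" unfolding tp by (simp only: mult_ac)
    also have "s powr (-1/3) * s powr (1/6) = s powr (-1/6)" by (simp flip: powr_add)
    also have "K * (s powr (-1/6) * \<bar>y\<bar> powr (-1/2)) \<le> K * M"
      unfolding M_def using s by (intro mult_left_mono mult_right_mono K powr_mono') auto
    finally have 1: "(dz usim (s, y))\<^sup>2 \<le> 2 * K * (1 + M)" using KM by linarith
    have "(dz (dz usim) (s, y))\<^sup>2 = s powr (-1) * (G2 t)\<^sup>2"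
      unfolding parts using pw[of "-1/2"] by (simp add: power_mult_distrib)
    also have "\<dots> \<le> s powr (-1) * (K * \<bar>t\<bar> powr (-1/2))" by (intro mult_left_mono K t0) auto
    also have "\<dots> = K * ((s powr (-1) * s powr (1/6)) * \<bar>y\<bar> powr (-1/2))" unfolding tp by (simp only: mult_ac)
    also have "s powr (-1) * s powr (1/6) = s powr (-5/6)" by (subst powr_add[symmetric]) simp
    finally have 2: "(dz (dz usim) (s, y))\<^sup>2 \<le> 2 * K * (1 + M)" using KM unfolding M_def by linarith
    show ?thesis using 0 1 2 unfolding M_def by blast
  qed
  then show ?thesis using K(1) by (intro exI[of _ "2 * K"]) auto
qed

lemma integrable_abs_powr:
  fixes a L :: real assumes a: "a > -1"
  shows "integrable lborel (\<lambda>x. indicator {c - L..c + L} x * \<bar>x - c\<bar> powr a)"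
proof -
  have pos: "integrable lborel (\<lambda>x. indicator {0..L} x * x powr a)"
  proof (cases "L \<ge> 0")
    case True
    have "((\<lambda>x. x powr a) has_integral (L powr (a + 1) / (a + 1))) {0..L}" using has_integral_powr_from_0[OF a True] .
    from nn_integral_has_integral_lebesgue[OF _ this]
    have n: "(\<integral>\<^sup>+x. ennreal (indicator {0..L} x * x powr a) \<partial>lborel) = ennreal (L powr (a + 1) / (a + 1))" by simp
    show ?thesis
    proof (rule integrableI_bounded)
      show "(\<integral>\<^sup>+x. ennreal (norm (indicator {0..L} x * x powr a)) \<partial>lborel) < \<infinity>"
        using n by (simp add: abs_mult)
    qed measurable
  qed simp
  have "integrable lborel (\<lambda>x. indicator {0..L} (0 + -1 * x) * (0 + -1 * x) powr a)"
    using lborel_integrable_real_affine[OF pos, of "-1" 0] by simp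
  from Bochner_Integration.integrable_add[OF pos this]
  have "integrable lborel (\<lambda>x. indicator {0..L} x * x powr a + indicator {0..L} (- x) * (- x) powr a)" by simp
  then have "integrable lborel (\<lambda>x. indicator {-L..L} x * \<bar>x\<bar> powr a)"
  proof (rule Bochner_Integration.integrable_bound)
    show "AE x in lborel. norm (indicator {-L..L} x * \<bar>x\<bar> powr a) \<le> norm (indicator {0..L} x * x powr a + indicator {0..L} (- x) * (- x) powr a)"
      by (intro AE_I2) (auto simp: indicator_def)
  qed measurable
  from lborel_integrable_real_affine[OF this, of 1 "- c"]
  have "integrable lborel (\<lambda>x. indicator {-L..L} (x - c) * \<bar>x - c\<bar> powr a)" by simp
  moreover have "indicator {-L..L} (x - c) = (indicator {c - L..c + L} x :: real)" for x by (auto simp: indicator_def)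
  ultimately show ?thesis by simp
qed

text \<open>The majorant is a constant plus a tensor product of integrable powers. The line z = 0 is
  left out of the bound because \<open>0 powr (-1/2)\<close> is 0 there; it is a null set.\<close>

lemma L2_on_singular_bound:
  assumes x: "x0 < x1" and xi: "xi \<in> {x0..x1}" and c: "continuous_on (Omega x0 x1) w" and K: "K \<ge> 0"
    and b: "\<And>p. p \<in> Omega x0 x1 \<Longrightarrow> snd p \<noteq> 0 \<Longrightarrow> (w p)\<^sup>2 \<le> K * (1 + \<bar>fst p - xi\<bar> powr (-5/6) * \<bar>snd p\<bar> powr (-1/2))"
  shows "L2_on (Omega x0 x1) w"
proof -
  let ?Om = "Omega x0 x1"
  have m: "(\<lambda>p. indicator ?Om p * w p) \<in> borel_measurable borel"
    using borel_measurable_continuous_on_indicator[OF _ c] by simp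
  define L where "L = x1 - x0"
  define N where "N x = indicator {xi - L..xi + L} x * \<bar>x - xi\<bar> powr (-5/6)" for x
  define k where "k z = indicator {-1..1} z * \<bar>z\<bar> powr (-1/2)" for z :: real
  have N: "integrable lborel N" unfolding N_def by (rule integrable_abs_powr) simp
  have k: "integrable lborel k" unfolding k_def using integrable_abs_powr[of "-1/2" 0 1] by simp
  have [measurable]: "N \<in> borel_measurable borel" "k \<in> borel_measurable borel" using N k by auto
  have i1: "integrable lborel (\<lambda>p. N (fst p) * k (snd p))"
    by (rule integrable_tensor_bound[OF _ N k]) (auto simp: N_def k_def)
  have i2: "integrable lborel (indicator ?Om :: real \<times> real \<Rightarrow> real)"
    using emeasure_lborel_box_finite by (intro integrable_real_indicator) (auto simp: Omega_eq_box)
  have "integrable lborel (\<lambda>p. K * indicator ?Om p + K * (N (fst p) * k (snd p)))" using i1 i2 by simp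
  then have "integrable lborel (\<lambda>p. indicator ?Om p * (w p)\<^sup>2)"
  proof (rule Bochner_Integration.integrable_bound)
    have "(\<lambda>p. indicator ?Om p * (w p)\<^sup>2) = (\<lambda>p. (indicator ?Om p * w p)\<^sup>2)" by (auto simp: indicator_def)
    then show "(\<lambda>p. indicator ?Om p * (w p)\<^sup>2) \<in> borel_measurable lborel" using m by simp
    have "AE z in lborel. z \<noteq> (0::real)" by (rule AE_lborel_singleton)
    then have "AE p in lborel. snd p \<noteq> (0::real) \<and> fst p = (fst p :: real)"
    proof -
      have "AE x in lborel. AE z in lborel. snd (x::real, z::real) \<noteq> 0" using AE_lborel_singleton[of "0::real"] by simp
      moreover have "{p \<in> space (lborel \<Otimes>\<^sub>M lborel). snd p \<noteq> (0::real)} \<in> sets (lborel \<Otimes>\<^sub>M (lborel :: real measure))"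
        by measurable
      ultimately have "AE p in lborel \<Otimes>\<^sub>M lborel. snd (p :: real \<times> real) \<noteq> 0" by (intro lborel_pair.AE_pair_measure) auto
      then show ?thesis unfolding lborel_prod by simp
    qed
    then show "AE p in lborel. norm (indicator ?Om p * (w p)\<^sup>2) \<le> norm (K * indicator ?Om p + K * (N (fst p) * k (snd p)))"
    proof eventually_elim
      case (elim p)
      show ?case
      proof (cases "p \<in> ?Om")
        case True
        then have "fst p \<in> {xi - L..xi + L}" "snd p \<in> {-1..1}" using xi by (auto simp: Omega_def L_def)
        then have "K * (1 + \<bar>fst p - xi\<bar> powr (-5/6) * \<bar>snd p\<bar> powr (-1/2)) = K * indicator ?Om p + K * (N (fst p) * k (snd p))"
          using True by (simp add: N_def k_def algebra_simps)
        then have "(w p)\<^sup>2 \<le> K * indicator ?Om p + K * (N (fst p) * k (snd p))" using b[OF True] elim by simp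
        then show ?thesis using True by simp
      qed simp
    qed
  qed
  then have "integrable lebesgue (\<lambda>p. indicator ?Om p * (w p)\<^sup>2)"
    by (subst integrable_completion) auto
  then show ?thesis using m unfolding L2_on_def by (auto intro: measurable_completion)
qed

text \<open>With t = y' s^(-1/3) the radial factor is s^(1/6) (1 + t^2)^(1/4), which cancels the
  prefactor of \<open>Lambda0\<close>. Only equality of the squares of y and y' is asked, to allow
  the change of sign at the second corner.\<close>

lemma sqrt_sqrt_Lambda0:
  assumes s: "s > 0" and y: "y'\<^sup>2 = y\<^sup>2"
  shows "sqrt (sqrt (y\<^sup>2 + s powr (2/3))) * Lambda0 (y' * s powr (-1/3)) = usim (s, y')"
proof -
  define t where "t = y' * s powr (-1/3)"
  have t1: "1 + t\<^sup>2 > 0" by (simp add: add_pos_nonneg)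
  have "(s powr (-1/3))\<^sup>2 = s powr (-2/3)" using s by (simp add: powr_powr powr_numeral[symmetric])
  then have "s powr (2/3) * t\<^sup>2 = y\<^sup>2 * (s powr (2/3) * s powr (-2/3))" by (simp add: t_def power_mult_distrib y)
  also have "s powr (2/3) * s powr (-2/3) = 1" using s by (simp flip: powr_add)
  finally have e: "y\<^sup>2 + s powr (2/3) = s powr (2/3) * (1 + t\<^sup>2)" by (simp add: algebra_simps)
  have "sqrt (sqrt (y\<^sup>2 + s powr (2/3))) = ((s powr (2/3) * (1 + t\<^sup>2)) powr (1/2)) powr (1/2)"
    unfolding e using s t1 by (simp add: powr_half_sqrt)
  also have "\<dots> = s powr (1/6) * (1 + t\<^sup>2) powr (1/4)"
    by (simp add: powr_powr powr_mult)
  finally have "sqrt (sqrt (y\<^sup>2 + s powr (2/3))) * Lambda0 t = s powr (1/6) * ((1 + t\<^sup>2) powr (1/4) * (1 + t\<^sup>2) powr (-1/4)) * G0 t"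
    by (simp add: Lambda0_eq)
  also have "(1 + t\<^sup>2) powr (1/4) * (1 + t\<^sup>2) powr (-1/4) = 1" using t1 by (simp flip: powr_add)
  finally show ?thesis by (simp add: usim_def t_def)
qed

lemma partials_affine:
  assumes "f differentiable (at (c * fst p + d, c' * snd p + d'))"
  shows "dx (\<lambda>p. f (c * fst p + d, c' * snd p + d')) p = dx f (c * fst p + d, c' * snd p + d') * c"
    "dz (\<lambda>p. f (c * fst p + d, c' * snd p + d')) p = dz f (c * fst p + d, c' * snd p + d') * c'"
proof -
  let ?q = "(c * fst p + d, c' * snd p + d')"
  have "((\<lambda>p. (c * fst p + d, c' * snd p + d')) has_derivative (\<lambda>h. (c * fst h, c' * snd h))) (at p)"
    by (auto intro!: derivative_eq_intros)
  from has_derivative_compose[OF this has_derivative_partials[OF assms]]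
  have "((\<lambda>p. f (c * fst p + d, c' * snd p + d')) has_derivative (\<lambda>h. (dx f ?q * c) * fst h + (dz f ?q * c') * snd h)) (at p)"
    by (simp add: algebra_simps)
  from partials_of_has_derivative(3,4)[OF this]
  show "dx (\<lambda>p. f (c * fst p + d, c' * snd p + d')) p = dx f ?q * c" "dz (\<lambda>p. f (c * fst p + d, c' * snd p + d')) p = dz f ?q * c'" .
qed

lemma smooth_upto_affine:
  assumes f: "smooth_upto O1 S1 f" and S: "\<And>p. p \<in> S2 \<Longrightarrow> (c * fst p + d, c' * snd p + d') \<in> S1"
    and O: "\<And>p. p \<in> O2 \<Longrightarrow> (c * fst p + d, c' * snd p + d') \<in> O1"
  shows "smooth_upto O2 S2 (\<lambda>p. f (c * fst p + d, c' * snd p + d'))"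
  unfolding smooth_upto_def
proof
  fix p assume p: "p \<in> S2"
  obtain U g where U: "open U" "(c * fst p + d, c' * snd p + d') \<in> U" "smooth_on U g" "\<And>q. q \<in> U \<inter> O1 \<Longrightarrow> g q = f q"
    using f S[OF p] by (rule smooth_uptoE) blast
  define V where "V = {p. (c * fst p + d, c' * snd p + d') \<in> U}"
  have "open ((\<lambda>p. (c * fst p + d, c' * snd p + d')) -` U)" by (intro open_vimage U(1) continuous_intros)
  then have V: "open V" by (simp add: V_def vimage_def)
  have "smooth_on V (\<lambda>p. g (c * fst p + d, c' * snd p + d'))"
    unfolding smooth_on_def
  proof (intro conjI allI V)
    fix k show "Ck_on k V (\<lambda>p. g (c * fst p + d, c' * snd p + d'))"
      by (rule Ck_on_affine[OF U(1) V]) (use U(3) in \<open>auto simp: smooth_on_def V_def\<close>)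
  qed
  then show "\<exists>U g. open U \<and> p \<in> U \<and> smooth_on U g \<and> (\<forall>q\<in>U \<inter> O2. g q = f (c * fst q + d, c' * snd q + d'))"
    using V U(2,4) O by (intro exI[of _ V] exI[of _ "\<lambda>p. g (c * fst p + d, c' * snd p + d')"]) (auto simp: V_def)
qed

lemma smooth_upto_cong:
  assumes "smooth_upto Om S f" "\<And>p. p \<in> Om \<Longrightarrow> f p = g p" shows "smooth_upto Om S g"
  unfolding smooth_upto_def
proof
  fix p assume "p \<in> S"
  with assms(1) obtain U h where U: "open U" "p \<in> U" "smooth_on U h" "\<And>q. q \<in> U \<inter> Om \<Longrightarrow> h q = f q"
    by (rule smooth_uptoE) blast
  then show "\<exists>U h. open U \<and> p \<in> U \<and> smooth_on U h \<and> (\<forall>q\<in>U \<inter> Om. h q = g q)"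
    using assms(2) by (intro exI[of _ U] exI[of _ h]) auto
qed

text \<open>If f is not integrable, its integral is 0 by convention, so no measurability of f has to
  be checked.\<close>

lemma abs_integral_le:
  fixes f g :: "'a \<Rightarrow> real"
  assumes g: "integrable M g" and b: "\<And>p. \<bar>f p\<bar> \<le> g p"
  shows "\<bar>integral\<^sup>L M f\<bar> \<le> integral\<^sup>L M g"
proof (cases "integrable M f")
  case True
  have "\<bar>integral\<^sup>L M f\<bar> \<le> (\<integral>p. \<bar>f p\<bar> \<partial>M)" by (rule integral_abs_bound)
  also have "\<dots> \<le> integral\<^sup>L M g" using True g b by (intro integral_mono) auto
  finally show ?thesis .
next
  case False
  have "0 \<le> g p" for p using b[of p] by linarith
  then show ?thesis using False by (simp add: not_integrable_integral_eq)
qed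

lemma closure_Omega: "x0 < x1 \<Longrightarrow> closure (Omega x0 x1) = {x0..x1} \<times> {-1..1}"
  by (simp add: Omega_def closure_Times closure_greaterThanLessThan)

lemma smooth_upto_mult: "smooth_upto Om S f \<Longrightarrow> smooth_upto Om S g \<Longrightarrow> smooth_upto Om S (\<lambda>p. f p * g p)"
  by (rule smooth_upto_binop[of "\<lambda>a b. a * b"]) (rule smooth_on_mult)

lemma smooth_upto_diff: "smooth_upto Om S f \<Longrightarrow> smooth_upto Om S g \<Longrightarrow> smooth_upto Om S (\<lambda>p. f p - g p)"
  by (rule smooth_upto_binop[of "\<lambda>a b. a - b"]) (rule smooth_on_diff)

subsection \<open>The truncated solution at a corner\<close>

text \<open>Both corners are treated at once: \<open>e = 1\<close> at \<open>(x0, 0)\<close> and \<open>e = -1\<close> at \<open>(x1, 0)\<close>; the equation is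
  invariant under \<open>(x, z) \<mapsto> (-x, -z)\<close>.\<close>

locale corner =
  fixes x0 x1 xi e Rbar :: real and i :: nat and chi :: "real \<times> real \<Rightarrow> real"
  assumes x: "x0 < x1" and e: "e = (-1) ^ i" and corner: "e = 1 \<and> xi = x0 \<or> e = -1 \<and> xi = x1"
    and Rbar: "Rbar < 1/2" "Rbar < (x1 - x0) / 2"
    and chi: "smooth_upto (Omega x0 x1) (closure (Omega x0 x1)) chi"
    and chi_near: "\<exists>\<epsilon>>0. \<forall>p\<in>closure (Omega x0 x1). dist p (xi, 0) < \<epsilon> \<longrightarrow> chi p = 1"
    and chi_far: "\<And>p. p \<in> closure (Omega x0 x1) \<Longrightarrow> dist p (xi, 0) \<ge> Rbar \<Longrightarrow> chi p = 0"
begin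

abbreviation "Om \<equiv> Omega x0 x1"

text \<open>The components are the distance to the lateral side through the corner and the height,
  counted positive towards the inflow part of that side. The \<open>+ 0\<close> keeps the form of
  the affine lemmas.\<close>

definition aff :: "real \<times> real \<Rightarrow> real \<times> real" where
  "aff p = (e * fst p + (- e * xi), e * snd p + 0)"

definition ub :: "real \<times> real \<Rightarrow> real" where
  "ub p = usim (aff p)"

definition u :: "real \<times> real \<Rightarrow> real" where
  "u = u_sing xi chi i"

definition f :: "real \<times> real \<Rightarrow> real" where
  "f p = snd p * dx u p - dz (dz u) p"

lemma e_sq: "e * e = 1" "\<bar>e\<bar> = 1"
  using corner by auto

lemma aff_Om:
  assumes "p \<in> Om" shows "fst (aff p) > 0" "fst (aff p) = \<bar>fst p - xi\<bar>" "snd (aff p) = e * snd p"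
  using corner assms by (auto simp: aff_def Omega_def)

lemma xi_mem: "xi \<in> {x0..x1}"
  using corner x by auto

lemma Om_closure: "p \<in> Om \<Longrightarrow> p \<in> closure Om"
  using closure_subset by blast

lemma u_eq: "p \<in> Om \<Longrightarrow> u p = ub p * chi p"
proof -
  assume p: "p \<in> Om"
  note a = aff_Om[OF p]
  have "(e * snd p)\<^sup>2 = (snd p)\<^sup>2" using e_sq(1) by (simp add: power2_eq_square)
  from sqrt_sqrt_Lambda0[OF a(1) this]
  have "sqrt (sqrt ((snd p)\<^sup>2 + fst (aff p) powr (2/3))) * Lambda0 (e * snd p * fst (aff p) powr (-1/3)) = usim (fst (aff p), e * snd p)" .
  moreover have "(fst (aff p), e * snd p) = aff p" using a(3) by (simp add: prod_eq_iff)
  ultimately show ?thesis unfolding u_def u_sing_def ub_def a(2)[symmetric] e[symmetric] by (simp only:)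
qed

lemma smooth_upto_ub: "smooth_upto Om (closure Om - {(xi, 0)}) ub"
  unfolding ub_def aff_def
proof (rule smooth_upto_affine[OF smooth_upto_usim])
  fix p assume p: "p \<in> closure Om - {(xi, 0)}"
  then show "(e * fst p + - e * xi, e * snd p + 0) \<in> {p. 0 \<le> fst p} - {(0, 0)}"
    using corner by (cases p) (auto simp: closure_Omega[OF x])
next
  fix p assume "p \<in> Om"
  then show "(e * fst p + - e * xi, e * snd p + 0) \<in> {p. 0 < fst p}" using aff_Om(1)[of p] by (simp add: aff_def)
qed

lemma smooth_upto_u: "smooth_upto Om (closure Om - {(xi, 0)}) u"
proof -
  have "smooth_upto Om (closure Om - {(xi, 0)}) chi" by (rule smooth_upto_subset[OF chi]) auto
  from smooth_upto_mult[OF smooth_upto_ub this] show ?thesis by (rule smooth_upto_cong) (simp add: u_eq)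
qed

lemma corner_not_in_Om: "Om \<subseteq> closure Om - {(xi, 0)}"
  using corner closure_subset[of Om] by (auto simp: Omega_def)

lemma smooth_on_u: "smooth_on Om u"
  by (rule smooth_on_if_smooth_upto[OF smooth_upto_u Omega_open corner_not_in_Om])

lemma ub_partials:
  assumes p: "p \<in> Om"
  shows "dx ub p = e * dx usim (aff p)" "dz ub p = e * dz usim (aff p)" "dz (dz ub) p = dz (dz usim) (aff p)"
proof -
  have pos: "aff q \<in> {p. fst p > 0}" if "q \<in> Om" for q using aff_Om(1)[OF that] by simp
  have d: "usim differentiable (at (aff q))" "dz usim differentiable (at (aff q))" if "q \<in> Om" for q
    using smooth_on_differentiable[OF smooth_on_usim pos[OF that]] smooth_on_differentiable[OF smooth_on_dz[OF smooth_on_usim] pos[OF that]] by auto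
  have 1: "dx ub q = e * dx usim (aff q)" "dz ub q = e * dz usim (aff q)" if "q \<in> Om" for q
    using partials_affine[OF d(1)[OF that, unfolded aff_def]] unfolding ub_def aff_def by (simp_all add: mult.commute)
  then show "dx ub p = e * dx usim (aff p)" "dz ub p = e * dz usim (aff p)" using p by auto
  have "dz (dz ub) p = dz (\<lambda>q. e * dz usim (aff q)) p" by (rule partials_cong(2)[OF Omega_open p]) (rule 1(2))
  also have "\<dots> = e * dz (\<lambda>q. dz usim (aff q)) p"
  proof -
    have "(aff has_derivative (\<lambda>h. (e * fst h, e * snd h))) (at p)"
      unfolding aff_def[abs_def] by (auto intro!: derivative_eq_intros)
    from has_derivative_compose[OF this has_derivative_partials[OF d(2)[OF p]]]
    have "(\<lambda>q. dz usim (aff q)) differentiable (at p)" unfolding differentiable_def by blast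
    from partials_of_has_derivative(2)[OF has_derivative_partials[OF this]]
    show ?thesis unfolding dz_def[of "\<lambda>q. e * dz usim (aff q)"] by (intro DERIV_imp_deriv DERIV_cmult)
  qed
  also have "dz (\<lambda>q. dz usim (aff q)) p = dz (dz usim) (aff p) * e"
    using partials_affine(2)[OF d(2)[OF p, unfolded aff_def]] unfolding aff_def .
  finally show "dz (dz ub) p = dz (dz usim) (aff p)" using e_sq(1) by (simp add: mult.left_commute)
qed

lemma ub_pde:
  assumes p: "p \<in> Om" shows "snd p * dx ub p = dz (dz ub) p"
proof -
  have "snd p * dx ub p = snd (aff p) * dx usim (aff p)"
    unfolding ub_partials[OF p] aff_Om(3)[OF p] by (simp add: mult_ac)
  also have "\<dots> = dz (dz usim) (aff p)" by (rule usim_pde[OF aff_Om(1)[OF p]])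
  finally show ?thesis by (simp add: ub_partials[OF p])
qed

lemma partials_eq:
  assumes "open V" "p \<in> V" "p \<in> Om" "\<And>q. q \<in> V \<Longrightarrow> q \<in> Om \<Longrightarrow> u q = g q"
  shows "u p = g p" "dx u p = dx g p" "dz u p = dz g p" "dz (dz u) p = dz (dz g) p"
proof -
  have o: "open (V \<inter> Om)" using assms(1) by auto
  have 1: "dx u q = dx g q" "dz u q = dz g q" if "q \<in> V \<inter> Om" for q
    using partials_cong[OF o that, of u g] assms(4) by auto
  have "p \<in> V \<inter> Om" using assms(2,3) by blast
  then show "u p = g p" "dx u p = dx g p" "dz u p = dz g p" "dz (dz u) p = dz (dz g) p"
    using 1 partials_cong(2)[OF o, of p "dz u" "dz g"] assms(4) by auto
qed

text \<open>A radius within which the cutoff is 1; the cap at 1 places the ball in the range s <= 1,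
  |y| <= 1 of \<open>usim_square_bounds\<close>.\<close>

definition \<delta> :: real where
  "\<delta> = (SOME d. d > 0 \<and> d \<le> 1 \<and> (\<forall>p\<in>closure Om. dist p (xi, 0) < d \<longrightarrow> chi p = 1))"

lemma \<delta>: "\<delta> > 0" "\<delta> \<le> 1" "\<And>p. p \<in> Om \<Longrightarrow> dist p (xi, 0) < \<delta> \<Longrightarrow> chi p = 1"
proof -
  obtain d where "d > 0" "\<forall>p\<in>closure Om. dist p (xi, 0) < d \<longrightarrow> chi p = 1" using chi_near by blast
  then have "\<exists>d. d > 0 \<and> d \<le> 1 \<and> (\<forall>p\<in>closure Om. dist p (xi, 0) < d \<longrightarrow> chi p = 1)"
    by (intro exI[of _ "min d 1"]) auto
  from someI_ex[OF this] show "\<delta> > 0" "\<delta> \<le> 1" "\<And>p. p \<in> Om \<Longrightarrow> dist p (xi, 0) < \<delta> \<Longrightarrow> chi p = 1"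
    unfolding \<delta>_def[symmetric] using Om_closure by auto
qed

lemma near:
  assumes "p \<in> Om" "dist p (xi, 0) < \<delta>"
  shows "u p = ub p" "dx u p = dx ub p" "dz u p = dz ub p" "dz (dz u) p = dz (dz ub) p"
proof -
  have b: "p \<in> ball (xi, 0) \<delta>" using assms(2) by (simp add: dist_commute)
  have "u q = ub q" if "q \<in> ball (xi, 0) \<delta>" "q \<in> Om" for q
    using that \<delta>(3)[of q] by (simp add: u_eq dist_commute)
  from partials_eq[OF open_ball b assms(1) this]
  show "u p = ub p" "dx u p = dx ub p" "dz u p = dz ub p" "dz (dz u) p = dz (dz ub) p" by auto
qed

lemma far:
  assumes "p \<in> Om" "dist p (xi, 0) > Rbar"
  shows "u p = 0" "dx u p = 0" "dz (dz u) p = 0"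
proof -
  have o: "open (- cball (xi, 0) Rbar)" by (intro open_Compl closed_cball)
  have b: "p \<in> - cball (xi, 0) Rbar" using assms(2) by (simp add: dist_commute)
  have "u q = 0" if "q \<in> - cball (xi, 0) Rbar" "q \<in> Om" for q
    using that chi_far[OF Om_closure[OF that(2)]] by (simp add: u_eq dist_commute)
  from partials_eq[OF o b assms(1), of "\<lambda>_. 0", OF this]
  show "u p = 0" "dx u p = 0" "dz (dz u) p = 0" by (auto simp: dx_def dz_def)
qed

lemma dist_ge: "\<bar>fst p - xi\<bar> \<le> dist p (xi, 0)" "\<bar>snd p\<bar> \<le> dist p (xi, 0)"
  using dist_fst_le[of p "(xi, 0)"] dist_snd_le[of p "(xi, 0)"] by (auto simp: dist_real_def)

lemma f_near: "p \<in> Om \<Longrightarrow> dist p (xi, 0) < \<delta> \<Longrightarrow> f p = 0"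
  unfolding f_def by (simp add: near ub_pde)

lemma f_far: "p \<in> Om \<Longrightarrow> dist p (xi, 0) > Rbar \<Longrightarrow> f p = 0"
  unfolding f_def by (simp add: far)

text \<open>Near the corner f is identically 0, because the similarity solution satisfies the
  equation exactly; the singularity of u thus leaves no trace in f. Elsewhere smoothness is
  inherited from u.\<close>

lemma smooth_upto_f: "smooth_upto Om (closure Om) f"
  unfolding smooth_upto_def
proof
  fix p assume p: "p \<in> closure Om"
  show "\<exists>U g. open U \<and> p \<in> U \<and> smooth_on U g \<and> (\<forall>q\<in>U \<inter> Om. g q = f q)"
  proof (cases "p = (xi, 0)")
    case True
    have "smooth_on (ball (xi, 0) \<delta>) (\<lambda>_. 0)" by (simp add: smooth_on_def)
    then show ?thesis using f_near \<delta>(1) True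
      by (intro exI[of _ "ball (xi, 0) \<delta>"] exI[of _ "\<lambda>_. 0"]) (auto simp: dist_commute)
  next
    case False
    have z: "smooth_upto Om (closure Om - {(xi, 0)}) snd"
      unfolding smooth_upto_def by (intro ballI exI[of _ UNIV] exI[of _ snd]) (auto simp: smooth_on_snd)
    note ux = smooth_upto_partials(1)[OF smooth_upto_u Omega_open]
      and uzz = smooth_upto_partials(2)[OF smooth_upto_partials(2)[OF smooth_upto_u Omega_open] Omega_open]
    have "smooth_upto Om (closure Om - {(xi, 0)}) f"
      using smooth_upto_diff[OF smooth_upto_mult[OF z ux] uzz] by (rule smooth_upto_cong) (simp add: f_def)
    then show ?thesis using p False unfolding smooth_upto_def by blast
  qed
qed

lemma f_vanishes: "\<exists>\<epsilon>>0. \<forall>p\<in>Om. (dist p (xi, 0) < \<epsilon> \<or> \<bar>snd p\<bar> > 1 - \<epsilon>) \<longrightarrow> f p = 0"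
\<comment> \<open>The value 1/2 works at top and bottom because Rbar < 1/2.\<close>
proof (intro exI[of _ "min \<delta> (1/2)"] conjI ballI impI)
  fix p assume p: "p \<in> Om" and d: "dist p (xi, 0) < min \<delta> (1/2) \<or> \<bar>snd p\<bar> > 1 - min \<delta> (1/2)"
  then consider "dist p (xi, 0) < \<delta>" | "\<bar>snd p\<bar> \<ge> 1/2" by linarith
  then show "f p = 0"
  proof cases
    case 2
    then have "dist p (xi, 0) > Rbar" using dist_ge(2)[of p] Rbar(1) by linarith
    then show ?thesis using f_far p by blast
  qed (use f_near p in blast)
qed (use \<delta>(1) in simp)

lemma compact_closure_Om: "compact (closure Om)"
  unfolding closure_Omega[OF x] by (intro compact_Times compact_Icc)

text \<open>Only a neighbourhood of the corner matters: off the ball, compactness bounds w by a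
  constant.\<close>

lemma L2_if_near_bound:
  assumes w: "smooth_upto Om (closure Om - {(xi, 0)}) w" and K: "K \<ge> 0"
    and b: "\<And>p. p \<in> Om \<Longrightarrow> dist p (xi, 0) < \<delta> \<Longrightarrow> snd p \<noteq> 0 \<Longrightarrow> (w p)\<^sup>2 \<le> K * (1 + \<bar>fst p - xi\<bar> powr (-5/6) * \<bar>snd p\<bar> powr (-1/2))"
  shows "L2_on Om w"
proof -
  have S: "compact (closure Om - ball (xi, 0) \<delta>)" by (intro compact_diff compact_closure_Om open_ball)
  have "smooth_upto Om (closure Om - ball (xi, 0) \<delta>) w" by (rule smooth_upto_subset[OF w]) (use \<delta>(1) in auto)
  then obtain C where C: "\<And>p. p \<in> Om \<inter> (closure Om - ball (xi, 0) \<delta>) \<Longrightarrow> \<bar>w p\<bar> \<le> C" using smooth_upto_bounded[OF _ S] by blast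
  show ?thesis
  proof (rule L2_on_singular_bound[OF x xi_mem, of w "K + C\<^sup>2"])
    show "continuous_on Om w"
      by (rule smooth_on_continuous[OF smooth_on_if_smooth_upto[OF w Omega_open corner_not_in_Om]])
    show "K + C\<^sup>2 \<ge> 0" using K by simp
    fix p assume p: "p \<in> Om" and z: "snd p \<noteq> 0"
    define M where "M = 1 + \<bar>fst p - xi\<bar> powr (-5/6) * \<bar>snd p\<bar> powr (-1/2)"
    have M: "M \<ge> 1" by (simp add: M_def)
    have "(w p)\<^sup>2 \<le> (K + C\<^sup>2) * M"
    proof (cases "dist p (xi, 0) < \<delta>")
      case True
      have "(w p)\<^sup>2 \<le> K * M" using b[OF p True z] by (simp add: M_def)
      also have "\<dots> \<le> (K + C\<^sup>2) * M" using M by (intro mult_right_mono) auto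
      finally show ?thesis .
    next
      case False
      then have "\<bar>w p\<bar> \<le> C" using C[of p] p Om_closure[OF p] by (auto simp: dist_commute)
      then have "(w p)\<^sup>2 \<le> C\<^sup>2" using power_mono[of "\<bar>w p\<bar>" C 2] by simp
      also have "\<dots> \<le> K + C\<^sup>2" using K by simp
      also have "\<dots> = (K + C\<^sup>2) * 1" by simp
      also have "\<dots> \<le> (K + C\<^sup>2) * M" using M K by (intro mult_left_mono) auto
      finally show ?thesis .
    qed
    then show "(w p)\<^sup>2 \<le> (K + C\<^sup>2) * (1 + \<bar>fst p - xi\<bar> powr (-5/6) * \<bar>snd p\<bar> powr (-1/2))" by (simp add: M_def)
  qed
qed

lemma Z0_u: "Z0 x0 x1 u"
proof -
  obtain K where K: "K \<ge> 0" "\<And>s y. 0 < s \<Longrightarrow> s \<le> 1 \<Longrightarrow> \<bar>y\<bar> \<le> 1 \<Longrightarrow> y \<noteq> 0 \<Longrightarrow>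
     (usim (s, y))\<^sup>2 \<le> K * (1 + s powr (-5/6) * \<bar>y\<bar> powr (-1/2)) \<and>
     (dz usim (s, y))\<^sup>2 \<le> K * (1 + s powr (-5/6) * \<bar>y\<bar> powr (-1/2)) \<and>
     (dz (dz usim) (s, y))\<^sup>2 \<le> K * (1 + s powr (-5/6) * \<bar>y\<bar> powr (-1/2))"
    using usim_square_bounds by blast
  have bd: "(usim (aff p))\<^sup>2 \<le> K * (1 + \<bar>fst p - xi\<bar> powr (-5/6) * \<bar>snd p\<bar> powr (-1/2)) \<and>
     (dz usim (aff p))\<^sup>2 \<le> K * (1 + \<bar>fst p - xi\<bar> powr (-5/6) * \<bar>snd p\<bar> powr (-1/2)) \<and>
     (dz (dz usim) (aff p))\<^sup>2 \<le> K * (1 + \<bar>fst p - xi\<bar> powr (-5/6) * \<bar>snd p\<bar> powr (-1/2))"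
    if p: "p \<in> Om" "dist p (xi, 0) < \<delta>" "snd p \<noteq> 0" for p
  proof -
    have "fst (aff p) \<le> 1" using aff_Om(2)[OF p(1)] dist_ge(1)[of p] p(2) \<delta>(2) by linarith
    moreover have abs: "\<bar>snd (aff p)\<bar> = \<bar>snd p\<bar>" using aff_Om(3)[OF p(1)] e_sq(2) by (simp add: abs_mult)
    moreover have "\<bar>snd (aff p)\<bar> \<le> 1" using abs dist_ge(2)[of p] p(2) \<delta>(2) by linarith
    moreover have "snd (aff p) \<noteq> 0" using abs p(3) by auto
    ultimately have "0 < fst (aff p)" "fst (aff p) \<le> 1" "\<bar>snd (aff p)\<bar> \<le> 1" "snd (aff p) \<noteq> 0" using aff_Om(1)[OF p(1)] by auto
    from K(2)[OF this, unfolded prod.collapse, unfolded abs aff_Om(2)[OF p(1)]] show ?thesis .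
  qed
  have sq: "(e * r)\<^sup>2 = r\<^sup>2" for r using e_sq(1) by (simp add: power_mult_distrib power2_eq_square)
  note uz = smooth_upto_partials(2)[OF smooth_upto_u Omega_open]
  note uzz = smooth_upto_partials(2)[OF uz Omega_open]
  have L0: "L2_on Om u" by (rule L2_if_near_bound[OF smooth_upto_u K(1)]) (use bd near in \<open>auto simp: ub_def\<close>)
  have L1: "L2_on Om (dz u)" by (rule L2_if_near_bound[OF uz K(1)]) (use bd near sq in \<open>auto simp: ub_partials\<close>)
  have L2: "L2_on Om (dz (dz u))" by (rule L2_if_near_bound[OF uzz K(1)]) (use bd near in \<open>auto simp: ub_partials\<close>)
  have L3: "L2_on Om (\<lambda>p. snd p * dx u p)"
  proof (rule L2_if_near_bound[OF _ K(1)])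
    have z: "smooth_upto Om (closure Om - {(xi, 0)}) snd"
      unfolding smooth_upto_def by (intro ballI exI[of _ UNIV] exI[of _ snd]) (auto simp: smooth_on_snd)
    show "smooth_upto Om (closure Om - {(xi, 0)}) (\<lambda>p. snd p * dx u p)"
      by (rule smooth_upto_mult[OF z smooth_upto_partials(1)[OF smooth_upto_u Omega_open]])
    \<comment> \<open>Near the corner the equation turns z dx u into dzz u, which is already
      bounded.\<close>
    show "(snd p * dx u p)\<^sup>2 \<le> K * (1 + \<bar>fst p - xi\<bar> powr (-5/6) * \<bar>snd p\<bar> powr (-1/2))"
      if "p \<in> Om" "dist p (xi, 0) < \<delta>" "snd p \<noteq> 0" for p
      using bd[OF that] near[OF that(1,2)] ub_pde[OF that(1)] ub_partials(3)[OF that(1)] by simp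
  qed
  show ?thesis unfolding Z0_def using L0 L1 L2 L3 weak_partials_smooth[OF Omega_open smooth_on_u] by blast
qed

lemma trace_top_bottom: "trace_zero_top_bottom x0 x1 u"
  unfolding trace_zero_top_bottom_def
proof (intro AE_I2 impI)
  fix x assume xx: "x \<in> {x0<..<x1}"
  \<comment> \<open>The extension by 0 is continuous because u vanishes wherever 1/2 < |z| <
    1.\<close>
  define g where "g z = (if \<bar>z\<bar> < 1 then u (x, z) else 0)" for z
  have "continuous_on {-1<..<1} (\<lambda>z. u (x, z))"
    by (rule continuous_on_compose2[OF smooth_on_continuous[OF smooth_on_u]])
      (use xx in \<open>auto simp: Omega_def intro!: continuous_intros\<close>)
  then have c1: "continuous_on {-1<..<1} g" by (rule continuous_on_eq) (auto simp: g_def)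
  have g0: "g z = 0" if "\<bar>z\<bar> > 1/2" for z
  proof (cases "\<bar>z\<bar> < 1")
    case True
    then have "(x, z) \<in> Om" using xx by (auto simp: Omega_def)
    moreover have "dist (x, z) (xi, 0) > Rbar" using dist_ge(2)[of "(x, z)"] that Rbar(1) by simp
    ultimately show ?thesis using far(1) by (simp add: g_def)
  qed (simp add: g_def)
  have c2: "continuous_on {z. \<bar>z\<bar> > 1/2} g" by (rule continuous_on_eq[of _ "\<lambda>_. 0"]) (auto simp: g0)
  have "open {z::real. \<bar>z\<bar> > 1/2}" by (intro open_Collect_less continuous_intros)
  then have "continuous_on ({-1<..<1} \<union> {z. \<bar>z\<bar> > 1/2}) g" by (intro continuous_on_open_Un c1 c2) auto
  then have "continuous_on {-1..1} g" by (rule continuous_on_subset) auto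
  moreover have "AE z in lborel. z \<in> {-1<..<1} \<longrightarrow> u (x, z) = g z" by (intro AE_I2) (auto simp: g_def)
  ultimately show "\<exists>g. continuous_on {-1..1} g \<and> g (-1) = 0 \<and> g 1 = 0 \<and> (AE z in lborel. z \<in> {-1<..<1} \<longrightarrow> u (x, z) = g z)"
    using g0 by (intro exI[of _ g]) auto
qed

lemma trace_average:
  assumes R: "\<And>h. R h \<in> sets borel" and meas: "\<And>h. h > 0 \<Longrightarrow> emeasure lborel (R h) = ennreal h"
    and h0: "h0 > 0" and K: "K \<ge> 0"
    and b: "\<And>h p. 0 < h \<Longrightarrow> h < h0 \<Longrightarrow> p \<in> R h \<Longrightarrow> \<bar>snd p\<bar> * (u p)\<^sup>2 \<le> K * h powr (1/3)"
  shows "((\<lambda>h. (1 / h) * (LINT p:R h|lebesgue. \<bar>snd p\<bar> * (u p)\<^sup>2)) \<longlongrightarrow> 0) (at_right 0)"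
proof (rule Lim_null_comparison)
  have "((\<lambda>h::real. h powr (1/3)) \<longlongrightarrow> 0 powr (1/3)) (at_right 0)"
    by (intro tendsto_intros) (auto simp: eventually_at_filter)
  from tendsto_mult[OF tendsto_const[of K] this] show "((\<lambda>h. K * h powr (1/3)) \<longlongrightarrow> 0) (at_right 0)" by simp
  have "\<forall>\<^sub>F h in at_right 0. h < h0" using h0 by (auto simp: eventually_at_right_field)
  then show "\<forall>\<^sub>F h in at_right 0. norm ((1 / h) * (LINT p:R h|lebesgue. \<bar>snd p\<bar> * (u p)\<^sup>2)) \<le> K * h powr (1/3)"
    using eventually_at_right_less[of "0::real"]
  proof eventually_elim
    case (elim h)
    have m: "R h \<in> sets lebesgue" "emeasure lebesgue (R h) = ennreal h" using R[of h] meas[OF elim(2)] by auto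
    have i: "integrable lebesgue (indicator (R h) :: real \<times> real \<Rightarrow> real)" using m by (intro integrable_real_indicator) auto
    have mI: "integral\<^sup>L lebesgue (indicator (R h) :: real \<times> real \<Rightarrow> real) = h"
      using m elim(2) by (simp add: measure_def)
    have "\<bar>LINT p:R h|lebesgue. \<bar>snd p\<bar> * (u p)\<^sup>2\<bar> \<le> (\<integral>p. (K * h powr (1/3)) * indicator (R h) p \<partial>lebesgue)"
      unfolding set_lebesgue_integral_def
    proof (rule abs_integral_le)
      show "integrable lebesgue (\<lambda>p. (K * h powr (1/3)) * indicator (R h) p)" using i by simp
      show "\<bar>indicator (R h) p *\<^sub>R (\<bar>snd p\<bar> * (u p)\<^sup>2)\<bar> \<le> (K * h powr (1/3)) * indicator (R h) p" for p
        using b[OF elim(2,1), of p] by (cases "p \<in> R h") auto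
    qed
    also have "\<dots> = (K * h powr (1/3)) * h" using mI by simp
    finally show ?case using elim(2) by (simp add: abs_mult field_simps)
  qed
qed

text \<open>On the inflow side the similarity variable is nonnegative, where \<open>G0\<close> is
  bounded; so u^2 is of order s^(1/3), with s <= h.\<close>

lemma trace_bound:
  assumes "p \<in> Om" "e * snd p > 0" "\<bar>fst p - xi\<bar> \<le> h" "h > 0"
    and G: "\<And>t. t \<ge> 0 \<Longrightarrow> \<bar>G0 t\<bar> \<le> C" and c: "\<bar>chi p\<bar> \<le> D"
  shows "\<bar>snd p\<bar> * (u p)\<^sup>2 \<le> (C * D)\<^sup>2 * h powr (1/3)"
proof -
  note a = aff_Om[OF assms(1)]
  define s where "s = fst (aff p)"
  have s: "s > 0" "s \<le> h" using a assms(3) by (auto simp: s_def)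
  have "\<bar>G0 (snd (aff p) * s powr (-1/3))\<bar> \<le> C" by (rule G) (use assms(2) a(3) in simp)
  moreover have "C \<ge> 0" using G[of 0] by simp
  ultimately have "\<bar>G0 (snd (aff p) * s powr (-1/3))\<bar> * \<bar>chi p\<bar> \<le> C * D" using c by (intro mult_mono) auto
  then have "(\<bar>G0 (snd (aff p) * s powr (-1/3))\<bar> * \<bar>chi p\<bar>)\<^sup>2 \<le> (C * D)\<^sup>2" by (intro power_mono) auto
  then have q: "(G0 (snd (aff p) * s powr (-1/3)) * chi p)\<^sup>2 \<le> (C * D)\<^sup>2" by (simp add: power_mult_distrib)
  have "(s powr (1/6))\<^sup>2 = s powr (1/3)" using s by (simp add: powr_powr powr_numeral[symmetric])
  then have "(u p)\<^sup>2 = s powr (1/3) * (G0 (snd (aff p) * s powr (-1/3)) * chi p)\<^sup>2"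
    unfolding u_eq[OF assms(1)] ub_def usim_def s_def by (simp add: power_mult_distrib)
  also have "\<dots> \<le> h powr (1/3) * (C * D)\<^sup>2" using s q by (intro mult_mono powr_mono2) auto
  finally have "(u p)\<^sup>2 \<le> (C * D)\<^sup>2 * h powr (1/3)" by (simp add: mult.commute)
  moreover have "\<bar>snd p\<bar> \<le> 1" using assms(1) by (auto simp: Omega_def)
  then have "\<bar>snd p\<bar> * (u p)\<^sup>2 \<le> 1 * (u p)\<^sup>2" by (intro mult_right_mono) auto
  ultimately show ?thesis by simp
qed

text \<open>At the side through the corner \<open>trace_bound\<close> applies. At the opposite side,
  points of a strip narrower than (x1 - x0)/2 are farther than Rbar from the corner, so u is zero
  there.\<close>

lemma trace_Sigma: "trace_zero_Sigma0 x0 u" "trace_zero_Sigma1 x1 u"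
proof -
  obtain C where C: "\<And>t. t \<ge> 0 \<Longrightarrow> \<bar>G0 t\<bar> \<le> C" using G0_bounded_pos by blast
  obtain D where D: "\<And>p. p \<in> Om \<inter> closure Om \<Longrightarrow> \<bar>chi p\<bar> \<le> D" using smooth_upto_bounded[OF chi compact_closure_Om] by blast
  define K where "K = (C * D)\<^sup>2"
  have K: "K \<ge> 0" by (simp add: K_def)
  have D': "\<bar>chi p\<bar> \<le> D" if "p \<in> Om" for p using D[of p] that Om_closure[OF that] by blast
  have h0: "(x1 - x0) / 2 > 0" using x by simp
  have box: "{a<..<b} \<times> {c<..<d} = box (a, c) (b, d)" for a b c d :: real by (auto simp: box_def Basis_prod_def)
  have area: "emeasure lborel ({a<..<b} \<times> {c<..<d}) = ennreal ((b - a) * (d - c))" if "a \<le> b" "c \<le> d" for a b c d :: real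
    unfolding box using that by (subst emeasure_lborel_box) (auto simp: Basis_prod_def inner_prod_def)
  show "trace_zero_Sigma0 x0 u" unfolding trace_zero_Sigma0_def
  proof (rule trace_average[OF _ _ h0 K])
    show "{x0<..<x0+h} \<times> {0<..<1::real} \<in> sets borel" for h by (intro borel_open open_Times) auto
    show "emeasure lborel ({x0<..<x0+h} \<times> {0<..<1::real}) = ennreal h" if "h > 0" for h using that area[of x0 "x0 + h" 0 1] by simp
    fix h p assume h: "0 < h" "h < (x1 - x0) / 2" and p: "p \<in> {x0<..<x0+h} \<times> {0<..<1::real}"
    have pO: "p \<in> Om" using h p by (auto simp: Omega_def)
    show "\<bar>snd p\<bar> * (u p)\<^sup>2 \<le> K * h powr (1/3)"
    proof (cases "e = 1")
      case True
      then have "xi = x0" using corner by auto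
      then show ?thesis unfolding K_def using True p h by (intro trace_bound pO C D') auto
    next
      case False
      then have "xi = x1" using corner by auto
      then have "dist p (xi, 0) > Rbar" using dist_ge(1)[of p] p h Rbar(2) by (auto simp: abs_le_iff)
      then show ?thesis using far(1)[OF pO] K by simp
    qed
  qed
  show "trace_zero_Sigma1 x1 u" unfolding trace_zero_Sigma1_def
  proof (rule trace_average[OF _ _ h0 K])
    show "{x1-h<..<x1} \<times> {-1<..<0::real} \<in> sets borel" for h by (intro borel_open open_Times) auto
    show "emeasure lborel ({x1-h<..<x1} \<times> {-1<..<0::real}) = ennreal h" if "h > 0" for h using that area[of "x1 - h" x1 "-1" 0] by simp
    fix h p assume h: "0 < h" "h < (x1 - x0) / 2" and p: "p \<in> {x1-h<..<x1} \<times> {-1<..<0::real}"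
    have pO: "p \<in> Om" using h p by (auto simp: Omega_def)
    show "\<bar>snd p\<bar> * (u p)\<^sup>2 \<le> K * h powr (1/3)"
    proof (cases "e = 1")
      case True
      then have "xi = x0" using corner by auto
      then have "dist p (xi, 0) > Rbar" using dist_ge(1)[of p] p h Rbar(2) by (auto simp: abs_le_iff)
      then show ?thesis using far(1)[OF pO] K by simp
    next
      case False
      then have "e = -1" "xi = x1" using corner by auto
      then show ?thesis unfolding K_def using p h by (intro trace_bound pO C D') auto
    qed
  qed
qed

lemma solves_u: "solves_bvp x0 x1 f u"
proof -
  have "weak_eq Om u (\<lambda>\<phi> p. - (snd p * dx \<phi> p) - dz (dz \<phi>) p) f"
    using weak_partials_smooth(5)[OF Omega_open smooth_on_u] unfolding f_def[abs_def] .
  then show ?thesis unfolding solves_bvp_def using trace_Sigma trace_top_bottom by blast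
qed

end

text \<open>Almost everywhere equality of g and w is not established first: the weak identity is
  tested with smooth approximations \<phi> of the indicator of the box, and |g| \<phi> <= g^2 / (2
  m) + m \<phi>^2 / 2. The factor e covers w of either constant sign.\<close>

lemma weak_L2_lower_bound:
  assumes g: "L2_on (Omega x0 x1) g" and w: "smooth_on (Omega x0 x1) w"
    and gi: "\<And>\<phi>. test_fn (Omega x0 x1) \<phi> \<Longrightarrow> set_integrable lebesgue (Omega x0 x1) (\<lambda>p. g p * \<phi> p)"
    and eq: "\<And>\<phi>. test_fn (Omega x0 x1) \<phi> \<Longrightarrow>
      (LINT p:Omega x0 x1|lebesgue. w p * \<phi> p) = (LINT p:Omega x0 x1|lebesgue. g p * \<phi> p)"
    and Q: "x0 \<le> p1" "p1 \<le> q1" "q1 \<le> x1" "-1 \<le> p2" "p2 \<le> q2" "q2 \<le> 1"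
    and m: "m > 0" "\<bar>e\<bar> = 1" "\<And>p. p \<in> {p1<..<q1} \<times> {p2<..<q2} \<Longrightarrow> m \<le> e * w p"
  shows "m\<^sup>2 * ((q1 - p1) * (q2 - p2)) \<le> (\<integral>p. indicator (Omega x0 x1) p * (g p)\<^sup>2 \<partial>lebesgue)"
proof -
  let ?Om = "Omega x0 x1"
  define Q where "Q = {p1<..<q1} \<times> {p2<..<q2}"
  define I where "I = (\<integral>p. indicator ?Om p * (g p)\<^sup>2 \<partial>lebesgue)"
  define \<phi> where "\<phi> n p = bump p1 q1 (Suc n) (fst p) * bump p2 q2 (Suc n) (snd p)" for n and p :: "real \<times> real"
  have zero: "bump a b (Suc n) x = 0" if "x \<notin> {a<..<b}" for a b x n
    using tf1_bump[of a a b b n] that unfolding tf1_def by fastforce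
  have QOm: "Q \<subseteq> ?Om" using Q by (auto simp: Q_def Omega_def)
  have out: "\<phi> n p = 0" if "p \<notin> Q" for n p
    using that zero[of "fst p" p1 q1 n] zero[of "snd p" p2 q2 n] by (cases p) (auto simp: \<phi>_def Q_def)
  have nn: "0 \<le> \<phi> n p" "\<phi> n p \<le> 1" for n p
    unfolding \<phi>_def by (auto intro!: mult_nonneg_nonneg mult_le_one bump_bounds)
  have t: "test_fn ?Om (\<phi> n)" for n
    unfolding \<phi>_def[abs_def] using Q by (intro test_fn_tensor tf1_bump) auto
  have "smooth_on ?Om (\<lambda>_. 1)" using Omega_open by (simp add: smooth_on_def)
  from set_integrable_test_fn[OF Omega_open this t]
  have i\<phi>: "integrable lebesgue (\<lambda>p. indicator ?Om p * \<phi> n p)" for n by (simp add: set_integrable_def)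
  have iw: "integrable lebesgue (\<lambda>p. indicator ?Om p * (w p * \<phi> n p))" for n
    using set_integrable_test_fn[OF Omega_open w t] by (simp add: set_integrable_def)
  have ig: "integrable lebesgue (\<lambda>p. indicator ?Om p * (g p * \<phi> n p))" for n
    using gi[OF t] by (simp add: set_integrable_def)
  have ig2: "integrable lebesgue (\<lambda>p. indicator ?Om p * (g p)\<^sup>2)" using g by (simp add: L2_on_def)
  have bound: "m\<^sup>2 * (\<integral>p. indicator ?Om p * \<phi> n p \<partial>lebesgue) \<le> I" for n
  proof -
    have "m * (\<integral>p. indicator ?Om p * \<phi> n p \<partial>lebesgue) = (\<integral>p. m * (indicator ?Om p * \<phi> n p) \<partial>lebesgue)" by simp
    also have "\<dots> \<le> (\<integral>p. e * (indicator ?Om p * (w p * \<phi> n p)) \<partial>lebesgue)"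
    proof (intro integral_mono integrable_mult_right i\<phi> iw)
      fix p
      show "m * (indicator ?Om p * \<phi> n p) \<le> e * (indicator ?Om p * (w p * \<phi> n p))"
      proof (cases "p \<in> Q")
        case True
        then show ?thesis using mult_right_mono[OF m(3)[of p] nn(1)[of n p]] QOm by (auto simp: Q_def mult_ac)
      qed (simp add: out)
    qed
    also have "\<dots> = e * (\<integral>p. indicator ?Om p * (w p * \<phi> n p) \<partial>lebesgue)" by simp
    also have "\<dots> = e * (\<integral>p. indicator ?Om p * (g p * \<phi> n p) \<partial>lebesgue)"
      using eq[OF t, of n] by (simp add: set_lebesgue_integral_def)
    also have "\<dots> = (\<integral>p. e * (indicator ?Om p * (g p * \<phi> n p)) \<partial>lebesgue)" by simp
    also have "\<dots> \<le> (\<integral>p. 1 / (2 * m) * (indicator ?Om p * (g p)\<^sup>2) + m / 2 * (indicator ?Om p * \<phi> n p) \<partial>lebesgue)"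
    proof (intro integral_mono Bochner_Integration.integrable_add integrable_mult_right ig ig2 i\<phi>)
      fix p
      have "e * (g p * \<phi> n p) \<le> \<bar>e * (g p * \<phi> n p)\<bar>" by simp
      also have "\<dots> = \<bar>g p\<bar> * \<phi> n p" using nn(1)[of n p] m(2) by (simp add: abs_mult)
      also have "\<dots> \<le> 1 / (2 * m) * (g p)\<^sup>2 + m / 2 * (\<phi> n p)\<^sup>2"
      proof -
        have "0 \<le> (\<bar>g p\<bar> - m * \<phi> n p)\<^sup>2" by simp
        also have "\<dots> = (g p)\<^sup>2 + m\<^sup>2 * (\<phi> n p)\<^sup>2 - 2 * m * (\<bar>g p\<bar> * \<phi> n p)"
          by (simp add: power2_diff power_mult_distrib)
        finally show ?thesis using m(1) by (simp add: field_simps power2_eq_square)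
      qed
      \<comment> \<open>Replacing \<phi>^2 by \<phi>, as 0 <= \<phi> <= 1, lets the last term be
        absorbed into the left-hand side m \<phi>.\<close>
      also have "\<dots> \<le> 1 / (2 * m) * (g p)\<^sup>2 + m / 2 * \<phi> n p"
        using m(1) mult_left_mono[OF nn(2)[of n p] nn(1)[of n p]] by (simp add: power2_eq_square)
      finally show "e * (indicator ?Om p * (g p * \<phi> n p)) \<le>
          1 / (2 * m) * (indicator ?Om p * (g p)\<^sup>2) + m / 2 * (indicator ?Om p * \<phi> n p)"
        by (cases "p \<in> ?Om") auto
    qed
    also have "\<dots> = 1 / (2 * m) * I + m / 2 * (\<integral>p. indicator ?Om p * \<phi> n p \<partial>lebesgue)"
      unfolding I_def
      by (subst Bochner_Integration.integral_add) (use ig2 i\<phi> in auto)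
    finally show ?thesis using m(1) by (simp add: field_simps power2_eq_square)
  qed
  have box: "Q = box (p1, p2) (q1, q2)" by (auto simp: Q_def box_def Basis_prod_def)
  have area: "emeasure lborel Q = ennreal ((q1 - p1) * (q2 - p2))"
    unfolding box using Q by (subst emeasure_lborel_box) (auto simp: Basis_prod_def inner_prod_def)
  have Qm: "Q \<in> sets borel" unfolding Q_def by (intro borel_open open_Times) auto
  then have eQ: "emeasure lebesgue Q = ennreal ((q1 - p1) * (q2 - p2))" using area by simp
  have iQ: "integrable lebesgue (indicator Q :: real \<times> real \<Rightarrow> real)" using eQ Qm by (intro integrable_real_indicator) auto
  have mQ: "integral\<^sup>L lebesgue (indicator Q :: real \<times> real \<Rightarrow> real) = (q1 - p1) * (q2 - p2)"
    using eQ Q Qm by (simp add: measure_def)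
  have "(\<lambda>n. \<integral>p. indicator ?Om p * \<phi> n p \<partial>lebesgue) \<longlonglongrightarrow> integral\<^sup>L lebesgue (indicator Q :: real \<times> real \<Rightarrow> real)"
  proof (rule integral_dominated_convergence[where w="indicator Q"])
    show "AE p in lebesgue. (\<lambda>n. indicator ?Om p * \<phi> n p) \<longlonglongrightarrow> indicator Q p"
    proof (rule AE_I2)
      fix p :: "real \<times> real"
      have "(\<lambda>n. \<phi> n p) \<longlonglongrightarrow> indicator {p1<..<q1} (fst p) * indicator {p2<..<q2} (snd p)"
        unfolding \<phi>_def by (intro tendsto_mult bump_tendsto)
      also have "(\<lambda>n. \<phi> n p) = (\<lambda>n. indicator ?Om p * \<phi> n p)"
        using QOm out[of p] by (cases "p \<in> Q") (auto simp: fun_eq_iff)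
      also have "indicator {p1<..<q1} (fst p) * indicator {p2<..<q2} (snd p) = (indicator Q p :: real)"
        by (cases p) (auto simp: Q_def indicator_def)
      finally show "(\<lambda>n. indicator ?Om p * \<phi> n p) \<longlonglongrightarrow> indicator Q p" .
    qed
    show "AE p in lebesgue. norm (indicator ?Om p * \<phi> n p) \<le> indicator Q p" for n
      using nn[of n] out[of _ n] by (intro AE_I2) (auto simp: indicator_def)
  qed (use iQ i\<phi> in auto)
  then have "(\<lambda>n. m\<^sup>2 * (\<integral>p. indicator ?Om p * \<phi> n p \<partial>lebesgue)) \<longlonglongrightarrow> m\<^sup>2 * ((q1 - p1) * (q2 - p2))"
    unfolding mQ by (intro tendsto_intros)
  then show ?thesis using bound unfolding I_def by (intro LIMSEQ_le_const2) auto
qed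

section \<open>The x-derivative is not square integrable\<close>

context corner
begin

text \<open>In such a box the similarity variable satisfies |t| < d, so the profile of dx u is close
  to its value G0(0)/6 > 0 at t = 0, while s^(-5/6) is of order b^(-5/2).\<close>

lemma dx_ub_lower_bound:
  obtains c d where "c > 0" "d > 0" "d \<le> 1"
    "\<And>b p. 0 < b \<Longrightarrow> p \<in> Om \<Longrightarrow> b ^ 3 < \<bar>fst p - xi\<bar> \<Longrightarrow> \<bar>fst p - xi\<bar> < 2 * b ^ 3 \<Longrightarrow> \<bar>snd p\<bar> < d * b \<Longrightarrow>
      c * b powr (-5/2) \<le> e * dx ub p"
proof -
  define H where "H t = G0 t / 6 - t / 3 * G1 t" for t
  have "continuous_on UNIV H" unfolding H_def by (intro continuous_intros continuous_G) auto
  then have "isCont H 0" by (simp add: continuous_on_eq_continuous_at)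
  then have "\<forall>\<epsilon>>0. \<exists>r>0. \<forall>t. \<bar>t\<bar> < r \<longrightarrow> \<bar>H t - H 0\<bar> < \<epsilon>" by (simp add: continuous_at_real_range)
  moreover have H0: "H 0 > 0" unfolding H_def G0_0 by (simp add: Gamma_real_pos)
  then have "H 0 / 2 > 0" by simp
  ultimately obtain r where r: "r > 0" "\<And>t. \<bar>t\<bar> < r \<Longrightarrow> \<bar>H t - H 0\<bar> < H 0 / 2" by blast
  define d where "d = min r 1"
  show thesis
  \<comment> \<open>One factor 1/2 is lost to the continuity of \<open>H\<close>, another to
    2^(-5/6) >= 1/2, as s goes up to 2 b^3.\<close>
  proof (rule that[of "H 0 / 4" d])
    fix b p assume b: "0 < b" and p: "p \<in> Om" "b ^ 3 < \<bar>fst p - xi\<bar>" "\<bar>fst p - xi\<bar> < 2 * b ^ 3" "\<bar>snd p\<bar> < d * b"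
    note a = aff_Om[OF p(1)]
    define s where "s = fst (aff p)"
    have s: "s > 0" "b ^ 3 \<le> s" "s \<le> 2 * b ^ 3" using a p by (auto simp: s_def)
    define t where "t = snd (aff p) * s powr (-1/3)"
    have b3: "(b ^ 3) powr r = b powr (3 * r)" for r using b by (simp add: powr_powr flip: powr_numeral)
    have "s powr (-1/3) \<le> (b ^ 3) powr (-1/3)" using s b by (intro powr_mono2') auto
    also have "\<dots> = 1 / b" unfolding b3 using b by (simp add: powr_minus_divide)
    finally have "\<bar>snd p\<bar> * s powr (-1/3) \<le> \<bar>snd p\<bar> * (1 / b)" by (intro mult_left_mono) auto
    also have "\<dots> < d" using p(4) b by (simp add: field_simps)
    finally have "\<bar>t\<bar> < r" unfolding t_def using a(3) e_sq(2) by (simp add: abs_mult d_def)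
    then have Ht: "H t > H 0 / 2" using r(2)[of t] by linarith
    have "b powr (-5/2) / 2 \<le> b powr (-5/2) * 2 powr (-5/6)"
    proof -
      have "(1::real) / 2 \<le> 2 powr (-5/6)" using powr_mono[of "-1" "-5/6" "2::real"] by (simp add: powr_minus_divide)
      from mult_left_mono[OF this powr_ge_zero[of b "-5/2"]] show ?thesis by simp
    qed
    also have "\<dots> = (2 * b ^ 3) powr (-5/6)" using b powr_mult[of 2 "b ^ 3" "-5/6"] b3[of "-5/6"] by simp
    also have "\<dots> \<le> s powr (-5/6)" using s by (intro powr_mono2') auto
    finally have "(b powr (-5/2) / 2) * (H 0 / 2) \<le> s powr (-5/6) * H t" using Ht H0 by (intro mult_mono) auto
    also have "\<dots> = e * dx ub p"
      unfolding ub_partials(1)[OF p(1)] usim_partials(3)[OF a(1)] using e_sq(1)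
      by (simp add: s_def t_def H_def flip: mult.assoc)
    finally show "H 0 / 4 * b powr (-5/2) \<le> e * dx ub p" by (simp add: mult.commute)
  qed (use H0 r in \<open>auto simp: d_def\<close>)
qed

text \<open>At the parabolic scale \<open>\<bar>x - xi\<bar> \<approx> b\<^sup>3\<close>, \<open>\<bar>z\<bar> \<lesssim> b\<close>, a box of area of order \<open>b\<^sup>4\<close>, the derivative \<open>dx u\<close> is at least
  of order \<open>b powr (-5/2)\<close>, so the integral of its square is at least of order \<open>1 / b\<close>.\<close>

lemma not_H1H1_u: "\<not> H1H1 x0 x1 u"
proof
  assume "H1H1 x0 x1 u"
  then obtain g where g: "L2_on Om g" "weak_dx Om u g" unfolding H1H1_def by blast
  define I where "I = (\<integral>p. indicator Om p * (g p)\<^sup>2 \<partial>lebesgue)"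
  have I: "I \<ge> 0" unfolding I_def by (intro integral_nonneg_AE AE_I2) auto
  have eq: "(LINT p:Om|lebesgue. dx u p * \<phi> p) = (LINT p:Om|lebesgue. g p * \<phi> p)"
    and gi: "set_integrable lebesgue Om (\<lambda>p. g p * \<phi> p)" if "test_fn Om \<phi>" for \<phi>
    using g(2) weak_partials_smooth(2)[OF Omega_open smooth_on_u] that unfolding weak_dx_def weak_eq_def by metis+
  obtain c d where c: "c > 0" "d > 0" "d \<le> 1"
    and lower: "\<And>b p. 0 < b \<Longrightarrow> p \<in> Om \<Longrightarrow> b ^ 3 < \<bar>fst p - xi\<bar> \<Longrightarrow> \<bar>fst p - xi\<bar> < 2 * b ^ 3 \<Longrightarrow> \<bar>snd p\<bar> < d * b \<Longrightarrow>
      c * b powr (-5/2) \<le> e * dx ub p"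
    using dx_ub_lower_bound by blast
  \<comment> \<open>The first two terms put the box inside the ball of radius \<delta>, its points
    having distance below 2 b^3 + d b <= 3 b, and inside the domain; the third contradicts 2 c^2 d /
    b <= I.\<close>
  define b where "b = min (min (\<delta> / 4) ((x1 - x0) / 2)) (c\<^sup>2 * d / (I + 1))"
  have b: "b > 0" "4 * b \<le> \<delta>" "2 * b \<le> x1 - x0" "b \<le> c\<^sup>2 * d / (I + 1)"
  proof -
    have "c\<^sup>2 * d / (I + 1) > 0" using c I by (intro divide_pos_pos mult_pos_pos) auto
    then show "b > 0" using \<delta>(1) x by (simp add: b_def)
    have le: "b \<le> min (\<delta> / 4) ((x1 - x0) / 2)" unfolding b_def by (rule min.cobounded1)
    show "4 * b \<le> \<delta>" using order_trans[OF le min.cobounded1] by simp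
    show "2 * b \<le> x1 - x0" using order_trans[OF le min.cobounded2] by simp
    show "b \<le> c\<^sup>2 * d / (I + 1)" unfolding b_def by (rule min.cobounded2)
  qed
  have b1: "b \<le> 1" using b(2) \<delta>(2) b(1) by linarith
  have b3: "b ^ 3 \<le> b" using power_decreasing[of 1 3 b] b(1) b1 by simp
  have db: "d * b \<le> b" using c b(1) by simp
  \<comment> \<open>The left end of the x-range lying between b^3 and 2 b^3 inward from the
    corner.\<close>
  define p1 where "p1 = (if e = 1 then xi + b ^ 3 else xi - 2 * b ^ 3)"
  have xs: "b ^ 3 < \<bar>y - xi\<bar>" "\<bar>y - xi\<bar> < 2 * b ^ 3" if "y \<in> {p1<..<p1 + b ^ 3}" for y
    using that b(1) zero_less_power[OF b(1), of 3] corner by (auto simp: p1_def split: if_splits)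
  have bnds: "x0 \<le> p1" "p1 + b ^ 3 \<le> x1"
    using corner b3 b(3) zero_less_power[OF b(1), of 3] by (auto simp: p1_def)
  have "(c * b powr (-5/2))\<^sup>2 * ((p1 + b ^ 3 - p1) * (d * b - (- (d * b)))) \<le> I"
    unfolding I_def
  proof (rule weak_L2_lower_bound[OF g(1) smooth_on_dx[OF smooth_on_u] gi eq])
    show "x0 \<le> p1" "p1 + b ^ 3 \<le> x1" by (fact bnds)+
    show "p1 \<le> p1 + b ^ 3" using b(1) by simp
    show "-1 \<le> - (d * b)" "d * b \<le> 1" using db b1 by auto
    show "- (d * b) \<le> d * b" "c * b powr (-5/2) > 0" "\<bar>e\<bar> = 1" using c b(1) e_sq(2) by auto
    fix p assume p: "p \<in> {p1<..<p1 + b ^ 3} \<times> {- (d * b)<..<d * b}"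
    then have z: "\<bar>snd p\<bar> < d * b" by auto
    have pO: "p \<in> Om" using p bnds db b1 by (auto simp: Omega_def)
    have y: "b ^ 3 < \<bar>fst p - xi\<bar>" "\<bar>fst p - xi\<bar> < 2 * b ^ 3" using xs[of "fst p"] p by auto
    have "dist p (xi, 0) \<le> \<bar>fst p - xi\<bar> + \<bar>snd p\<bar>"
      using sqrt_sum_squares_le_sum_abs[of "fst p - xi" "snd p"] by (cases p) (simp add: dist_prod_def dist_real_def)
    also have "\<dots> < \<delta>" using y z b3 db b(1,2) by linarith
    finally show "c * b powr (-5/2) \<le> e * dx u p" using lower[OF b(1) pO y z] near(2)[OF pO] by simp
  qed
  moreover have "(b powr (-5/2))\<^sup>2 * b ^ 4 = 1 / b"
  proof -
    have "(b powr (-5/2))\<^sup>2 * b ^ 4 = b powr (-5) * b powr 4" using b(1) by (simp add: powr_powr flip: powr_numeral)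
    also have "\<dots> = b powr (-1)" by (simp flip: powr_add)
    finally show ?thesis using b(1) by (simp add: powr_minus_divide)
  qed
  moreover have "(c * b powr (-5/2))\<^sup>2 * ((p1 + b ^ 3 - p1) * (d * b - (- (d * b)))) = 2 * (c\<^sup>2 * d) * ((b powr (-5/2))\<^sup>2 * b ^ 4)"
    by (simp add: power_mult_distrib algebra_simps power3_eq_cube power4_eq_xxxx)
  ultimately have "2 * (c\<^sup>2 * d) / b \<le> I" by simp
  then have "2 * (c\<^sup>2 * d) \<le> I * b" using b(1) by (simp add: field_simps)
  also have "\<dots> \<le> (I + 1) * b" using b(1) by simp
  also have "\<dots> \<le> c\<^sup>2 * d" using b(4) I by (simp add: field_simps)
  finally show False using c by simp
qed

end

theorem lemma2p18:
  fixes x0 x1 Rbar :: real and i :: nat and chi :: "real \<times> real \<Rightarrow> real"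
  defines "xi \<equiv> (if i = 0 then x0 else x1)"
  assumes "x0 < x1" and "i \<le> 1"
    and "0 < Rbar" and "Rbar < min 1 (x1 - x0) / 2"
    and "smooth_upto (Omega x0 x1) (closure (Omega x0 x1)) chi"
    and "\<exists>\<epsilon>>0. \<forall>p\<in>closure (Omega x0 x1). dist p (xi, 0) < \<epsilon> \<longrightarrow> chi p = 1"
    and "closure {p \<in> closure (Omega x0 x1). chi p \<noteq> 0} \<subseteq> ball (xi, 0) Rbar"
  shows "\<exists>f. smooth_upto (Omega x0 x1) (closure (Omega x0 x1)) f
           \<and> (\<exists>\<epsilon>>0. \<forall>p\<in>Omega x0 x1. (dist p (xi, 0) < \<epsilon> \<or> \<bar>snd p\<bar> > 1 - \<epsilon>) \<longrightarrow> f p = 0)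
           \<and> Z0 x0 x1 (u_sing xi chi i)
           \<and> solves_bvp x0 x1 f (u_sing xi chi i)
           \<and> (\<forall>v. Z0 x0 x1 v \<and> solves_bvp x0 x1 f v \<longrightarrow>
                 (AE p in lebesgue. p \<in> Omega x0 x1 \<longrightarrow> v p = u_sing xi chi i p))
           \<and> smooth_upto (Omega x0 x1) (closure (Omega x0 x1) - {(xi, 0)}) (u_sing xi chi i)
           \<and> \<not> H1H1 x0 x1 (u_sing xi chi i)"
proof -
  interpret corner x0 x1 xi "(-1) ^ i" Rbar i chi
  proof
    show "(- 1) ^ i = (1::real) \<and> xi = x0 \<or> (- 1) ^ i = (-1::real) \<and> xi = x1"
      using \<open>i \<le> 1\<close> by (cases i) (auto simp: xi_def)
    show "Rbar < 1/2" "Rbar < (x1 - x0) / 2" using assms(5) by auto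
    fix p assume p: "p \<in> closure (Omega x0 x1)" "Rbar \<le> dist p (xi, 0)"
    show "chi p = 0"
    proof (rule ccontr)
      assume "chi p \<noteq> 0"
      then have "p \<in> closure {p \<in> closure (Omega x0 x1). chi p \<noteq> 0}" using p(1) by (intro subsetD[OF closure_subset]) simp
      then show False using assms(8) p(2) by (auto simp: dist_commute)
    qed
  qed (use assms in auto)
  have "AE p in lebesgue. p \<in> Omega x0 x1 \<longrightarrow> v p = u p" if "Z0 x0 x1 v" "solves_bvp x0 x1 f v" for v
    using Z0_bvp_unique[OF x Z0_u solves_u] that by blast
  then show ?thesis
    using smooth_upto_f f_vanishes Z0_u solves_u smooth_upto_u not_H1H1_u unfolding u_def by blast
qed

end
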